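(* Let $n\ge2$, let $\Omega\subset\mathbb{R}^n$ be a bounded Lipschitz domain and suppose $1<\alpha<2$. Then there exists a positive measure $\omega\in L^1_{loc}(\Omega)$ (that is, $d\omega=q\,dx$ with $q\ge0$, $q\in L^1_{loc}(\Omega)$) such that $\|T\|_{L^2(\omega)\to L^2(\omega)}<1$, but $u_1=1+\mathcal{G}\omega$ is identically $+\infty$ on $\Omega$, where $T$ and $\mathcal{G}$ (both depending on $\omega$, $\Omega$ and $\alpha$) are as defined in the context.
   Context: $\Omega^c=\mathbb{R}^n\setminus\Omega$. For $0<s<n$, the Riesz potential is $I_s\mu=k_s*\mu$, $k_s(x)=c_{s,n}|x|^{s-n}$, with $c_{s,n}>0$ chosen so that $I_s$ is the Fourier multiplier $|\xi|^{-s}$ (where the multiplier $|\xi|^2$ corresponds to $-\triangle$). For $E\subset\mathbb{R}^n$, $\mathrm{cap}_\alpha(E)=\inf\{\|f\|_{L^2(\mathbb{R}^n)}^2: f\ge 0,\ f\in L^2(\mathbb{R}^n),\ I_{\alpha/2}f\ge\chi_E\}$; q.e. means outside a set of capacity $0$. Green's function: for $y\in\Omega$ let $\varepsilon_y'$ be the balayage of the unit point mass at $y$ onto $\Omega^c$, i.e. the unique positive measure supported in $\Omega^c$ with finite energy $\int I_\alpha\varepsilon_y'\,d\varepsilon_y'<\infty$ and with $I_\alpha\varepsilon_y'(x)=k_\alpha(x-y)$ for q.e. $x\in\Omega^c$. Green's function of order $\alpha$ (i.e. for $(-\triangle)^{\alpha/2}$) on $\Omega$ is $G(x,y)=k_\alpha(x-y)-I_\alpha\varepsilon_y'(x)$,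 $x\in\mathbb{R}^n$, $y\in\Omega$ (with $G(y,y)=+\infty$); it is non-negative and symmetric. Operators: $Tf(x)=\int_\Omega G(x,y)f(y)\,d\omega(y)$, and $\|T\|_{L^2(\omega)\to L^2(\omega)}$ is its operator norm on $L^2(\omega)$. Set $G_1=G$, $G_j(x,y)=\int_\Omega G_{j-1}(x,z)G(z,y)\,d\omega(z)$ for $j\ge2$, $\mathcal{G}(x,y)=\sum_{j\ge1}G_j(x,y)$ for $x,y\in\Omega$, and $\mathcal{G}\omega(x)=\int_\Omega\mathcal{G}(x,y)\,d\omega(y)\in[0,+\infty]$ for $x\in\Omega$. *)

theory Defs
  imports "HOL-Probability.Probability"
begin

section \<open>Lipschitz domains and local integrability\<close>

text \<open>Near each boundary point the set is, in suitable orthonormal coordinates, the region strictly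
  above the graph of a Lipschitz function on a hyperplane. The last coordinate axis is given by the
  unit vector \<open>e\<close>, and \<open>x - (x \<bullet> e) *\<^sub>R e\<close> is the projection of \<open>x\<close> onto the hyperplane
  orthogonal to \<open>e\<close>.\<close>

definition lipschitz_boundary :: "'a::euclidean_space set \<Rightarrow> bool" where
  "lipschitz_boundary \<Omega> \<longleftrightarrow>
     (\<forall>p\<in>frontier \<Omega>. \<exists>e r L \<phi>. norm e = 1 \<and> 0 < r \<and> L-lipschitz_on {y. y \<bullet> e = 0} (\<phi> :: 'a \<Rightarrow> real) \<and>
        \<Omega> \<inter> ball p r = {x \<in> ball p r. \<phi> (x - (x \<bullet> e) *\<^sub>R e) < x \<bullet> e})"

definition bounded_lipschitz_domain :: "'a::euclidean_space set \<Rightarrow> bool" where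
  "bounded_lipschitz_domain \<Omega> \<longleftrightarrow>
     open \<Omega> \<and> connected \<Omega> \<and> \<Omega> \<noteq> {} \<and> bounded \<Omega> \<and> lipschitz_boundary \<Omega>"

definition L1_loc :: "'a::euclidean_space set \<Rightarrow> ('a \<Rightarrow> real) set" where
  "L1_loc \<Omega> = {q \<in> borel_measurable (restrict_space lborel \<Omega>).
     \<forall>K. compact K \<and> K \<subseteq> \<Omega> \<longrightarrow> set_integrable lborel K q}"

section \<open>Riesz potentials and capacity\<close>

text \<open>The closed form of the normalising constant. That it makes convolution with the Riesz kernel
  the Fourier multiplier $|\xi|^{-s}$, for the transform with kernel $e^{-i x \cdot \xi}$ (so that
  $-\triangle$ is the multiplier $|\xi|^2$), is lemma \<open>fourier_riesz_kernel\<close> below.\<close>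

definition riesz_const :: "nat \<Rightarrow> real \<Rightarrow> real" where
  "riesz_const n s =
     Gamma ((real n - s) / 2) / (2 powr s * pi powr (real n / 2) * Gamma (s / 2))"

definition riesz_kernel :: "real \<Rightarrow> 'a::euclidean_space \<Rightarrow> ennreal" where
  "riesz_kernel s x =
     (if x = 0 then \<infinity> else ennreal (riesz_const DIM('a) s * norm x powr (s - real DIM('a))))"

definition riesz_potential :: "real \<Rightarrow> 'a::euclidean_space measure \<Rightarrow> 'a \<Rightarrow> ennreal" where
  "riesz_potential s \<mu> x = (\<integral>\<^sup>+y. riesz_kernel s (x - y) \<partial>\<mu>)"

definition riesz_capacity :: "real \<Rightarrow> 'a::euclidean_space set \<Rightarrow> ennreal" where
  "riesz_capacity \<alpha> E =
     Inf {\<integral>\<^sup>+x. ennreal ((f x)\<^sup>2) \<partial>lborel | f :: 'a \<Rightarrow> real.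
            f \<in> borel_measurable lborel \<and> (\<forall>x. 0 \<le> f x) \<and> integrable lborel (\<lambda>x. (f x)\<^sup>2) \<and>
            (\<forall>x. indicator E x \<le> riesz_potential (\<alpha> / 2) (density lborel (\<lambda>y. ennreal (f y))) x)}"

section \<open>Balayage and Green's function\<close>

definition is_balayage :: "'a::euclidean_space set \<Rightarrow> real \<Rightarrow> 'a \<Rightarrow> 'a measure \<Rightarrow> bool" where
  "is_balayage \<Omega> \<alpha> y \<mu> \<longleftrightarrow>
     sets \<mu> = sets borel \<and> emeasure \<mu> \<Omega> = 0 \<and>
     (\<integral>\<^sup>+x. riesz_potential \<alpha> \<mu> x \<partial>\<mu>) < \<infinity> \<and>
     riesz_capacity \<alpha> {x \<in> - \<Omega>. riesz_potential \<alpha> \<mu> x \<noteq> riesz_kernel \<alpha> (x - y)} = 0"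

definition balayage :: "'a::euclidean_space set \<Rightarrow> real \<Rightarrow> 'a \<Rightarrow> 'a measure" where
  "balayage \<Omega> \<alpha> y = (THE \<mu>. is_balayage \<Omega> \<alpha> y \<mu>)"

text \<open>Subtraction on \<^typ>\<open>ennreal\<close> truncates at \<open>0\<close>; this is harmless, since the balayage potential
  is dominated by the kernel.\<close>

definition green :: "'a::euclidean_space set \<Rightarrow> real \<Rightarrow> 'a \<Rightarrow> 'a \<Rightarrow> ennreal" where
  "green \<Omega> \<alpha> x y =
     (if x = y then \<infinity>
      else riesz_kernel \<alpha> (x - y) - riesz_potential \<alpha> (balayage \<Omega> \<alpha> y) x)"

section \<open>Operators and iterated kernels\<close>

text \<open>The measure \<open>q dx\<close> lives on the space \<open>\<Omega>\<close>, so that integrals against it are integrals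
  over \<open>\<Omega>\<close>.\<close>

definition weight_measure :: "'a::euclidean_space set \<Rightarrow> ('a \<Rightarrow> real) \<Rightarrow> 'a measure" where
  "weight_measure \<Omega> q = density (restrict_space lborel \<Omega>) (\<lambda>x. ennreal (q x))"

definition L2 :: "'a measure \<Rightarrow> ('a \<Rightarrow> real) set" where
  "L2 \<omega> = {f \<in> borel_measurable \<omega>. integrable \<omega> (\<lambda>x. (f x)\<^sup>2)}"

definition L2_norm :: "'a measure \<Rightarrow> ('a \<Rightarrow> real) \<Rightarrow> real" where
  "L2_norm \<omega> f = sqrt (\<integral>x. (f x)\<^sup>2 \<partial>\<omega>)"

definition kernel_operator ::
    "('a \<Rightarrow> 'a \<Rightarrow> ennreal) \<Rightarrow> 'a measure \<Rightarrow> ('a \<Rightarrow> real) \<Rightarrow> 'a \<Rightarrow> real" where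
  "kernel_operator K \<omega> f x = (\<integral>y. enn2real (K x y) * f y \<partial>\<omega>)"

text \<open>The operator norm on \<open>L\<^sup>2(\<omega>)\<close>, infinite if the operator is not bounded. The integral is required
  to converge absolutely almost everywhere, because a divergent Bochner integral is \<open>0\<close> by
  convention.\<close>

definition kernel_operator_norm :: "('a \<Rightarrow> 'a \<Rightarrow> ennreal) \<Rightarrow> 'a measure \<Rightarrow> ennreal" where
  "kernel_operator_norm K \<omega> =
     Inf {ennreal C | C. 0 \<le> C \<and>
       (\<forall>f\<in>L2 \<omega>. (AE x in \<omega>. (\<integral>\<^sup>+y. K x y * ennreal \<bar>f y\<bar> \<partial>\<omega>) < \<infinity>) \<and>
          kernel_operator K \<omega> f \<in> L2 \<omega> \<and>
          L2_norm \<omega> (kernel_operator K \<omega> f) \<le> C * L2_norm \<omega> f)}"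

text \<open>The index is shifted by one: \<open>iterated_kernel K \<omega> j\<close> is the iterate $K_{j+1}$.\<close>

primrec iterated_kernel ::
    "('a \<Rightarrow> 'a \<Rightarrow> ennreal) \<Rightarrow> 'a measure \<Rightarrow> nat \<Rightarrow> 'a \<Rightarrow> 'a \<Rightarrow> ennreal" where
  "iterated_kernel K \<omega> 0 = K"
| "iterated_kernel K \<omega> (Suc j) = (\<lambda>x y. \<integral>\<^sup>+z. iterated_kernel K \<omega> j x z * K z y \<partial>\<omega>)"

definition neumann_kernel ::
    "('a \<Rightarrow> 'a \<Rightarrow> ennreal) \<Rightarrow> 'a measure \<Rightarrow> 'a \<Rightarrow> 'a \<Rightarrow> ennreal" where
  "neumann_kernel K \<omega> x y = (\<Sum>j. iterated_kernel K \<omega> j x y)"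

definition u1 :: "'a::euclidean_space set \<Rightarrow> real \<Rightarrow> 'a measure \<Rightarrow> 'a \<Rightarrow> ennreal" where
  "u1 \<Omega> \<alpha> \<omega> x = 1 + (\<integral>\<^sup>+y. neumann_kernel (green \<Omega> \<alpha>) \<omega> x y \<partial>\<omega>)"

section \<open>The normalising constant\<close>

text \<open>If \<open>\<phi>'\<close> is the Fourier transform of \<open>\<phi>\<close>, then pairing the Riesz kernel with \<open>\<phi>'\<close> is the same
  as pairing $|\xi|^{-s}$ with \<open>\<phi>\<close>, i.e. the Riesz kernel has Fourier transform $|\xi|^{-s}$ in the
  sense of distributions. The proof writes both powers as mixtures of Gaussians.\<close>

lemma gamma_scaled:
  fixes a b :: real
  assumes "0 < a" "0 < b"
  shows "has_bochner_integral lborel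
     (\<lambda>t. indicator {0<..} t * (t powr (a - 1) * exp (- (b * t)))) (Gamma a / b powr a)"
proof (rule has_bochner_integral_nn_integral)
  let ?f = "\<lambda>t. ennreal (indicator {0..} t * t powr (a - 1) / exp t)"
  have "ennreal (Gamma a) = ennreal \<bar>b\<bar> * (\<integral>\<^sup>+t. ?f (0 + b * t) \<partial>lborel)"
    unfolding Gamma_conv_nn_integral_real[OF assms(1)]
    by (rule nn_integral_real_affine) (use assms in auto)
  also have "\<dots> = ennreal b * (\<integral>\<^sup>+t. ennreal (b powr (a - 1)) * ennreal (indicator {0<..} t * (t powr (a - 1) * exp (- (b * t)))) \<partial>lborel)"
  proof -
    have "(\<integral>\<^sup>+t. ?f (0 + b * t) \<partial>lborel) =
      (\<integral>\<^sup>+t. ennreal (b powr (a - 1)) * ennreal (indicator {0<..} t * (t powr (a - 1) * exp (- (b * t)))) \<partial>lborel)"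
    proof (intro nn_integral_cong)
      fix t :: real
      show "?f (0 + b * t) = ennreal (b powr (a - 1)) * ennreal (indicator {0<..} t * (t powr (a - 1) * exp (- (b * t))))"
      proof (cases "0 < t")
        case True
        have "(b * t) powr (a - 1) / exp (b * t) = b powr (a - 1) * (t powr (a - 1) * exp (- (b * t)))"
          using True assms by (simp add: powr_mult exp_minus divide_inverse)
        thus ?thesis using True assms by (simp add: ennreal_mult')
      next
        case False
        thus ?thesis using assms by (cases "t = 0") (auto simp: indicator_def zero_le_mult_iff)
      qed
    qed
    thus ?thesis using assms by simp
  qed
  also have "\<dots> = ennreal (b powr a) * (\<integral>\<^sup>+t. ennreal (indicator {0<..} t * (t powr (a - 1) * exp (- (b * t)))) \<partial>lborel)"
  proof -
    have "b * b powr (a - 1) = b powr a" using assms by (simp add: powr_diff)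
    thus ?thesis using assms
      by (subst nn_integral_cmult) (auto simp: mult.assoc[symmetric] ennreal_mult'[symmetric])
  qed
  finally have *: "ennreal (Gamma a) = ennreal (b powr a) * (\<integral>\<^sup>+t. ennreal (indicator {0<..} t * (t powr (a - 1) * exp (- (b * t)))) \<partial>lborel)" .
  have "ennreal (Gamma a / b powr a) = ennreal (1 / b powr a) * ennreal (Gamma a)"
    by (subst ennreal_mult'[symmetric]) auto
  also have "\<dots> = (\<integral>\<^sup>+t. ennreal (indicator {0<..} t * (t powr (a - 1) * exp (- (b * t)))) \<partial>lborel)"
    unfolding * mult.assoc[symmetric] ennreal_mult'[symmetric, OF powr_ge_zero]
    using assms by (simp add: ennreal_mult'[symmetric] mult.assoc[symmetric])
  finally show "(\<integral>\<^sup>+t. ennreal (indicator {0<..} t * (t powr (a - 1) * exp (- (b * t)))) \<partial>lborel) =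
     ennreal (Gamma a / b powr a)" by simp
qed (use assms in \<open>auto intro!: Gamma_real_pos less_imp_le\<close>)

lemma gamma_inverted:
  fixes a b :: real
  assumes "0 < a" "0 < b"
  shows "has_bochner_integral lborel
     (\<lambda>t. indicator {0<..} t * (t powr (- a - 1) * exp (- (b / t)))) (Gamma a / b powr a)"
proof -
  let ?f = "\<lambda>t::real. t powr (a - 1) * exp (- (b * t))"
  let ?S = "{0<..} :: real set"
  have im: "(\<lambda>t. 1 / t) ` ?S = ?S"
    by (auto simp: image_iff intro!: bexI[of _ "1 / _"])
  have inj: "inj_on (\<lambda>t::real. 1 / t) ?S" by (auto simp: inj_on_def)
  have der: "((\<lambda>t. 1 / t) has_real_derivative (- 1 / t\<^sup>2)) (at t within ?S)" if "t \<in> ?S" for t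
    using that by (auto intro!: derivative_eq_intros simp: power2_eq_square field_simps)
  have A: "set_integrable lborel ?S ?f" "(LINT t:?S|lborel. ?f t) = Gamma a / b powr a"
    using gamma_scaled[OF assms] unfolding set_integrable_def set_lebesgue_integral_def
    by (auto simp: has_bochner_integral_iff)
  have A': "?f absolutely_integrable_on ?S"
    using A(1) unfolding set_integrable_def
    by (rule integrable_completion[THEN iffD2, rotated]) measurable
  have A'': "integral ?S ?f = Gamma a / b powr a"
    using set_borel_integral_eq_integral(2)[OF A(1)] A(2) by simp
  have B: "(\<lambda>t. \<bar>- 1 / t\<^sup>2\<bar> *\<^sub>R ?f (1 / t)) absolutely_integrable_on ?S \<and>
        integral ?S (\<lambda>t. \<bar>- 1 / t\<^sup>2\<bar> *\<^sub>R ?f (1 / t)) = Gamma a / b powr a"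
    using has_absolute_integral_change_of_variables_real[OF _ der inj, of ?f "Gamma a / b powr a"] A' A'' im
    by auto
  have eq: "indicat_real ?S t *\<^sub>R (\<bar>- 1 / t\<^sup>2\<bar> *\<^sub>R ?f (1 / t)) = indicator ?S t * (t powr (- a - 1) * exp (- (b / t)))" for t
  proof (cases "t > 0")
    case True
    have "t powr (- a - 1) = (1/t) powr (a - 1) / t\<^sup>2"
      using True by (simp add: powr_divide powr_diff powr_minus power2_eq_square field_simps)
    thus ?thesis using True by simp
  qed auto
  have meas: "(\<lambda>t. indicator ?S t * (t powr (- a - 1) * exp (- (b / t)))) \<in> borel_measurable lborel"
    by measurable
  have "integrable lebesgue (\<lambda>t. indicator ?S t * (t powr (- a - 1) * exp (- (b / t))))"
    using B unfolding set_integrable_def eq by simp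
  hence I: "integrable lborel (\<lambda>t. indicator ?S t * (t powr (- a - 1) * exp (- (b / t))))"
    using integrable_completion[OF meas] by simp
  hence I': "set_integrable lborel ?S (\<lambda>t. \<bar>- 1 / t\<^sup>2\<bar> *\<^sub>R ?f (1 / t))"
    unfolding set_integrable_def eq .
  have "(LINT t|lborel. indicator ?S t * (t powr (- a - 1) * exp (- (b / t)))) = Gamma a / b powr a"
    using set_borel_integral_eq_integral(2)[OF I'] B unfolding set_lebesgue_integral_def eq by simp
  thus ?thesis using I by (simp add: has_bochner_integral_iff)
qed

lemma gaussian_fourier_1:
  fixes t y :: real
  assumes "0 < t"
  shows "has_bochner_integral lborel (\<lambda>x. complex_of_real (exp (- (t * x\<^sup>2))) * cis (- (x * y)))
     (complex_of_real (sqrt (pi / t) * exp (- (y\<^sup>2 / (4 * t)))))"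
proof -
  define c where "c = 1 / sqrt (2 * t)"
  have c: "c > 0" "t * c\<^sup>2 = 1/2" "c\<^sup>2 = 1 / (2*t)"
    using assms by (auto simp: c_def power_divide)
  let ?g = "\<lambda>x. complex_of_real (exp (- (t * x\<^sup>2))) * cis (- (x * y))"
  have eq: "?g (0 + c * x) = sqrt (2 * pi) *\<^sub>R (std_normal_density x *\<^sub>R iexp ((- (c * y)) * x))" for x
  proof -
    have "t * (c * x)\<^sup>2 = x\<^sup>2 / 2"
      using c(2) by (simp add: power_mult_distrib)
    thus ?thesis
      by (simp add: std_normal_density_def cis_conv_exp scaleR_conv_of_real mult_ac)
  qed
  have std: "integrable std_normal_distribution (\<lambda>x. iexp ((- (c * y)) * x))"
    using prob_space.integrable_iexp[OF real_distribution.axioms(1)[OF real_dist_normal_dist],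
        of "\<lambda>x. complex_of_real ((- (c * y)) * x)"] by simp
  have std': "integrable lborel (\<lambda>x. std_normal_density x *\<^sub>R iexp ((- (c * y)) * x))"
    using std by (subst (asm) integrable_density) auto
  have val: "(LINT x|lborel. std_normal_density x *\<^sub>R iexp ((- (c * y)) * x)) = complex_of_real (exp (- (c * y)\<^sup>2 / 2))"
    using fun_cong[OF char_std_normal_distribution, of "- (c * y)"] unfolding char_def
    by (subst (asm) integral_density) auto
  have "has_bochner_integral lborel (\<lambda>x. ?g (0 + c * x)) (sqrt (2 * pi) *\<^sub>R complex_of_real (exp (- (c * y)\<^sup>2 / 2)))"
    unfolding eq using std' val by (intro has_bochner_integral_scaleR_right) (auto simp: has_bochner_integral_iff)
  moreover have "sqrt (2 * pi) *\<^sub>R complex_of_real (exp (- (c * y)\<^sup>2 / 2)) =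
     (complex_of_real (sqrt (pi / t) * exp (- (y\<^sup>2 / (4 * t))))) /\<^sub>R \<bar>c\<bar>"
  proof -
    have "sqrt (pi / t) / c = sqrt (2 * pi)" 
      using assms by (simp add: c_def flip: real_sqrt_mult)
    moreover have "(c * y)\<^sup>2 / 2 = y\<^sup>2 / (4 * t)" using c(3) by (simp add: power_mult_distrib)
    ultimately show ?thesis using c(1) by (simp add: scaleR_conv_of_real field_simps flip: of_real_mult)
  qed
  ultimately show ?thesis
    using lborel_has_bochner_integral_real_affine_iff[of c ?g _ 0] c(1) by simp
qed

lemma gaussian_fourier:
  fixes y :: "'a::euclidean_space" and t :: real
  assumes "0 < t"
  shows "has_bochner_integral lborel (\<lambda>x::'a. complex_of_real (exp (- (t * (norm x)\<^sup>2))) * cis (- (x \<bullet> y)))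
     (complex_of_real ((pi / t) powr (real DIM('a) / 2) * exp (- ((norm y)\<^sup>2 / (4 * t)))))"
proof -
  interpret product_sigma_finite "\<lambda>_::'a. lborel :: real measure" ..
  let ?g = "\<lambda>b::'a. \<lambda>x. complex_of_real (exp (- (t * x\<^sup>2))) * cis (- (x * (y \<bullet> b)))"
  let ?P = "\<Pi>\<^sub>M b\<in>(Basis::'a set). (lborel :: real measure)"
  let ?T = "\<lambda>f. \<Sum>b\<in>(Basis::'a set). f b *\<^sub>R b"
  let ?F = "\<lambda>x::'a. complex_of_real (exp (- (t * (norm x)\<^sup>2))) * cis (- (x \<bullet> y))"
  have Tm: "?T \<in> measurable ?P borel" by measurable
  have Fm: "?F \<in> borel_measurable borel" by (auto simp: cis_conv_exp)
  have cisprod: "cis (sum h A) = (\<Prod>b\<in>A. cis (h b))" if "finite A" for h and A :: "'a set"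
    using that by (induction A rule: finite_induct) (auto simp: cis_mult[symmetric])
  have eq: "?F (?T f) = (\<Prod>b\<in>Basis. ?g b (f b))" for f
  proof -
    have coord: "?T f \<bullet> b = f b" if "b \<in> Basis" for b using that by simp
    have "(norm (?T f))\<^sup>2 = (\<Sum>b\<in>Basis. (f b)\<^sup>2)"
      unfolding power2_norm_eq_inner by (subst euclidean_inner) (simp add: coord power2_eq_square)
    moreover have "?T f \<bullet> y = (\<Sum>b\<in>Basis. f b * (y \<bullet> b))"
      by (subst euclidean_inner) (simp add: coord)
    ultimately show ?thesis
      by (simp add: prod.distrib cisprod exp_sum sum_distrib_left flip: sum_negf of_real_prod)
  qed
  have g1: "integrable lborel (?g b)" "integral\<^sup>L lborel (?g b) = complex_of_real (sqrt (pi / t) * exp (- ((y \<bullet> b)\<^sup>2 / (4 * t))))" for b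
    using gaussian_fourier_1[OF assms, of "y \<bullet> b"] unfolding has_bochner_integral_iff by auto
  have I: "integrable ?P (\<lambda>f. \<Prod>b\<in>Basis. ?g b (f b))"
    by (rule product_integrable_prod) (use g1 in auto)
  have V: "(LINT f|?P. (\<Prod>b\<in>Basis. ?g b (f b))) = (\<Prod>b\<in>Basis. complex_of_real (sqrt (pi / t) * exp (- ((y \<bullet> b)\<^sup>2 / (4 * t)))))"
    by (subst product_integral_prod) (use g1 in auto)
  also have "\<dots> = complex_of_real ((pi / t) powr (real DIM('a) / 2) * exp (- ((norm y)\<^sup>2 / (4 * t))))"
  proof -
    have "(\<Prod>b\<in>Basis. exp (- ((y \<bullet> b)\<^sup>2 / (4 * t)))) = exp (- ((norm y)\<^sup>2 / (4 * t)))"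
      unfolding power2_norm_eq_inner by (subst (2) euclidean_inner) (simp add: power2_eq_square sum_divide_distrib sum_negf flip: exp_sum)
    moreover have "sqrt (pi / t) ^ DIM('a) = (pi / t) powr (real DIM('a) / 2)"
      using assms by (simp add: powr_half_sqrt[symmetric] powr_powr flip: powr_realpow)
    moreover have "(\<Prod>b\<in>(Basis::'a set). complex_of_real (sqrt (pi / t) * exp (- ((y \<bullet> b)\<^sup>2 / (4 * t))))) =
        complex_of_real (sqrt (pi / t) ^ DIM('a) * (\<Prod>b\<in>(Basis::'a set). exp (- ((y \<bullet> b)\<^sup>2 / (4 * t)))))"
      unfolding of_real_prod[symmetric] by (subst prod.distrib, subst prod_constant) (rule refl)
    ultimately show ?thesis by (simp only:)
  qed
  finally have "has_bochner_integral (distr ?P borel ?T) ?F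
      (complex_of_real ((pi / t) powr (real DIM('a) / 2) * exp (- ((norm y)\<^sup>2 / (4 * t)))))"
    unfolding has_bochner_integral_iff integrable_distr_eq[OF Tm Fm] integral_distr[OF Tm Fm] eq
    using I by simp
  thus ?thesis by (simp only: lborel_eq[where 'a = 'a, symmetric])
qed

lemma mixture_integral:
  fixes g :: "'a::euclidean_space \<Rightarrow> complex" and w :: "'a \<Rightarrow> real \<Rightarrow> real"
  assumes [measurable]: "(\<lambda>(x, t). w x t) \<in> borel_measurable (lborel \<Otimes>\<^sub>M lborel)"
      "g \<in> borel_measurable lborel"
    and nn: "\<And>x t. 0 \<le> w x t"
    and W: "\<And>x. x \<noteq> 0 \<Longrightarrow> has_bochner_integral lborel (w x) (W x)"
    and int: "integrable lborel (\<lambda>x. W x *\<^sub>R g x)"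
  shows "(\<integral>x. W x *\<^sub>R g x \<partial>lborel) = (\<integral>t. (\<integral>x. w x t *\<^sub>R g x \<partial>lborel) \<partial>lborel)"
proof -
  have ne: "AE x in lborel. x \<noteq> (0::'a)" by (rule AE_lborel_singleton)
  have inner: "integrable lborel (\<lambda>t. w x t *\<^sub>R g x)" "(\<integral>t. w x t *\<^sub>R g x \<partial>lborel) = W x *\<^sub>R g x"
      "(\<integral>t. norm (w x t *\<^sub>R g x) \<partial>lborel) = norm (W x *\<^sub>R g x)" if "x \<noteq> 0" for x
  proof -
    have *: "integrable lborel (w x)" "integral\<^sup>L lborel (w x) = W x"
      using W[OF that] by (auto simp: has_bochner_integral_iff)
    hence "0 \<le> W x" using nn by (metis integral_nonneg_AE AE_I2)
    thus "integrable lborel (\<lambda>t. w x t *\<^sub>R g x)" "(\<integral>t. w x t *\<^sub>R g x \<partial>lborel) = W x *\<^sub>R g x"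
      "(\<integral>t. norm (w x t *\<^sub>R g x) \<partial>lborel) = norm (W x *\<^sub>R g x)" 
      using * nn by auto
  qed
  have I: "integrable (lborel \<Otimes>\<^sub>M lborel) (\<lambda>(x, t). w x t *\<^sub>R g x)"
  proof (rule lborel_pair.Fubini_integrable)
    show "AE x in lborel. integrable lborel (\<lambda>t. case (x, t) of (x, t) \<Rightarrow> w x t *\<^sub>R g x)"
      using ne by eventually_elim (use inner in auto)
    show "integrable lborel (\<lambda>x. \<integral>t. norm (case (x, t) of (x, t) \<Rightarrow> w x t *\<^sub>R g x) \<partial>lborel)"
    proof (rule integrable_cong_AE_imp[OF integrable_norm[OF int]])
      show "AE x in lborel. norm (W x *\<^sub>R g x) = (\<integral>t. norm (case (x, t) of (x, t) \<Rightarrow> w x t *\<^sub>R g x) \<partial>lborel)"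
        using ne by eventually_elim (simp only: prod.case inner(3) not_False_eq_True simp_thms)
    qed measurable
  qed measurable
  have "(\<integral>x. W x *\<^sub>R g x \<partial>lborel) = (\<integral>x. (\<integral>t. w x t *\<^sub>R g x \<partial>lborel) \<partial>lborel)"
  proof (rule integral_cong_AE)
    show "AE x in lborel. W x *\<^sub>R g x = (\<integral>t. w x t *\<^sub>R g x \<partial>lborel)"
      using ne by eventually_elim (use inner(2) in auto)
  qed (use int in measurable)
  also have "\<dots> = (\<integral>t. (\<integral>x. w x t *\<^sub>R g x \<partial>lborel) \<partial>lborel)"
    using lborel_pair.Fubini_integral[OF I] by simp
  finally show ?thesis .
qed

lemma fourier_riesz_kernel:
  fixes \<phi> \<phi>' :: "'a::euclidean_space \<Rightarrow> complex" and s :: real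
  defines "\<phi>' \<equiv> (\<lambda>x. \<integral>\<xi>. cis (- (x \<bullet> \<xi>)) * \<phi> \<xi> \<partial>lborel)"
  assumes s: "0 < s" "s < real DIM('a)"
    and int: "integrable lborel \<phi>"
      "integrable lborel (\<lambda>\<xi>. norm \<xi> powr (- s) *\<^sub>R \<phi> \<xi>)"
      "integrable lborel (\<lambda>x. norm x powr (s - real DIM('a)) *\<^sub>R \<phi>' x)"
  shows "(\<integral>x. (riesz_const DIM('a) s * norm x powr (s - real DIM('a))) *\<^sub>R \<phi>' x \<partial>lborel) =
         (\<integral>\<xi>. norm \<xi> powr (- s) *\<^sub>R \<phi> \<xi> \<partial>lborel)"
proof -
  define n where "n = real DIM('a)"
  define a where "a = (n - s) / 2"
  have a: "a > 0" "s / 2 > 0" using s by (auto simp: a_def n_def)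
  have [measurable]: "\<phi> \<in> borel_measurable borel" using int(1) by auto
  have [measurable]: "(\<lambda>x. cis (f x)) \<in> borel_measurable M" if [measurable]: "f \<in> borel_measurable M" for f :: "'b \<Rightarrow> real" and M
    unfolding cis_conv_exp by measurable
  have [measurable]: "\<phi>' \<in> borel_measurable borel" unfolding \<phi>'_def by measurable
  define E where "E = (\<lambda>t. \<lambda>x::'a. exp (- (t * (norm x)\<^sup>2)))"

  have parseval: "(4 * pi * t) powr (n / 2) *\<^sub>R (\<integral>\<xi>. E t \<xi> *\<^sub>R \<phi> \<xi> \<partial>lborel) =
      (\<integral>x. E (1 / (4 * t)) x *\<^sub>R \<phi>' x \<partial>lborel)" if t: "0 < t" for t
  proof -
    let ?u = "1 / (4 * t)"
    let ?K = "\<lambda>x \<xi>. (complex_of_real (E ?u x) * cis (- (x \<bullet> \<xi>))) * \<phi> \<xi>"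
    have G: "has_bochner_integral lborel (\<lambda>x. complex_of_real (E ?u x) * cis (- (x \<bullet> \<xi>)))
       (complex_of_real ((4 * pi * t) powr (n / 2) * E t \<xi>))" for \<xi>
      using gaussian_fourier[of ?u \<xi>] t by (simp add: E_def n_def mult_ac)
    have Ei: "integrable lborel (E ?u)"
    proof -
      have "integrable lborel (\<lambda>x. complex_of_real (E ?u x))"
        using G[of 0] by (simp add: has_bochner_integral_iff)
      thus ?thesis by (simp only: complex_of_real_integrable_eq)
    qed
    have I: "integrable (lborel \<Otimes>\<^sub>M lborel) (\<lambda>(x, \<xi>). ?K x \<xi>)"
    proof (rule lborel_pair.Fubini_integrable)
      show "AE x in lborel. integrable lborel (\<lambda>\<xi>. case (x, \<xi>) of (x, \<xi>) \<Rightarrow> ?K x \<xi>)"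
      proof (rule AE_I2)
        fix x :: 'a
        have "integrable lborel (\<lambda>\<xi>. norm (E ?u x *\<^sub>R \<phi> \<xi>))"
          using int(1) by (intro integrable_norm integrable_scaleR_right) auto
        thus "integrable lborel (\<lambda>\<xi>. case (x, \<xi>) of (x, \<xi>) \<Rightarrow> ?K x \<xi>)"
          by (rule Bochner_Integration.integrable_bound) (auto simp: norm_mult)
      qed
      have "(\<lambda>x. \<integral>\<xi>. norm (case (x, \<xi>) of (x, \<xi>) \<Rightarrow> ?K x \<xi>) \<partial>lborel) = (\<lambda>x. E ?u x * (\<integral>\<xi>. norm (\<phi> \<xi>) \<partial>lborel))"
        by (auto simp: norm_mult E_def)
      thus "integrable lborel (\<lambda>x. \<integral>\<xi>. norm (case (x, \<xi>) of (x, \<xi>) \<Rightarrow> ?K x \<xi>) \<partial>lborel)"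
        using Ei by simp
    qed (auto simp: E_def case_prod_unfold)
    have "(\<integral>x. E ?u x *\<^sub>R \<phi>' x \<partial>lborel) = (\<integral>x. (\<integral>\<xi>. ?K x \<xi> \<partial>lborel) \<partial>lborel)"
      by (simp add: \<phi>'_def scaleR_conv_of_real mult.assoc)
    also have "\<dots> = (\<integral>\<xi>. (\<integral>x. ?K x \<xi> \<partial>lborel) \<partial>lborel)"
      using lborel_pair.Fubini_integral[OF I] by simp
    also have "\<dots> = (\<integral>\<xi>. (4 * pi * t) powr (n / 2) *\<^sub>R (E t \<xi> *\<^sub>R \<phi> \<xi>) \<partial>lborel)"
    proof (rule Bochner_Integration.integral_cong)
      fix \<xi> :: 'a
      have "(\<integral>x. ?K x \<xi> \<partial>lborel) = complex_of_real ((4 * pi * t) powr (n / 2) * E t \<xi>) * \<phi> \<xi>"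
        using has_bochner_integral_mult_left[OF G[of \<xi>], of "\<phi> \<xi>"] by (simp add: has_bochner_integral_iff)
      thus "(\<integral>x. ?K x \<xi> \<partial>lborel) = (4 * pi * t) powr (n / 2) *\<^sub>R (E t \<xi> *\<^sub>R \<phi> \<xi>)"
        by (simp add: scaleR_conv_of_real)
    qed simp
    finally show ?thesis by (simp only: integral_scaleR_right)
  qed

  define p where "p = (\<lambda>t. indicat_real {0<..} t * t powr (s / 2 - 1))"
  define q where "q = (\<lambda>t. indicat_real {0<..} t * t powr (- a - 1))"
  have "(\<integral>\<xi>. (Gamma (s / 2) * norm \<xi> powr (- s)) *\<^sub>R \<phi> \<xi> \<partial>lborel) =
        (\<integral>t. (\<integral>\<xi>. (p t * E t \<xi>) *\<^sub>R \<phi> \<xi> \<partial>lborel) \<partial>lborel)"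
  proof (rule mixture_integral)
    fix \<xi> :: 'a assume "\<xi> \<noteq> 0"
    moreover from this have "((norm \<xi>)\<^sup>2) powr (s / 2) = norm \<xi> powr s"
      by (simp add: powr_powr flip: powr_numeral)
    ultimately have "Gamma (s / 2) * norm \<xi> powr (- s) = Gamma (s / 2) / ((norm \<xi>)\<^sup>2) powr (s / 2)"
      by (simp add: powr_minus_divide)
    moreover have "(\<lambda>t. p t * E t \<xi>) = (\<lambda>t. indicator {0<..} t * (t powr (s / 2 - 1) * exp (- ((norm \<xi>)\<^sup>2 * t))))"
      by (rule ext) (simp add: p_def E_def mult_ac)
    ultimately show "has_bochner_integral lborel (\<lambda>t. p t * E t \<xi>) (Gamma (s / 2) * norm \<xi> powr (- s))"
      using gamma_scaled[OF a(2), of "(norm \<xi>)\<^sup>2"] \<open>\<xi> \<noteq> 0\<close> by simp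
  next
    show "integrable lborel (\<lambda>\<xi>. (Gamma (s / 2) * norm \<xi> powr (- s)) *\<^sub>R \<phi> \<xi>)"
      using int(2) by (simp flip: scaleR_scaleR)
  qed (auto simp: p_def E_def)
  also have "\<dots> = (\<integral>t. (\<integral>x. ((4 * pi) powr (- n / 2) * q t * E (1 / (4 * t)) x) *\<^sub>R \<phi>' x \<partial>lborel) \<partial>lborel)"
  proof (rule Bochner_Integration.integral_cong)
    fix t :: real
    show "(\<integral>\<xi>. (p t * E t \<xi>) *\<^sub>R \<phi> \<xi> \<partial>lborel) =
        (\<integral>x. ((4 * pi) powr (- n / 2) * q t * E (1 / (4 * t)) x) *\<^sub>R \<phi>' x \<partial>lborel)"
    proof (cases "0 < t")
      case True
      have pq: "p t = (4 * pi) powr (- n / 2) * q t * (4 * pi * t) powr (n / 2)"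
      proof -
        have "(4 * pi) powr (- n / 2) * q t * (4 * pi * t) powr (n / 2) =
          ((4 * pi) powr (- n / 2) * (4 * pi) powr (n / 2)) * (t powr (- a - 1) * t powr (n / 2))"
          using True by (simp add: q_def powr_mult)
        also have "\<dots> = t powr (s / 2 - 1)"
          using True unfolding powr_add[symmetric] by (simp add: a_def field_simps)
        finally show ?thesis using True by (simp add: p_def)
      qed
      have "(\<integral>\<xi>. (p t * E t \<xi>) *\<^sub>R \<phi> \<xi> \<partial>lborel) = p t *\<^sub>R (\<integral>\<xi>. E t \<xi> *\<^sub>R \<phi> \<xi> \<partial>lborel)"
        by (simp flip: scaleR_scaleR)
      also have "\<dots> = ((4 * pi) powr (- n / 2) * q t) *\<^sub>R (\<integral>x. E (1 / (4 * t)) x *\<^sub>R \<phi>' x \<partial>lborel)"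
        unfolding pq parseval[OF True, symmetric] by simp
      also have "\<dots> = (\<integral>x. ((4 * pi) powr (- n / 2) * q t) *\<^sub>R (E (1 / (4 * t)) x *\<^sub>R \<phi>' x) \<partial>lborel)"
        by (rule integral_scaleR_right[symmetric])
      finally show ?thesis unfolding scaleR_scaleR .
    qed (simp add: p_def q_def)
  qed simp
  also have "\<dots> = (\<integral>x. (Gamma (s / 2) * riesz_const DIM('a) s * norm x powr (s - n)) *\<^sub>R \<phi>' x \<partial>lborel)"
  proof (rule mixture_integral[symmetric])
    fix x :: 'a assume x: "x \<noteq> 0"
    have G: "has_bochner_integral lborel (\<lambda>t. q t * E (1 / (4 * t)) x) (Gamma a / ((norm x)\<^sup>2 / 4) powr a)"
      using gamma_inverted[OF a(1), of "(norm x)\<^sup>2 / 4"] x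
      by (simp add: q_def E_def mult.assoc)
    have "((norm x)\<^sup>2 / 4) powr a = (norm x / 2) powr (2 * a)"
    proof -
      have "(norm x)\<^sup>2 / 4 = (norm x / 2) powr 2" using x by (simp add: power_divide)
      thus ?thesis by (simp only: powr_powr)
    qed
    also have "\<dots> = norm x powr (n - s) / 2 powr (n - s)"
    proof -
      have "2 * a = n - s" by (simp add: a_def)
      thus ?thesis using x by (simp add: powr_divide)
    qed
    finally have 1: "((norm x)\<^sup>2 / 4) powr a = norm x powr (n - s) / 2 powr (n - s)" .
    have "(4 * pi) powr (- n / 2) = 1 / (2 powr n * pi powr (n / 2))"
    proof -
      have "(4::real) powr (n / 2) = (2 powr 2) powr (n / 2)" by simp
      also have "\<dots> = 2 powr n" unfolding powr_powr by simp
      finally show ?thesis by (simp add: powr_minus powr_mult field_simps)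
    qed
    moreover have "norm x powr (s - n) = 1 / norm x powr (n - s)"
      using powr_minus_divide[of "norm x" "n - s"] by simp
    moreover have "(2::real) powr (n - s) = 2 powr n / 2 powr s" by (simp add: powr_diff)
    moreover have "Gamma (s / 2) > 0" using a by (intro Gamma_real_pos) auto
    ultimately have "(4 * pi) powr (- n / 2) * (Gamma a / ((norm x)\<^sup>2 / 4) powr a) =
        Gamma (s / 2) * riesz_const DIM('a) s * norm x powr (s - n)"
      unfolding 1 riesz_const_def n_def[symmetric] a_def[symmetric] using x by simp
    thus "has_bochner_integral lborel (\<lambda>t. (4 * pi) powr (- n / 2) * q t * E (1 / (4 * t)) x)
        (Gamma (s / 2) * riesz_const DIM('a) s * norm x powr (s - n))"
      using has_bochner_integral_mult_right[OF G, of "(4 * pi) powr (- n / 2)"]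
      by (simp add: mult.assoc)
  next
    show "integrable lborel (\<lambda>x. (Gamma (s / 2) * riesz_const DIM('a) s * norm x powr (s - n)) *\<^sub>R \<phi>' x)"
      using int(3) unfolding n_def[symmetric] scaleR_scaleR[symmetric] by (intro integrable_scaleR_right) auto
  qed (auto simp: q_def E_def)
  finally have "Gamma (s / 2) *\<^sub>R (\<integral>\<xi>. norm \<xi> powr (- s) *\<^sub>R \<phi> \<xi> \<partial>lborel) =
      Gamma (s / 2) *\<^sub>R (\<integral>x. (riesz_const DIM('a) s * norm x powr (s - n)) *\<^sub>R \<phi>' x \<partial>lborel)"
    by (simp only: mult.assoc scaleR_scaleR[symmetric, of "Gamma (s / 2)"] integral_scaleR_right)
  moreover have "Gamma (s / 2) \<noteq> 0" using Gamma_real_pos[OF a(2)] by linarith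
  ultimately show ?thesis by (simp add: n_def)
qed

end

theory Submission
  imports Defs
begin

text \<open>The weight \<open>q\<close> is the killing density of the \<open>\<alpha>\<close>-stable process in \<open>\<Omega>\<close>, that is, the rate
  $\int_{\Omega^c} J(x - w)\,dw$ of jumps from \<open>x\<close> out of \<open>\<Omega>\<close>, which is comparable to the distance to the
  boundary to the power \<open>-\<alpha>\<close>. Since the process leaves \<open>\<Omega>\<close> by a jump, the Green potential of \<open>q\<close>
  is at least \<open>1\<close> on \<open>\<Omega>\<close>: so every term of the series for $\mathcal{G}\omega$ is at least \<open>1\<close>, and the
  series diverges. On the other hand, the quadratic form of $(-\triangle)^{\alpha/2}$ on functions vanishing off
  \<open>\<Omega>\<close> is the sum of the censored form, which counts only the jumps inside \<open>\<Omega>\<close>, and $\int u^2 q$. For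
  \<open>\<alpha> > 1\<close> the censored form dominates a multiple of $\int u^2 q$ by Hardy's inequality, and this spectral
  gap makes the norm of \<open>T\<close> smaller than \<open>1\<close>.

  Balayage is made explicit by a walk on balls, whose exit distribution is found from Riesz's Poisson
  kernel of a ball. Hardy's inequality needs only exterior corkscrew balls: one compares \<open>u y\<close> with
  \<open>u x\<close>, averaged over the points \<open>x\<close> near \<open>y\<close> that are \<open>l\<close> times closer to the boundary; the terms with
  \<open>u x\<close> add up to a multiple of $l^{1-\alpha} \int u^2 q$, which is absorbed for large \<open>l\<close>.\<close>

section \<open>Polar coordinates and substitution\<close>

text \<open>Green's function is given here through a balayage measure known only up to sets of
  capacity zero, not as the inverse of an operator, and no form domain or differentiation is at
  hand. Everything is therefore drawn from one identity at positive radius, \<open>k_split\<close>: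
  the Riesz kernel is the Green function of a small ball about the pole plus the potential of its
  Poisson density. The nonlocal operator appears only as the radius tends to 0, and each such limit
  is arranged so that a one-sided inequality suffices. All integrals are nonnegative and possibly
  infinite, so equations are kept additive and a common term is cancelled only once it is finite.

  The delicate limit is that of the energy. It asks for an upper bound on averages of a Green
  potential over shrinking balls, whereas potentials of nonnegative densities are in general only
  lower semicontinuous. The Green potential is therefore written as the potential of a constant
  density on a large ball, whose continuity is explicit, minus the potential of a nonnegative
  density, to which Fatou's lemma applies.\<close>

lemma nn_integral_lborel_affine:
  fixes f :: "'a::euclidean_space \<Rightarrow> ennreal"
  assumes [measurable]: "f \<in> borel_measurable borel" and c: "c \<noteq> 0"
  shows "(\<integral>\<^sup>+x. f x \<partial>lborel) = ennreal (\<bar>c\<bar> ^ DIM('a)) * (\<integral>\<^sup>+x. f (t + c *\<^sub>R x) \<partial>lborel)"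
  using c by (subst lborel_affine[of c t])
    (simp_all add: nn_integral_density nn_integral_distr nn_integral_cmult)

lemma nn_integral_lborel_translate:
  fixes f :: "'a::euclidean_space \<Rightarrow> ennreal"
  assumes [measurable]: "f \<in> borel_measurable borel"
  shows "(\<integral>\<^sup>+x. f (t + x) \<partial>lborel) = (\<integral>\<^sup>+x. f x \<partial>lborel)"
    and "(\<integral>\<^sup>+x. f (x + t) \<partial>lborel) = (\<integral>\<^sup>+x. f x \<partial>lborel)"
    and "(\<integral>\<^sup>+x. f (x - t) \<partial>lborel) = (\<integral>\<^sup>+x. f x \<partial>lborel)"
    and "(\<integral>\<^sup>+x. f (t - x) \<partial>lborel) = (\<integral>\<^sup>+x. f x \<partial>lborel)"
proof -
  have 1: "(\<integral>\<^sup>+x. f (t + x) \<partial>lborel) = (\<integral>\<^sup>+x. f x \<partial>lborel)" for t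
    using nn_integral_lborel_affine[OF assms, of 1 t] by simp
  show "(\<integral>\<^sup>+x. f (t + x) \<partial>lborel) = (\<integral>\<^sup>+x. f x \<partial>lborel)" by (rule 1)
  show "(\<integral>\<^sup>+x. f (x + t) \<partial>lborel) = (\<integral>\<^sup>+x. f x \<partial>lborel)" using 1[of t] by (simp only: add.commute[of t])
  show "(\<integral>\<^sup>+x. f (x - t) \<partial>lborel) = (\<integral>\<^sup>+x. f x \<partial>lborel)" using 1[of "-t"] by (simp add: algebra_simps)
  show "(\<integral>\<^sup>+x. f (t - x) \<partial>lborel) = (\<integral>\<^sup>+x. f x \<partial>lborel)"
    using nn_integral_lborel_affine[OF assms, of "-1" t] by simp
qed

text \<open>The admissible t fill the interval from s / e to s, which has length ln e = 1 with
  respect to dt / t.\<close>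

lemma nn_integral_log_window:
  fixes s :: real
  assumes "0 < s"
  shows "(\<integral>\<^sup>+t. indicator {0<..} t * (indicator {1..exp 1} (s / t) * ennreal (1 / t)) \<partial>lborel) = 1"
proof -
  have "(\<integral>\<^sup>+t. indicator {0<..} t * (indicator {1..exp 1} (s / t) * ennreal (1 / t)) \<partial>lborel)
      = (\<integral>\<^sup>+t. ennreal (1 / t) * indicator {s / exp 1..s} t \<partial>lborel)"
    using assms by (intro nn_integral_cong) (auto simp: indicator_def field_simps ennreal_neg not_less zero_le_divide_iff)
  also have "\<dots> = ennreal (ln s - ln (s / exp 1))"
  proof (rule nn_integral_FTC_Icc)
    show "s / exp 1 \<le> s" using assms by (simp add: field_simps)
    fix x assume "x \<in> {s / exp 1..s}"
    moreover have "0 < s / exp 1" using assms by simp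
    ultimately have "0 < x" by (meson atLeastAtMost_iff order_less_le_trans)
    then have "(ln has_real_derivative 1 / x) (at x)" "0 \<le> 1 / x"
      by (auto intro!: derivative_eq_intros)
    then show "DERIV ln x :> 1 / x" "0 \<le> 1 / x" by auto
  qed simp
  also have "ln s - ln (s / exp 1) = 1" using assms by (simp add: ln_div)
  finally show ?thesis by simp
qed

text \<open>Polar integration without a surface measure: the directions are smeared over the shell
  between the radii \<open>1\<close> and \<open>e\<close>, whose logarithmic width is \<open>1\<close>.\<close>

lemma nn_integral_polar:
  fixes f :: "'a::euclidean_space \<Rightarrow> ennreal"
  assumes [measurable]: "f \<in> borel_measurable borel"
  shows "(\<integral>\<^sup>+x. f x \<partial>lborel) = (\<integral>\<^sup>+v. indicator {1..exp 1} (norm v) *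
     (\<integral>\<^sup>+t. indicator {0<..} t * (ennreal (t ^ (DIM('a) - 1)) * f (t *\<^sub>R v)) \<partial>lborel) \<partial>lborel)"
proof -
  have "(\<integral>\<^sup>+v. indicator {1..exp 1} (norm v) *
     (\<integral>\<^sup>+t. indicator {0<..} t * (ennreal (t ^ (DIM('a) - 1)) * f (t *\<^sub>R v)) \<partial>lborel) \<partial>lborel) =
     (\<integral>\<^sup>+v. (\<integral>\<^sup>+t. indicator {1..exp 1} (norm v) *
       (indicator {0<..} t * (ennreal (t ^ (DIM('a) - 1)) * f (t *\<^sub>R v))) \<partial>lborel) \<partial>lborel)"
    by (subst nn_integral_cmult) auto
  also have "\<dots> = (\<integral>\<^sup>+t. (\<integral>\<^sup>+v. indicator {1..exp 1} (norm v) *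
       (indicator {0<..} t * (ennreal (t ^ (DIM('a) - 1)) * f (t *\<^sub>R v))) \<partial>lborel) \<partial>lborel)"
    by (rule lborel_pair.Fubini') simp
  \<comment> \<open>Replacing v by v / t for fixed t produces the Jacobian t^(-n), which leaves 1 /
    t of the factor t^(n - 1); the argument of f then no longer depends on t.\<close>
  also have "\<dots> = (\<integral>\<^sup>+t. (\<integral>\<^sup>+v. indicator {0<..} t * (indicator {1..exp 1} (norm v / t) * ennreal (1 / t)) * f v \<partial>lborel) \<partial>lborel)"
  proof (rule nn_integral_cong)
    fix t :: real
    show "(\<integral>\<^sup>+v. indicator {1..exp 1} (norm v) *
       (indicator {0<..} t * (ennreal (t ^ (DIM('a) - 1)) * f (t *\<^sub>R v))) \<partial>lborel) =
      (\<integral>\<^sup>+v. indicator {0<..} t * (indicator {1..exp 1} (norm v / t) * ennreal (1 / t)) * f v \<partial>lborel)"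
    proof (cases "0 < t")
      case True
      have "t ^ DIM('a) = t ^ (DIM('a) - 1) * t"
        using power_minus_mult[of "DIM('a)" t] by simp
      then have pw: "ennreal (t ^ (DIM('a) - 1)) = ennreal (t ^ DIM('a)) * ennreal (1 / t)"
        using True by (simp add: ennreal_mult'[symmetric])
      have "(\<integral>\<^sup>+v. indicator {0<..} t * (indicator {1..exp 1} (norm v / t) * ennreal (1 / t)) * f v \<partial>lborel) =
        ennreal (t ^ DIM('a)) * (\<integral>\<^sup>+v. indicator {1..exp 1} (norm v) * ennreal (1 / t) * f (t *\<^sub>R v) \<partial>lborel)"
        using True by (subst nn_integral_lborel_affine[of _ t 0]) auto
      also have "\<dots> = (\<integral>\<^sup>+v. indicator {1..exp 1} (norm v) *
         (indicator {0<..} t * (ennreal (t ^ (DIM('a) - 1)) * f (t *\<^sub>R v))) \<partial>lborel)"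
        unfolding pw using True
        by (subst nn_integral_cmult[symmetric]) (auto intro!: nn_integral_cong simp: ac_simps)
      finally show ?thesis by simp
    qed simp
  qed
  also have "\<dots> = (\<integral>\<^sup>+v. (\<integral>\<^sup>+t. indicator {0<..} t * (indicator {1..exp 1} (norm v / t) * ennreal (1 / t)) * f v \<partial>lborel) \<partial>lborel)"
    by (rule lborel_pair.Fubini') simp
  also have "\<dots> = (\<integral>\<^sup>+v. (\<integral>\<^sup>+t. indicator {0<..} t * (indicator {1..exp 1} (norm v / t) * ennreal (1 / t)) \<partial>lborel) * f v \<partial>lborel)"
    by (subst nn_integral_multc) auto
  also have "\<dots> = (\<integral>\<^sup>+v. f v \<partial>lborel)"
  proof (rule nn_integral_cong_AE)
    have "AE v in lborel. v \<noteq> (0::'a)" by (rule AE_lborel_singleton)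
    then show "AE v in lborel. (\<integral>\<^sup>+t. indicator {0<..} t * (indicator {1..exp 1} (norm (v::'a) / t) * ennreal (1 / t)) \<partial>lborel) * f v = f v"
      by eventually_elim (simp only: nn_integral_log_window zero_less_norm_iff not_False_eq_True mult_1)
  qed
  finally show ?thesis by simp
qed

text \<open>Induction over nonnegative Borel functions: the real-valued substitution rule settles
  indicator functions, and sums, multiples and monotone limits preserve the claim.\<close>

lemma nn_integral_substitution_Icc:
  fixes f :: "real \<Rightarrow> ennreal"
  assumes f: "f \<in> borel_measurable borel"
    and [measurable]: "g \<in> borel_measurable borel" "g' \<in> borel_measurable borel"
    and deriv: "\<And>x. x \<in> {a..b} \<Longrightarrow> (g has_real_derivative g' x) (at x)"
    and cont: "continuous_on {a..b} g'" and nonneg: "\<And>x. x \<in> {a..b} \<Longrightarrow> 0 \<le> g' x" and "a \<le> b"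
  shows "(\<integral>\<^sup>+x. f x * indicator {g a..g b} x \<partial>lborel) = (\<integral>\<^sup>+x. f (g x) * ennreal (g' x) * indicator {a..b} x \<partial>lborel)"
  using f
proof (induction f rule: borel_measurable_induct)
  case (cong f h)
  then show ?case by (metis (no_types, lifting) nn_integral_cong space_borel UNIV_I)
next
  case (set A)
  then have [measurable]: "A \<in> sets borel" by simp
  have "(\<integral>\<^sup>+x. indicator A x * indicator {g a..g b} x \<partial>lborel) = (\<integral>\<^sup>+x. ennreal (indicator A x * indicator {g a..g b} x) \<partial>lborel)"
    by (intro nn_integral_cong) (auto simp: indicator_def)
  also have "\<dots> = (\<integral>\<^sup>+x. ennreal (indicator A (g x) * g' x * indicator {a..b} x) \<partial>lborel)"
    by (rule nn_integral_substitution) (use deriv cont nonneg \<open>a \<le> b\<close> in \<open>auto simp: set_borel_measurable_def\<close>)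
  also have "\<dots> = (\<integral>\<^sup>+x. indicator A (g x) * ennreal (g' x) * indicator {a..b} x \<partial>lborel)"
    by (intro nn_integral_cong) (auto simp: indicator_def)
  finally show ?case .
next
  case (mult u c)
  then have [measurable]: "u \<in> borel_measurable borel" by simp
  have "(\<integral>\<^sup>+x. c * u x * indicator {g a..g b} x \<partial>lborel) = c * (\<integral>\<^sup>+x. u x * indicator {g a..g b} x \<partial>lborel)"
    by (subst nn_integral_cmult[symmetric]) (auto simp: mult.assoc)
  also have "\<dots> = (\<integral>\<^sup>+x. c * u (g x) * ennreal (g' x) * indicator {a..b} x \<partial>lborel)"
    unfolding mult.IH by (subst nn_integral_cmult[symmetric]) (auto simp: mult.assoc)
  finally show ?case .
next
  case (add u v)
  then have [measurable]: "u \<in> borel_measurable borel" "v \<in> borel_measurable borel" by simp_all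
  have "(\<integral>\<^sup>+x. (v x + u x) * indicator {g a..g b} x \<partial>lborel) =
     (\<integral>\<^sup>+x. v x * indicator {g a..g b} x \<partial>lborel) + (\<integral>\<^sup>+x. u x * indicator {g a..g b} x \<partial>lborel)"
    by (subst nn_integral_add[symmetric]) (auto simp: distrib_right)
  also have "\<dots> = (\<integral>\<^sup>+x. (v (g x) + u (g x)) * ennreal (g' x) * indicator {a..b} x \<partial>lborel)"
    unfolding add.IH by (subst nn_integral_add[symmetric]) (auto simp: distrib_right)
  finally show ?case .
next
  case (seq U)
  then have [measurable]: "\<And>i. U i \<in> borel_measurable borel" by simp_all
  have inc: "incseq (\<lambda>i x. U i (h x) * w x * v x)" for h w v
    using seq(3) by (auto simp: incseq_def le_fun_def intro!: mult_right_mono)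
  have inc': "incseq (\<lambda>i x. U i x * v x)" for v
    using seq(3) by (auto simp: incseq_def le_fun_def intro!: mult_right_mono)
  have "(\<integral>\<^sup>+x. (SUP i. U i) x * indicator {g a..g b} x \<partial>lborel) = (SUP i. \<integral>\<^sup>+x. U i x * indicator {g a..g b} x \<partial>lborel)"
    by (subst nn_integral_monotone_convergence_SUP[symmetric, OF inc'])
       (auto simp: SUP_mult_right_ennreal image_comp)
  also have "\<dots> = (\<integral>\<^sup>+x. (SUP i. U i) (g x) * ennreal (g' x) * indicator {a..b} x \<partial>lborel)"
    unfolding seq.IH by (subst nn_integral_monotone_convergence_SUP[symmetric, OF inc])
       (auto simp: SUP_mult_right_ennreal image_comp)
  finally show ?case .
qed

lemma nn_integral_substitution_Icc_decreasing:
  fixes f :: "real \<Rightarrow> ennreal"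
  assumes [measurable]: "f \<in> borel_measurable borel" "g \<in> borel_measurable borel" "g' \<in> borel_measurable borel"
    and deriv: "\<And>x. x \<in> {a..b} \<Longrightarrow> (g has_real_derivative - g' x) (at x)"
    and cont: "continuous_on {a..b} g'" and nonneg: "\<And>x. x \<in> {a..b} \<Longrightarrow> 0 \<le> g' x" and "a \<le> b"
  shows "(\<integral>\<^sup>+x. f x * indicator {g b..g a} x \<partial>lborel) = (\<integral>\<^sup>+x. f (g x) * ennreal (g' x) * indicator {a..b} x \<partial>lborel)"
proof -
  have "(\<integral>\<^sup>+x. f x * indicator {g b..g a} x \<partial>lborel) = (\<integral>\<^sup>+x. f (0 - x) * indicator {g b..g a} (0 - x) \<partial>lborel)"
    by (subst nn_integral_lborel_translate(4)) auto
  also have "\<dots> = (\<integral>\<^sup>+x. f (- x) * indicator {- g a..- g b} x \<partial>lborel)"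
    by (intro nn_integral_cong) (auto simp: indicator_def)
  also have "\<dots> = (\<integral>\<^sup>+x. f (- (- g x)) * ennreal (g' x) * indicator {a..b} x \<partial>lborel)"
    by (rule nn_integral_substitution_Icc[where g="\<lambda>x. - g x" and g'=g' and f="\<lambda>x. f (- x)"])
      (use nonneg cont \<open>a \<le> b\<close> in \<open>auto intro!: derivative_eq_intros deriv\<close>)
  finally show ?thesis by simp
qed

lemma nn_integral_indicator_SUP:
  fixes f :: "real \<Rightarrow> ennreal" and A :: "nat \<Rightarrow> real set"
  assumes [measurable]: "f \<in> borel_measurable borel" "\<And>i. A i \<in> sets borel" and "incseq A"
  shows "(\<integral>\<^sup>+x. f x * indicator (\<Union>i. A i) x \<partial>lborel) = (SUP i. \<integral>\<^sup>+x. f x * indicator (A i) x \<partial>lborel)"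
proof -
  have inc: "incseq (\<lambda>i x. f x * indicator (A i) x)"
    using \<open>incseq A\<close> by (auto simp: incseq_def le_fun_def indicator_def intro!: mult_left_mono)
  have "(SUP i. f x * indicator (A i) x) = f x * indicator (\<Union>i. A i) x" for x
  proof -
    have "(SUP i. indicator (A i) x :: ennreal) = indicator (\<Union>i. A i) x"
    proof (cases "\<exists>i. x \<in> A i")
      case True
      then obtain i where "x \<in> A i" by auto
      then have "(1::ennreal) \<le> (SUP i. indicator (A i) x)" by (intro SUP_upper2[of i]) auto
      moreover have "(SUP i. indicator (A i) x) \<le> (1::ennreal)" by (intro SUP_least) (auto simp: indicator_def)
      ultimately show ?thesis using True by (auto simp: indicator_def antisym)
    qed (auto simp: indicator_def)
    then show ?thesis by (metis SUP_mult_left_ennreal)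
  qed
  then show ?thesis
    by (subst nn_integral_monotone_convergence_SUP[symmetric, OF inc]) auto
qed

text \<open>Substitution on an open interval, described by an exhaustion with compact intervals.\<close>

lemma nn_integral_substitution_decreasing:
  fixes f :: "real \<Rightarrow> ennreal" and a b :: "nat \<Rightarrow> real"
  assumes [measurable]: "f \<in> borel_measurable borel" "g \<in> borel_measurable borel" "g' \<in> borel_measurable borel"
    and deriv: "\<And>x. x \<in> S \<Longrightarrow> (g has_real_derivative - g' x) (at x)"
    and cont: "continuous_on S g'" and nonneg: "\<And>x. x \<in> S \<Longrightarrow> 0 \<le> g' x"
    and ab: "\<And>i. a i \<le> b i" "decseq a" "incseq b"
    and S: "S = (\<Union>i. {a i..b i})" "T = (\<Union>i. {g (b i)..g (a i)})"
  shows "(\<integral>\<^sup>+x. f x * indicator T x \<partial>lborel) = (\<integral>\<^sup>+x. f (g x) * ennreal (g' x) * indicator S x \<partial>lborel)"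
proof -
  have sub: "{a i..b i} \<subseteq> S" for i using S by auto
  have inc1: "incseq (\<lambda>i. {a i..b i})"
    using ab by (auto simp: incseq_def decseq_def intro: order_trans)
  have anti: "g y \<le> g x" if xy: "x \<le> y" "x \<in> S" "y \<in> S" for x y
  proof -
    obtain i j where ij: "x \<in> {a i..b i}" "y \<in> {a j..b j}" using xy S(1) by blast
    have "{a i..b i} \<subseteq> {a (max i j)..b (max i j)}" "{a j..b j} \<subseteq> {a (max i j)..b (max i j)}"
      using inc1 by (auto simp: incseq_def)
    then have "{x..y} \<subseteq> S" using ij sub[of "max i j"] by force
    then show ?thesis
      using deriv nonneg by (intro DERIV_nonpos_imp_nonincreasing[OF xy(1)]) force
  qed
  have inc2: "incseq (\<lambda>i. {g (b i)..g (a i)})"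
  proof (rule incseq_SucI)
    fix i
    have "a (Suc i) \<le> a i" "b i \<le> b (Suc i)" using ab by (auto simp: incseq_def decseq_def)
    moreover have "a i \<in> S" "b i \<in> S" "a (Suc i) \<in> S" "b (Suc i) \<in> S" using sub ab(1) by (meson atLeastAtMost_iff order_refl subsetD)+
    ultimately have "g (b (Suc i)) \<le> g (b i)" "g (a i) \<le> g (a (Suc i))" using anti by auto
    then show "{g (b i)..g (a i)} \<subseteq> {g (b (Suc i))..g (a (Suc i))}" by auto
  qed
  show ?thesis
    unfolding S
    by (subst nn_integral_indicator_SUP[OF _ _ inc2], simp, simp,
        subst nn_integral_indicator_SUP[OF _ _ inc1], simp, simp,
        intro SUP_cong refl nn_integral_substitution_Icc_decreasing)
      (use deriv[OF subsetD[OF sub]] nonneg[OF subsetD[OF sub]] ab continuous_on_subset[OF cont sub] in auto)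
qed

lemma nn_integral_substitution_decreasing_interval:
  fixes f :: "real \<Rightarrow> ennreal" and c d :: real
  assumes [measurable]: "f \<in> borel_measurable borel" "g \<in> borel_measurable borel" "g' \<in> borel_measurable borel"
    and deriv: "\<And>x. c < x \<Longrightarrow> x < d \<Longrightarrow> (g has_real_derivative - g' x) (at x)"
    and cont: "continuous_on {c<..<d} g'" and nonneg: "\<And>x. c < x \<Longrightarrow> x < d \<Longrightarrow> 0 \<le> g' x"
    and "c < d"
    and range: "\<And>x. c < x \<Longrightarrow> x < d \<Longrightarrow> c' < g x \<and> g x < d'"
    and inv: "\<And>y. c' < y \<Longrightarrow> y < d' \<Longrightarrow> \<exists>x. c < x \<and> x < d \<and> g x = y"
  shows "(\<integral>\<^sup>+x. f x * indicator {c'<..<d'} x \<partial>lborel) =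
    (\<integral>\<^sup>+x. f (g x) * ennreal (g' x) * indicator {c<..<d} x \<partial>lborel)"
proof -
  \<comment> \<open>The summand 2 makes \<open>e 0\<close> half the length of the interval, so that
    already \<open>a 0 \<le> b 0\<close>.\<close>
  define e where "e = (\<lambda>i. (d - c) / real (i + 2))"
  define a where "a = (\<lambda>i. c + e i)"
  define b where "b = (\<lambda>i. d - e i)"
  have e: "0 < e i" "e i \<le> (d - c) / 2" "decseq e" for i
    unfolding e_def decseq_def using \<open>c < d\<close>
    by (simp, intro divide_left_mono, simp_all, intro allI impI divide_left_mono, simp_all)
  have ab: "a i \<le> b i" "decseq a" "incseq b" for i
    using e(3) e(2)[of i] by (auto simp: a_def b_def decseq_def incseq_def field_simps)
  have in_S: "c < x \<and> x < d" if "x \<in> {a i..b i}" for x i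
    using that e(1)[of i] by (auto simp: a_def b_def)
  have ex: "\<exists>i. x \<in> {a i..b i}" if x: "c < x" "x < d" for x
  proof -
    obtain i where i: "(d - c) / min (x - c) (d - x) \<le> real i" using real_arch_simple by blast
    have m: "0 < min (x - c) (d - x)" using x by auto
    then have "d - c \<le> real i * min (x - c) (d - x)" using i by (simp add: field_simps)
    also have "\<dots> \<le> real (i + 2) * min (x - c) (d - x)" using m by (intro mult_right_mono) auto
    finally have "e i \<le> min (x - c) (d - x)"
      unfolding e_def by (subst pos_divide_le_eq) (simp_all add: mult.commute)
    then show ?thesis by (intro exI[of _ i]) (auto simp: a_def b_def)
  qed
  have anti: "g y \<le> g x" if xy: "x \<le> y" "c < x" "y < d" for x y
    using deriv nonneg xy by (intro DERIV_nonpos_imp_nonincreasing[OF xy(1)]) force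
  show ?thesis
  proof (rule nn_integral_substitution_decreasing[OF _ _ _ _ _ _ ab])
    show "{c<..<d} = (\<Union>i. {a i..b i})" using ex in_S by fastforce
    show "{c'<..<d'} = (\<Union>i. {g (b i)..g (a i)})"
    proof (intro equalityI subsetI)
      fix y assume "y \<in> {c'<..<d'}"
      then obtain x where x: "c < x" "x < d" "g x = y" using inv by auto
      obtain i where "x \<in> {a i..b i}" using ex x by blast
      then have "y \<in> {g (b i)..g (a i)}" using anti x in_S[of "a i" i] in_S[of "b i" i] ab(1)[of i] by auto
      then show "y \<in> (\<Union>i. {g (b i)..g (a i)})" by blast
    next
      fix y assume "y \<in> (\<Union>i. {g (b i)..g (a i)})"
      then obtain i where "y \<in> {g (b i)..g (a i)}" by blast
      then show "y \<in> {c'<..<d'}"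
        using range[of "a i"] range[of "b i"] in_S[of "a i" i] in_S[of "b i" i] ab(1)[of i] by auto
    qed
  qed (use deriv nonneg cont in auto)
qed

lemma nn_integral_pos_reciprocal:
  fixes f :: "real \<Rightarrow> ennreal"
  assumes [measurable]: "f \<in> borel_measurable borel" and c: "0 < c"
  shows "(\<integral>\<^sup>+t. f t * indicator {0<..} t \<partial>lborel) = (\<integral>\<^sup>+t. f (c / t) * ennreal (c / t\<^sup>2) * indicator {0<..} t \<partial>lborel)"
proof -
  \<comment> \<open>The map t -> c / t carries the interval from 1 / (i + 1) to i + 1 onto c times
    itself, so both exhaustions have the same shape.\<close>
  define a where "a = (\<lambda>i. 1 / real (Suc i))"
  define b where "b = (\<lambda>i. real (Suc i))"
  have ab: "a i \<le> b i" "decseq a" "incseq b" for i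
    by (auto simp: a_def b_def decseq_def incseq_def field_simps)
  have ex: "x \<in> (\<Union>i. {u * a i..u * b i})" if x: "0 < x" and u: "0 < u" for x u
  proof -
    obtain i where i: "max (x / u) (u / x) \<le> real i" using real_arch_simple by blast
    have "x \<le> u * real i" "u \<le> x * real i" using i x u by (auto simp: field_simps)
    moreover have "u * real i \<le> u * real (Suc i)" "x * real i \<le> x * real (Suc i)" using x u by auto
    ultimately have "u * a i \<le> x" "x \<le> u * b i"
      unfolding a_def b_def using x u by (auto simp: field_simps)
    then show ?thesis by auto
  qed
  have pos: "0 < a i" "0 < b i" for i by (auto simp: a_def b_def)
  show ?thesis
  proof (rule nn_integral_substitution_decreasing[OF _ _ _ _ _ _ ab])
    show "{0<..} = (\<Union>i. {a i..b i})"
      using ex[of _ 1] less_le_trans[OF pos(1)] by fastforce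
    have "c / b i = c * a i" "c / a i = c * b i" for i by (auto simp: a_def b_def)
    then show "{0<..} = (\<Union>i. {c / b i..c / a i})"
      using ex[of _ c] less_le_trans[OF mult_pos_pos[OF c pos(1)]] c by fastforce
  qed (use c in \<open>auto intro!: derivative_eq_intros continuous_intros simp: power2_eq_square\<close>)
qed


section \<open>The Riesz potential of the weight of a ball\<close>

text \<open>The involution \<open>g\<close> is the Moebius map of the interval that fixes s and
  interchanges -1 and 1, so it exchanges the two sides of s. The exponents \<alpha> - 2 and
  -\<alpha> / 2 are such that all powers of 1 - s^2 and of \<open>D\<close> cancel against the
  Jacobian \<open>g'\<close>.\<close>

lemma swap_sides:
  fixes s \<alpha> :: real
  assumes s: "-1 < s" "s < 1"
  shows "(\<integral>\<^sup>+y. ennreal ((y - s) powr (\<alpha> - 2) * (1 - y\<^sup>2) powr (- \<alpha> / 2)) * indicator {s<..<1} y \<partial>lborel) =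
    (\<integral>\<^sup>+y. ennreal ((s - y) powr (\<alpha> - 2) * (1 - y\<^sup>2) powr (- \<alpha> / 2)) * indicator {-1<..<s} y \<partial>lborel)"
proof -
  define D where "D y = 1 + s\<^sup>2 - 2 * s * y" for y
  define g where "g y = (2 * s - (1 + s\<^sup>2) * y) / D y" for y
  define g' where "g' y = (1 - s\<^sup>2)\<^sup>2 / (D y)\<^sup>2" for y
  have s2: "0 < 1 - s\<^sup>2" using s by (simp add: abs_square_less_1)
  have D: "0 < D y" if "-1 < y" "y < 1" for y
  proof -
    have "\<bar>s * y\<bar> < 1" using s that by (metis abs_mult abs_less_iff mult_strict_mono' abs_ge_zero mult_1 minus_less_iff)
    moreover have "2 * \<bar>s * y\<bar> \<le> 2 * \<bar>s\<bar>" using s that by (simp add: abs_mult mult_left_le)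
    moreover have "(1 - \<bar>s\<bar>)\<^sup>2 > 0" using s by (auto simp: abs_if)
    ultimately show ?thesis unfolding D_def by (auto simp: power2_eq_square algebra_simps abs_if split: if_splits)
  qed
  have 1: "g y - s = (1 - s\<^sup>2) * (s - y) / D y" if "-1 < y" "y < 1" for y
    using D[OF that] unfolding g_def by (simp add: field_simps) (simp add: D_def power2_eq_square algebra_simps)
  have 2: "1 - g y = (1 - s)\<^sup>2 * (1 + y) / D y" if "-1 < y" "y < 1" for y
    using D[OF that] unfolding g_def by (simp add: field_simps) (simp add: D_def power2_eq_square algebra_simps)
  have 3: "1 - (g y)\<^sup>2 = (1 - s\<^sup>2)\<^sup>2 * (1 - y\<^sup>2) / (D y)\<^sup>2" if "-1 < y" "y < 1" for y
  proof -
    have "1 + g y = (1 + s)\<^sup>2 * (1 - y) / D y"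
      using D[OF that] unfolding g_def by (simp add: field_simps) (simp add: D_def power2_eq_square algebra_simps)
    then have "(1 - g y) * (1 + g y) = ((1 - s)\<^sup>2 * (1 + y) / D y) * ((1 + s)\<^sup>2 * (1 - y) / D y)"
      using 2[OF that] by simp
    then show ?thesis by (simp add: power2_eq_square algebra_simps)
  qed
  \<comment> \<open>Being its own inverse, \<open>g\<close> supplies the preimage of y as
    \<open>g y\<close> in the substitution below.\<close>
  have inv: "g (g y) = y" if y: "-1 < y" "y < 1" for y
  proof -
    have gD: "g y * D y = 2 * s - (1 + s\<^sup>2) * y" using D[OF y] by (simp add: g_def)
    have "D (g y) * D y = (1 + s\<^sup>2) * D y - 2 * s * (g y * D y)"
      unfolding D_def[of "g y"] by (simp add: algebra_simps)
    also have "\<dots> = (1 - s\<^sup>2)\<^sup>2" unfolding gD by (simp add: D_def power2_eq_square algebra_simps)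
    finally have "D (g y) = (1 - s\<^sup>2)\<^sup>2 / D y" using D[OF y] by (simp add: field_simps)
    moreover have "(2 * s - (1 + s\<^sup>2) * g y) * D y = 2 * s * D y - (1 + s\<^sup>2) * (g y * D y)"
      by (simp add: algebra_simps)
    then have "(2 * s - (1 + s\<^sup>2) * g y) * D y = (1 - s\<^sup>2)\<^sup>2 * y"
      unfolding gD by (simp add: D_def power2_eq_square algebra_simps)
    then have "2 * s - (1 + s\<^sup>2) * g y = (1 - s\<^sup>2)\<^sup>2 * y / D y" using D[OF y] by (simp add: field_simps)
    ultimately show ?thesis unfolding g_def[of "g y"] using D[OF y] s2 by simp
  qed
  have "(\<integral>\<^sup>+y. ennreal ((y - s) powr (\<alpha> - 2) * (1 - y\<^sup>2) powr (- \<alpha> / 2)) * indicator {s<..<1} y \<partial>lborel) =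
    (\<integral>\<^sup>+y. ennreal ((g y - s) powr (\<alpha> - 2) * (1 - (g y)\<^sup>2) powr (- \<alpha> / 2)) * ennreal (g' y) * indicator {-1<..<s} y \<partial>lborel)"
  proof (rule nn_integral_substitution_decreasing_interval)
    fix y assume "-1 < y" "y < s"
    then have y: "-1 < y" "y < 1" "0 < s - y" using s by auto
    have "s < g y" using 1[OF y(1,2)] y(3) s2 D[OF y(1,2)] by (metis diff_gt_0_iff_gt divide_pos_pos mult_pos_pos)
    moreover have "0 < 1 - g y" unfolding 2[OF y(1,2)] using y s D[OF y(1,2)] by auto
    ultimately show "s < g y \<and> g y < 1" by simp
    have "(g has_real_derivative ((- (1 + s\<^sup>2)) * D y - (2 * s - (1 + s\<^sup>2) * y) * (- 2 * s)) / (D y)\<^sup>2) (at y)"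
      unfolding g_def[abs_def] using D[OF y(1,2)]
      by (auto intro!: derivative_eq_intros simp: D_def[abs_def] power2_eq_square)
    also have "((- (1 + s\<^sup>2)) * D y - (2 * s - (1 + s\<^sup>2) * y) * (- 2 * s)) = - (1 - s\<^sup>2)\<^sup>2"
      by (simp add: D_def power2_eq_square algebra_simps)
    finally show "(g has_real_derivative - g' y) (at y)" unfolding g'_def by simp
  next
    fix y assume y': "s < y" "y < 1"
    then have y: "-1 < y" "y < 1" "0 < y - s" using s by auto
    have "g y - s < 0" unfolding 1[OF y(1,2)] using y(3) s2 D[OF y(1,2)] by (simp add: divide_neg_pos mult_pos_neg)
    moreover have "- 1 < g y"
    proof -
      have "0 < 1 - y\<^sup>2" using y by (simp add: abs_square_less_1)
      then have "0 < 1 - (g y)\<^sup>2" unfolding 3[OF y(1,2)]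
        using s2 D[OF y(1,2)] by (intro divide_pos_pos mult_pos_pos) auto
      then show ?thesis by (simp add: abs_square_less_1)
    qed
    ultimately show "\<exists>x>- 1. x < s \<and> g x = y" using inv[OF y(1,2)] by (intro exI[of _ "g y"]) auto
  next
    show "continuous_on {-1<..<s} g'"
    proof -
      have "D y \<noteq> 0" if "y \<in> {-1<..<s}" for y using D[of y] that s by auto
      then show ?thesis unfolding g'_def[abs_def] D_def by (intro continuous_intros) auto
    qed
    show "g \<in> borel_measurable borel" "g' \<in> borel_measurable borel" unfolding g_def[abs_def] g'_def[abs_def] D_def by measurable
  qed (use s in \<open>auto simp: g'_def\<close>)
  also have "\<dots> = (\<integral>\<^sup>+y. ennreal ((s - y) powr (\<alpha> - 2) * (1 - y\<^sup>2) powr (- \<alpha> / 2)) * indicator {-1<..<s} y \<partial>lborel)"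
  proof (intro nn_integral_cong)
    fix y :: real
    show "ennreal ((g y - s) powr (\<alpha> - 2) * (1 - (g y)\<^sup>2) powr (- \<alpha> / 2)) * ennreal (g' y) * indicator {-1<..<s} y =
      ennreal ((s - y) powr (\<alpha> - 2) * (1 - y\<^sup>2) powr (- \<alpha> / 2)) * indicator {-1<..<s} y"
    proof (cases "y \<in> {-1<..<s}")
      case True
      then have y: "-1 < y" "y < 1" "0 < s - y" using s by auto
      have y2: "0 < 1 - y\<^sup>2" using y by (simp add: abs_square_less_1)
      let ?c = "1 - s\<^sup>2" and ?D = "D y"
      note pos = D[OF y(1,2)] s2 y(3) y2
      have e: "(?c\<^sup>2) powr p = ?c powr (2 * p)" "(?D\<^sup>2) powr p = ?D powr (2 * p)" for p
        using pos by (simp_all add: powr_powr flip: powr_numeral)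
      have "(g y - s) powr (\<alpha> - 2) * (1 - (g y)\<^sup>2) powr (- \<alpha> / 2) * g' y =
        (?c powr (\<alpha> - 2) * (s - y) powr (\<alpha> - 2) / ?D powr (\<alpha> - 2)) *
        (?c powr (- \<alpha>) * (1 - y\<^sup>2) powr (- \<alpha> / 2) / ?D powr (- \<alpha>)) * (?c powr 2 / ?D powr 2)"
        unfolding 1[OF y(1,2)] 3[OF y(1,2)] g'_def using pos by (simp add: powr_mult powr_divide e)
      also have "\<dots> = (?c powr (\<alpha> - 2) * ?c powr (- \<alpha>) * ?c powr 2) / (?D powr (\<alpha> - 2) * ?D powr (- \<alpha>) * ?D powr 2) *
        ((s - y) powr (\<alpha> - 2) * (1 - y\<^sup>2) powr (- \<alpha> / 2))" by (simp add: field_simps)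
      also have "?c powr (\<alpha> - 2) * ?c powr (- \<alpha>) * ?c powr 2 = 1"
        unfolding powr_add[symmetric] using pos by simp
      also have "?D powr (\<alpha> - 2) * ?D powr (- \<alpha>) * ?D powr 2 = 1"
        unfolding powr_add[symmetric] using pos by simp
      finally show ?thesis by (simp add: ennreal_mult'[symmetric] g'_def)
    qed simp
  qed
  finally show ?thesis .
qed

lemma nn_integral_powr_from_0:
  fixes a b :: real
  assumes "-1 < a" "0 \<le> b"
  shows "(\<integral>\<^sup>+t. ennreal (t powr a) * indicator {0..b} t \<partial>lborel) = ennreal (b powr (a + 1) / (a + 1))"
  using has_integral_powr_from_0[OF assms] by (intro nn_integral_has_integral_lebesgue') auto

lemma nn_integral_powr_to_inf:
  fixes a b :: real
  assumes "a < -1" "0 < b"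
  shows "(\<integral>\<^sup>+t. ennreal (t powr a) * indicator {b..} t \<partial>lborel) = ennreal (- (b powr (a + 1)) / (a + 1))"
  using has_integral_powr_to_inf[OF assms] by (intro nn_integral_has_integral_lebesgue') auto

text \<open>The fundamental theorem of calculus for the power of a positive part, whose derivative
  may be singular at 0. It is written as a sum because the terms will later be integrated as
  possibly infinite quantities.\<close>

lemma pos_part_powr_eq:
  fixes a b p :: real
  assumes p: "1 < p" and ab: "a \<le> b"
  shows "ennreal (max 0 b powr (p - 1)) = ennreal (max 0 a powr (p - 1)) +
     ennreal (p - 1) * (\<integral>\<^sup>+t. ennreal (t powr (p - 2)) * indicator {0<..} t * indicator {a<..<b} t \<partial>lborel)"
proof -
  have E: "ennreal (p - 1) * (\<integral>\<^sup>+t. ennreal (t powr (p - 2)) * indicator {0..max 0 c} t \<partial>lborel) = ennreal (max 0 c powr (p - 1))" for c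
    using p by (subst nn_integral_powr_from_0) (auto simp: ennreal_mult'[symmetric])
  have ne: "AE t in lborel. t \<noteq> 0 \<and> t \<noteq> a \<and> t \<noteq> b"
    using AE_lborel_singleton[of "0::real"] AE_lborel_singleton[of a] AE_lborel_singleton[of b] by eventually_elim simp
  have "(\<integral>\<^sup>+t. ennreal (t powr (p - 2)) * indicator {0..max 0 b} t \<partial>lborel) =
     (\<integral>\<^sup>+t. ennreal (t powr (p - 2)) * indicator {0..max 0 a} t + ennreal (t powr (p - 2)) * indicator {0<..} t * indicator {a<..<b} t \<partial>lborel)"
    (is "_ = (\<integral>\<^sup>+t. ?r t \<partial>lborel)")
  proof (intro nn_integral_cong_AE)
    show "AE t in lborel. ennreal (t powr (p - 2)) * indicator {0..max 0 b} t = ?r t"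
      using ne by eventually_elim (use ab in \<open>auto simp: indicator_def max_def\<close>)
  qed
  also have "\<dots> = (\<integral>\<^sup>+t. ennreal (t powr (p - 2)) * indicator {0..max 0 a} t \<partial>lborel) +
      (\<integral>\<^sup>+t. ennreal (t powr (p - 2)) * indicator {0<..} t * indicator {a<..<b} t \<partial>lborel)"
    by (rule nn_integral_add) auto
  finally show ?thesis unfolding E[of b, symmetric] by (simp only: distrib_left E)
qed

text \<open>The trace of the problem on a chord of the ball: the polar Jacobian t^(n - 1) turns the
  kernel t^(\<alpha> - n) into t^(\<alpha> - 1), whatever the dimension.\<close>

definition line_potential :: "real \<Rightarrow> real \<Rightarrow> ennreal" where
  "line_potential \<alpha> x = (\<integral>\<^sup>+y. ennreal (\<bar>x - y\<bar> powr (\<alpha> - 1) * (1 - y\<^sup>2) powr (- \<alpha> / 2)) * indicator {-1<..<1} y \<partial>lborel)"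

text \<open>The derivative in \<open>x\<close> of the potential is the difference of the two sides in
  \<open>swap_sides\<close>; integrating it by Fubini avoids differentiating under the integral.\<close>

lemma line_potential_const:
  assumes \<alpha>: "1 < \<alpha>" and x: "-1 < x" "x < 1"
  shows "line_potential \<alpha> x = line_potential \<alpha> 0"
proof -
  define pp where "pp t = ennreal (max 0 t powr (\<alpha> - 1))" for t :: real
  define w where "w y = ennreal ((1 - y\<^sup>2) powr (- \<alpha> / 2)) * indicator {-1<..<1} y" for y :: real
  have [measurable]: "pp \<in> borel_measurable borel" "w \<in> borel_measurable borel"
    unfolding pp_def[abs_def] w_def[abs_def] by measurable
  have split: "line_potential \<alpha> x = (\<integral>\<^sup>+y. pp (x - y) * w y \<partial>lborel) + (\<integral>\<^sup>+y. pp (y - x) * w y \<partial>lborel)" for x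
    unfolding line_potential_def by (subst nn_integral_add[symmetric])
      (auto intro!: nn_integral_cong simp: pp_def w_def indicator_def ennreal_mult'' max_def)
  have pos: "line_potential \<alpha> x = line_potential \<alpha> 0" if x: "0 \<le> x" "x < 1" for x
  proof -
    have 1: "pp (x - y) = pp (0 - y) + ennreal (\<alpha> - 1) *
       (\<integral>\<^sup>+s. ennreal ((s - y) powr (\<alpha> - 2)) * indicator {0<..} (s - y) * indicator {0<..<x} s \<partial>lborel)" for y
    proof -
      have "(\<integral>\<^sup>+t. ennreal (t powr (\<alpha> - 2)) * indicator {0<..} t * indicator {0 - y<..<x - y} t \<partial>lborel) =
        (\<integral>\<^sup>+s. ennreal ((s - y) powr (\<alpha> - 2)) * indicator {0<..} (s - y) * indicator {0 - y<..<x - y} (s - y) \<partial>lborel)"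
        by (subst nn_integral_lborel_translate(3)) auto
      then show ?thesis unfolding pp_def using pos_part_powr_eq[OF \<alpha>, of "0 - y" "x - y"] x
        by (auto simp: indicator_def cong: if_cong)
    qed
    have 2: "pp (y - 0) = pp (y - x) + ennreal (\<alpha> - 1) *
       (\<integral>\<^sup>+s. ennreal ((y - s) powr (\<alpha> - 2)) * indicator {0<..} (y - s) * indicator {0<..<x} s \<partial>lborel)" for y
    proof -
      have "(\<integral>\<^sup>+t. ennreal (t powr (\<alpha> - 2)) * indicator {0<..} t * indicator {y - x<..<y - 0} t \<partial>lborel) =
        (\<integral>\<^sup>+s. ennreal ((y - s) powr (\<alpha> - 2)) * indicator {0<..} (y - s) * indicator {y - x<..<y - 0} (y - s) \<partial>lborel)"
        by (subst nn_integral_lborel_translate(4)) auto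
      also have "\<dots> = (\<integral>\<^sup>+s. ennreal ((y - s) powr (\<alpha> - 2)) * indicator {0<..} (y - s) * indicator {0<..<x} s \<partial>lborel)"
        by (intro nn_integral_cong) (auto simp: indicator_def)
      finally show ?thesis unfolding pp_def using pos_part_powr_eq[OF \<alpha>, of "y - x" "y - 0"] x by simp
    qed
    have fub: "(\<integral>\<^sup>+y. (\<integral>\<^sup>+s. H s y * indicator {0<..<x} s \<partial>lborel) * w y \<partial>lborel) =
       (\<integral>\<^sup>+s. (\<integral>\<^sup>+y. H s y * w y \<partial>lborel) * indicator {0<..<x} s \<partial>lborel)"
      if [measurable]: "(\<lambda>(s, y). H s y) \<in> borel_measurable (borel \<Otimes>\<^sub>M borel)" for H :: "real \<Rightarrow> real \<Rightarrow> ennreal"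
    proof -
      have "(\<integral>\<^sup>+y. (\<integral>\<^sup>+s. H s y * indicator {0<..<x} s \<partial>lborel) * w y \<partial>lborel) =
        (\<integral>\<^sup>+y. (\<integral>\<^sup>+s. H s y * indicator {0<..<x} s * w y \<partial>lborel) \<partial>lborel)"
        by (subst nn_integral_multc) auto
      also have "\<dots> = (\<integral>\<^sup>+s. (\<integral>\<^sup>+y. H s y * indicator {0<..<x} s * w y \<partial>lborel) \<partial>lborel)"
        by (rule lborel_pair.Fubini') simp
      also have "\<dots> = (\<integral>\<^sup>+s. (\<integral>\<^sup>+y. H s y * w y \<partial>lborel) * indicator {0<..<x} s \<partial>lborel)"
        by (subst nn_integral_multc[symmetric]) (auto intro!: nn_integral_cong simp: ac_simps)
      finally show ?thesis .
    qed
    define X where "X = (\<integral>\<^sup>+s. (\<integral>\<^sup>+y. (ennreal ((s - y) powr (\<alpha> - 2)) * indicator {0<..} (s - y)) * w y \<partial>lborel) * indicator {0<..<x} s \<partial>lborel)"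
    define Y where "Y = (\<integral>\<^sup>+s. (\<integral>\<^sup>+y. (ennreal ((y - s) powr (\<alpha> - 2)) * indicator {0<..} (y - s)) * w y \<partial>lborel) * indicator {0<..<x} s \<partial>lborel)"
    have fX: "(\<integral>\<^sup>+y. (\<integral>\<^sup>+s. ennreal ((s - y) powr (\<alpha> - 2)) * indicator {0<..} (s - y) * indicator {0<..<x} s \<partial>lborel) * w y \<partial>lborel) = X"
      unfolding X_def by (rule fub) measurable
    have fY: "(\<integral>\<^sup>+y. (\<integral>\<^sup>+s. ennreal ((y - s) powr (\<alpha> - 2)) * indicator {0<..} (y - s) * indicator {0<..<x} s \<partial>lborel) * w y \<partial>lborel) = Y"
      unfolding Y_def by (rule fub) measurable
    have "X = Y" unfolding X_def Y_def
    proof (intro nn_integral_cong)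
      fix s :: real
      show "(\<integral>\<^sup>+y. (ennreal ((s - y) powr (\<alpha> - 2)) * indicator {0<..} (s - y)) * w y \<partial>lborel) * indicator {0<..<x} s =
        (\<integral>\<^sup>+y. (ennreal ((y - s) powr (\<alpha> - 2)) * indicator {0<..} (y - s)) * w y \<partial>lborel) * indicator {0<..<x} s"
      proof (cases "s \<in> {0<..<x}")
        case True
        then have s: "-1 < s" "s < 1" using x by auto
        have "(\<integral>\<^sup>+y. (ennreal ((s - y) powr (\<alpha> - 2)) * indicator {0<..} (s - y)) * w y \<partial>lborel) =
          (\<integral>\<^sup>+y. ennreal ((s - y) powr (\<alpha> - 2) * (1 - y\<^sup>2) powr (- \<alpha> / 2)) * indicator {-1<..<s} y \<partial>lborel)"
          using s by (intro nn_integral_cong) (auto simp: w_def indicator_def ennreal_mult'')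
        also have "\<dots> = (\<integral>\<^sup>+y. ennreal ((y - s) powr (\<alpha> - 2) * (1 - y\<^sup>2) powr (- \<alpha> / 2)) * indicator {s<..<1} y \<partial>lborel)"
          by (rule swap_sides[OF s, symmetric])
        also have "\<dots> = (\<integral>\<^sup>+y. (ennreal ((y - s) powr (\<alpha> - 2)) * indicator {0<..} (y - s)) * w y \<partial>lborel)"
          using s by (intro nn_integral_cong) (auto simp: w_def indicator_def ennreal_mult'')
        finally show ?thesis by simp
      qed simp
    qed
    have lin: "(\<integral>\<^sup>+y. (f y + ennreal (\<alpha> - 1) * g y) * w y \<partial>lborel) =
        (\<integral>\<^sup>+y. f y * w y \<partial>lborel) + ennreal (\<alpha> - 1) * (\<integral>\<^sup>+y. g y * w y \<partial>lborel)"
      if [measurable]: "f \<in> borel_measurable borel" "g \<in> borel_measurable borel" for f g :: "real \<Rightarrow> ennreal"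
    proof -
      have "(\<integral>\<^sup>+y. (f y + ennreal (\<alpha> - 1) * g y) * w y \<partial>lborel) = (\<integral>\<^sup>+y. f y * w y + ennreal (\<alpha> - 1) * (g y * w y) \<partial>lborel)"
        by (intro nn_integral_cong) (simp only: distrib_right mult.assoc)
      also have "\<dots> = (\<integral>\<^sup>+y. f y * w y \<partial>lborel) + (\<integral>\<^sup>+y. ennreal (\<alpha> - 1) * (g y * w y) \<partial>lborel)"
        by (rule nn_integral_add) measurable
      also have "(\<integral>\<^sup>+y. ennreal (\<alpha> - 1) * (g y * w y) \<partial>lborel) = ennreal (\<alpha> - 1) * (\<integral>\<^sup>+y. g y * w y \<partial>lborel)"
        by (rule nn_integral_cmult) measurable
      finally show ?thesis .
    qed
    have "(\<integral>\<^sup>+y. pp (x - y) * w y \<partial>lborel) = (\<integral>\<^sup>+y. pp (0 - y) * w y \<partial>lborel) + ennreal (\<alpha> - 1) * X"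
      unfolding 1 fX[symmetric] by (rule lin) measurable
    moreover have "(\<integral>\<^sup>+y. pp (y - 0) * w y \<partial>lborel) = (\<integral>\<^sup>+y. pp (y - x) * w y \<partial>lborel) + ennreal (\<alpha> - 1) * Y"
      unfolding 2 fY[symmetric] by (rule lin) measurable
    ultimately show ?thesis unfolding split[of x] split[of 0] \<open>X = Y\<close> by (simp add: ac_simps)
  qed
  show ?thesis
  proof (cases "0 \<le> x")
    case False
    have "line_potential \<alpha> x = line_potential \<alpha> (- x)"
      unfolding line_potential_def
      by (subst nn_integral_lborel_translate(4)[of _ 0, symmetric])
        (auto intro!: nn_integral_cong simp: indicator_def abs_minus_commute)
    also have "\<dots> = line_potential \<alpha> 0" by (rule pos) (use x False in auto)
    finally show ?thesis .
  qed (rule pos, use x in auto)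
qed


section \<open>From the interval to the ball, along chords\<close>

definition ball_weight :: "real \<Rightarrow> 'a::euclidean_space \<Rightarrow> ennreal" where
  "ball_weight \<alpha> w = ennreal ((1 - (norm w)\<^sup>2) powr (- \<alpha> / 2)) * indicator (ball 0 1) w"

lemma ball_weight_measurable [measurable]: "ball_weight \<alpha> \<in> borel_measurable borel"
proof -
  have [measurable]: "ball 0 1 \<in> sets (borel :: 'a measure)" by simp
  show ?thesis unfolding ball_weight_def[abs_def] by measurable
qed

text \<open>By \<open>key\<close> the weight along the chord is, after an affine change of
  parameter, the one-dimensional weight. The integral is thus a line potential at \<tau> / \<rho>,
  which does not depend on the position; the exponents of \<rho> add up to 0, so the length of the
  chord drops out as well.\<close>

lemma chord_potential:
  fixes x v :: "'a::euclidean_space"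
  assumes \<alpha>: "1 < \<alpha>" and x: "norm x < 1" and v: "v \<noteq> 0"
  shows "(\<integral>\<^sup>+t. ennreal (\<bar>t\<bar> powr (\<alpha> - 1)) * ball_weight \<alpha> (x + t *\<^sub>R v) \<partial>lborel) =
    ennreal (norm v powr (- \<alpha>)) * line_potential \<alpha> 0"
proof -
  \<comment> \<open>-\<tau> is the parameter of the midpoint of the chord and \<rho> half its
    length, both measured in multiples of v.\<close>
  define \<tau> where "\<tau> = (x \<bullet> v) / (norm v)\<^sup>2"
  define \<rho> where "\<rho> = sqrt ((1 - (norm x)\<^sup>2) / (norm v)\<^sup>2 + \<tau>\<^sup>2)"
  have nv: "norm v > 0" using v by simp
  have x2: "0 < 1 - (norm x)\<^sup>2" using x by (simp add: abs_square_less_1)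
  have \<rho>2: "\<rho>\<^sup>2 = (1 - (norm x)\<^sup>2) / (norm v)\<^sup>2 + \<tau>\<^sup>2" unfolding \<rho>_def using x2 by simp
  have "\<tau>\<^sup>2 < \<rho>\<^sup>2" unfolding \<rho>2 using x2 nv by simp
  moreover have \<rho>0: "0 < \<rho>" unfolding \<rho>_def using x2 nv by (auto intro!: add_pos_nonneg)
  ultimately have \<tau>\<rho>: "\<bar>\<tau>\<bar> < \<rho>" by (simp add: power2_less_imp_less)
  have key: "1 - (norm (x + (\<rho> * s - \<tau>) *\<^sub>R v))\<^sup>2 = (norm v * \<rho>)\<^sup>2 * (1 - s\<^sup>2)" for s
  proof -
    have nvv: "v \<bullet> v = (norm v)\<^sup>2" "x \<bullet> x = (norm x)\<^sup>2" by (simp_all add: power2_norm_eq_inner)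
    have xv: "x \<bullet> v = \<tau> * (norm v)\<^sup>2" unfolding \<tau>_def using nv by simp
    have 1: "(norm v)\<^sup>2 * \<rho>\<^sup>2 = 1 - (norm x)\<^sup>2 + \<tau>\<^sup>2 * (norm v)\<^sup>2" unfolding \<rho>2 using nv by (simp add: field_simps)
    have "(norm (x + (\<rho> * s - \<tau>) *\<^sub>R v))\<^sup>2 = (norm x)\<^sup>2 + 2 * (\<rho> * s - \<tau>) * (x \<bullet> v) + (\<rho> * s - \<tau>)\<^sup>2 * (norm v)\<^sup>2"
      unfolding power2_norm_eq_inner by (simp add: inner_add_left inner_add_right inner_commute power2_eq_square algebra_simps)
    also have "\<dots> = (norm x)\<^sup>2 - \<tau>\<^sup>2 * (norm v)\<^sup>2 + s\<^sup>2 * ((norm v)\<^sup>2 * \<rho>\<^sup>2)"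
      unfolding xv by (simp add: power2_eq_square algebra_simps)
    also have "\<dots> = 1 - (norm v)\<^sup>2 * \<rho>\<^sup>2 + s\<^sup>2 * ((norm v)\<^sup>2 * \<rho>\<^sup>2)" using 1 by simp
    finally show ?thesis by (simp add: power_mult_distrib algebra_simps)
  qed
  have "(\<integral>\<^sup>+t. ennreal (\<bar>t\<bar> powr (\<alpha> - 1)) * ball_weight \<alpha> (x + t *\<^sub>R v) \<partial>lborel) =
    ennreal \<rho> * (\<integral>\<^sup>+s. ennreal (\<bar>- \<tau> + \<rho> * s\<bar> powr (\<alpha> - 1)) * ball_weight \<alpha> (x + (- \<tau> + \<rho> * s) *\<^sub>R v) \<partial>lborel)"
    using nn_integral_real_affine[of "\<lambda>t. ennreal (\<bar>t\<bar> powr (\<alpha> - 1)) * ball_weight \<alpha> (x + t *\<^sub>R v)" \<rho> "- \<tau>"] \<rho>0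
    by simp
  also have "\<dots> = ennreal \<rho> * (\<integral>\<^sup>+s. ennreal (\<rho> powr (\<alpha> - 1) * (norm v * \<rho>) powr (- \<alpha>)) *
      (ennreal (\<bar>\<tau> / \<rho> - s\<bar> powr (\<alpha> - 1) * (1 - s\<^sup>2) powr (- \<alpha> / 2)) * indicator {-1<..<1} s) \<partial>lborel)"
  proof (rule arg_cong[where f="(*) (ennreal \<rho>)"], rule nn_integral_cong)
    fix s :: real
    have e: "\<bar>- \<tau> + \<rho> * s\<bar> = \<rho> * \<bar>\<tau> / \<rho> - s\<bar>"
    proof -
      have "- \<tau> + \<rho> * s = - (\<rho> * (\<tau> / \<rho> - s))" using \<rho>0 by (simp add: algebra_simps)
      then show ?thesis using \<rho>0 by (simp only: abs_minus_cancel abs_mult abs_of_pos)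
    qed
    have k: "1 - (norm (x + (- \<tau> + \<rho> * s) *\<^sub>R v))\<^sup>2 = (norm v * \<rho>)\<^sup>2 * (1 - s\<^sup>2)" using key[of s] by (simp add: algebra_simps)
    have iff: "x + (- \<tau> + \<rho> * s) *\<^sub>R v \<in> ball 0 1 \<longleftrightarrow> s \<in> {-1<..<1}"
    proof -
      have "x + (- \<tau> + \<rho> * s) *\<^sub>R v \<in> ball 0 1 \<longleftrightarrow> 0 < 1 - (norm (x + (- \<tau> + \<rho> * s) *\<^sub>R v))\<^sup>2"
        by (simp add: abs_square_less_1)
      also have "\<dots> \<longleftrightarrow> 0 < 1 - s\<^sup>2" unfolding k using nv \<rho>0 by (simp add: zero_less_mult_iff)
      also have "\<dots> \<longleftrightarrow> s \<in> {-1<..<1}" by (auto simp: abs_square_less_1)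
      finally show ?thesis .
    qed
    show "ennreal (\<bar>- \<tau> + \<rho> * s\<bar> powr (\<alpha> - 1)) * ball_weight \<alpha> (x + (- \<tau> + \<rho> * s) *\<^sub>R v) =
      ennreal (\<rho> powr (\<alpha> - 1) * (norm v * \<rho>) powr (- \<alpha>)) *
      (ennreal (\<bar>\<tau> / \<rho> - s\<bar> powr (\<alpha> - 1) * (1 - s\<^sup>2) powr (- \<alpha> / 2)) * indicator {-1<..<1} s)"
    proof (cases "s \<in> {-1<..<1}")
      case True
      then have s2: "0 < 1 - s\<^sup>2" by (auto simp: abs_square_less_1)
      have p: "((norm v * \<rho>)\<^sup>2) powr (- \<alpha> / 2) = (norm v * \<rho>) powr (- \<alpha>)"
      proof -
        have "((norm v * \<rho>)\<^sup>2) powr (- \<alpha> / 2) = ((norm v * \<rho>) powr 2) powr (- \<alpha> / 2)"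
          using nv \<rho>0 by simp
        then show ?thesis by (simp only: powr_powr) simp
      qed
      have "ball_weight \<alpha> (x + (- \<tau> + \<rho> * s) *\<^sub>R v) = ennreal ((norm v * \<rho>) powr (- \<alpha>) * (1 - s\<^sup>2) powr (- \<alpha> / 2))"
        unfolding p[symmetric] powr_mult[symmetric] ball_weight_def k using True iff by simp
      then show ?thesis unfolding e using True \<rho>0
        by (simp add: powr_mult ennreal_mult'[symmetric] ac_simps)
    next
      case False
      then show ?thesis using iff by (simp add: ball_weight_def)
    qed
  qed
  also have "\<dots> = ennreal (\<rho> * (\<rho> powr (\<alpha> - 1) * (norm v * \<rho>) powr (- \<alpha>))) * line_potential \<alpha> (\<tau> / \<rho>)"
    unfolding line_potential_def using \<rho>0
    by (subst nn_integral_cmult) (auto simp: ennreal_mult' mult.assoc)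
  also have "line_potential \<alpha> (\<tau> / \<rho>) = line_potential \<alpha> 0"
    using \<tau>\<rho> \<rho>0 by (intro line_potential_const[OF \<alpha>]) (auto simp: field_simps abs_less_iff)
  also have "\<rho> * (\<rho> powr (\<alpha> - 1) * (norm v * \<rho>) powr (- \<alpha>)) = norm v powr (- \<alpha>)"
  proof -
    have "\<rho> * \<rho> powr (\<alpha> - 1) * \<rho> powr (- \<alpha>) = \<rho> powr (1 + (\<alpha> - 1) + (- \<alpha>))"
      unfolding powr_add using \<rho>0 by simp
    then show ?thesis using \<rho>0 nv by (simp add: powr_mult ac_simps)
  qed
  finally show ?thesis .
qed

text \<open>The constant of the Riesz kernel is left out. Up to a factor, \<open>ball_weight\<close>
  is the density of the equilibrium measure of the unit ball, hence the constant potential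
  inside.\<close>

definition ball_potential :: "real \<Rightarrow> 'a::euclidean_space \<Rightarrow> ennreal" where
  "ball_potential \<alpha> x = (\<integral>\<^sup>+w. ennreal (norm (x - w) powr (\<alpha> - DIM('a))) * ball_weight \<alpha> w \<partial>lborel)"

lemma power_DIM_powr:
  assumes "0 < t" shows "t ^ (DIM('a::euclidean_space) - 1) = t powr (real DIM('a) - 1)"
  using assms powr_realpow[of t "DIM('a) - 1"] by (simp add: of_nat_diff)

text \<open>Polar coordinates about x reduce the potential to integrals over half-lines. The
  potential is doubled in order to pair the directions v and -v into a whole chord, for which
  \<open>chord_potential\<close> gives a value independent of x.\<close>

lemma ball_potential_inside:
  fixes x :: "'a::euclidean_space"
  assumes \<alpha>: "1 < \<alpha>" and x: "norm x < 1"
  shows "ball_potential \<alpha> x = ball_potential \<alpha> (0::'a)"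
proof -
  have *: "2 * ball_potential \<alpha> x = (\<integral>\<^sup>+v. indicator {1..exp 1} (norm v) *
      (ennreal (norm (v::'a) powr (\<alpha> - DIM('a))) * (ennreal (norm v powr (- \<alpha>)) * line_potential \<alpha> 0)) \<partial>lborel)"
    if x: "norm x < 1" for x :: 'a
  proof -
    define F where "F v = indicator {1..exp 1} (norm (v::'a)) * (ennreal (norm v powr (\<alpha> - DIM('a))) *
        (\<integral>\<^sup>+t. ennreal (\<bar>t\<bar> powr (\<alpha> - 1)) * ball_weight \<alpha> (x + t *\<^sub>R v) * indicator {0<..} t \<partial>lborel))" for v
    have [measurable]: "F \<in> borel_measurable borel" unfolding F_def[abs_def] by measurable
    have "ball_potential \<alpha> x = (\<integral>\<^sup>+w. ennreal (norm w powr (\<alpha> - DIM('a))) * ball_weight \<alpha> (x + w) \<partial>lborel)"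
      unfolding ball_potential_def
      by (subst nn_integral_lborel_translate(1)[of _ x, symmetric]) simp_all
    also have "\<dots> = (\<integral>\<^sup>+v. indicator {1..exp 1} (norm v) *
     (\<integral>\<^sup>+t. indicator {0<..} t * (ennreal (t ^ (DIM('a) - 1)) *
       (ennreal (norm (t *\<^sub>R v) powr (\<alpha> - DIM('a))) * ball_weight \<alpha> (x + t *\<^sub>R v))) \<partial>lborel) \<partial>lborel)"
      by (rule nn_integral_polar) measurable
    also have "\<dots> = (\<integral>\<^sup>+v. F v \<partial>lborel)"
    proof (intro nn_integral_cong)
      fix v :: 'a
      have "(\<integral>\<^sup>+t. indicator {0<..} t * (ennreal (t ^ (DIM('a) - 1)) *
         (ennreal (norm (t *\<^sub>R v) powr (\<alpha> - DIM('a))) * ball_weight \<alpha> (x + t *\<^sub>R v))) \<partial>lborel) =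
        (\<integral>\<^sup>+t. ennreal (norm v powr (\<alpha> - DIM('a))) * (ennreal (\<bar>t\<bar> powr (\<alpha> - 1)) * ball_weight \<alpha> (x + t *\<^sub>R v) * indicator {0<..} t) \<partial>lborel)"
      proof (intro nn_integral_cong)
        fix t :: real
        show "indicator {0<..} t * (ennreal (t ^ (DIM('a) - 1)) *
         (ennreal (norm (t *\<^sub>R v) powr (\<alpha> - DIM('a))) * ball_weight \<alpha> (x + t *\<^sub>R v))) =
         ennreal (norm v powr (\<alpha> - DIM('a))) * (ennreal (\<bar>t\<bar> powr (\<alpha> - 1)) * ball_weight \<alpha> (x + t *\<^sub>R v) * indicator {0<..} t)"
        proof (cases "0 < t")
          case True
          have "t ^ (DIM('a) - 1) * norm (t *\<^sub>R v) powr (\<alpha> - DIM('a)) =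
             (t powr (real DIM('a) - 1) * t powr (\<alpha> - real DIM('a))) * norm v powr (\<alpha> - DIM('a))"
            unfolding power_DIM_powr[OF True] norm_scaleR using True by (simp add: powr_mult)
          also have "\<dots> = t powr (\<alpha> - 1) * norm v powr (\<alpha> - DIM('a))"
            unfolding powr_add[symmetric] by simp
          finally have "ennreal (t ^ (DIM('a) - 1)) * ennreal (norm (t *\<^sub>R v) powr (\<alpha> - DIM('a))) =
             ennreal (t powr (\<alpha> - 1)) * ennreal (norm v powr (\<alpha> - DIM('a)))"
            using True by (simp add: ennreal_mult'[symmetric])
          then show ?thesis using True by (simp add: mult.assoc[symmetric]) (simp add: ac_simps)
        qed simp
      qed
      then show "indicator {1..exp 1} (norm v) * (\<integral>\<^sup>+t. indicator {0<..} t * (ennreal (t ^ (DIM('a) - 1)) *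
         (ennreal (norm (t *\<^sub>R v) powr (\<alpha> - DIM('a))) * ball_weight \<alpha> (x + t *\<^sub>R v))) \<partial>lborel) = F v"
        unfolding F_def by (subst (asm) nn_integral_cmult) simp_all
    qed
    finally have 1: "ball_potential \<alpha> x = (\<integral>\<^sup>+v. F v \<partial>lborel)" .
    also have "\<dots> = (\<integral>\<^sup>+v. F (0 - v) \<partial>lborel)" by (rule nn_integral_lborel_translate(4)[symmetric]) simp
    finally have "2 * ball_potential \<alpha> x = (\<integral>\<^sup>+v. F v + F (0 - v) \<partial>lborel)"
      unfolding mult_2 by (subst nn_integral_add) (use 1 in simp_all)
    also have "\<dots> = (\<integral>\<^sup>+v. indicator {1..exp 1} (norm v) *
      (ennreal (norm (v::'a) powr (\<alpha> - DIM('a))) * (ennreal (norm v powr (- \<alpha>)) * line_potential \<alpha> 0)) \<partial>lborel)"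
    proof (intro nn_integral_cong)
      fix v :: 'a
      show "F v + F (0 - v) = indicator {1..exp 1} (norm v) *
        (ennreal (norm v powr (\<alpha> - DIM('a))) * (ennreal (norm v powr (- \<alpha>)) * line_potential \<alpha> 0))"
      proof (cases "norm v \<in> {1..exp 1}")
        case True
        then have v: "v \<noteq> 0" by auto
        let ?h = "\<lambda>t. ennreal (\<bar>t\<bar> powr (\<alpha> - 1)) * ball_weight \<alpha> (x + t *\<^sub>R v)"
        have "(\<integral>\<^sup>+t. ennreal (\<bar>t\<bar> powr (\<alpha> - 1)) * ball_weight \<alpha> (x + t *\<^sub>R (0 - v)) * indicator {0<..} t \<partial>lborel) =
          (\<integral>\<^sup>+t. ?h t * indicator {..<0} t \<partial>lborel)"
          by (subst nn_integral_lborel_translate(4)[of _ 0, symmetric])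
            (auto intro!: nn_integral_cong simp: indicator_def)
        moreover have "(\<integral>\<^sup>+t. ?h t * indicator {0<..} t \<partial>lborel) + (\<integral>\<^sup>+t. ?h t * indicator {..<0} t \<partial>lborel) = (\<integral>\<^sup>+t. ?h t \<partial>lborel)"
          by (subst nn_integral_add[symmetric]) (auto intro!: nn_integral_cong simp: indicator_def)
        ultimately show ?thesis
          unfolding chord_potential[OF \<alpha> x v, symmetric] F_def using True by (simp add: distrib_left[symmetric])
      qed (simp add: F_def)
    qed
    finally show ?thesis .
  qed
  have "2 * ball_potential \<alpha> x = 2 * ball_potential \<alpha> (0::'a)"
    using *[OF x] *[of 0] by simp
  then show ?thesis by (simp add: ennreal_mult_cancel_left)
qed

section \<open>Radial integrals and inversion in the unit sphere\<close>

definition shell_integral :: "'a::euclidean_space itself \<Rightarrow> ennreal" where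
  "shell_integral _ = (\<integral>\<^sup>+v. indicator {1..exp 1} (norm (v::'a)) * ennreal (norm v powr (- DIM('a))) \<partial>lborel)"

lemma shell_integral_finite: "shell_integral TYPE('a::euclidean_space) < \<infinity>"
proof -
  have "shell_integral TYPE('a) \<le> (\<integral>\<^sup>+v. indicator (cball (0::'a) (exp 1)) v \<partial>lborel)"
    unfolding shell_integral_def
  proof (intro nn_integral_mono)
    fix v :: 'a
    show "indicator {1..exp 1} (norm v) * ennreal (norm v powr (- DIM('a))) \<le> indicator (cball 0 (exp 1)) v"
    proof (cases "1 \<le> norm v")
      case True
      then have "1 \<le> norm v powr DIM('a)" by (intro ge_one_powr_ge_zero) auto
      then have "norm v powr (- DIM('a)) \<le> 1" by (simp add: powr_minus_divide divide_le_eq)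
      then show ?thesis by (auto simp: indicator_def)
    qed simp
  qed
  also have "\<dots> < \<infinity>" using emeasure_lborel_cball_finite by (simp add: less_top)
  finally show ?thesis .
qed

text \<open>\<open>shell_integral\<close> takes the place of the surface area of the unit sphere:
  the shell between the radii 1 and e has logarithmic width 1.\<close>

lemma nn_integral_radial:
  fixes f :: "real \<Rightarrow> ennreal"
  assumes [measurable]: "f \<in> borel_measurable borel"
  shows "(\<integral>\<^sup>+x. f (norm (x::'a::euclidean_space)) \<partial>lborel) =
    shell_integral TYPE('a) * (\<integral>\<^sup>+t. f t * ennreal (t powr (real DIM('a) - 1)) * indicator {0<..} t \<partial>lborel)"
proof -
  let ?I = "\<integral>\<^sup>+t. f t * ennreal (t powr (real DIM('a) - 1)) * indicator {0<..} t \<partial>lborel"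
  have "(\<integral>\<^sup>+x. f (norm (x::'a)) \<partial>lborel) = (\<integral>\<^sup>+v. indicator {1..exp 1} (norm (v::'a)) *
     (\<integral>\<^sup>+t. indicator {0<..} t * (ennreal (t ^ (DIM('a) - 1)) * f (norm (t *\<^sub>R v))) \<partial>lborel) \<partial>lborel)"
    by (rule nn_integral_polar) measurable
  also have "\<dots> = (\<integral>\<^sup>+v. (indicator {1..exp 1} (norm (v::'a)) * ennreal (norm v powr (- DIM('a)))) * ?I \<partial>lborel)"
  proof (rule nn_integral_cong)
    fix v :: 'a
    show "indicator {1..exp 1} (norm v) *
     (\<integral>\<^sup>+t. indicator {0<..} t * (ennreal (t ^ (DIM('a) - 1)) * f (norm (t *\<^sub>R v))) \<partial>lborel) =
     (indicator {1..exp 1} (norm v) * ennreal (norm v powr (- DIM('a)))) * ?I"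
    proof (cases "norm v \<in> {1..exp 1}")
      case True
      define c where "c = norm v"
      have c: "0 < c" using True unfolding c_def by auto
      let ?m = "real DIM('a) - 1"
      have "?I = ennreal c * (\<integral>\<^sup>+t. f (c * t) * ennreal ((c * t) powr ?m) * indicator {0<..} (c * t) \<partial>lborel)"
        using nn_integral_real_affine[of "\<lambda>t. f t * ennreal (t powr ?m) * indicator {0<..} t" c 0] c by simp
      also have "(\<integral>\<^sup>+t. f (c * t) * ennreal ((c * t) powr ?m) * indicator {0<..} (c * t) \<partial>lborel) =
         (\<integral>\<^sup>+t. ennreal (c powr ?m) * (indicator {0<..} t * (ennreal (t ^ (DIM('a) - 1)) * f (norm (t *\<^sub>R v)))) \<partial>lborel)"
      proof (rule nn_integral_cong)
        fix t :: real
        show "f (c * t) * ennreal ((c * t) powr ?m) * indicator {0<..} (c * t) =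
          ennreal (c powr ?m) * (indicator {0<..} t * (ennreal (t ^ (DIM('a) - 1)) * f (norm (t *\<^sub>R v))))"
        proof (cases "0 < t")
          case True
          then have "norm (t *\<^sub>R v) = c * t" by (simp add: c_def)
          then show ?thesis unfolding power_DIM_powr[OF True] powr_mult using True c
            by (simp add: ennreal_mult' ac_simps)
        next
          case False
          then show ?thesis using c by (simp add: zero_less_mult_iff)
        qed
      qed
      also have "\<dots> = ennreal (c powr ?m) * (\<integral>\<^sup>+t. indicator {0<..} t * (ennreal (t ^ (DIM('a) - 1)) * f (norm (t *\<^sub>R v))) \<partial>lborel)"
        by (rule nn_integral_cmult) measurable
      finally have I: "?I = ennreal c * (ennreal (c powr ?m) * (\<integral>\<^sup>+t. indicator {0<..} t * (ennreal (t ^ (DIM('a) - 1)) * f (norm (t *\<^sub>R v))) \<partial>lborel))" .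
      have "c powr (- DIM('a)) * (c * c powr ?m) = c powr (- DIM('a) + (1 + ?m))"
        unfolding powr_add using c by simp
      also have "\<dots> = 1" using c by simp
      finally have "ennreal (c powr (- DIM('a))) * (ennreal c * ennreal (c powr ?m)) = 1"
        using c by (simp add: ennreal_mult'[symmetric])
      then have "ennreal (c powr (- DIM('a))) * ?I = (\<integral>\<^sup>+t. indicator {0<..} t * (ennreal (t ^ (DIM('a) - 1)) * f (norm (t *\<^sub>R v))) \<partial>lborel)"
        unfolding I by (simp add: mult.assoc[symmetric])
      then show ?thesis using True by (simp add: c_def)
    qed simp
  qed
  also have "\<dots> = shell_integral TYPE('a) * ?I"
    unfolding shell_integral_def by (rule nn_integral_multc) measurable
  finally show ?thesis .
qed

lemma nn_integral_norm_powr_near: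
  assumes "- real DIM('a) < a" "0 \<le> R"
  shows "(\<integral>\<^sup>+x. ennreal (norm (x::'a::euclidean_space) powr a) * indicator {..R} (norm x) \<partial>lborel) =
    shell_integral TYPE('a) * ennreal (R powr (a + DIM('a)) / (a + DIM('a)))"
proof -
  have "(\<integral>\<^sup>+x. ennreal (norm (x::'a) powr a) * indicator {..R} (norm x) \<partial>lborel) = shell_integral TYPE('a) *
    (\<integral>\<^sup>+t. ennreal (t powr a) * indicator {..R} t * ennreal (t powr (real DIM('a) - 1)) * indicator {0<..} t \<partial>lborel)"
    by (rule nn_integral_radial) measurable
  also have "(\<integral>\<^sup>+t. ennreal (t powr a) * indicator {..R} t * ennreal (t powr (real DIM('a) - 1)) * indicator {0<..} t \<partial>lborel) =
    (\<integral>\<^sup>+t. ennreal (t powr (a + (real DIM('a) - 1))) * indicator {0..R} t \<partial>lborel)"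
    by (intro nn_integral_cong) (auto simp: indicator_def powr_add ennreal_mult')
  also have "\<dots> = ennreal (R powr (a + DIM('a)) / (a + DIM('a)))"
    using assms by (subst nn_integral_powr_from_0) auto
  finally show ?thesis .
qed

lemma nn_integral_norm_powr_far:
  assumes "a < - real DIM('a)" "0 < R"
  shows "(\<integral>\<^sup>+x. ennreal (norm (x::'a::euclidean_space) powr a) * indicator {R..} (norm x) \<partial>lborel) =
    shell_integral TYPE('a) * ennreal (R powr (a + DIM('a)) / (- a - DIM('a)))"
proof -
  have "(\<integral>\<^sup>+x. ennreal (norm (x::'a) powr a) * indicator {R..} (norm x) \<partial>lborel) = shell_integral TYPE('a) *
    (\<integral>\<^sup>+t. ennreal (t powr a) * indicator {R..} t * ennreal (t powr (real DIM('a) - 1)) * indicator {0<..} t \<partial>lborel)"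
    by (rule nn_integral_radial) measurable
  also have "(\<integral>\<^sup>+t. ennreal (t powr a) * indicator {R..} t * ennreal (t powr (real DIM('a) - 1)) * indicator {0<..} t \<partial>lborel) =
    (\<integral>\<^sup>+t. ennreal (t powr (a + (real DIM('a) - 1))) * indicator {R..} t \<partial>lborel)"
    using assms by (intro nn_integral_cong) (auto simp: indicator_def powr_add ennreal_mult')
  also have "\<dots> = ennreal (- (R powr (a + DIM('a))) / (a + DIM('a)))"
    using assms by (subst nn_integral_powr_to_inf) auto
  also have "- (R powr (a + DIM('a))) / (a + DIM('a)) = R powr (a + DIM('a)) / (- a - DIM('a))"
    using assms by (simp add: field_simps)
  finally show ?thesis .
qed

text \<open>On each ray the inversion acts as t -> c / t with c = 1 / |v|^2, so the one-dimensional
  substitution combines with polar coordinates to the Jacobian |x|^(-2n).\<close>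

lemma nn_integral_inversion:
  fixes f :: "'a::euclidean_space \<Rightarrow> ennreal"
  assumes [measurable]: "f \<in> borel_measurable borel"
  shows "(\<integral>\<^sup>+x. f x \<partial>lborel) = (\<integral>\<^sup>+x. f (x /\<^sub>R (norm x)\<^sup>2) * ennreal (norm x powr (- 2 * real DIM('a))) \<partial>lborel)"
proof -
  let ?n = "real DIM('a)"
  have "(\<integral>\<^sup>+x. f x \<partial>lborel) = (\<integral>\<^sup>+v. indicator {1..exp 1} (norm (v::'a)) *
     (\<integral>\<^sup>+t. indicator {0<..} t * (ennreal (t ^ (DIM('a) - 1)) * f (t *\<^sub>R v)) \<partial>lborel) \<partial>lborel)"
    by (rule nn_integral_polar) measurable
  also have "\<dots> = (\<integral>\<^sup>+v. indicator {1..exp 1} (norm (v::'a)) *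
     (\<integral>\<^sup>+t. indicator {0<..} t * (ennreal (t ^ (DIM('a) - 1)) *
       (f ((t *\<^sub>R v) /\<^sub>R (norm (t *\<^sub>R v))\<^sup>2) * ennreal (norm (t *\<^sub>R v) powr (- 2 * ?n)))) \<partial>lborel) \<partial>lborel)"
  proof (rule nn_integral_cong)
    fix v :: 'a
    show "indicator {1..exp 1} (norm v) *
      (\<integral>\<^sup>+t. indicator {0<..} t * (ennreal (t ^ (DIM('a) - 1)) * f (t *\<^sub>R v)) \<partial>lborel) =
      indicator {1..exp 1} (norm v) * (\<integral>\<^sup>+t. indicator {0<..} t * (ennreal (t ^ (DIM('a) - 1)) *
       (f ((t *\<^sub>R v) /\<^sub>R (norm (t *\<^sub>R v))\<^sup>2) * ennreal (norm (t *\<^sub>R v) powr (- 2 * ?n)))) \<partial>lborel)"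
    proof (cases "norm v \<in> {1..exp 1}")
      case True
      then have nv: "0 < norm v" by auto
      define c where "c = 1 / (norm v)\<^sup>2"
      have c: "0 < c" using nv by (simp add: c_def)
      have "(\<integral>\<^sup>+t. indicator {0<..} t * (ennreal (t ^ (DIM('a) - 1)) * f (t *\<^sub>R v)) \<partial>lborel) =
        (\<integral>\<^sup>+t. ennreal (t ^ (DIM('a) - 1)) * f (t *\<^sub>R v) * indicator {0<..} t \<partial>lborel)"
        by (intro nn_integral_cong) (simp add: ac_simps)
      also have "\<dots> = (\<integral>\<^sup>+t. ennreal ((c / t) ^ (DIM('a) - 1)) * f ((c / t) *\<^sub>R v) * ennreal (c / t\<^sup>2) * indicator {0<..} t \<partial>lborel)"
        by (rule nn_integral_pos_reciprocal[OF _ c]) measurable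
      also have "\<dots> = (\<integral>\<^sup>+t. indicator {0<..} t * (ennreal (t ^ (DIM('a) - 1)) *
       (f ((t *\<^sub>R v) /\<^sub>R (norm (t *\<^sub>R v))\<^sup>2) * ennreal (norm (t *\<^sub>R v) powr (- 2 * ?n)))) \<partial>lborel)"
      proof (rule nn_integral_cong)
        fix t :: real
        show "ennreal ((c / t) ^ (DIM('a) - 1)) * f ((c / t) *\<^sub>R v) * ennreal (c / t\<^sup>2) * indicator {0<..} t =
          indicator {0<..} t * (ennreal (t ^ (DIM('a) - 1)) *
       (f ((t *\<^sub>R v) /\<^sub>R (norm (t *\<^sub>R v))\<^sup>2) * ennreal (norm (t *\<^sub>R v) powr (- 2 * ?n))))"
        proof (cases "0 < t")
          case t: True
          have a: "(t *\<^sub>R v) /\<^sub>R (norm (t *\<^sub>R v))\<^sup>2 = (c / t) *\<^sub>R v"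
            using t nv by (simp add: c_def power2_eq_square field_simps)
          have ct: "0 < c / t" using c t by simp
          have cc: "c = norm v powr (-2)" using nv by (simp add: c_def powr_minus divide_inverse)
          have "(c / t) ^ (DIM('a) - 1) * (c / t\<^sup>2) = (c powr (?n - 1) * c powr 1) * (t powr (- (?n - 1)) * t powr (-2))"
          proof -
            have "(c / t) powr (?n - 1) = c powr (?n - 1) * t powr (- (?n - 1))"
              unfolding powr_minus powr_divide by (simp add: divide_inverse)
            moreover have "c / t\<^sup>2 = c powr 1 * t powr (-2)"
              using t c by (simp add: powr_minus divide_inverse)
            ultimately show ?thesis unfolding power_DIM_powr[OF ct] by (simp only: ac_simps)
          qed
          also have "\<dots> = c powr ?n * t powr (- 1 - ?n)" unfolding powr_add[symmetric] by simp
          also have "\<dots> = norm v powr (- 2 * ?n) * (t powr (?n - 1) * t powr (- 2 * ?n))"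
          proof -
            have e: "?n - 1 + - 2 * ?n = - 1 - ?n" by simp
            show ?thesis unfolding powr_add[symmetric] cc powr_powr e ..
          qed
          also have "\<dots> = t ^ (DIM('a) - 1) * norm (t *\<^sub>R v) powr (- 2 * ?n)"
            unfolding power_DIM_powr[OF t] norm_scaleR powr_mult using t by simp
          finally have "ennreal ((c / t) ^ (DIM('a) - 1)) * ennreal (c / t\<^sup>2) = ennreal (t ^ (DIM('a) - 1)) * ennreal (norm (t *\<^sub>R v) powr (- 2 * ?n))"
            using t c by (simp add: ennreal_mult'[symmetric] del: norm_scaleR)
          then show ?thesis unfolding a using t by (simp add: ac_simps del: norm_scaleR)
        qed simp
      qed
      finally show ?thesis by simp
    qed simp
  qed
  also have "\<dots> = (\<integral>\<^sup>+x. f (x /\<^sub>R (norm x)\<^sup>2) * ennreal (norm x powr (- 2 * real DIM('a))) \<partial>lborel)"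
    by (rule nn_integral_polar[symmetric]) measurable
  finally show ?thesis .
qed

lemma norm_diff_inversion:
  fixes x w :: "'a::real_inner"
  assumes "x \<noteq> 0" "w \<noteq> 0"
  shows "norm (x - w /\<^sub>R (norm w)\<^sup>2) = norm x * norm (x /\<^sub>R (norm x)\<^sup>2 - w) / norm w"
proof -
  have sq: "(norm (u - v))\<^sup>2 = (norm u)\<^sup>2 - 2 * (u \<bullet> v) + (norm v)\<^sup>2" for u v :: 'a
    by (simp add: power2_norm_eq_inner inner_diff_left inner_diff_right inner_commute algebra_simps)
  define a where "a = (norm x)\<^sup>2"
  define b where "b = (norm w)\<^sup>2"
  have ab: "0 < a" "0 < b" using assms by (auto simp: a_def b_def)
  have na: "(norm (x /\<^sub>R a))\<^sup>2 = 1 / a" "(norm (w /\<^sub>R b))\<^sup>2 = 1 / b"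
    using ab by (simp_all add: power_mult_distrib a_def[symmetric] b_def[symmetric])
      (simp_all add: power2_eq_square field_simps)
  have "(norm (x - w /\<^sub>R b))\<^sup>2 = a - 2 * ((x \<bullet> w) / b) + 1 / b"
    unfolding sq na by (simp add: a_def divide_inverse)
  also have "\<dots> = a * (1 / a - 2 * ((x \<bullet> w) / a) + b) / b"
    using ab by (simp add: field_simps)
  also have "1 / a - 2 * ((x \<bullet> w) / a) + b = (norm (x /\<^sub>R a - w))\<^sup>2"
    unfolding sq na by (simp add: b_def divide_inverse)
  finally have "(norm (x - w /\<^sub>R b))\<^sup>2 = (norm x * norm (x /\<^sub>R a - w) / norm w)\<^sup>2"
    by (simp add: a_def b_def power_mult_distrib power_divide)
  then show ?thesis unfolding a_def b_def by (rule power2_eq_imp_eq) auto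
qed

text \<open>The Jacobian tames the kernel at the centre, where t^(\<alpha> - 1) \<le> 1 remains; the
  singularity of order -\<alpha> / 2 of the weight at the boundary is integrable because \<alpha> <
  2.\<close>

lemma ball_potential_0_finite:
  assumes "1 < \<alpha>" "\<alpha> < 2"
  shows "ball_potential \<alpha> (0::'a::euclidean_space) < \<infinity>"
proof -
  have "ball_potential \<alpha> (0::'a) = (\<integral>\<^sup>+w. ennreal (norm (w::'a) powr (\<alpha> - DIM('a))) * (ennreal ((1 - (norm w)\<^sup>2) powr (- \<alpha> / 2)) * indicator {..<1} (norm w)) \<partial>lborel)"
    unfolding ball_potential_def ball_weight_def by (intro nn_integral_cong) (simp add: indicator_def)
  also have "\<dots> = shell_integral TYPE('a) * (\<integral>\<^sup>+t. ennreal (t powr (\<alpha> - DIM('a))) * (ennreal ((1 - t\<^sup>2) powr (- \<alpha> / 2)) * indicator {..<1} t)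
      * ennreal (t powr (real DIM('a) - 1)) * indicator {0<..} t \<partial>lborel)"
    by (rule nn_integral_radial) measurable
  also have "\<dots> \<le> shell_integral TYPE('a) * (\<integral>\<^sup>+t. ennreal ((1 - t) powr (- \<alpha> / 2)) * indicator {0..1} (1 - t) \<partial>lborel)"
  proof (intro mult_left_mono nn_integral_mono)
    fix t :: real
    show "ennreal (t powr (\<alpha> - DIM('a))) * (ennreal ((1 - t\<^sup>2) powr (- \<alpha> / 2)) * indicator {..<1} t)
      * ennreal (t powr (real DIM('a) - 1)) * indicator {0<..} t \<le> ennreal ((1 - t) powr (- \<alpha> / 2)) * indicator {0..1} (1 - t)"
    proof (cases "0 < t \<and> t < 1")
      case True
      have "t powr (\<alpha> - DIM('a)) * t powr (real DIM('a) - 1) = t powr (\<alpha> - 1)" unfolding powr_add[symmetric] by simp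
      moreover have "t powr (\<alpha> - 1) \<le> 1" using True assms by (intro powr_le1) auto
      moreover have "(1 - t\<^sup>2) powr (- \<alpha> / 2) \<le> (1 - t) powr (- \<alpha> / 2)"
        using True assms by (intro powr_mono2') (auto simp: power2_eq_square mult_left_le)
      ultimately have "(t powr (\<alpha> - DIM('a)) * t powr (real DIM('a) - 1)) * (1 - t\<^sup>2) powr (- \<alpha> / 2) \<le> (1 - t) powr (- \<alpha> / 2)"
        using mult_mono[of "t powr (\<alpha> - 1)" 1 "(1 - t\<^sup>2) powr (- \<alpha> / 2)" "(1 - t) powr (- \<alpha> / 2)"]
        by (simp only: powr_ge_zero mult_1 simp_thms zero_le_one)
      then have "t powr (\<alpha> - DIM('a)) * (1 - t\<^sup>2) powr (- \<alpha> / 2) * t powr (real DIM('a) - 1) \<le> (1 - t) powr (- \<alpha> / 2)"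
        by (simp only: ac_simps)
      then show ?thesis using True by (simp add: ennreal_mult'[symmetric])
    qed (auto simp: indicator_def)
  qed simp
  also have "(\<integral>\<^sup>+t. ennreal ((1 - t) powr (- \<alpha> / 2)) * indicator {0..1} (1 - t) \<partial>lborel) = (\<integral>\<^sup>+t. ennreal (t powr (- \<alpha> / 2)) * indicator {0..1} t \<partial>lborel)"
    by (rule nn_integral_lborel_translate(4)) measurable
  also have "shell_integral TYPE('a) * \<dots> < \<infinity>"
    using assms shell_integral_finite[where 'a='a] by (subst nn_integral_powr_from_0) (auto simp: ennreal_mult_less_top)
  finally show ?thesis .
qed

lemma ball_potential_0_pos:
  assumes "0 < \<alpha>" "\<alpha> < real DIM('a)"
  shows "0 < ball_potential \<alpha> (0::'a::euclidean_space)"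
proof -
  have ne: "AE w in lborel. w \<noteq> (0::'a)" by (rule AE_lborel_singleton)
  have "0 < emeasure lborel (ball (0::'a) 1)" by (simp add: emeasure_ball unit_ball_vol_def)
  also have "\<dots> = (\<integral>\<^sup>+w. indicator (ball (0::'a) 1) w \<partial>lborel)" by simp
  also have "\<dots> \<le> ball_potential \<alpha> (0::'a)" unfolding ball_potential_def
  proof (rule nn_integral_mono_AE)
    show "AE w in lborel. indicator (ball (0::'a) 1) w \<le> ennreal (norm (0 - w) powr (\<alpha> - real DIM('a))) * ball_weight \<alpha> w"
      using ne
    proof eventually_elim
      case (elim w)
      show ?case
      proof (cases "norm w < 1")
        case True
        have "1 \<le> norm w powr (\<alpha> - DIM('a))" using True elim assms powr_mono2'[of "\<alpha> - DIM('a)" "norm w" 1] by simp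
        moreover have "1 \<le> (1 - (norm w)\<^sup>2) powr (- \<alpha> / 2)"
        proof -
          have "0 < 1 - (norm w)\<^sup>2" using True by (simp add: abs_square_less_1)
          then show ?thesis using assms powr_mono2'[of "- \<alpha> / 2" "1 - (norm w)\<^sup>2" 1] by simp
        qed
        ultimately have "1 \<le> norm w powr (\<alpha> - DIM('a)) * (1 - (norm w)\<^sup>2) powr (- \<alpha> / 2)"
          by (metis mult_mono' mult_1 zero_le_one)
        then show ?thesis using True by (simp add: ball_weight_def ennreal_mult'[symmetric])
      qed simp
    qed
  qed
  finally show ?thesis .
qed

text \<open>A maximum principle by projection: the nearest-point map onto a closed ball does not
  increase distances to points of that ball, so moving x to its projection increases the kernel
  there. The weight is first restricted to smaller concentric balls, which makes the projection an
  interior point of the unit ball, where the potential is constant.\<close>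

lemma ball_potential_outside:
  fixes x :: "'a::euclidean_space"
  assumes \<alpha>: "1 < \<alpha>" "\<alpha> < real DIM('a)"
  shows "ball_potential \<alpha> x \<le> ball_potential \<alpha> (0::'a)"
proof -
  define B where "B i = ball (0::'a) (1 - 1 / real (Suc i))" for i
  let ?f = "\<lambda>w. ennreal (norm (x - w) powr (\<alpha> - DIM('a))) * ball_weight \<alpha> w"
  have [measurable]: "B i \<in> sets borel" for i by (simp add: B_def)
  have inc: "incseq (\<lambda>i w. ?f w * indicator (B i) w)"
  proof (rule incseq_SucI, rule le_funI)
    fix i w
    have "1 / real (Suc (Suc i)) \<le> 1 / real (Suc i)" by (simp add: field_simps)
    then have "B i \<subseteq> B (Suc i)" unfolding B_def by (intro subset_ball) simp
    then show "?f w * indicator (B i) w \<le> ?f w * indicator (B (Suc i)) w"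
      by (auto simp: indicator_def)
  qed
  have sup: "?f w = (SUP i. ?f w * indicator (B i) w)" for w
  proof (rule antisym)
    show "(SUP i. ?f w * indicator (B i) w) \<le> ?f w" by (intro SUP_least) (auto simp: indicator_def)
    show "?f w \<le> (SUP i. ?f w * indicator (B i) w)"
    proof (cases "norm w < 1")
      case True
      then obtain i where "inverse (real (Suc i)) < 1 - norm w" using reals_Archimedean[of "1 - norm w"] by auto
      then have "w \<in> B i" by (simp add: B_def inverse_eq_divide)
      then show ?thesis by (intro SUP_upper2[of i]) auto
    qed (simp add: ball_weight_def)
  qed
  have "ball_potential \<alpha> x = (\<integral>\<^sup>+w. (SUP i. ?f w * indicator (B i) w) \<partial>lborel)"
    unfolding ball_potential_def by (rule nn_integral_cong) (rule sup)
  also have "\<dots> = (SUP i. \<integral>\<^sup>+w. ?f w * indicator (B i) w \<partial>lborel)"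
    by (rule nn_integral_monotone_convergence_SUP[OF inc]) measurable
  also have "\<dots> \<le> ball_potential \<alpha> (0::'a)"
  proof (rule SUP_least)
    fix i
    define C where "C = cball (0::'a) (1 - 1 / real (Suc i))"
    define y where "y = closest_point C x"
    have C: "convex C" "closed C" "C \<noteq> {}" unfolding C_def by (auto simp: field_simps)
    have "y \<in> C" unfolding y_def using C by (intro closest_point_in_set)
    then have "norm y \<le> 1 - 1 / real (Suc i)" unfolding C_def by simp
    moreover have "0 < 1 / real (Suc i)" by simp
    ultimately have y: "norm y < 1" by linarith
    have ne: "AE w in lborel. w \<noteq> y" by (rule AE_lborel_singleton)
    have near: "norm (x - w) powr (\<alpha> - DIM('a)) \<le> norm (y - w) powr (\<alpha> - DIM('a))" if w: "w \<in> B i" "w \<noteq> y" for w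
    proof (rule powr_mono2')
      have wC: "w \<in> C" using w(1) by (simp add: B_def C_def)
      have "dist y (closest_point C w) \<le> dist x w" unfolding y_def by (rule closest_point_lipschitz[OF C])
      then show "norm (y - w) \<le> norm (x - w)" unfolding closest_point_self[OF wC] by (simp add: dist_norm)
    qed (use w \<alpha> in auto)
    have "(\<integral>\<^sup>+w. ?f w * indicator (B i) w \<partial>lborel) \<le> ball_potential \<alpha> y"
      unfolding ball_potential_def
    proof (rule nn_integral_mono_AE)
      show "AE w in lborel. ?f w * indicator (B i) w \<le> ennreal (norm (y - w) powr (\<alpha> - DIM('a))) * ball_weight \<alpha> w"
        using ne
      proof eventually_elim
        case (elim w)
        then show ?case using near[of w] by (auto simp: indicator_def intro!: mult_right_mono ennreal_leI)
      qed
    qed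
    then show "(\<integral>\<^sup>+w. ?f w * indicator (B i) w \<partial>lborel) \<le> ball_potential \<alpha> (0::'a)"
      using ball_potential_inside[OF \<alpha>(1) y] by simp
  qed
  finally show ?thesis .
qed

section \<open>The Poisson kernel of a ball\<close>

locale riesz_order =
  fixes \<alpha> :: real and T :: "'a::euclidean_space itself"
  assumes alpha: "1 < \<alpha>" "\<alpha> < 2" and dim: "2 \<le> DIM('a)"
begin

abbreviation k :: "'a \<Rightarrow> ennreal" where "k \<equiv> riesz_kernel \<alpha>"

lemma alpha_less_dim: "\<alpha> < real DIM('a)"
  using alpha dim by linarith

definition c0 :: real where "c0 = enn2real (ball_potential \<alpha> (0::'a))"

lemma c0_pos: "0 < c0"
  and ball_potential_c0: "ball_potential \<alpha> (0::'a) = ennreal c0"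
  using ball_potential_0_finite[OF alpha, where 'a='a] ball_potential_0_pos[of \<alpha>, where 'a='a] alpha alpha_less_dim
  by (auto simp: c0_def enn2real_positive_iff)

text \<open>M. Riesz's density of the balayage of the unit mass at \<open>0\<close> onto the complement of the ball of
  radius \<open>r\<close> about \<open>0\<close>; it vanishes inside that ball.\<close>

definition poisson :: "real \<Rightarrow> 'a \<Rightarrow> ennreal" where
  "poisson r w = ennreal (r powr \<alpha> * ((norm w)\<^sup>2 - r\<^sup>2) powr (- \<alpha> / 2) * norm w powr (- real DIM('a)) / c0) *
     indicator {0<..} (norm w - r)"

lemma measurable_poisson [measurable (raw)]:
  assumes [measurable]: "f \<in> borel_measurable M" "g \<in> borel_measurable M"
  shows "(\<lambda>x. poisson (f x) (g x)) \<in> borel_measurable M"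
  unfolding poisson_def by measurable

lemma poisson_scale:
  assumes r: "0 < r"
  shows "poisson r (r *\<^sub>R w) = ennreal (r powr (- real DIM('a))) * poisson 1 w"
proof (cases "1 < norm w")
  case True
  have 0: "(norm (r *\<^sub>R w))\<^sup>2 - r\<^sup>2 = r\<^sup>2 * ((norm w)\<^sup>2 - 1)"
    using r by (simp add: power_mult_distrib algebra_simps)
  have "(r\<^sup>2) powr (- \<alpha> / 2) = (r powr 2) powr (- \<alpha> / 2)" using r by simp
  then have 1: "(r\<^sup>2) powr (- \<alpha> / 2) = r powr (- \<alpha>)" by (simp only: powr_powr) simp
  have "r powr \<alpha> * r powr (- \<alpha>) = 1" using r by (simp add: powr_minus)
  then have "r powr \<alpha> * ((norm (r *\<^sub>R w))\<^sup>2 - r\<^sup>2) powr (- \<alpha> / 2) * norm (r *\<^sub>R w) powr (- real DIM('a)) =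
    r powr (- real DIM('a)) * (1 powr \<alpha> * ((norm w)\<^sup>2 - 1\<^sup>2) powr (- \<alpha> / 2) * norm w powr (- real DIM('a)))"
    unfolding 0 powr_mult 1 unfolding norm_scaleR powr_mult using r by simp
  moreover have "r < r * norm w" using True r by simp
  ultimately show ?thesis unfolding poisson_def using True r c0_pos
    by (simp add: ennreal_mult'[symmetric] del: norm_scaleR) simp
next
  case False
  then have "r * norm w \<le> r * 1" using r by (intro mult_left_mono) auto
  then show ?thesis using False r by (simp add: poisson_def)
qed

text \<open>The Kelvin transform: inversion turns the Poisson density outside the unit ball into the
  equilibrium weight inside it, and the conformal factor of |x - w| absorbs the remaining powers of
  |w|. The second claim is the version without a kernel, used for the total mass.\<close>

lemma inversion_poisson:
  fixes x w :: 'a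
  assumes w: "w \<noteq> 0" and x: "x \<noteq> 0"
  shows "ennreal (norm (x - w /\<^sub>R (norm w)\<^sup>2) powr (\<alpha> - DIM('a))) * poisson 1 (w /\<^sub>R (norm w)\<^sup>2) * ennreal (norm w powr (- 2 * real DIM('a))) =
    ennreal (norm x powr (\<alpha> - DIM('a)) / c0) * (ennreal (norm (x /\<^sub>R (norm x)\<^sup>2 - w) powr (\<alpha> - DIM('a))) * ball_weight \<alpha> w)"
    and "poisson 1 (w /\<^sub>R (norm w)\<^sup>2) * ennreal (norm w powr (- 2 * real DIM('a))) =
    ennreal (1 / c0) * (ennreal (norm (0 - w) powr (\<alpha> - DIM('a))) * ball_weight \<alpha> w)"
proof -
  let ?n = "real DIM('a)"
  define u where "u = norm w"
  have u: "0 < u" using w by (simp add: u_def)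
  have nw: "norm (w /\<^sub>R u\<^sup>2) = u powr (-1)" using w unfolding u_def by (simp add: power2_eq_square powr_minus field_simps)
  define d where "d = norm (x /\<^sub>R (norm x)\<^sup>2 - w)"
  have nx: "norm (x - w /\<^sub>R u\<^sup>2) = norm x * d * u powr (-1)"
    unfolding u_def d_def norm_diff_inversion[OF x w] using w by (simp add: powr_minus divide_inverse)
  have ind: "indicator {0<..} (u powr (-1) - 1) = (indicator (ball 0 1) w :: ennreal)"
    using u by (auto simp: indicator_def u_def powr_minus one_less_inverse_iff)
  have P: "poisson 1 (w /\<^sub>R u\<^sup>2) = ennreal (u powr (\<alpha> + ?n) * (1 - u\<^sup>2) powr (- \<alpha> / 2) / c0) * indicator (ball 0 1) w"
  proof (cases "u < 1")
    case True
    have "(u powr (-1))\<^sup>2 - 1 = (1 - u\<^sup>2) * u powr (-2)"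
      using u by (simp add: powr_minus field_simps power2_eq_square)
    then have "((u powr (-1))\<^sup>2 - 1) powr (- \<alpha> / 2) = (1 - u\<^sup>2) powr (- \<alpha> / 2) * (u powr (-2)) powr (- \<alpha> / 2)"
      by (simp only: powr_mult)
    also have "(u powr (-2)) powr (- \<alpha> / 2) = u powr \<alpha>" by (simp only: powr_powr) simp
    finally have 1: "((u powr (-1))\<^sup>2 - 1\<^sup>2) powr (- \<alpha> / 2) = (1 - u\<^sup>2) powr (- \<alpha> / 2) * u powr \<alpha>" by simp
    have 2: "(u powr (-1)) powr (- ?n) = u powr ?n" by (simp only: powr_powr) simp
    show ?thesis unfolding poisson_def nw ind 1 2 powr_add by (simp add: ac_simps)
  next
    case False
    then show ?thesis unfolding poisson_def nw ind by (simp add: u_def)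
  qed
  have pw: "u powr (\<alpha> + ?n) * u powr (- 2 * ?n) = u powr (\<alpha> - ?n)"
    unfolding powr_add[symmetric] by (simp add: algebra_simps)
  have one: "u powr (- (\<alpha> - ?n)) * u powr (\<alpha> - ?n) = 1"
    unfolding powr_add[symmetric] using u by simp
  have real2: "u powr (\<alpha> + ?n) * (1 - u\<^sup>2) powr (- \<alpha> / 2) / c0 * u powr (- 2 * ?n) = 1 / c0 * (u powr (\<alpha> - ?n) * (1 - u\<^sup>2) powr (- \<alpha> / 2))"
    unfolding pw[symmetric] by simp
  have E: "poisson 1 (w /\<^sub>R u\<^sup>2) * ennreal (u powr (- 2 * ?n)) =
    ennreal (1 / c0) * (ennreal (u powr (\<alpha> - ?n)) * ball_weight \<alpha> w)"
  proof (cases "w \<in> ball 0 1")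
    case True
    have "poisson 1 (w /\<^sub>R u\<^sup>2) * ennreal (u powr (- 2 * ?n)) = ennreal (u powr (\<alpha> + ?n) * (1 - u\<^sup>2) powr (- \<alpha> / 2) / c0 * u powr (- 2 * ?n))"
      unfolding P using True c0_pos by (simp add: ennreal_mult''[symmetric])
    also have "\<dots> = ennreal (1 / c0) * (ennreal (u powr (\<alpha> - ?n)) * ball_weight \<alpha> w)"
      unfolding real2 ball_weight_def u_def[symmetric] using True c0_pos
      by (simp only: indicator_simps mult_1_right ennreal_mult' powr_ge_zero divide_nonneg_nonneg zero_le_one less_imp_le mult_nonneg_nonneg)
    finally show ?thesis .
  qed (simp add: P ball_weight_def)
  then show "poisson 1 (w /\<^sub>R (norm w)\<^sup>2) * ennreal (norm w powr (- 2 * real DIM('a))) =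
    ennreal (1 / c0) * (ennreal (norm (0 - w) powr (\<alpha> - DIM('a))) * ball_weight \<alpha> w)"
    by (simp add: u_def)
  have "ennreal (norm (x - w /\<^sub>R u\<^sup>2) powr (\<alpha> - ?n)) * (poisson 1 (w /\<^sub>R u\<^sup>2) * ennreal (u powr (- 2 * ?n))) =
    (ennreal (norm x powr (\<alpha> - ?n)) * ennreal (1 / c0)) * (ennreal (d powr (\<alpha> - ?n)) * ball_weight \<alpha> w) *
    ennreal (u powr (- (\<alpha> - ?n)) * u powr (\<alpha> - ?n))"
    unfolding E nx powr_mult powr_powr by (simp add: ennreal_mult' ac_simps)
  also have "ennreal (norm x powr (\<alpha> - ?n)) * ennreal (1 / c0) = ennreal (norm x powr (\<alpha> - ?n) / c0)"
    using c0_pos by (simp add: ennreal_mult'[symmetric])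
  finally show "ennreal (norm (x - w /\<^sub>R (norm w)\<^sup>2) powr (\<alpha> - DIM('a))) * poisson 1 (w /\<^sub>R (norm w)\<^sup>2) * ennreal (norm w powr (- 2 * real DIM('a))) =
    ennreal (norm x powr (\<alpha> - DIM('a)) / c0) * (ennreal (norm (x /\<^sub>R (norm x)\<^sup>2 - w) powr (\<alpha> - DIM('a))) * ball_weight \<alpha> w)"
    unfolding one by (simp add: u_def d_def mult.assoc)
qed

lemma riesz_poisson_1:
  assumes x: "x \<noteq> (0::'a)"
  shows "(\<integral>\<^sup>+w. ennreal (norm (x - w) powr (\<alpha> - DIM('a))) * poisson 1 w \<partial>lborel) =
    ennreal (norm x powr (\<alpha> - DIM('a)) / c0) * ball_potential \<alpha> (x /\<^sub>R (norm x)\<^sup>2)"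
proof -
  have ne: "AE w in lborel. w \<noteq> (0::'a)" by (rule AE_lborel_singleton)
  have "(\<integral>\<^sup>+w. ennreal (norm (x - w) powr (\<alpha> - DIM('a))) * poisson 1 w \<partial>lborel) =
    (\<integral>\<^sup>+w. ennreal (norm (x - w /\<^sub>R (norm w)\<^sup>2) powr (\<alpha> - DIM('a))) * poisson 1 (w /\<^sub>R (norm w)\<^sup>2) * ennreal (norm w powr (- 2 * real DIM('a))) \<partial>lborel)"
    by (rule nn_integral_inversion) measurable
  also have "\<dots> = (\<integral>\<^sup>+w. ennreal (norm x powr (\<alpha> - DIM('a)) / c0) * (ennreal (norm (x /\<^sub>R (norm x)\<^sup>2 - w) powr (\<alpha> - DIM('a))) * ball_weight \<alpha> w) \<partial>lborel)"
    (is "(\<integral>\<^sup>+w. ?l w \<partial>lborel) = (\<integral>\<^sup>+w. ?r w \<partial>lborel)")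
  proof (rule nn_integral_cong_AE)
    show "AE w in lborel. ?l w = ?r w" using ne by eventually_elim (rule inversion_poisson(1)[OF _ x])
  qed
  also have "\<dots> = ennreal (norm x powr (\<alpha> - DIM('a)) / c0) * ball_potential \<alpha> (x /\<^sub>R (norm x)\<^sup>2)"
    unfolding ball_potential_def by (rule nn_integral_cmult) measurable
  finally show ?thesis .
qed

text \<open>Inversion turns the total mass into the ball potential at the origin divided by
  \<open>c0\<close>; this is what dictates the normalisation of \<open>poisson\<close>.\<close>

lemma nn_integral_poisson_1: "(\<integral>\<^sup>+w. poisson 1 w \<partial>lborel) = 1"
proof -
  have ne: "AE w in lborel. w \<noteq> (0::'a)" by (rule AE_lborel_singleton)
  obtain x :: 'a where x: "x \<noteq> 0" using nonempty_Basis nonzero_Basis by blast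
  have "(\<integral>\<^sup>+w. poisson 1 w \<partial>lborel) =
    (\<integral>\<^sup>+w. poisson 1 (w /\<^sub>R (norm w)\<^sup>2) * ennreal (norm w powr (- 2 * real DIM('a))) \<partial>lborel)"
    by (rule nn_integral_inversion) measurable
  also have "\<dots> = (\<integral>\<^sup>+w. ennreal (1 / c0) * (ennreal (norm (0 - (w::'a)) powr (\<alpha> - DIM('a))) * ball_weight \<alpha> w) \<partial>lborel)"
    (is "(\<integral>\<^sup>+w. ?l w \<partial>lborel) = (\<integral>\<^sup>+w. ?r w \<partial>lborel)")
  proof (rule nn_integral_cong_AE)
    show "AE w in lborel. ?l w = ?r w" using ne by eventually_elim (rule inversion_poisson(2)[OF _ x])
  qed
  also have "\<dots> = ennreal (1 / c0) * ball_potential \<alpha> (0::'a)"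
    unfolding ball_potential_def by (rule nn_integral_cmult) measurable
  also have "\<dots> = 1" unfolding ball_potential_c0 using c0_pos by (simp add: ennreal_mult'[symmetric])
  finally show ?thesis .
qed

lemma nn_integral_poisson:
  assumes r: "0 < r"
  shows "(\<integral>\<^sup>+w. poisson r w \<partial>lborel) = 1"
proof -
  have "(\<integral>\<^sup>+w. poisson r w \<partial>lborel) = ennreal (\<bar>r\<bar> ^ DIM('a)) * (\<integral>\<^sup>+w. poisson r (0 + r *\<^sub>R w) \<partial>lborel)"
    by (rule nn_integral_lborel_affine) (use r in auto)
  also have "\<dots> = ennreal (\<bar>r\<bar> ^ DIM('a)) * (ennreal (r powr (- real DIM('a))) * (\<integral>\<^sup>+w. poisson 1 w \<partial>lborel))"
    using r by (simp add: poisson_scale nn_integral_cmult)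
  also have "\<dots> = ennreal (r powr DIM('a) * r powr (- real DIM('a)))"
    using r by (simp add: nn_integral_poisson_1 ennreal_mult' powr_realpow)
  also have "\<dots> = 1" unfolding powr_add[symmetric] using r by simp
  finally show ?thesis .
qed

section \<open>The Riesz kernel and the potential of the Poisson density\<close>

definition kc :: real where "kc = riesz_const DIM('a) \<alpha>"

lemma kc_pos: "0 < kc"
  unfolding kc_def riesz_const_def using alpha alpha_less_dim
  by (auto intro!: divide_pos_pos mult_pos_pos Gamma_real_pos)

lemma k_eq: "x \<noteq> 0 \<Longrightarrow> k x = ennreal (kc * norm x powr (\<alpha> - DIM('a)))"
  by (simp add: riesz_kernel_def kc_def)

lemma k_0 [simp]: "k 0 = \<infinity>"
  by (simp add: riesz_kernel_def)

lemma measurable_k [measurable]: "k \<in> borel_measurable borel"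
  unfolding riesz_kernel_def[abs_def] by measurable

lemma k_minus [simp]: "k (- x) = k x"
  by (simp add: riesz_kernel_def)

lemma k_minus_commute: "k (x - y) = k (y - x)"
  using k_minus[of "x - y"] by simp

lemma k_finite: "x \<noteq> 0 \<Longrightarrow> k x < \<infinity>"
  by (simp add: k_eq)

lemma k_pos: "0 < k x"
  using kc_pos by (cases "x = 0") (auto simp: k_eq)

lemma k_antimono: "norm x \<le> norm y \<Longrightarrow> k y \<le> k x"
proof (cases "x = 0")
  case False
  assume "norm x \<le> norm y"
  then have "y \<noteq> 0" using False by auto
  with \<open>norm x \<le> norm y\<close> show ?thesis using False kc_pos alpha_less_dim
    by (auto simp: k_eq intro!: ennreal_leI mult_left_mono powr_mono2')
qed simp

lemma k_scale: "0 < r \<Longrightarrow> k (r *\<^sub>R x) = ennreal (r powr (\<alpha> - DIM('a))) * k x"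
  using kc_pos by (cases "x = 0") (auto simp: k_eq powr_mult ennreal_mult'[symmetric] ac_simps ennreal_mult_eq_top_iff)

definition poisson_pot :: "real \<Rightarrow> 'a \<Rightarrow> ennreal" where
  "poisson_pot r x = (\<integral>\<^sup>+w. k (x - w) * poisson r w \<partial>lborel)"

lemma poisson_pot_scale:
  assumes r: "0 < r"
  shows "poisson_pot r (r *\<^sub>R x) = ennreal (r powr (\<alpha> - DIM('a))) * poisson_pot 1 x"
proof -
  have "poisson_pot r (r *\<^sub>R x) = ennreal (\<bar>r\<bar> ^ DIM('a)) * (\<integral>\<^sup>+w. k (r *\<^sub>R x - (0 + r *\<^sub>R w)) * poisson r (0 + r *\<^sub>R w) \<partial>lborel)"
    unfolding poisson_pot_def by (rule nn_integral_lborel_affine) (use r in auto)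
  also have "\<dots> = ennreal (\<bar>r\<bar> ^ DIM('a)) * (\<integral>\<^sup>+w. (ennreal (r powr (\<alpha> - DIM('a))) * ennreal (r powr (- real DIM('a)))) * (k (x - w) * poisson 1 w) \<partial>lborel)"
  proof -
    have "k (r *\<^sub>R x - (0 + r *\<^sub>R w)) = ennreal (r powr (\<alpha> - DIM('a))) * k (x - w)" for w
      using k_scale[OF r, of "x - w"] by (simp add: algebra_simps)
    then show ?thesis using r by (simp add: poisson_scale ac_simps)
  qed
  also have "\<dots> = ennreal (\<bar>r\<bar> ^ DIM('a)) * ((ennreal (r powr (\<alpha> - DIM('a))) * ennreal (r powr (- real DIM('a)))) * poisson_pot 1 x)"
    unfolding poisson_pot_def by (subst nn_integral_cmult) auto
  also have "\<dots> = ennreal (r powr DIM('a) * r powr (- real DIM('a))) * (ennreal (r powr (\<alpha> - DIM('a))) * poisson_pot 1 x)"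
    using r by (simp add: ennreal_mult' powr_realpow ac_simps)
  also have "r powr DIM('a) * r powr (- real DIM('a)) = 1" unfolding powr_add[symmetric] using r by simp
  finally show ?thesis by simp
qed

text \<open>After the Kelvin transform the comparison is between the ball potential at the inverted
  point and at 0: a point outside the closed unit ball is sent inside, where the two agree, and the
  inequality everywhere is the maximum principle.\<close>

lemma poisson_pot_1:
  assumes x: "x \<noteq> 0"
  shows "poisson_pot 1 x \<le> k x" and "1 < norm x \<Longrightarrow> poisson_pot 1 x = k x"
proof -
  have ne: "AE w in lborel. w \<noteq> x" by (rule AE_lborel_singleton)
  have "poisson_pot 1 x = (\<integral>\<^sup>+w. ennreal kc * (ennreal (norm (x - w) powr (\<alpha> - DIM('a))) * poisson 1 w) \<partial>lborel)"
    unfolding poisson_pot_def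
  proof (rule nn_integral_cong_AE)
    show "AE w in lborel. k (x - w) * poisson 1 w = ennreal kc * (ennreal (norm (x - w) powr (\<alpha> - DIM('a))) * poisson 1 w)"
      using ne by eventually_elim (use kc_pos in \<open>auto simp: k_eq ennreal_mult' mult.assoc\<close>)
  qed
  also have "\<dots> = ennreal kc * (ennreal (norm x powr (\<alpha> - DIM('a)) / c0) * ball_potential \<alpha> (x /\<^sub>R (norm x)\<^sup>2))"
    by (subst nn_integral_cmult) (simp_all add: riesz_poisson_1[OF x])
  finally have K: "poisson_pot 1 x = ennreal kc * (ennreal (norm x powr (\<alpha> - DIM('a)) / c0) * ball_potential \<alpha> (x /\<^sub>R (norm x)\<^sup>2))" .
  have "ennreal kc * (ennreal (norm x powr (\<alpha> - DIM('a)) / c0) * ball_potential \<alpha> (0::'a)) = k x"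
    unfolding ball_potential_c0 using x kc_pos c0_pos by (simp add: k_eq ennreal_mult'[symmetric])
  note kx = this[symmetric]
  show "poisson_pot 1 x \<le> k x" unfolding K kx
    by (intro mult_left_mono ball_potential_outside alpha alpha_less_dim) auto
  show "poisson_pot 1 x = k x" if "1 < norm x"
  proof -
    have "norm (x /\<^sub>R (norm x)\<^sup>2) < 1" using that by (simp add: power2_eq_square field_simps)
    then show ?thesis unfolding K kx by (simp only: ball_potential_inside[OF alpha(1)])
  qed
qed

lemma poisson_pot_le: "0 < r \<Longrightarrow> poisson_pot r x \<le> k x"
  using poisson_pot_scale[of r "x /\<^sub>R r"] k_scale[of r "x /\<^sub>R r"] poisson_pot_1(1)[of "x /\<^sub>R r"]
  by (cases "x = 0") (auto intro: mult_left_mono)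

lemma poisson_pot_eq: "0 < r \<Longrightarrow> r < norm x \<Longrightarrow> poisson_pot r x = k x"
  using poisson_pot_scale[of r "x /\<^sub>R r"] k_scale[of r "x /\<^sub>R r"] poisson_pot_1(2)[of "x /\<^sub>R r"]
  by (cases "x = 0") (auto simp: field_simps)

lemma measurable_poisson_pot [measurable (raw)]:
  assumes [measurable]: "f \<in> borel_measurable M" "g \<in> borel_measurable M"
  shows "(\<lambda>x. poisson_pot (f x) (g x)) \<in> borel_measurable M"
  unfolding poisson_pot_def by measurable

section \<open>Green's function of a ball with pole at its centre\<close>

definition ball_green :: "real \<Rightarrow> 'a \<Rightarrow> ennreal" where
  "ball_green r x = k x - poisson_pot r x"

lemma measurable_ball_green [measurable (raw)]:
  assumes [measurable]: "f \<in> borel_measurable M" "g \<in> borel_measurable M"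
  shows "(\<lambda>x. ball_green (f x) (g x)) \<in> borel_measurable M"
  unfolding ball_green_def by measurable

text \<open>The truncated subtraction in \<open>ball_green\<close> loses nothing, since the Poisson
  potential is at most the kernel; at 0 both sides are infinite. This splitting is the source of all
  later mean value relations.\<close>

lemma k_split: "0 < r \<Longrightarrow> k x = ball_green r x + poisson_pot r x"
  unfolding ball_green_def using poisson_pot_le[of r x] by (simp add: diff_add_cancel_ennreal)

lemma ball_green_zero: "0 < r \<Longrightarrow> r < norm x \<Longrightarrow> ball_green r x = 0"
  unfolding ball_green_def using poisson_pot_eq[of r x] k_finite[of x] by (cases "x = 0") auto

lemma ball_green_le_k: "ball_green r x \<le> k x"
  unfolding ball_green_def by (simp add: diff_le_self_ennreal)

lemma poisson_minus [simp]: "poisson r (- x) = poisson r x"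
  by (simp add: poisson_def)

lemma poisson_minus_commute: "poisson r (x - y) = poisson r (y - x)"
  using poisson_minus[of r "x - y"] by simp

lemma poisson_pot_minus [simp]: "poisson_pot r (- x) = poisson_pot r x"
proof -
  have "poisson_pot r (- x) = (\<integral>\<^sup>+w. k (- x - (0 - w)) * poisson r (0 - w) \<partial>lborel)"
    unfolding poisson_pot_def by (subst nn_integral_lborel_translate(4)) auto
  also have "\<dots> = poisson_pot r x"
    unfolding poisson_pot_def using k_minus_commute by (intro nn_integral_cong) simp
  finally show ?thesis .
qed

lemma ball_green_minus [simp]: "ball_green r (- x) = ball_green r x"
  by (simp add: ball_green_def)

lemma ball_green_scale: "0 < r \<Longrightarrow> ball_green r (r *\<^sub>R x) = ennreal (r powr (\<alpha> - DIM('a))) * ball_green 1 x"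
  unfolding ball_green_def by (simp add: poisson_pot_scale k_scale ennreal_right_diff_distrib)

lemma nn_integral_k_ball:
  assumes "0 \<le> R"
  shows "(\<integral>\<^sup>+x. k x * indicator {..R} (norm x) \<partial>lborel) < \<infinity>"
proof -
  have ne: "AE w in lborel. w \<noteq> (0::'a)" by (rule AE_lborel_singleton)
  have "(\<integral>\<^sup>+x. k x * indicator {..R} (norm x) \<partial>lborel) =
    (\<integral>\<^sup>+x. ennreal kc * (ennreal (norm (x::'a) powr (\<alpha> - DIM('a))) * indicator {..R} (norm x)) \<partial>lborel)"
    (is "(\<integral>\<^sup>+w. ?l w \<partial>lborel) = (\<integral>\<^sup>+w. ?r w \<partial>lborel)")
  proof (rule nn_integral_cong_AE)
    show "AE w in lborel. ?l w = ?r w" using ne by eventually_elim (use kc_pos in \<open>auto simp: k_eq ennreal_mult' mult.assoc\<close>)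
  qed
  also have "\<dots> = ennreal kc * (shell_integral TYPE('a) * ennreal (R powr (\<alpha> - DIM('a) + DIM('a)) / (\<alpha> - DIM('a) + DIM('a))))"
    using alpha assms by (subst nn_integral_cmult, measurable, subst nn_integral_norm_powr_near) auto
  also have "\<dots> < \<infinity>"
    using shell_integral_finite[where 'a='a] by (simp add: ennreal_mult_less_top)
  finally show ?thesis .
qed

text \<open>The mean exit time from the unit ball, started at its centre, for the stable process
  whose potential kernel is \<open>k\<close>.\<close>

definition gam :: real where "gam = enn2real (\<integral>\<^sup>+x. ball_green 1 x \<partial>lborel)"

lemma nn_integral_ball_green_1_finite: "(\<integral>\<^sup>+x. ball_green 1 x \<partial>lborel) < \<infinity>"
proof -
  have "ball_green 1 x \<le> k x * indicator {..1} (norm x)" for x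
    using ball_green_le_k[of 1 x] ball_green_zero[of 1 x] by (cases "norm x \<le> 1") auto
  then have "(\<integral>\<^sup>+x. ball_green 1 x \<partial>lborel) \<le> (\<integral>\<^sup>+x. k x * indicator {..1} (norm x) \<partial>lborel)"
    by (intro nn_integral_mono)
  also have "\<dots> < \<infinity>" using nn_integral_k_ball[of 1] by simp
  finally show ?thesis .
qed

text \<open>The Poisson mass lies at distance at least 1/2 from x, whereas x lies at distance less
  than 1/2 from the pole. Positivity on this small ball is enough to make \<open>gam\<close>
  positive.\<close>

lemma ball_green_1_pos:
  assumes x: "norm x < 1 / 4"
  shows "0 < ball_green 1 x"
proof (cases "x = 0")
  case False
  obtain e :: 'a where e: "norm e = 1" using nonempty_Basis norm_Basis by blast
  have "poisson_pot 1 x \<le> (\<integral>\<^sup>+w. k ((1/2) *\<^sub>R e) * poisson 1 w \<partial>lborel)"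
    unfolding poisson_pot_def
  proof (intro nn_integral_mono)
    fix w :: 'a
    show "k (x - w) * poisson 1 w \<le> k ((1/2) *\<^sub>R e) * poisson 1 w"
    proof (cases "1 < norm w")
      case True
      have "norm w - norm x \<le> norm (x - w)" using norm_triangle_ineq3[of w x] by (simp add: norm_minus_commute)
      then have "norm ((1/2) *\<^sub>R e) \<le> norm (x - w)" using True x e by simp
      then show ?thesis by (intro mult_right_mono k_antimono) auto
    qed (simp add: poisson_def)
  qed
  also have "\<dots> = k ((1/2) *\<^sub>R e)" by (simp add: nn_integral_cmult nn_integral_poisson)
  also have "\<dots> < k x"
  proof -
    have "(1/2) powr (\<alpha> - DIM('a)) < norm x powr (\<alpha> - DIM('a))"
      using x False alpha_less_dim by (intro powr_less_mono2_neg) auto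
    moreover have "k ((1/2) *\<^sub>R e) = ennreal (kc * (1/2) powr (\<alpha> - DIM('a)))"
      using e by (subst k_eq) auto
    ultimately show ?thesis using False kc_pos by (auto simp: k_eq ennreal_less_iff)
  qed
  finally show ?thesis unfolding ball_green_def using k_finite[OF False] by (simp add: diff_gr0_ennreal)
next
  case True
  have "poisson_pot 1 0 < \<infinity>"
  proof -
    obtain e :: 'a where e: "norm e = 1" using nonempty_Basis norm_Basis by blast
    have "poisson_pot 1 0 \<le> (\<integral>\<^sup>+w. k e * poisson 1 w \<partial>lborel)"
      unfolding poisson_pot_def
    proof (intro nn_integral_mono)
      fix w :: 'a
      show "k (0 - w) * poisson 1 w \<le> k e * poisson 1 w"
        using e by (cases "1 < norm w") (auto simp: poisson_def intro!: mult_right_mono k_antimono)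
    qed
    also have "\<dots> = k e" by (simp add: nn_integral_cmult nn_integral_poisson)
    also have "\<dots> < \<infinity>" using e by (intro k_finite) auto
    finally show ?thesis .
  qed
  then show ?thesis using True by (simp add: ball_green_def ennreal_top_minus)
qed

lemma nn_integral_ball_green_1: "(\<integral>\<^sup>+x. ball_green 1 x \<partial>lborel) = ennreal gam" and gam_pos: "0 < gam"
proof -
  show *: "(\<integral>\<^sup>+x. ball_green 1 x \<partial>lborel) = ennreal gam"
    unfolding gam_def using nn_integral_ball_green_1_finite by simp
  have "(\<integral>\<^sup>+x. ball_green 1 x \<partial>lborel) \<noteq> 0"
  proof
    assume "(\<integral>\<^sup>+x. ball_green 1 x \<partial>lborel) = 0"
    then have "AE x in lborel. ball_green 1 x = 0" by (subst (asm) nn_integral_0_iff_AE) auto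
    then have "AE x in lborel. x \<notin> ball (0::'a) (1/4)"
      by eventually_elim (use ball_green_1_pos in force)
    then have "emeasure lborel (ball (0::'a) (1/4)) = 0"
      by (subst (asm) AE_iff_measurable[of "ball (0::'a) (1/4)"]) (auto simp: set_eq_iff)
    moreover have "0 < emeasure lborel (ball (0::'a) (1/4))" by (simp add: emeasure_ball unit_ball_vol_def)
    ultimately show False by simp
  qed
  then show "0 < gam" unfolding * by (simp add: ennreal_eq_0_iff not_le)
qed

lemma nn_integral_ball_green:
  assumes r: "0 < r"
  shows "(\<integral>\<^sup>+x. ball_green r x \<partial>lborel) = ennreal (r powr \<alpha> * gam)"
proof -
  have "(\<integral>\<^sup>+w. ball_green r w \<partial>lborel) = ennreal (\<bar>r\<bar> ^ DIM('a)) * (\<integral>\<^sup>+w. ball_green r (0 + r *\<^sub>R w) \<partial>lborel)"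
    by (rule nn_integral_lborel_affine) (use r in auto)
  also have "\<dots> = ennreal (r powr DIM('a)) * (ennreal (r powr (\<alpha> - DIM('a))) * ennreal gam)"
    using r by (simp add: ball_green_scale nn_integral_cmult nn_integral_ball_green_1 powr_realpow)
  also have "\<dots> = ennreal ((r powr DIM('a) * r powr (\<alpha> - DIM('a))) * gam)"
    using gam_pos by (simp add: ennreal_mult'[symmetric] mult.assoc)
  also have "r powr DIM('a) * r powr (\<alpha> - DIM('a)) = r powr \<alpha>" unfolding powr_add[symmetric] by simp
  finally show ?thesis .
qed

text \<open>The jump density of the operator inverse to convolution with \<open>k\<close>: by the scaling of
  \<open>poisson\<close> and of \<open>nn_integral_ball_green\<close> it is the limit of \<open>poisson r w\<close> divided by the total
  mass of \<open>ball_green r\<close> as \<open>r \<rightarrow> 0\<close>.\<close>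

definition J :: "'a \<Rightarrow> ennreal" where
  "J w = ennreal (norm w powr (- \<alpha> - DIM('a)) / (c0 * gam))"

lemma measurable_J [measurable]: "J \<in> borel_measurable borel"
  unfolding J_def[abs_def] by measurable

lemma J_minus [simp]: "J (- x) = J x"
  by (simp add: J_def)

lemma J_minus_commute: "J (x - y) = J (y - x)"
  using J_minus[of "x - y"] by simp

text \<open>Omitting r^2 from |w|^2 - r^2 only decreases the density. Together with
  \<open>poisson_le\<close> this encloses the Poisson density between multiples of \<open>J\<close>
  whose ratio tends to 1 as the radius shrinks, away from the pole.\<close>

lemma poisson_ge:
  assumes "0 < r" "r < norm w"
  shows "ennreal (r powr \<alpha> * gam) * J w \<le> poisson r w"
proof -
  have 0: "0 < (norm w)\<^sup>2 - r\<^sup>2" using assms by (simp add: power_strict_mono)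
  have "((norm w)\<^sup>2) powr (- \<alpha> / 2) \<le> ((norm w)\<^sup>2 - r\<^sup>2) powr (- \<alpha> / 2)"
    using 0 assms alpha by (intro powr_mono2') auto
  moreover have "((norm w)\<^sup>2) powr (- \<alpha> / 2) = (norm w powr 2) powr (- \<alpha> / 2)" using assms by simp
  then have "((norm w)\<^sup>2) powr (- \<alpha> / 2) = norm w powr (- \<alpha>)" by (simp only: powr_powr) simp
  ultimately have "norm w powr (- \<alpha>) * norm w powr (- real DIM('a)) \<le> ((norm w)\<^sup>2 - r\<^sup>2) powr (- \<alpha> / 2) * norm w powr (- real DIM('a))"
    by (intro mult_right_mono) auto
  then have "r powr \<alpha> * (norm w powr (- \<alpha> - DIM('a))) \<le> r powr \<alpha> * (((norm w)\<^sup>2 - r\<^sup>2) powr (- \<alpha> / 2) * norm w powr (- real DIM('a)))"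
    unfolding powr_add[symmetric] by (intro mult_left_mono) auto
  then have "r powr \<alpha> * norm w powr (- \<alpha> - DIM('a)) / c0 \<le> r powr \<alpha> * ((norm w)\<^sup>2 - r\<^sup>2) powr (- \<alpha> / 2) * norm w powr (- real DIM('a)) / c0"
    using c0_pos by (intro divide_right_mono) (auto simp: mult.assoc)
  moreover have "(r powr \<alpha> * gam) * (norm w powr (- \<alpha> - DIM('a)) / (c0 * gam)) = r powr \<alpha> * norm w powr (- \<alpha> - DIM('a)) / c0"
    using gam_pos by simp
  ultimately show ?thesis
    unfolding J_def poisson_def using assms gam_pos c0_pos
    by (simp add: ennreal_mult'[symmetric] ennreal_leI)
qed

lemma poisson_le:
  assumes "0 < s" "s < \<eta>" "\<eta> \<le> norm v"
  shows "poisson s v \<le> ennreal (s powr \<alpha> * gam * (1 - s\<^sup>2 / \<eta>\<^sup>2) powr (- \<alpha> / 2)) * J v"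
proof -
  define q where "q = 1 - s\<^sup>2 / \<eta>\<^sup>2"
  have q: "0 < q" unfolding q_def using assms by (simp add: power_strict_mono)
  have v: "0 < norm v" using assms by auto
  have "q * (norm v)\<^sup>2 \<le> (norm v)\<^sup>2 - s\<^sup>2"
  proof -
    have "s\<^sup>2 * \<eta>\<^sup>2 \<le> s\<^sup>2 * (norm v)\<^sup>2" using assms by (intro mult_left_mono power_mono) auto
    then have "s\<^sup>2 \<le> s\<^sup>2 / \<eta>\<^sup>2 * (norm v)\<^sup>2" using assms by (simp add: field_simps)
    then show ?thesis by (simp add: q_def algebra_simps)
  qed
  then have "((norm v)\<^sup>2 - s\<^sup>2) powr (- \<alpha> / 2) \<le> (q * (norm v)\<^sup>2) powr (- \<alpha> / 2)"
    using q v alpha by (intro powr_mono2') auto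
  also have "\<dots> = q powr (- \<alpha> / 2) * norm v powr (- \<alpha>)"
  proof -
    have "((norm v)\<^sup>2) powr (- \<alpha> / 2) = (norm v powr 2) powr (- \<alpha> / 2)" using v by simp
    also have "\<dots> = norm v powr (- \<alpha>)" by (simp only: powr_powr) simp
    finally show ?thesis by (simp only: powr_mult)
  qed
  finally have "((norm v)\<^sup>2 - s\<^sup>2) powr (- \<alpha> / 2) * norm v powr (- real DIM('a)) \<le> q powr (- \<alpha> / 2) * norm v powr (- \<alpha>) * norm v powr (- real DIM('a))"
    by (intro mult_right_mono) auto
  also have "\<dots> = q powr (- \<alpha> / 2) * norm v powr (- \<alpha> - DIM('a))"
    unfolding mult.assoc powr_add[symmetric] by simp
  finally have "s powr \<alpha> * (((norm v)\<^sup>2 - s\<^sup>2) powr (- \<alpha> / 2) * norm v powr (- real DIM('a))) / c0 \<le> s powr \<alpha> * (q powr (- \<alpha> / 2) * norm v powr (- \<alpha> - DIM('a))) / c0"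
    using c0_pos by (intro divide_right_mono mult_left_mono) auto
  moreover have "(s powr \<alpha> * gam * q powr (- \<alpha> / 2)) * (norm v powr (- \<alpha> - DIM('a)) / (c0 * gam)) = s powr \<alpha> * (q powr (- \<alpha> / 2) * norm v powr (- \<alpha> - DIM('a))) / c0"
    using gam_pos by simp
  ultimately show ?thesis
    unfolding J_def poisson_def q_def[symmetric] using assms gam_pos c0_pos
    by (simp add: ennreal_mult'[symmetric] ennreal_leI mult.assoc)
qed

text \<open>At a point w outside both balls, k w equals its own convolution with either Poisson
  density. Splitting the remaining kernel once more shows that both sides differ from k w by the
  convolution of k with both densities. This term \<open>X r s\<close> is symmetric in the radii and
  finite, so it cancels.\<close>

lemma ball_green_poisson_commute:
  assumes r: "0 < r" and s: "0 < s" and w: "r < norm w" "s < norm w"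
  shows "(\<integral>\<^sup>+z. ball_green r z * poisson s (w - z) \<partial>lborel) = (\<integral>\<^sup>+z. ball_green s z * poisson r (w - z) \<partial>lborel)"
proof -
  define X where "X r s = (\<integral>\<^sup>+z. poisson_pot r z * poisson s (w - z) \<partial>lborel)" for r s
  have split: "k w = (\<integral>\<^sup>+z. ball_green r z * poisson s (w - z) \<partial>lborel) + X r s" if "0 < r" "0 < s" "s < norm w" for r s
  proof -
    have "k w = poisson_pot s w" using poisson_pot_eq[of s w] that by simp
    also have "\<dots> = (\<integral>\<^sup>+z. k (w - (w - z)) * poisson s (w - z) \<partial>lborel)"
      unfolding poisson_pot_def by (subst nn_integral_lborel_translate(4)[of "\<lambda>z. k (w - z) * poisson s z" w]) auto
    also have "\<dots> = (\<integral>\<^sup>+z. ball_green r z * poisson s (w - z) + poisson_pot r z * poisson s (w - z) \<partial>lborel)"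
      using k_split[OF that(1)] by (intro nn_integral_cong) (simp add: distrib_right)
    also have "\<dots> = (\<integral>\<^sup>+z. ball_green r z * poisson s (w - z) \<partial>lborel) + X r s"
      unfolding X_def by (rule nn_integral_add) measurable
    finally show ?thesis .
  qed
  have X: "X r s = (\<integral>\<^sup>+z. \<integral>\<^sup>+u. k (w - z - u) * poisson r u * poisson s z \<partial>lborel \<partial>lborel)" for r s
  proof -
    have "X r s = (\<integral>\<^sup>+z. poisson_pot r (w - z) * poisson s (w - (w - z)) \<partial>lborel)"
      unfolding X_def by (subst nn_integral_lborel_translate(4)[of "\<lambda>z. poisson_pot r z * poisson s (w - z)" w]) auto
    also have "\<dots> = (\<integral>\<^sup>+z. \<integral>\<^sup>+u. k (w - z - u) * poisson r u * poisson s z \<partial>lborel \<partial>lborel)"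
      unfolding poisson_pot_def by (simp add: nn_integral_multc)
    finally show ?thesis .
  qed
  have "X r s = (\<integral>\<^sup>+u. \<integral>\<^sup>+z. k (w - z - u) * poisson r u * poisson s z \<partial>lborel \<partial>lborel)"
    unfolding X by (rule lborel_pair.Fubini') measurable
  also have "\<dots> = X s r"
    unfolding X by (intro nn_integral_cong) (simp add: algebra_simps)
  finally have XX: "X r s = X s r" .
  have "w \<noteq> 0" using w r by auto
  then have "X r s \<noteq> \<infinity>" using split[OF r s w(2)] k_finite[of w] by auto
  then show ?thesis using split[OF r s w(2)] split[OF s r w(1)] XX by simp
qed

text \<open>Letting \<open>s \<rightarrow> 0\<close> in \<open>ball_green_poisson_commute\<close>: \<open>ball_green s\<close> becomes a point mass and
  \<open>poisson s\<close> the jump kernel \<open>J\<close>.\<close>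

lemma poisson_le_ball_green_J:
  assumes r: "0 < r" and w: "r < norm w"
  shows "poisson r w \<le> (\<integral>\<^sup>+z. ball_green r z * J (w - z) \<partial>lborel)"
proof (cases "(\<integral>\<^sup>+z. ball_green r z * J (w - z) \<partial>lborel) = \<infinity>")
  case False
  define I where "I = enn2real (\<integral>\<^sup>+z. ball_green r z * J (w - z) \<partial>lborel)"
  have I: "(\<integral>\<^sup>+z. ball_green r z * J (w - z) \<partial>lborel) = ennreal I" using False by (simp add: I_def less_top)
  have I0: "0 \<le> I" by (simp add: I_def)
  define \<eta> where "\<eta> = norm w - r"
  have \<eta>: "0 < \<eta>" using w by (simp add: \<eta>_def)
  define p where "p t = r powr \<alpha> * (t\<^sup>2 - r\<^sup>2) powr (- \<alpha> / 2) * t powr (- real DIM('a)) / c0" for t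
  \<comment> \<open>\<open>ball_green s\<close> has mass s^\<alpha> \<open>gam\<close> and lives on
    the ball of radius s, where the decreasing profile p bounds \<open>poisson r (w - z)\<close>
    below by its value at |w| + s. The condition s < \<eta> keeps w - z outside the ball of radius
    r.\<close>
  have ineq: "p (norm w + s) \<le> (1 - s\<^sup>2 / \<eta>\<^sup>2) powr (- \<alpha> / 2) * I" if s: "0 < s" "s < \<eta>" for s
  proof -
    have sw: "s < norm w" using s r by (simp add: \<eta>_def)
    have p_le: "ennreal (p (norm w + s)) \<le> poisson r (w - z)" if z: "norm z \<le> s" for z
    proof -
      have lo: "r < norm (w - z)" using norm_triangle_ineq2[of w z] z s by (simp add: \<eta>_def)
      have hi: "norm (w - z) \<le> norm w + s" using norm_triangle_ineq4[of w z] z by simp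
      have "(norm (w - z))\<^sup>2 \<le> (norm w + s)\<^sup>2" using hi by (intro power_mono) auto
      moreover have "0 < (norm (w - z))\<^sup>2 - r\<^sup>2" using lo r by (simp add: power_strict_mono)
      ultimately have "((norm w + s)\<^sup>2 - r\<^sup>2) powr (- \<alpha> / 2) \<le> ((norm (w - z))\<^sup>2 - r\<^sup>2) powr (- \<alpha> / 2)"
        using alpha by (intro powr_mono2') auto
      moreover have "(norm w + s) powr (- real DIM('a)) \<le> norm (w - z) powr (- real DIM('a))"
        using lo r hi by (intro powr_mono2') auto
      ultimately have "p (norm w + s) \<le> r powr \<alpha> * ((norm (w - z))\<^sup>2 - r\<^sup>2) powr (- \<alpha> / 2) * norm (w - z) powr (- real DIM('a)) / c0"
        unfolding p_def using c0_pos by (intro divide_right_mono mult_mono mult_left_mono) auto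
      then show ?thesis unfolding poisson_def using lo by (simp add: ennreal_leI)
    qed
    have "ennreal (s powr \<alpha> * gam) * ennreal (p (norm w + s)) = (\<integral>\<^sup>+z. ball_green s z * ennreal (p (norm w + s)) \<partial>lborel)"
      using s by (simp add: nn_integral_multc nn_integral_ball_green)
    also have "\<dots> \<le> (\<integral>\<^sup>+z. ball_green s z * poisson r (w - z) \<partial>lborel)"
    proof (rule nn_integral_mono)
      fix z :: 'a
      show "ball_green s z * ennreal (p (norm w + s)) \<le> ball_green s z * poisson r (w - z)"
        using p_le[of z] ball_green_zero[OF s(1), of z] by (cases "norm z \<le> s") (auto intro: mult_left_mono)
    qed
    also have "\<dots> = (\<integral>\<^sup>+z. ball_green r z * poisson s (w - z) \<partial>lborel)"
      by (rule ball_green_poisson_commute[symmetric]) (use r s w sw in auto)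
    also have "\<dots> \<le> (\<integral>\<^sup>+z. ennreal (s powr \<alpha> * gam * (1 - s\<^sup>2 / \<eta>\<^sup>2) powr (- \<alpha> / 2)) * (ball_green r z * J (w - z)) \<partial>lborel)"
    proof (rule nn_integral_mono)
      fix z :: 'a
      show "ball_green r z * poisson s (w - z) \<le> ennreal (s powr \<alpha> * gam * (1 - s\<^sup>2 / \<eta>\<^sup>2) powr (- \<alpha> / 2)) * (ball_green r z * J (w - z))"
      proof (cases "norm z \<le> r")
        case True
        then have "\<eta> \<le> norm (w - z)" using norm_triangle_ineq2[of w z] by (simp add: \<eta>_def)
        from mult_left_mono[OF poisson_le[OF s this], of "ball_green r z"] show ?thesis
          by (simp add: ac_simps)
      next
        case False
        then show ?thesis using ball_green_zero[OF r, of z] by simp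
      qed
    qed
    also have "\<dots> = ennreal (s powr \<alpha> * gam * (1 - s\<^sup>2 / \<eta>\<^sup>2) powr (- \<alpha> / 2)) * ennreal I"
      by (subst nn_integral_cmult) (simp_all add: I)
    finally have "(s powr \<alpha> * gam) * p (norm w + s) \<le> (s powr \<alpha> * gam) * ((1 - s\<^sup>2 / \<eta>\<^sup>2) powr (- \<alpha> / 2) * I)"
      using gam_pos I0 by (simp add: ennreal_mult''[symmetric] ennreal_mult'[symmetric] ennreal_le_iff mult.assoc)
    then show ?thesis using s gam_pos by (subst (asm) mult_le_cancel_left_pos) auto
  qed
  have "p (norm w) \<le> I"
  proof (rule tendsto_le[OF trivial_limit_at_right_real])
    show "((\<lambda>s. p (norm w + s)) \<longlongrightarrow> p (norm w)) (at_right 0)"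
    proof -
      have "0 < (norm w)\<^sup>2 - r\<^sup>2" using w r by (simp add: power_strict_mono)
      then have n0: "(norm w + 0)\<^sup>2 - r\<^sup>2 \<noteq> 0" "norm w + 0 \<noteq> 0" "c0 \<noteq> 0" using w r c0_pos by auto
      have "((\<lambda>s. p (norm w + s)) \<longlongrightarrow> p (norm w + 0)) (at_right 0)"
        unfolding p_def by (intro tendsto_intros tendsto_ident_at n0 disjI1)
      then show ?thesis by simp
    qed
    show "((\<lambda>s. (1 - s\<^sup>2 / \<eta>\<^sup>2) powr (- \<alpha> / 2) * I) \<longlongrightarrow> I) (at_right 0)"
    proof -
      have "isCont (\<lambda>s. (1 - s\<^sup>2 / \<eta>\<^sup>2) powr (- \<alpha> / 2) * I) 0"
        using \<eta> by (intro continuous_intros) auto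
      then show ?thesis unfolding isCont_def by (simp add: filterlim_at_split)
    qed
    show "\<forall>\<^sub>F s in at_right 0. p (norm w + s) \<le> (1 - s\<^sup>2 / \<eta>\<^sup>2) powr (- \<alpha> / 2) * I"
      using eventually_at_right_real[OF \<eta>] by eventually_elim (use ineq in auto)
  qed
  moreover have "poisson r w = ennreal (p (norm w))" unfolding poisson_def p_def using w by simp
  ultimately show ?thesis unfolding I by (simp add: ennreal_leI)
qed simp

end

section \<open>The walk on balls\<close>

text \<open>All regularity of the boundary enters through this condition, stated at interior points
  at the scale of their own distance: it controls the escape of the walk, the killing density from
  below and the layers in Hardy's inequality.\<close>

locale corkscrew_domain = riesz_order \<alpha> T for \<alpha> :: real and T :: "'a::euclidean_space itself" +
  fixes \<Omega> :: "'a set" and ck Ck :: real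
  assumes open_dom: "open \<Omega>" and bounded_dom: "bounded \<Omega>"
    and ck: "0 < ck" and Ck: "0 < Ck"
    and corkscrew: "y \<in> \<Omega> \<Longrightarrow> \<exists>w. ball w (ck * infdist y (- \<Omega>)) \<subseteq> - \<Omega> \<and> norm (w - y) \<le> Ck * infdist y (- \<Omega>)"
begin

definition d :: "'a \<Rightarrow> real" where "d y = infdist y (- \<Omega>)"

lemma compl_nonempty: "- \<Omega> \<noteq> {}"
  using bounded_dom not_bounded_UNIV by (metis double_compl Compl_empty_eq)

lemma d_pos: "y \<in> \<Omega> \<Longrightarrow> 0 < d y"
  unfolding d_def using in_closed_iff_infdist_zero[of "- \<Omega>" y] open_dom compl_nonempty infdist_nonneg[of y "- \<Omega>"]
  by (auto simp: less_le)

lemma d_le: "x \<notin> \<Omega> \<Longrightarrow> d y \<le> norm (x - y)"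
  unfolding d_def using infdist_le[of x "- \<Omega>" y] by (simp add: dist_norm norm_minus_commute)

lemma d_lipschitz: "\<bar>d x - d y\<bar> \<le> norm (x - y)"
  unfolding d_def using infdist_triangle_abs[of x "- \<Omega>" y] by (simp add: dist_norm)

lemma measurable_d [measurable]: "d \<in> borel_measurable borel"
  unfolding d_def[abs_def] by (intro borel_measurable_continuous_onI continuous_intros)

lemma measurable_dom [measurable]: "\<Omega> \<in> sets borel"
  using open_dom by simp

text \<open>Half the distance, rather than all of it, puts every point outside
  \<open>\<Omega>\<close> strictly outside the ball, where \<open>ball_green\<close> is 0 and
  \<open>poisson_ge\<close> applies.\<close>

definition p :: "'a \<Rightarrow> 'a \<Rightarrow> ennreal" where "p z w = poisson (d z / 2) (w - z)"

lemma measurable_p [measurable (raw)]: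
  assumes [measurable]: "f \<in> borel_measurable M" "g \<in> borel_measurable M"
  shows "(\<lambda>x. p (f x) (g x)) \<in> borel_measurable M"
  unfolding p_def by measurable

text \<open>One step of a walk that jumps out of the ball of radius \<open>d z / 2\<close> about its position \<open>z\<close>:
  \<open>Q\<close> keeps the jumps landing in \<open>\<Omega>\<close>, \<open>S\<close> those leaving it.\<close>

definition Q :: "('a \<Rightarrow> ennreal) \<Rightarrow> 'a \<Rightarrow> ennreal" where
  "Q h z = (\<integral>\<^sup>+w. indicator \<Omega> w * h w * p z w \<partial>lborel)"

definition S :: "('a \<Rightarrow> ennreal) \<Rightarrow> 'a \<Rightarrow> ennreal" where
  "S h z = (\<integral>\<^sup>+w. indicator (- \<Omega>) w * h w * p z w \<partial>lborel)"

lemma measurable_Q [measurable]: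
  assumes [measurable]: "h \<in> borel_measurable borel"
  shows "Q h \<in> borel_measurable borel"
  unfolding Q_def[abs_def] by measurable

lemma measurable_S [measurable]:
  assumes [measurable]: "h \<in> borel_measurable borel"
  shows "S h \<in> borel_measurable borel"
  unfolding S_def[abs_def] by measurable

lemma measurable_Q_pow [measurable]: "h \<in> borel_measurable borel \<Longrightarrow> (Q ^^ j) h \<in> borel_measurable borel"
  by (induction j) auto

lemma SQ_sum:
  assumes [measurable]: "h \<in> borel_measurable borel"
  shows "S h z + Q h z = (\<integral>\<^sup>+w. h w * p z w \<partial>lborel)"
  unfolding S_def Q_def by (subst nn_integral_add[symmetric]) (auto intro!: nn_integral_cong simp: indicator_def)

lemma Q_cong: "(\<And>z. z \<in> \<Omega> \<Longrightarrow> f z = g z) \<Longrightarrow> Q f = Q g"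
  unfolding Q_def by (intro ext nn_integral_cong) (auto simp: indicator_def)

lemma Q_mono: "(\<And>z. z \<in> \<Omega> \<Longrightarrow> f z \<le> g z) \<Longrightarrow> Q f y \<le> Q g y"
  unfolding Q_def by (intro nn_integral_mono) (auto simp: indicator_def intro: mult_right_mono)

lemma Q_add:
  assumes [measurable]: "f \<in> borel_measurable borel" "g \<in> borel_measurable borel"
  shows "Q (\<lambda>z. f z + g z) y = Q f y + Q g y"
  unfolding Q_def by (subst nn_integral_add[symmetric]) (auto intro!: nn_integral_cong simp: algebra_simps)

lemma Q_cmult:
  assumes [measurable]: "f \<in> borel_measurable borel"
  shows "Q (\<lambda>z. c * f z) y = c * Q f y"
  unfolding Q_def by (subst nn_integral_cmult[symmetric]) (auto intro!: nn_integral_cong simp: algebra_simps)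

lemma Q_pow_add:
  assumes [measurable]: "f \<in> borel_measurable borel" "g \<in> borel_measurable borel"
  shows "(Q ^^ j) (\<lambda>z. f z + g z) y = (Q ^^ j) f y + (Q ^^ j) g y"
proof (induction j arbitrary: y)
  case (Suc j)
  then have "(Q ^^ j) (\<lambda>z. f z + g z) = (\<lambda>z. (Q ^^ j) f z + (Q ^^ j) g z)" by blast
  then show ?case by (simp add: Q_add)
qed simp

lemma Q_telescope:
  assumes [measurable]: "h \<in> borel_measurable borel" "a \<in> borel_measurable borel"
    and eq: "\<And>z. z \<in> \<Omega> \<Longrightarrow> h z = a z + Q h z" and y: "y \<in> \<Omega>"
  shows "h y = (\<Sum>j<N. (Q ^^ j) a y) + (Q ^^ N) h y"
proof (induction N)
  case (Suc N)
  have "(Q ^^ N) h y = (Q ^^ N) (\<lambda>z. a z + Q h z) y"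
  \<comment> \<open>The equation for h holds only in \<open>\<Omega>\<close>: for N = 0 it is used
    at y itself, otherwise the innermost Q sees only values in \<open>\<Omega>\<close>.\<close>
  proof (cases N)
    case 0
    then show ?thesis using eq y by simp
  next
    case (Suc M)
    have "Q h = Q (\<lambda>z. a z + Q h z)" by (rule Q_cong) (rule eq)
    then show ?thesis unfolding Suc funpow_Suc_right o_def by simp
  qed
  also have "\<dots> = (Q ^^ N) a y + (Q ^^ N) (Q h) y" by (rule Q_pow_add) measurable
  finally show ?case using Suc by (simp add: add.assoc funpow_swap1)
qed simp

lemma Q_pow_contract:
  assumes [measurable]: "h \<in> borel_measurable borel" and le: "\<And>z. z \<in> \<Omega> \<Longrightarrow> Q h z \<le> \<theta> * h z" and y: "y \<in> \<Omega>"
  shows "(Q ^^ N) h y \<le> \<theta> ^ N * h y"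
  using y
proof (induction N arbitrary: y)
  case (Suc N)
  have "(Q ^^ Suc N) h y \<le> Q (\<lambda>z. \<theta> ^ N * h z) y"
    using Suc.IH by (auto intro: Q_mono)
  also have "\<dots> = \<theta> ^ N * Q h y" by (rule Q_cmult) measurable
  also have "\<dots> \<le> \<theta> ^ N * (\<theta> * h y)" using le Suc.prems by (intro mult_left_mono) auto
  finally show ?case by (simp add: ac_simps)
qed simp

text \<open>If every step consumes at least the fraction b of h, then Q h \<le> (1 - b) h, so the
  remainder of the telescoping sum decays geometrically; finiteness of h permits the subtraction.
  Without such a bound the remainder is simply dropped.\<close>

lemma Q_telescope_limit:
  assumes [measurable]: "h \<in> borel_measurable borel" "a \<in> borel_measurable borel"
    and eq: "\<And>z. z \<in> \<Omega> \<Longrightarrow> h z = a z + Q h z" and y: "y \<in> \<Omega>"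
  shows "(\<Sum>j. (Q ^^ j) a y) \<le> h y"
    and "0 < b \<Longrightarrow> (\<And>z. z \<in> \<Omega> \<Longrightarrow> ennreal b * h z \<le> a z) \<Longrightarrow> (\<And>z. z \<in> \<Omega> \<Longrightarrow> h z < \<infinity>) \<Longrightarrow> (\<Sum>j. (Q ^^ j) a y) = h y"
proof -
  note tel = Q_telescope[OF assms(1,2) eq y]
  show le: "(\<Sum>j. (Q ^^ j) a y) \<le> h y"
  proof (rule suminf_le_const)
    fix N
    show "(\<Sum>j<N. (Q ^^ j) a y) \<le> h y" using tel[of N] by simp
  qed simp
  show "(\<Sum>j. (Q ^^ j) a y) = h y"
    if b: "0 < b" and ba: "\<And>z. z \<in> \<Omega> \<Longrightarrow> ennreal b * h z \<le> a z" and fin: "\<And>z. z \<in> \<Omega> \<Longrightarrow> h z < \<infinity>"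
  proof (rule antisym[OF le])
    \<comment> \<open>The maximum covers b > 1, where the assumptions force h to vanish in
      \<open>\<Omega>\<close>.\<close>
    define \<theta> where "\<theta> = max 0 (1 - b)"
    have \<theta>: "0 \<le> \<theta>" "\<theta> < 1" using b by (auto simp: \<theta>_def)
    have contr: "Q h z \<le> ennreal \<theta> * h z" if z: "z \<in> \<Omega>" for z
    proof -
      have "ennreal b * h z + Q h z \<le> h z" using ba[OF z] by (subst (2) eq[OF z]) (intro add_right_mono)
      moreover obtain t where t: "h z = ennreal t" "0 \<le> t" using fin[OF z] by (cases "h z") auto
      ultimately have le: "ennreal (b * t) + Q h z \<le> ennreal t" using b by (simp add: ennreal_mult'')
      then have "Q h z \<le> ennreal t" using order_trans[OF _ le, of "Q h z"] by simp
      then obtain q where q: "Q h z = ennreal q" "0 \<le> q" by (cases "Q h z") (auto simp: top_unique)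
      have "b * t + q \<le> t" using le q b t by (simp add: ennreal_plus[symmetric] del: ennreal_plus)
      then have "q \<le> (1 - b) * t" by (simp add: algebra_simps)
      also have "\<dots> \<le> \<theta> * t" unfolding \<theta>_def using t by (intro mult_right_mono) auto
      finally show ?thesis using q t \<theta> by (simp add: ennreal_mult'[symmetric] ennreal_leI)
    qed
    obtain t where t: "h y = ennreal t" "0 \<le> t" using fin[OF y] by (cases "h y") auto
    have ub: "h y \<le> (\<Sum>j. (Q ^^ j) a y) + ennreal (\<theta> ^ N * t)" for N
    proof -
      have "h y \<le> (\<Sum>j<N. (Q ^^ j) a y) + ennreal \<theta> ^ N * h y"
        using tel[of N] Q_pow_contract[OF assms(1) contr y, of N] by (metis add_left_mono)
      also have "\<dots> \<le> (\<Sum>j. (Q ^^ j) a y) + ennreal (\<theta> ^ N * t)"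
        using \<theta> t by (intro add_mono sum_le_suminf) (auto simp: ennreal_mult' ennreal_power)
      finally show ?thesis .
    qed
    have "(\<lambda>N. (\<Sum>j. (Q ^^ j) a y) + ennreal (\<theta> ^ N * t)) \<longlonglongrightarrow> (\<Sum>j. (Q ^^ j) a y) + ennreal (0 * t)"
      using \<theta> by (intro tendsto_intros LIMSEQ_realpow_zero) auto
    then show "h y \<le> (\<Sum>j. (Q ^^ j) a y)"
      using ub by (intro tendsto_lowerbound[where f="\<lambda>N. (\<Sum>j. (Q ^^ j) a y) + ennreal (\<theta> ^ N * t)"]) auto
  qed
qed

section \<open>Uniform escape from the domain\<close>

lemma half_d_pos: "y \<in> \<Omega> \<Longrightarrow> 0 < d y / 2"
  using d_pos by simp

lemma nn_integral_p: "y \<in> \<Omega> \<Longrightarrow> (\<integral>\<^sup>+w. p y w \<partial>lborel) = 1"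
  unfolding p_def using nn_integral_poisson[OF half_d_pos] by (subst nn_integral_lborel_translate(3)) auto

definition b0 :: real where
  "b0 = (1/2) powr \<alpha> * (Ck + ck) powr (- \<alpha> - DIM('a)) * unit_ball_vol (real DIM('a)) * ck ^ DIM('a) / c0"

lemma b0_pos: "0 < b0"
  unfolding b0_def using ck Ck c0_pos by (auto intro!: divide_pos_pos mult_pos_pos simp: unit_ball_vol_def)

text \<open>At distances comparable to d y the jump density is at least of order d y^(-n), and a
  corkscrew ball has volume of order d y^n. The powers of d y cancel, which leaves the bound
  \<open>b0\<close> common to all y.\<close>

lemma escape_mass:
  assumes y: "y \<in> \<Omega>"
  obtains w where "ball w (ck * d y) \<subseteq> - \<Omega>" "\<And>v. v \<in> ball w (ck * d y) \<Longrightarrow> norm (v - y) \<le> (Ck + ck) * d y"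
    "ennreal b0 \<le> (\<integral>\<^sup>+v. indicator (ball w (ck * d y)) v * p y v \<partial>lborel)"
proof -
  obtain w where w: "ball w (ck * d y) \<subseteq> - \<Omega>" "norm (w - y) \<le> Ck * d y"
    using corkscrew[OF y] by (auto simp: d_def)
  let ?n = "real DIM('a)"
  let ?M = "Ck + ck"
  define t where "t = d y"
  have t: "0 < t" using d_pos[OF y] by (simp add: t_def)
  have near: "norm (v - y) \<le> ?M * t" if "v \<in> ball w (ck * d y)" for v
  proof -
    have "norm (v - w) \<le> ck * t" using that by (simp add: dist_norm norm_minus_commute t_def)
    then show ?thesis using w(2) norm_triangle_ineq[of "v - w" "w - y"] by (simp add: t_def algebra_simps)
  qed
  define m where "m = (t / 2) powr \<alpha> * (?M * t) powr (- \<alpha> - ?n) / c0"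
  have m0: "0 \<le> m" using c0_pos by (simp add: m_def)
  have lower: "ennreal m \<le> p y v" if v: "v \<in> ball w (ck * d y)" for v
  proof -
    have "v \<notin> \<Omega>" using v w by auto
    then have vd: "t \<le> norm (v - y)" using d_le[of v y] by (simp add: t_def)
    have "(?M * t) powr (- \<alpha> - ?n) \<le> norm (v - y) powr (- \<alpha> - ?n)"
      using near[OF v] vd t alpha by (intro powr_mono2') auto
    then have "m \<le> (t / 2) powr \<alpha> * norm (v - y) powr (- \<alpha> - ?n) / c0"
      unfolding m_def using c0_pos by (intro divide_right_mono mult_left_mono) auto
    also have "\<dots> = (t / 2) powr \<alpha> * gam * (norm (v - y) powr (- \<alpha> - ?n) / (c0 * gam))"
      using gam_pos by simp
    finally have "ennreal m \<le> ennreal ((t / 2) powr \<alpha> * gam) * J (v - y)"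
      unfolding J_def using gam_pos c0_pos by (simp add: ennreal_mult'[symmetric] ennreal_leI)
    also have "\<dots> \<le> p y v" unfolding p_def t_def[symmetric]
      using vd t by (intro poisson_ge) auto
    finally show ?thesis .
  qed
  have "b0 = m * (unit_ball_vol ?n * (ck * t) ^ DIM('a))"
  proof -
    have "(t / 2) powr \<alpha> = t powr \<alpha> * (1/2) powr \<alpha>" unfolding powr_mult[symmetric] by simp
    moreover have "t powr \<alpha> * t powr (- \<alpha> - ?n) * t ^ DIM('a) = 1"
    proof -
      have "t ^ DIM('a) = t powr ?n" using t by (simp add: powr_realpow)
      then show ?thesis unfolding powr_add[symmetric] using t by (simp add: powr_add[symmetric])
    qed
    ultimately have "m * (unit_ball_vol ?n * (ck * t) ^ DIM('a)) =
      (t powr \<alpha> * t powr (- \<alpha> - ?n) * t ^ DIM('a)) * b0"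
      unfolding m_def b0_def powr_mult power_mult_distrib by simp
    then show ?thesis using \<open>t powr \<alpha> * t powr (- \<alpha> - ?n) * t ^ DIM('a) = 1\<close> by simp
  qed
  then have "ennreal b0 = ennreal m * emeasure lborel (ball w (ck * d y))"
    using ck t m0 by (simp add: emeasure_ball t_def ennreal_mult')
  also have "\<dots> = (\<integral>\<^sup>+v. ennreal m * indicator (ball w (ck * d y)) v \<partial>lborel)"
    by (subst nn_integral_cmult_indicator) simp_all
  also have "\<dots> \<le> (\<integral>\<^sup>+v. indicator (ball w (ck * d y)) v * p y v \<partial>lborel)"
    using lower by (intro nn_integral_mono) (auto simp: indicator_def)
  finally show ?thesis using that[OF w(1)] near by (auto simp: t_def)
qed

lemma S_lower:
  assumes z: "z \<in> \<Omega>" and [measurable]: "h \<in> borel_measurable borel"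
    and h: "\<And>w. w \<notin> \<Omega> \<Longrightarrow> norm (w - z) \<le> (Ck + ck) * d z \<Longrightarrow> c \<le> h w"
  shows "ennreal b0 * c \<le> S h z"
proof -
  obtain w where w: "ball w (ck * d z) \<subseteq> - \<Omega>" "\<And>v. v \<in> ball w (ck * d z) \<Longrightarrow> norm (v - z) \<le> (Ck + ck) * d z"
    "ennreal b0 \<le> (\<integral>\<^sup>+v. indicator (ball w (ck * d z)) v * p z v \<partial>lborel)"
    by (rule escape_mass[OF z]) blast
  have [measurable]: "ball w (ck * d z) \<in> sets borel" by simp
  have "ennreal b0 * c \<le> (\<integral>\<^sup>+v. indicator (ball w (ck * d z)) v * p z v \<partial>lborel) * c"
    by (intro mult_right_mono w) auto
  also have "\<dots> = (\<integral>\<^sup>+v. indicator (ball w (ck * d z)) v * p z v * c \<partial>lborel)"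
    by (rule nn_integral_multc[symmetric]) measurable
  also have "\<dots> \<le> S h z" unfolding S_def
  proof (rule nn_integral_mono)
    fix v
    show "indicator (ball w (ck * d z)) v * p z v * c \<le> indicator (- \<Omega>) v * h v * p z v"
    proof (cases "v \<in> ball w (ck * d z)")
      case True
      then have "v \<notin> \<Omega>" "c \<le> h v" using w h by auto
      then have "p z v * c \<le> p z v * h v" by (intro mult_left_mono) auto
      then show ?thesis using True \<open>v \<notin> \<Omega>\<close> by (simp add: ac_simps del: mem_ball)
    qed simp
  qed
  finally show ?thesis .
qed

text \<open>With h = 1: each step leaves \<open>\<Omega>\<close> with probability at least
  \<open>b0\<close>, so the walk leaves almost surely.\<close>

lemma chain_exit_mass:
  assumes y: "y \<in> \<Omega>"
  shows "(\<Sum>j. (Q ^^ j) (S (\<lambda>_. 1)) y) = 1"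
proof (rule Q_telescope_limit(2)[OF _ _ _ y b0_pos])
  show "1 = S (\<lambda>_. 1) z + Q (\<lambda>_. 1) z" if "z \<in> \<Omega>" for z
    using SQ_sum[of "\<lambda>_. 1" z] nn_integral_p[OF that] by simp
  show "ennreal b0 * 1 \<le> S (\<lambda>_. 1) z" if "z \<in> \<Omega>" for z
    by (rule S_lower[OF that]) auto
qed auto

lemma k_chain_split:
  assumes z: "z \<in> \<Omega>"
  shows "k (x - z) = ball_green (d z / 2) (x - z) + S (\<lambda>w. k (x - w)) z + Q (\<lambda>w. k (x - w)) z"
proof -
  have "poisson_pot (d z / 2) (x - z) = (\<integral>\<^sup>+w. k (x - (w + z)) * poisson (d z / 2) (w + z - z) \<partial>lborel)"
    unfolding poisson_pot_def by (simp add: algebra_simps)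
  also have "\<dots> = (\<integral>\<^sup>+w. k (x - w) * p z w \<partial>lborel)"
    unfolding p_def by (rule nn_integral_lborel_translate(2)) measurable
  also have "\<dots> = S (\<lambda>w. k (x - w)) z + Q (\<lambda>w. k (x - w)) z"
    by (rule SQ_sum[symmetric]) measurable
  finally show ?thesis using k_split[OF half_d_pos[OF z], of "x - z"] by (simp add: add.assoc)
qed

lemma chain_potential_le:
  assumes y: "y \<in> \<Omega>"
  shows "(\<Sum>j. (Q ^^ j) (\<lambda>z. ball_green (d z / 2) (x - z)) y) + (\<Sum>j. (Q ^^ j) (S (\<lambda>w. k (x - w))) y) \<le> k (x - y)"
proof -
  have "(\<Sum>j. (Q ^^ j) (\<lambda>z. ball_green (d z / 2) (x - z)) y) + (\<Sum>j. (Q ^^ j) (S (\<lambda>w. k (x - w))) y) =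
    (\<Sum>j. (Q ^^ j) (\<lambda>z. ball_green (d z / 2) (x - z) + S (\<lambda>w. k (x - w)) z) y)"
    by (subst suminf_add) (auto simp: Q_pow_add)
  also have "\<dots> \<le> k (x - y)"
    by (rule Q_telescope_limit(1)[where h="\<lambda>w. k (x - w)", OF _ _ k_chain_split y]) measurable
  finally show ?thesis .
qed

text \<open>For x outside \<open>\<Omega>\<close> the ball terms vanish, and each step hands a fixed
  fraction of the potential to the complement: since d z \<le> |x - z|, all points of the corkscrew
  ball lie within (1 + Ck + ck) |x - z| of x, where the kernel is at least a constant multiple of k
  (x - z). The remainder therefore dies out.\<close>

lemma chain_potential_eq:
  assumes y: "y \<in> \<Omega>" and x: "x \<notin> \<Omega>"
  shows "(\<Sum>j. (Q ^^ j) (S (\<lambda>w. k (x - w))) y) = k (x - y)"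
proof (rule Q_telescope_limit(2)[where h="\<lambda>w. k (x - w)" and b="b0 * (1 + Ck + ck) powr (\<alpha> - DIM('a))", OF _ _ _ y])
  let ?M = "1 + Ck + ck"
  have M: "0 < ?M" using ck Ck by simp
  show "0 < b0 * ?M powr (\<alpha> - DIM('a))" using b0_pos M by simp
  show "k (x - z) = S (\<lambda>w. k (x - w)) z + Q (\<lambda>w. k (x - w)) z" if z: "z \<in> \<Omega>" for z
  proof -
    have "ball_green (d z / 2) (x - z) = 0"
      using d_le[OF x, of z] d_pos[OF z] by (intro ball_green_zero) auto
    then show ?thesis using k_chain_split[OF z, of x] by simp
  qed
  show "ennreal (b0 * ?M powr (\<alpha> - DIM('a))) * k (x - z) \<le> S (\<lambda>w. k (x - w)) z" if z: "z \<in> \<Omega>" for z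
  proof -
    have "ennreal b0 * (ennreal (?M powr (\<alpha> - DIM('a))) * k (x - z)) \<le> S (\<lambda>w. k (x - w)) z"
    proof (rule S_lower[OF z])
      fix w assume w: "w \<notin> \<Omega>" "norm (w - z) \<le> (Ck + ck) * d z"
      have "norm (x - w) \<le> norm (x - z) + norm (w - z)"
        using norm_triangle_ineq4[of "x - z" "w - z"] by simp
      also have "\<dots> \<le> norm (x - z) + (Ck + ck) * norm (x - z)"
        using w(2) d_le[OF x, of z] ck Ck by (intro add_left_mono order_trans[OF w(2)] mult_left_mono) auto
      also have "\<dots> = norm (?M *\<^sub>R (x - z))" unfolding norm_scaleR using M by (simp add: algebra_simps)
      finally have "k (?M *\<^sub>R (x - z)) \<le> k (x - w)" by (rule k_antimono)
      then show "ennreal (?M powr (\<alpha> - DIM('a))) * k (x - z) \<le> k (x - w)" by (simp only: k_scale[OF M])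
    qed measurable
    then show ?thesis using b0_pos by (simp add: ennreal_mult' mult.assoc)
  qed
  show "k (x - z) < \<infinity>" if "z \<in> \<Omega>" for z using that x by (intro k_finite) auto
qed measurable

end

section \<open>Capacity and uniqueness of Riesz potentials\<close>

lemma borel_eq_compact: "borel = sigma UNIV (Collect (compact :: 'a::euclidean_space set \<Rightarrow> bool))"
  unfolding borel_eq_closed
proof (rule sigma_eqI)
  show "sigma_sets UNIV (Collect closed) = sigma_sets UNIV (Collect (compact :: 'a set \<Rightarrow> bool))"
  proof (rule sigma_sets_eqI)
    fix C :: "'a set" assume C: "C \<in> Collect closed"
    have "C = (\<Union>n::nat. C \<inter> cball 0 (real n))"
      using real_arch_simple by (auto simp: dist_norm)
    also have "\<dots> \<in> sigma_sets UNIV (Collect compact)"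
      using C by (intro sigma_sets.Union sigma_sets.Basic) (auto intro: closed_Int_compact)
    finally show "C \<in> sigma_sets UNIV (Collect compact)" .
  qed (auto intro: compact_imp_closed)
qed auto

lemma measure_eqI_compact:
  fixes M N :: "'a::euclidean_space measure"
  assumes "sets M = sets borel" "sets N = sets borel"
    and eq: "\<And>C. compact C \<Longrightarrow> emeasure M C = emeasure N C"
    and fin: "\<And>C. compact C \<Longrightarrow> emeasure M C < \<infinity>"
  shows "M = N"
proof (rule measure_eqI_generator_eq[where E="Collect compact" and \<Omega>=UNIV and A="\<lambda>n. cball 0 (real n)"])
  have "sets borel = sigma_sets UNIV (Collect (compact :: 'a set \<Rightarrow> bool))"
    by (subst borel_eq_compact) simp
  then show "sets M = sigma_sets UNIV (Collect compact)" "sets N = sigma_sets UNIV (Collect compact)"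
    using assms by simp_all
  show "(\<Union>n. cball (0::'a) (real n)) = UNIV" using real_arch_simple by (auto simp: dist_norm)
  show "emeasure M (cball 0 (real i)) \<noteq> \<infinity>" for i using fin[of "cball 0 (real i)"] by simp
qed (use eq in \<open>auto simp: Int_stable_def\<close>)

text \<open>Young's inequality with a free weight takes the place of the Cauchy-Schwarz inequality:
  for t = \<epsilon>, a bound \<epsilon>^2 on the integral of g^2 gives estimates linear in
  \<epsilon>, without square roots.\<close>

lemma nn_integral_product_le:
  fixes f g :: "'a \<Rightarrow> ennreal"
  assumes [measurable]: "f \<in> borel_measurable M" "g \<in> borel_measurable M" and t: "0 < t"
  shows "(\<integral>\<^sup>+x. f x * g x \<partial>M) \<le> ennreal t * (\<integral>\<^sup>+x. (f x)\<^sup>2 \<partial>M) + ennreal (1 / t) * (\<integral>\<^sup>+x. (g x)\<^sup>2 \<partial>M)"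
proof -
  have "(\<integral>\<^sup>+x. f x * g x \<partial>M) \<le> (\<integral>\<^sup>+x. ennreal t * (f x)\<^sup>2 + ennreal (1 / t) * (g x)\<^sup>2 \<partial>M)"
  proof (rule nn_integral_mono)
    fix x
    show "f x * g x \<le> ennreal t * (f x)\<^sup>2 + ennreal (1 / t) * (g x)\<^sup>2"
    proof (cases "f x = \<infinity> \<or> g x = \<infinity>")
      case True
      then show ?thesis using t by (auto simp: ennreal_mult_eq_top_iff power2_eq_square)
    next
      case False
      then obtain a b where ab: "f x = ennreal a" "g x = ennreal b" "0 \<le> a" "0 \<le> b"
        by (metis ennreal_cases infinity_ennreal_def)
      have "0 \<le> (t * a - b)\<^sup>2" by simp
      then have "2 * (a * b) * t \<le> t * t * (a * a) + b * b" by (simp add: power2_eq_square algebra_simps)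
      then have "2 * (a * b) \<le> t * a\<^sup>2 + 1 / t * b\<^sup>2" using t by (simp add: field_simps power2_eq_square)
      moreover have "0 \<le> a * b" using ab by simp
      ultimately have "a * b \<le> t * a\<^sup>2 + 1 / t * b\<^sup>2" by linarith
      then show ?thesis using ab t by (simp add: ennreal_mult'[symmetric] ennreal_power ennreal_plus[symmetric] ennreal_leI del: ennreal_plus)
    qed
  qed
  also have "\<dots> = ennreal t * (\<integral>\<^sup>+x. (f x)\<^sup>2 \<partial>M) + ennreal (1 / t) * (\<integral>\<^sup>+x. (g x)\<^sup>2 \<partial>M)"
    by (subst nn_integral_add) (simp_all add: nn_integral_cmult)
  finally show ?thesis .
qed

section \<open>Sets of capacity zero are Lebesgue null\<close>

context riesz_order
begin

abbreviation kh :: "'a \<Rightarrow> ennreal" where "kh \<equiv> riesz_kernel (\<alpha> / 2)"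

lemma measurable_kh [measurable]: "kh \<in> borel_measurable borel"
  unfolding riesz_kernel_def[abs_def] by measurable

lemma kh_near_finite: "(\<integral>\<^sup>+x. kh x * indicator {..1} (norm x) \<partial>lborel) < \<infinity>"
proof -
  have ne: "AE w in lborel. w \<noteq> (0::'a)" by (rule AE_lborel_singleton)
  have "(\<integral>\<^sup>+x. kh x * indicator {..1} (norm x) \<partial>lborel) =
    (\<integral>\<^sup>+x. ennreal (riesz_const DIM('a) (\<alpha> / 2)) * (ennreal (norm (x::'a) powr (\<alpha> / 2 - DIM('a))) * indicator {..1} (norm x)) \<partial>lborel)"
    (is "(\<integral>\<^sup>+w. ?l w \<partial>lborel) = (\<integral>\<^sup>+w. ?r w \<partial>lborel)")
  proof (rule nn_integral_cong_AE)
    show "AE w in lborel. ?l w = ?r w" using ne by eventually_elim (auto simp: riesz_kernel_def ennreal_mult'' mult.assoc)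
  qed
  also have "\<dots> = ennreal (riesz_const DIM('a) (\<alpha> / 2)) * (shell_integral TYPE('a) * ennreal (1 powr (\<alpha> / 2 - DIM('a) + DIM('a)) / (\<alpha> / 2 - DIM('a) + DIM('a))))"
    using alpha by (subst nn_integral_cmult, measurable, subst nn_integral_norm_powr_near) auto
  also have "\<dots> < \<infinity>"
    using shell_integral_finite[where 'a='a] by (simp add: ennreal_mult_less_top)
  finally show ?thesis .
qed

lemma kh_far_L2: "(\<integral>\<^sup>+x. (kh x * indicator {1<..} (norm x))\<^sup>2 \<partial>lborel) < \<infinity>"
proof -
  let ?c = "riesz_const DIM('a) (\<alpha> / 2)"
  have "(\<integral>\<^sup>+x. (kh x * indicator {1<..} (norm x))\<^sup>2 \<partial>lborel) \<le>
    (\<integral>\<^sup>+x. ennreal (?c\<^sup>2) * (ennreal (norm (x::'a) powr (\<alpha> - 2 * DIM('a))) * indicator {1..} (norm x)) \<partial>lborel)"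
  proof (rule nn_integral_mono)
    fix x :: 'a
    show "(kh x * indicator {1<..} (norm x))\<^sup>2 \<le> ennreal (?c\<^sup>2) * (ennreal (norm x powr (\<alpha> - 2 * DIM('a))) * indicator {1..} (norm x))"
    proof (cases "1 < norm x")
      case True
      have "norm x powr (\<alpha> / 2 - DIM('a)) * norm x powr (\<alpha> / 2 - DIM('a)) = norm x powr (\<alpha> - 2 * DIM('a))"
        unfolding powr_add[symmetric] by (simp add: algebra_simps)
      then have eq: "(?c * norm x powr (\<alpha> / 2 - DIM('a)))\<^sup>2 = ?c\<^sup>2 * norm x powr (\<alpha> - 2 * DIM('a))"
        by (simp add: power2_eq_square ac_simps)
      have sq: "(ennreal t)\<^sup>2 \<le> ennreal (t\<^sup>2)" for t :: real
        by (cases "0 \<le> t") (auto simp: ennreal_power ennreal_neg)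
      have kx: "kh x = ennreal (?c * norm x powr (\<alpha> / 2 - DIM('a)))" using True by (auto simp: riesz_kernel_def)
      have "(kh x)\<^sup>2 \<le> ennreal (?c\<^sup>2 * norm x powr (\<alpha> - 2 * DIM('a)))"
        unfolding kx eq[symmetric] by (rule sq)
      then show ?thesis using True by (simp add: ennreal_mult'')
    qed simp
  qed
  also have "\<dots> = ennreal (?c\<^sup>2) * (shell_integral TYPE('a) * ennreal (1 powr (\<alpha> - 2 * DIM('a) + DIM('a)) / (- (\<alpha> - 2 * DIM('a)) - DIM('a))))"
    using alpha_less_dim by (subst nn_integral_cmult, measurable, subst nn_integral_norm_powr_far) auto
  also have "\<dots> < \<infinity>"
    using shell_integral_finite[where 'a='a] by (simp add: ennreal_mult_less_top)
  finally show ?thesis .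
qed

text \<open>The kernel of order \<alpha> / 2 is cut at distance 1. The near part is integrable, so
  Fubini reduces it to the integral of f over a slightly larger ball; the far part is square
  integrable because \<alpha> < n, so its convolution with f is bounded at every point. Hence small
  norm in L2 gives small mean over a ball.\<close>

lemma half_potential_ball_bound:
  assumes R: "0 \<le> R"
  shows "\<exists>C::real. \<forall>\<epsilon> f. 0 < \<epsilon> \<longrightarrow> f \<in> borel_measurable borel \<longrightarrow> (\<integral>\<^sup>+x. (f x)\<^sup>2 \<partial>lborel) \<le> ennreal (\<epsilon>\<^sup>2) \<longrightarrow>
     (\<integral>\<^sup>+x. indicator (cball (0::'a) R) x * (\<integral>\<^sup>+y. kh (x - y) * f y \<partial>lborel) \<partial>lborel) \<le> ennreal (C * \<epsilon>)"
proof -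
  define H where "H = (\<integral>\<^sup>+x. kh x * indicator {..1} (norm x) \<partial>lborel)"
  define L where "L = (\<integral>\<^sup>+x. (kh x * indicator {1<..} (norm x))\<^sup>2 \<partial>lborel)"
  define B where "B = cball (0::'a) R"
  define B' where "B' = cball (0::'a) (R + 1)"
  have [measurable]: "B \<in> sets borel" "B' \<in> sets borel" by (auto simp: B_def B'_def)
  have "emeasure lborel B < \<infinity>" "emeasure lborel B' < \<infinity>"
    unfolding B_def B'_def using emeasure_lborel_cball_finite by (auto simp: less_top)
  then obtain b b' where b: "emeasure lborel B = ennreal b" "0 \<le> b" "emeasure lborel B' = ennreal b'" "0 \<le> b'"
    by (metis ennreal_cases infinity_ennreal_def less_irrefl)
  have "H < \<infinity>" "L < \<infinity>" using kh_near_finite kh_far_L2 by (simp_all add: H_def L_def)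
  then obtain h l where hl: "H = ennreal h" "0 \<le> h" "L = ennreal l" "0 \<le> l"
    by (metis ennreal_cases infinity_ennreal_def less_irrefl)
  define C where "C = h * (b' + 1) + b * (l + 1)"
  show ?thesis
  proof (intro exI[of _ C] allI impI)
    fix \<epsilon> :: real and f :: "'a \<Rightarrow> ennreal"
    assume \<epsilon>: "0 < \<epsilon>" and [measurable]: "f \<in> borel_measurable borel" and f2: "(\<integral>\<^sup>+x. (f x)\<^sup>2 \<partial>lborel) \<le> ennreal (\<epsilon>\<^sup>2)"
    define kn where "kn x = kh x * indicator {..1} (norm x)" for x
    define kf where "kf x = kh x * indicator {1<..} (norm x)" for x
    have [measurable]: "kn \<in> borel_measurable borel" "kf \<in> borel_measurable borel"
      unfolding kn_def[abs_def] kf_def[abs_def] by measurable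
    have kh_split: "kh x = kn x + kf x" for x by (auto simp: kn_def kf_def indicator_def)
    have e2: "ennreal (1 / \<epsilon>) * (\<integral>\<^sup>+x. (f x)\<^sup>2 \<partial>lborel) \<le> ennreal \<epsilon>"
    proof -
      have "ennreal (1 / \<epsilon>) * (\<integral>\<^sup>+x. (f x)\<^sup>2 \<partial>lborel) \<le> ennreal (1 / \<epsilon>) * ennreal (\<epsilon>\<^sup>2)"
        using f2 by (intro mult_left_mono) auto
      also have "\<dots> = ennreal \<epsilon>" using \<epsilon> by (simp add: ennreal_mult'[symmetric] power2_eq_square)
      finally show ?thesis .
    qed
    have far: "(\<integral>\<^sup>+y. kf (x - y) * f y \<partial>lborel) \<le> ennreal (\<epsilon> * (l + 1))" for x
    proof -
      have "(\<integral>\<^sup>+y. kf (x - y) * f y \<partial>lborel) \<le> ennreal \<epsilon> * (\<integral>\<^sup>+y. (kf (x - y))\<^sup>2 \<partial>lborel) + ennreal (1 / \<epsilon>) * (\<integral>\<^sup>+x. (f x)\<^sup>2 \<partial>lborel)"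
        using \<epsilon> by (intro nn_integral_product_le) auto
      also have "(\<integral>\<^sup>+y. (kf (x - y))\<^sup>2 \<partial>lborel) = (\<integral>\<^sup>+y. (kf y)\<^sup>2 \<partial>lborel)"
        by (rule nn_integral_lborel_translate(4)) measurable
      also have "\<dots> = ennreal l" using hl by (simp add: L_def kf_def)
      also have "ennreal \<epsilon> * ennreal l + ennreal (1 / \<epsilon>) * (\<integral>\<^sup>+x. (f x)\<^sup>2 \<partial>lborel) \<le> ennreal \<epsilon> * ennreal l + ennreal \<epsilon>"
        by (intro add_left_mono e2)
      also have "\<dots> = ennreal (\<epsilon> * (l + 1))"
        using \<epsilon> hl by (simp add: ennreal_mult'[symmetric] ennreal_plus[symmetric] algebra_simps del: ennreal_plus)
      finally show ?thesis .
    qed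
    have near: "(\<integral>\<^sup>+x. indicator B x * (\<integral>\<^sup>+y. kn (x - y) * f y \<partial>lborel) \<partial>lborel) \<le> ennreal (h * ((b' + 1) * \<epsilon>))"
    proof -
      have "(\<integral>\<^sup>+x. indicator B x * (\<integral>\<^sup>+y. kn (x - y) * f y \<partial>lborel) \<partial>lborel) =
        (\<integral>\<^sup>+x. \<integral>\<^sup>+y. indicator B x * (kn (x - y) * f y) \<partial>lborel \<partial>lborel)"
        by (intro nn_integral_cong, subst nn_integral_cmult) auto
      also have "\<dots> = (\<integral>\<^sup>+y. \<integral>\<^sup>+x. indicator B x * (kn (x - y) * f y) \<partial>lborel \<partial>lborel)"
        by (rule lborel_pair.Fubini') measurable
      also have "\<dots> \<le> (\<integral>\<^sup>+y. H * (indicator B' y * f y) \<partial>lborel)"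
      proof (rule nn_integral_mono)
        fix y :: 'a
        have "(\<integral>\<^sup>+x. indicator B x * (kn (x - y) * f y) \<partial>lborel) \<le> (\<integral>\<^sup>+x. kn (x - y) * (indicator B' y * f y) \<partial>lborel)"
        proof (rule nn_integral_mono)
          fix x :: 'a
          show "indicator B x * (kn (x - y) * f y) \<le> kn (x - y) * (indicator B' y * f y)"
          proof (cases "x \<in> B \<and> norm (x - y) \<le> 1")
            case True
            then have "y \<in> B'" using norm_triangle_ineq2[of y x] by (auto simp: B_def B'_def norm_minus_commute)
            then show ?thesis using True by simp
          qed (auto simp: kn_def indicator_def)
        qed
        also have "\<dots> = (\<integral>\<^sup>+x. kn (x - y) \<partial>lborel) * (indicator B' y * f y)"
          by (rule nn_integral_multc) measurable
        also have "(\<integral>\<^sup>+x. kn (x - y) \<partial>lborel) = H"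
          unfolding H_def kn_def
          by (rule nn_integral_lborel_translate(3)[of "\<lambda>x. kh x * indicator {..1} (norm x)"]) measurable
        finally show "(\<integral>\<^sup>+x. indicator B x * (kn (x - y) * f y) \<partial>lborel) \<le> H * (indicator B' y * f y)" .
      qed
      also have "\<dots> = H * (\<integral>\<^sup>+y. indicator B' y * f y \<partial>lborel)"
        by (rule nn_integral_cmult) measurable
      also have "\<dots> \<le> H * (ennreal \<epsilon> * (\<integral>\<^sup>+y. (indicator B' y)\<^sup>2 \<partial>lborel) + ennreal (1 / \<epsilon>) * (\<integral>\<^sup>+x. (f x)\<^sup>2 \<partial>lborel))"
        using \<epsilon> by (intro mult_left_mono nn_integral_product_le) auto
      also have "(\<integral>\<^sup>+y. (indicator B' y)\<^sup>2 \<partial>lborel) = (\<integral>\<^sup>+y. indicator B' y \<partial>lborel)"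
        by (intro nn_integral_cong) (auto simp: indicator_def)
      also have "\<dots> = ennreal b'" using b by simp
      also have "H * (ennreal \<epsilon> * ennreal b' + ennreal (1 / \<epsilon>) * (\<integral>\<^sup>+x. (f x)\<^sup>2 \<partial>lborel)) \<le> H * (ennreal \<epsilon> * ennreal b' + ennreal \<epsilon>)"
        by (intro mult_left_mono add_left_mono e2) auto
      also have "\<dots> = ennreal (h * ((b' + 1) * \<epsilon>))"
        using hl b \<epsilon> by (simp add: ennreal_mult'[symmetric] ennreal_plus[symmetric] algebra_simps del: ennreal_plus)
      finally show ?thesis .
    qed
    have "(\<integral>\<^sup>+x. indicator (cball (0::'a) R) x * (\<integral>\<^sup>+y. kh (x - y) * f y \<partial>lborel) \<partial>lborel) =
      (\<integral>\<^sup>+x. indicator B x * (\<integral>\<^sup>+y. kn (x - y) * f y \<partial>lborel) + indicator B x * (\<integral>\<^sup>+y. kf (x - y) * f y \<partial>lborel) \<partial>lborel)"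
    proof (rule nn_integral_cong)
      fix x :: 'a
      have "(\<integral>\<^sup>+y. kh (x - y) * f y \<partial>lborel) = (\<integral>\<^sup>+y. kn (x - y) * f y + kf (x - y) * f y \<partial>lborel)"
        unfolding kh_split by (simp only: distrib_right)
      also have "\<dots> = (\<integral>\<^sup>+y. kn (x - y) * f y \<partial>lborel) + (\<integral>\<^sup>+y. kf (x - y) * f y \<partial>lborel)"
        by (rule nn_integral_add) measurable
      finally show "indicator (cball (0::'a) R) x * (\<integral>\<^sup>+y. kh (x - y) * f y \<partial>lborel) =
        indicator B x * (\<integral>\<^sup>+y. kn (x - y) * f y \<partial>lborel) + indicator B x * (\<integral>\<^sup>+y. kf (x - y) * f y \<partial>lborel)"
        by (simp only: B_def distrib_left)
    qed
    also have "\<dots> = (\<integral>\<^sup>+x. indicator B x * (\<integral>\<^sup>+y. kn (x - y) * f y \<partial>lborel) \<partial>lborel) +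
      (\<integral>\<^sup>+x. indicator B x * (\<integral>\<^sup>+y. kf (x - y) * f y \<partial>lborel) \<partial>lborel)"
      by (rule nn_integral_add) measurable
    also have "\<dots> \<le> ennreal (h * ((b' + 1) * \<epsilon>)) + (\<integral>\<^sup>+x. indicator B x * ennreal (\<epsilon> * (l + 1)) \<partial>lborel)"
      by (intro add_mono near nn_integral_mono mult_left_mono far) auto
    also have "(\<integral>\<^sup>+x. indicator B x * ennreal (\<epsilon> * (l + 1)) \<partial>lborel) = ennreal (b * (\<epsilon> * (l + 1)))"
      using b \<epsilon> hl by (subst nn_integral_multc) (auto simp: ennreal_mult')
    also have "ennreal (h * ((b' + 1) * \<epsilon>)) + ennreal (b * (\<epsilon> * (l + 1))) = ennreal (C * \<epsilon>)"
      using b \<epsilon> hl unfolding C_def by (subst ennreal_plus[symmetric]) (auto simp: algebra_simps)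
    finally show "(\<integral>\<^sup>+x. indicator (cball (0::'a) R) x * (\<integral>\<^sup>+y. kh (x - y) * f y \<partial>lborel) \<partial>lborel) \<le> ennreal (C * \<epsilon>)" .
  qed
qed

text \<open>Admissible functions of norm at most 1 / (m + 1) have potentials at least 1 on E. The
  set Z where all these potentials are at least 1 is Borel even if E is not, and by
  \<open>half_potential_ball_bound\<close> it meets each ball in measure at most C / (m + 1) for
  every m.\<close>

lemma capacity_zero_imp_null:
  assumes "riesz_capacity \<alpha> (E :: 'a set) = 0"
  shows "\<exists>Z\<in>null_sets lborel. E \<subseteq> Z"
proof -
  have "\<exists>f::'a \<Rightarrow> real. f \<in> borel_measurable borel \<and> (\<forall>x. 0 \<le> f x) \<and> (\<integral>\<^sup>+x. ennreal ((f x)\<^sup>2) \<partial>lborel) \<le> ennreal (\<epsilon>\<^sup>2) \<and>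
     (\<forall>x\<in>E. 1 \<le> (\<integral>\<^sup>+y. kh (x - y) * ennreal (f y) \<partial>lborel))" if \<epsilon>: "0 < \<epsilon>" for \<epsilon> :: real
  proof -
    have "riesz_capacity \<alpha> E < ennreal (\<epsilon>\<^sup>2)" unfolding assms using \<epsilon> by simp
    then obtain f :: "'a \<Rightarrow> real" where f: "(\<integral>\<^sup>+x. ennreal ((f x)\<^sup>2) \<partial>lborel) < ennreal (\<epsilon>\<^sup>2)"
       "f \<in> borel_measurable lborel" "\<forall>x. 0 \<le> f x"
       "\<forall>x. indicator E x \<le> riesz_potential (\<alpha> / 2) (density lborel (\<lambda>y. ennreal (f y))) x"
      unfolding riesz_capacity_def Inf_less_iff by auto
    have [measurable]: "f \<in> borel_measurable borel" using f(2) by simp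
    have "1 \<le> (\<integral>\<^sup>+y. kh (x - y) * ennreal (f y) \<partial>lborel)" if "x \<in> E" for x
    proof -
      have "1 \<le> riesz_potential (\<alpha> / 2) (density lborel (\<lambda>y. ennreal (f y))) x"
        using f(4) that by (metis indicator_simps(1))
      also have "\<dots> = (\<integral>\<^sup>+y. kh (x - y) * ennreal (f y) \<partial>lborel)"
        unfolding riesz_potential_def by (subst nn_integral_density) (auto simp: mult.commute)
      finally show ?thesis .
    qed
    moreover have "f \<in> borel_measurable borel" "(\<integral>\<^sup>+x. ennreal ((f x)\<^sup>2) \<partial>lborel) \<le> ennreal (\<epsilon>\<^sup>2)"
      using f(1) by auto
    ultimately show ?thesis using f(3) by blast
  qed
  then have "\<exists>f::'a \<Rightarrow> real. f \<in> borel_measurable borel \<and> (\<forall>x. 0 \<le> f x) \<and> (\<integral>\<^sup>+x. ennreal ((f x)\<^sup>2) \<partial>lborel) \<le> ennreal ((1 / real (Suc m))\<^sup>2) \<and>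
     (\<forall>x\<in>E. 1 \<le> (\<integral>\<^sup>+y. kh (x - y) * ennreal (f y) \<partial>lborel))" for m :: nat
    by simp
  then obtain f :: "nat \<Rightarrow> 'a \<Rightarrow> real" where F: "\<And>m. f m \<in> borel_measurable borel \<and> (\<forall>x. 0 \<le> f m x) \<and>
     (\<integral>\<^sup>+x. ennreal ((f m x)\<^sup>2) \<partial>lborel) \<le> ennreal ((1 / real (Suc m))\<^sup>2) \<and>
     (\<forall>x\<in>E. 1 \<le> (\<integral>\<^sup>+y. kh (x - y) * ennreal (f m y) \<partial>lborel))" by moura
  have f: "f m \<in> borel_measurable borel" "0 \<le> f m x"
    "(\<integral>\<^sup>+x. ennreal ((f m x)\<^sup>2) \<partial>lborel) \<le> ennreal ((1 / real (Suc m))\<^sup>2)"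
    "x \<in> E \<Longrightarrow> 1 \<le> (\<integral>\<^sup>+y. kh (x - y) * ennreal (f m y) \<partial>lborel)" for m x
    using F[of m] by blast+
  note [measurable] = f(1)
  define P where "P m x = (\<integral>\<^sup>+y. kh (x - y) * ennreal (f m y) \<partial>lborel)" for m x
  have [measurable]: "P m \<in> borel_measurable borel" for m unfolding P_def[abs_def] by measurable
  define Z where "Z = {x. \<forall>m. 1 \<le> P m x}"
  have [measurable]: "Z \<in> sets borel" unfolding Z_def by measurable
  have zero: "emeasure lborel (Z \<inter> cball 0 (real R)) = 0" for R
  proof -
    obtain C where C: "\<And>\<epsilon> g. 0 < \<epsilon> \<Longrightarrow> g \<in> borel_measurable borel \<Longrightarrow> (\<integral>\<^sup>+x. (g x)\<^sup>2 \<partial>lborel) \<le> ennreal (\<epsilon>\<^sup>2) \<Longrightarrow>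
     (\<integral>\<^sup>+x. indicator (cball (0::'a) (real R)) x * (\<integral>\<^sup>+y. kh (x - y) * g y \<partial>lborel) \<partial>lborel) \<le> ennreal (C * \<epsilon>)"
      using half_potential_ball_bound[of "real R"] by auto
    have bound: "emeasure lborel (Z \<inter> cball 0 (real R)) \<le> ennreal (C * (1 / real (Suc m)))" for m
    proof -
      have "emeasure lborel (Z \<inter> cball 0 (real R)) = (\<integral>\<^sup>+x. indicator (Z \<inter> cball 0 (real R)) x \<partial>lborel)" by simp
      also have "\<dots> \<le> (\<integral>\<^sup>+x. indicator (cball (0::'a) (real R)) x * P m x \<partial>lborel)"
        by (intro nn_integral_mono) (auto simp: Z_def indicator_def)
      also have "\<dots> \<le> ennreal (C * (1 / real (Suc m)))"
        unfolding P_def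
      proof (rule C)
        show "(\<integral>\<^sup>+x. (ennreal (f m x))\<^sup>2 \<partial>lborel) \<le> ennreal ((1 / real (Suc m))\<^sup>2)"
          using f(3)[of m] by (simp only: ennreal_power f(2))
      qed simp_all
      finally show ?thesis .
    qed
    have "(\<lambda>m. ennreal (C * (1 / real (Suc m)))) \<longlonglongrightarrow> ennreal (C * 0)"
      by (intro tendsto_intros LIMSEQ_Suc[OF lim_1_over_n])
    then have "emeasure lborel (Z \<inter> cball 0 (real R)) \<le> 0"
      using bound by (intro tendsto_lowerbound[where f="\<lambda>m. ennreal (C * (1 / real (Suc m)))"]) auto
    then show ?thesis by simp
  qed
  have "Z = (\<Union>R. Z \<inter> cball 0 (real R))" using real_arch_simple by (auto simp: dist_norm)
  also have "\<dots> \<in> null_sets lborel"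
    by (intro null_sets_UN null_setsI zero) auto
  finally show ?thesis using f(4) by (intro bexI[of _ Z]) (auto simp: Z_def P_def)
qed

end

section \<open>A measure is determined by its Riesz potential\<close>

lemma sigma_finite_measure_if_compact_finite:
  fixes M :: "'a::euclidean_space measure"
  assumes sets: "sets M = sets borel" and fin: "\<And>C. compact C \<Longrightarrow> emeasure M C < \<infinity>"
  shows "sigma_finite_measure M"
proof
  have "space M = UNIV" using sets_eq_imp_space_eq[OF sets] by simp
  moreover have "(\<Union>n. cball (0::'a) (real n)) = UNIV" using real_arch_simple by (auto simp: dist_norm)
  moreover have "emeasure M (cball 0 (real n)) \<noteq> \<infinity>" for n using fin[of "cball 0 (real n)"] by simp
  ultimately show "\<exists>A. countable A \<and> A \<subseteq> sets M \<and> \<Union> A = space M \<and> (\<forall>a\<in>A. emeasure M a \<noteq> \<infinity>)"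
    using sets by (intro exI[of _ "range (\<lambda>n. cball 0 (real n))"]) auto
qed

context riesz_order
begin

lemma riesz_potential_split:
  fixes \<mu> :: "'a measure"
  assumes sets: "sets \<mu> = sets borel" and sf: "sigma_finite_measure \<mu>" and r: "0 < r"
  shows "riesz_potential \<alpha> \<mu> x = (\<integral>\<^sup>+z. ball_green r (x - z) \<partial>\<mu>) + (\<integral>\<^sup>+w. poisson r (x - w) * riesz_potential \<alpha> \<mu> w \<partial>lborel)"
proof -
  interpret sigma_finite_measure \<mu> by fact
  interpret pair_sigma_finite \<mu> "lborel :: 'a measure" ..
  note sets[measurable_cong]
  have "riesz_potential \<alpha> \<mu> x = (\<integral>\<^sup>+z. ball_green r (x - z) + poisson_pot r (x - z) \<partial>\<mu>)"
    unfolding riesz_potential_def using k_split[OF r] by simp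
  also have "\<dots> = (\<integral>\<^sup>+z. ball_green r (x - z) \<partial>\<mu>) + (\<integral>\<^sup>+z. poisson_pot r (x - z) \<partial>\<mu>)"
    by (rule nn_integral_add) measurable
  also have "(\<integral>\<^sup>+z. poisson_pot r (x - z) \<partial>\<mu>) = (\<integral>\<^sup>+z. \<integral>\<^sup>+w. poisson r (x - w) * k (w - z) \<partial>lborel \<partial>\<mu>)"
  proof (rule nn_integral_cong)
    fix z :: 'a
    have "poisson_pot r (x - z) = (\<integral>\<^sup>+w. k (x - z - (x - w)) * poisson r (x - w) \<partial>lborel)"
      unfolding poisson_pot_def by (rule nn_integral_lborel_translate(4)[symmetric]) measurable
    then show "poisson_pot r (x - z) = (\<integral>\<^sup>+w. poisson r (x - w) * k (w - z) \<partial>lborel)"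
      by (simp add: algebra_simps)
  qed
  also have "\<dots> = (\<integral>\<^sup>+w. \<integral>\<^sup>+z. poisson r (x - w) * k (w - z) \<partial>\<mu> \<partial>lborel)"
    by (rule Fubini'[symmetric]) measurable
  also have "\<dots> = (\<integral>\<^sup>+w. poisson r (x - w) * riesz_potential \<alpha> \<mu> w \<partial>lborel)"
    unfolding riesz_potential_def by (intro nn_integral_cong nn_integral_cmult) measurable
  finally show ?thesis .
qed

text \<open>Almost everywhere equal potentials have equal Poisson averages at every point, so these
  cancel from \<open>riesz_potential_split\<close> wherever the potential is finite.\<close>

lemma ball_green_convolution_eq:
  fixes \<mu> \<nu> :: "'a measure"
  assumes "sets \<mu> = sets borel" "sigma_finite_measure \<mu>" "sets \<nu> = sets borel" "sigma_finite_measure \<nu>"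
    and eq: "AE x in lborel. riesz_potential \<alpha> \<mu> x = riesz_potential \<alpha> \<nu> x \<and> riesz_potential \<alpha> \<mu> x < \<infinity>"
    and r: "0 < r"
  shows "AE x in lborel. (\<integral>\<^sup>+z. ball_green r (x - z) \<partial>\<mu>) = (\<integral>\<^sup>+z. ball_green r (x - z) \<partial>\<nu>)"
  using eq
proof eventually_elim
  case (elim x)
  have "(\<integral>\<^sup>+w. poisson r (x - w) * riesz_potential \<alpha> \<mu> w \<partial>lborel) = (\<integral>\<^sup>+w. poisson r (x - w) * riesz_potential \<alpha> \<nu> w \<partial>lborel)"
    (is "?a = ?b")
  proof (rule nn_integral_cong_AE)
    show "AE w in lborel. poisson r (x - w) * riesz_potential \<alpha> \<mu> w = poisson r (x - w) * riesz_potential \<alpha> \<nu> w"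
      using eq by eventually_elim simp
  qed
  moreover have "riesz_potential \<alpha> \<mu> x = (\<integral>\<^sup>+z. ball_green r (x - z) \<partial>\<mu>) + ?a" "riesz_potential \<alpha> \<nu> x = (\<integral>\<^sup>+z. ball_green r (x - z) \<partial>\<nu>) + ?b"
    by (rule riesz_potential_split; fact)+
  moreover have "?a \<noteq> \<infinity>" using elim calculation(2) by auto
  ultimately show ?case using elim by simp
qed

text \<open>Divided by its mass, \<open>ball_green r\<close> is an approximate identity supported in
  the ball of radius r. The two measures have the same convolution with it almost everywhere, so
  they agree on \<phi> convolved with it, which differs from the corresponding multiple of \<phi> by
  a relative error L r on a fixed bounded set.\<close>

lemma riesz_potential_test_le:
  fixes \<mu> \<nu> :: "'a measure" and \<phi> :: "'a \<Rightarrow> real"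
  assumes sets: "sets \<mu> = sets borel" "sets \<nu> = sets borel"
    and fin: "\<And>C. compact C \<Longrightarrow> emeasure \<mu> C < \<infinity>" "\<And>C. compact C \<Longrightarrow> emeasure \<nu> C < \<infinity>"
    and eq: "AE x in lborel. riesz_potential \<alpha> \<mu> x = riesz_potential \<alpha> \<nu> x \<and> riesz_potential \<alpha> \<mu> x < \<infinity>"
    and \<phi>: "\<phi> \<in> borel_measurable borel" "\<And>x. 0 \<le> \<phi> x" "\<And>x y. \<phi> x \<le> \<phi> y + L * norm (x - y)" "\<And>x. R < norm x \<Longrightarrow> \<phi> x = 0" and L: "0 \<le> L"
  shows "(\<integral>\<^sup>+x. \<phi> x \<partial>\<mu>) \<le> (\<integral>\<^sup>+x. \<phi> x \<partial>\<nu>)"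
proof -
  note [measurable] = \<phi>(1)
  note sets[measurable_cong]
  have sf: "sigma_finite_measure \<mu>" "sigma_finite_measure \<nu>"
    using sets fin by (auto intro: sigma_finite_measure_if_compact_finite)
  \<comment> \<open>The margin 1 accommodates the smearing by radii r \<le> 1.\<close>
  define K where "K = cball (0::'a) (R + 1)"
  have [measurable]: "K \<in> sets borel" by (simp add: K_def)
  have "emeasure \<mu> K < \<infinity>" "emeasure \<nu> K < \<infinity>" using fin by (auto simp: K_def)
  then obtain a b where ab: "emeasure \<mu> K = ennreal a" "0 \<le> a" "emeasure \<nu> K = ennreal b" "0 \<le> b"
    by (metis ennreal_cases infinity_ennreal_def less_irrefl)
  have main: "(\<integral>\<^sup>+x. \<phi> x \<partial>\<mu>) \<le> (\<integral>\<^sup>+x. \<phi> x \<partial>\<nu>) + ennreal (L * r * (a + b))" if r: "0 < r" "r \<le> 1" for r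
  proof -
    define c where "c = r powr \<alpha> * gam"
    have c: "0 < c" unfolding c_def using r gam_pos by simp
    define \<Phi> where "\<Phi> z = (\<integral>\<^sup>+x. ennreal (\<phi> x) * ball_green r (x - z) \<partial>lborel)" for z
    have [measurable]: "\<Phi> \<in> borel_measurable borel" unfolding \<Phi>_def[abs_def] by measurable
    have bgc: "(\<integral>\<^sup>+x. ball_green r (x - z) \<partial>lborel) = ennreal c" for z
      using nn_integral_ball_green[OF r(1)] by (subst nn_integral_lborel_translate(3)) (auto simp: c_def)
    have upper: "\<Phi> z \<le> ennreal c * ennreal (\<phi> z) + ennreal (c * (L * r)) * indicator K z" for z
    proof (cases "z \<in> K")
      case True
      have "\<Phi> z \<le> (\<integral>\<^sup>+x. ennreal (\<phi> z + L * r) * ball_green r (x - z) \<partial>lborel)"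
        unfolding \<Phi>_def
      proof (rule nn_integral_mono)
        fix x :: 'a
        show "ennreal (\<phi> x) * ball_green r (x - z) \<le> ennreal (\<phi> z + L * r) * ball_green r (x - z)"
        proof (cases "norm (x - z) \<le> r")
          case True
          then have "L * norm (x - z) \<le> L * r" using L by (intro mult_left_mono)
          then have "\<phi> x \<le> \<phi> z + L * r" using \<phi>(3)[of x z] by simp
          then show ?thesis by (intro mult_right_mono ennreal_leI) auto
        next
          case False
          then show ?thesis using ball_green_zero[OF r(1), of "x - z"] by simp
        qed
      qed
      also have "\<dots> = ennreal (\<phi> z + L * r) * ennreal c" by (simp add: nn_integral_cmult bgc)
      also have "\<dots> = ennreal c * ennreal (\<phi> z) + ennreal (c * (L * r)) * indicator K z"
        using True c L r \<phi>(2)[of z] by (simp add: ennreal_mult'[symmetric] ennreal_plus[symmetric] algebra_simps del: ennreal_plus)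
      finally show ?thesis .
    next
      case False
      have "\<Phi> z = (\<integral>\<^sup>+(x::'a). 0 \<partial>lborel)" unfolding \<Phi>_def
      proof (rule nn_integral_cong)
        fix x :: 'a
        show "ennreal (\<phi> x) * ball_green r (x - z) = 0"
        proof (cases "norm (x - z) \<le> r")
          case True
          then have "R < norm x" using False r norm_triangle_ineq2[of z x] by (auto simp: K_def norm_minus_commute)
          then show ?thesis using \<phi>(4) by simp
        next
          case False
          then show ?thesis using ball_green_zero[OF r(1), of "x - z"] by simp
        qed
      qed
      then show ?thesis by simp
    qed
    have lower: "ennreal c * ennreal (\<phi> z) \<le> \<Phi> z + ennreal (c * (L * r)) * indicator K z" for z
    proof (cases "z \<in> K")
      case True
      have "ennreal c * ennreal (\<phi> z) = (\<integral>\<^sup>+x. ennreal (\<phi> z) * ball_green r (x - z) \<partial>lborel)"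
        by (simp add: nn_integral_cmult bgc mult.commute)
      also have "\<dots> \<le> (\<integral>\<^sup>+x. ennreal (\<phi> x) * ball_green r (x - z) + ennreal (L * r) * ball_green r (x - z) \<partial>lborel)"
      proof (rule nn_integral_mono)
        fix x :: 'a
        show "ennreal (\<phi> z) * ball_green r (x - z) \<le> ennreal (\<phi> x) * ball_green r (x - z) + ennreal (L * r) * ball_green r (x - z)"
        proof (cases "norm (x - z) \<le> r")
          case True
          then have "L * norm (x - z) \<le> L * r" using L by (intro mult_left_mono)
          then have "\<phi> z \<le> \<phi> x + L * r" using \<phi>(3)[of z x] by (simp add: norm_minus_commute)
          then have "ennreal (\<phi> z) \<le> ennreal (\<phi> x + L * r)" by (rule ennreal_leI)
          also have "\<dots> = ennreal (\<phi> x) + ennreal (L * r)"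
            using \<phi>(2) L r by (intro ennreal_plus) auto
          finally have "ennreal (\<phi> z) \<le> ennreal (\<phi> x) + ennreal (L * r)" .
          then show ?thesis unfolding distrib_right[symmetric] by (intro mult_right_mono) auto
        next
          case False
          then show ?thesis using ball_green_zero[OF r(1), of "x - z"] by simp
        qed
      qed
      also have "\<dots> = \<Phi> z + ennreal (L * r) * ennreal c"
        unfolding \<Phi>_def by (subst nn_integral_add) (simp_all add: nn_integral_cmult bgc)
      also have "\<dots> = \<Phi> z + ennreal (c * (L * r)) * indicator K z"
        using True c L r by (simp add: ennreal_mult'[symmetric] ac_simps)
      finally show ?thesis .
    next
      case False
      then show ?thesis using \<phi>(4)[of z] by (auto simp: K_def)
    qed
    have \<Phi>int: "(\<integral>\<^sup>+z. \<Phi> z \<partial>M) = (\<integral>\<^sup>+x. ennreal (\<phi> x) * (\<integral>\<^sup>+z. ball_green r (x - z) \<partial>M) \<partial>lborel)"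
      if sM: "sets M = sets borel" and "sigma_finite_measure M" for M :: "'a measure"
    proof -
      interpret sigma_finite_measure M by fact
      interpret pair_sigma_finite M "lborel :: 'a measure" ..
      note sM[measurable_cong]
      have "(\<integral>\<^sup>+z. \<Phi> z \<partial>M) = (\<integral>\<^sup>+x. \<integral>\<^sup>+z. ennreal (\<phi> x) * ball_green r (x - z) \<partial>M \<partial>lborel)"
        unfolding \<Phi>_def by (rule Fubini'[symmetric]) measurable
      also have "\<dots> = (\<integral>\<^sup>+x. ennreal (\<phi> x) * (\<integral>\<^sup>+z. ball_green r (x - z) \<partial>M) \<partial>lborel)"
        by (intro nn_integral_cong nn_integral_cmult) measurable
      finally show ?thesis .
    qed
    have \<Phi>eq: "(\<integral>\<^sup>+z. \<Phi> z \<partial>\<mu>) = (\<integral>\<^sup>+z. \<Phi> z \<partial>\<nu>)"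
      unfolding \<Phi>int[OF sets(1) sf(1)] \<Phi>int[OF sets(2) sf(2)]
    proof (rule nn_integral_cong_AE)
      show "AE x in lborel. ennreal (\<phi> x) * (\<integral>\<^sup>+z. ball_green r (x - z) \<partial>\<mu>) = ennreal (\<phi> x) * (\<integral>\<^sup>+z. ball_green r (x - z) \<partial>\<nu>)"
        using ball_green_convolution_eq[OF sets(1) sf(1) sets(2) sf(2) eq r(1)] by eventually_elim simp
    qed
    have "ennreal c * (\<integral>\<^sup>+x. \<phi> x \<partial>\<mu>) = (\<integral>\<^sup>+z. ennreal c * ennreal (\<phi> z) \<partial>\<mu>)"
      by (rule nn_integral_cmult[symmetric]) measurable
    also have "\<dots> \<le> (\<integral>\<^sup>+z. \<Phi> z + ennreal (c * (L * r)) * indicator K z \<partial>\<mu>)"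
      by (intro nn_integral_mono lower)
    also have "\<dots> = (\<integral>\<^sup>+z. \<Phi> z \<partial>\<mu>) + ennreal (c * (L * r)) * ennreal a"
      using ab sets by (subst nn_integral_add) (auto simp: nn_integral_cmult_indicator)
    also have "(\<integral>\<^sup>+z. \<Phi> z \<partial>\<mu>) \<le> (\<integral>\<^sup>+z. ennreal c * ennreal (\<phi> z) + ennreal (c * (L * r)) * indicator K z \<partial>\<nu>)"
      unfolding \<Phi>eq by (intro nn_integral_mono upper)
    also have "\<dots> = ennreal c * (\<integral>\<^sup>+x. \<phi> x \<partial>\<nu>) + ennreal (c * (L * r)) * ennreal b"
      using ab sets by (subst nn_integral_add) (auto simp: nn_integral_cmult_indicator nn_integral_cmult)
    finally have "ennreal c * (\<integral>\<^sup>+x. \<phi> x \<partial>\<mu>) \<le> ennreal c * (\<integral>\<^sup>+x. \<phi> x \<partial>\<nu>) + ennreal (c * (L * r)) * ennreal b + ennreal (c * (L * r)) * ennreal a"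
      by (simp add: add_right_mono)
    also have "\<dots> = ennreal c * ((\<integral>\<^sup>+x. \<phi> x \<partial>\<nu>) + ennreal (L * r * (a + b)))"
      unfolding distrib_left using c L r ab
      by (simp add: ennreal_mult'[symmetric] ennreal_plus[symmetric] algebra_simps add.assoc del: ennreal_plus)
    finally show ?thesis using c by (simp add: ennreal_mult_le_mult_iff)
  qed
  have "(\<lambda>m. (\<integral>\<^sup>+x. \<phi> x \<partial>\<nu>) + ennreal (L * (1 / real (Suc m)) * (a + b))) \<longlonglongrightarrow> (\<integral>\<^sup>+x. \<phi> x \<partial>\<nu>) + ennreal (L * 0 * (a + b))"
    by (intro tendsto_intros LIMSEQ_Suc[OF lim_1_over_n])
  moreover have "(\<integral>\<^sup>+x. \<phi> x \<partial>\<mu>) \<le> (\<integral>\<^sup>+x. \<phi> x \<partial>\<nu>) + ennreal (L * (1 / real (Suc m)) * (a + b))" for m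
    by (rule main) auto
  ultimately have "(\<integral>\<^sup>+x. \<phi> x \<partial>\<mu>) \<le> (\<integral>\<^sup>+x. \<phi> x \<partial>\<nu>) + ennreal (L * 0 * (a + b))"
    by (rule tendsto_lowerbound[OF _ always_eventually[OF allI]]) auto
  then show ?thesis by simp
qed

text \<open>Lipschitz functions squeezed between the indicators of C and of its neighbourhood of
  width 1 / (m + 1) are admissible tests; the neighbourhoods then shrink to C.\<close>

lemma riesz_potential_compact_le:
  fixes \<mu> \<nu> :: "'a measure"
  assumes sets: "sets \<mu> = sets borel" "sets \<nu> = sets borel"
    and fin: "\<And>C. compact C \<Longrightarrow> emeasure \<mu> C < \<infinity>" "\<And>C. compact C \<Longrightarrow> emeasure \<nu> C < \<infinity>"
    and eq: "AE x in lborel. riesz_potential \<alpha> \<mu> x = riesz_potential \<alpha> \<nu> x \<and> riesz_potential \<alpha> \<mu> x < \<infinity>"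
    and C: "compact C"
  shows "emeasure \<mu> C \<le> emeasure \<nu> C"
proof (cases "C = {}")
  case False
  obtain \<rho> where \<rho>: "C \<subseteq> cball 0 \<rho>" using compact_imp_bounded[OF C] by (auto simp: bounded_iff subset_iff)
  define A where "A m = {x. infdist x C \<le> 1 / real (Suc m)}" for m
  have closedA: "closed (A m)" for m unfolding A_def by (intro closed_Collect_le continuous_intros)
  have sub: "A m \<subseteq> cball 0 (\<rho> + 1)" for m
  proof
    fix x assume x: "x \<in> A m"
    obtain y where y: "y \<in> C" "infdist x C = dist x y" using infdist_attains_inf[OF compact_imp_closed[OF C] False] by blast
    have "norm (x - y) \<le> 1 / real (Suc m)" using x y by (simp add: A_def dist_norm)
    also have "\<dots> \<le> 1" by simp
    finally have "norm (x - y) \<le> 1" .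
    then show "x \<in> cball 0 (\<rho> + 1)" using \<rho> y norm_triangle_ineq2[of x y] by (force simp: subset_iff)
  qed
  have finA: "emeasure \<nu> (A m) \<noteq> \<infinity>" for m
  proof -
    have "compact (A m)" using closedA sub by (metis compact_cball compact_Int_closed inf.absorb_iff2)
    then show ?thesis using fin(2)[of "A m"] by simp
  qed
  have le: "emeasure \<mu> C \<le> emeasure \<nu> (A m)" for m
  proof -
    define \<phi> where "\<phi> x = max 0 (1 - real (Suc m) * infdist x C)" for x
    have "emeasure \<mu> C = (\<integral>\<^sup>+x. indicator C x \<partial>\<mu>)" using sets C by (simp add: borel_compact)
    also have "\<dots> \<le> (\<integral>\<^sup>+x. \<phi> x \<partial>\<mu>)"
      by (intro nn_integral_mono) (auto simp: indicator_def \<phi>_def)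
    also have "\<dots> \<le> (\<integral>\<^sup>+x. \<phi> x \<partial>\<nu>)"
    proof (rule riesz_potential_test_le[OF sets fin eq, where L="real (Suc m)" and R="\<rho> + 1"])
      show "\<phi> \<in> borel_measurable borel" unfolding \<phi>_def[abs_def]
        by (intro borel_measurable_continuous_onI continuous_intros)
      show "\<phi> x \<le> \<phi> y + real (Suc m) * norm (x - y)" for x y
      proof -
        have "infdist y C \<le> infdist x C + norm (x - y)" using infdist_triangle[of y C x] by (simp add: dist_norm norm_minus_commute)
        then have "real (Suc m) * infdist y C \<le> real (Suc m) * (infdist x C + norm (x - y))" by (intro mult_left_mono) auto
        moreover have "0 \<le> real (Suc m) * norm (x - y)" by simp
        ultimately show ?thesis unfolding \<phi>_def distrib_left by linarith
      qed
      show "\<phi> x = 0" if "\<rho> + 1 < norm x" for x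
      proof -
        have "x \<notin> A m" using sub[of m] that by auto
        then show ?thesis by (auto simp: A_def \<phi>_def field_simps max_def)
      qed
    qed (auto simp: \<phi>_def)
    also have "\<dots> \<le> (\<integral>\<^sup>+x. indicator (A m) x \<partial>\<nu>)"
    proof (rule nn_integral_mono)
      fix x
      show "ennreal (\<phi> x) \<le> indicator (A m) x"
      proof (cases "x \<in> A m")
        case True
        then show ?thesis by (simp add: \<phi>_def infdist_nonneg)
      next
        case False
        then show ?thesis by (auto simp: A_def \<phi>_def field_simps max_def)
      qed
    qed
    also have "\<dots> = emeasure \<nu> (A m)" using sets closedA by simp
    finally show ?thesis .
  qed
  have "(\<lambda>m. emeasure \<nu> (A m)) \<longlonglongrightarrow> emeasure \<nu> (\<Inter>m. A m)"
  proof (rule Lim_emeasure_decseq)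
    show "decseq A"
    proof (rule decseq_SucI, rule subsetI)
      fix m x assume "x \<in> A (Suc m)"
      moreover have "1 / real (Suc (Suc m)) \<le> 1 / real (Suc m)" by (simp add: field_simps)
      ultimately show "x \<in> A m" unfolding A_def by (meson mem_Collect_eq order_trans)
    qed
  qed (use sets closedA finA in auto)
  moreover have "(\<Inter>m. A m) = C"
  proof
    show "C \<subseteq> (\<Inter>m. A m)" by (auto simp: A_def)
    show "(\<Inter>m. A m) \<subseteq> C"
    proof
      fix x assume "x \<in> (\<Inter>m. A m)"
      then have "infdist x C \<le> 1 / real (Suc m)" for m by (auto simp: A_def)
      then have "infdist x C \<le> 0"
        by (intro tendsto_lowerbound[OF LIMSEQ_Suc[OF lim_1_over_n]]) auto
      then show "x \<in> C" using in_closed_iff_infdist_zero[OF compact_imp_closed[OF C] False] infdist_nonneg[of x C] by auto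
    qed
  qed
  ultimately show ?thesis using le by (intro tendsto_lowerbound[where f="\<lambda>m. emeasure \<nu> (A m)"]) auto
qed simp

lemma riesz_potential_inj:
  fixes \<mu> \<nu> :: "'a measure"
  assumes "sets \<mu> = sets borel" "sets \<nu> = sets borel"
    and "\<And>C. compact C \<Longrightarrow> emeasure \<mu> C < \<infinity>" "\<And>C. compact C \<Longrightarrow> emeasure \<nu> C < \<infinity>"
    and eq: "AE x in lborel. riesz_potential \<alpha> \<mu> x = riesz_potential \<alpha> \<nu> x \<and> riesz_potential \<alpha> \<mu> x < \<infinity>"
  shows "\<mu> = \<nu>"
proof (rule measure_eqI_compact)
  have eq': "AE x in lborel. riesz_potential \<alpha> \<nu> x = riesz_potential \<alpha> \<mu> x \<and> riesz_potential \<alpha> \<nu> x < \<infinity>"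
    using eq by eventually_elim auto
  show "emeasure \<mu> C = emeasure \<nu> C" if "compact C" for C
    using that assms eq' by (intro antisym riesz_potential_compact_le) auto
qed fact+

end

context corkscrew_domain
begin

section \<open>Balayage and Green's function\<close>

text \<open>The density of the position after j + 1 jumps, of which the first j land in
  \<open>\<Omega>\<close>; the last one is unrestricted until \<open>exit_density\<close> selects
  the jumps out.\<close>

primrec chain_density :: "nat \<Rightarrow> 'a \<Rightarrow> 'a \<Rightarrow> ennreal" where
  "chain_density 0 y w = p y w"
| "chain_density (Suc j) y w = (\<integral>\<^sup>+z. indicator \<Omega> z * p y z * chain_density j z w \<partial>lborel)"

lemma measurable_chain_density_pair:
  "(\<lambda>(y, w). chain_density j y w) \<in> borel_measurable (borel \<Otimes>\<^sub>M borel)"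
proof (induction j)
  case 0
  show ?case by simp
next
  case (Suc j)
  note [measurable] = Suc
  show ?case unfolding chain_density.simps by measurable
qed

lemma measurable_chain_density [measurable (raw)]:
  assumes [measurable]: "f \<in> borel_measurable M" "g \<in> borel_measurable M"
  shows "(\<lambda>x. chain_density j (f x) (g x)) \<in> borel_measurable M"
  using measurable_compose[OF measurable_Pair[OF assms] measurable_chain_density_pair[of j]] by simp

lemma Q_pow_S_density:
  assumes [measurable]: "h \<in> borel_measurable borel"
  shows "(Q ^^ j) (S h) y = (\<integral>\<^sup>+w. indicator (- \<Omega>) w * h w * chain_density j y w \<partial>lborel)"
proof (induction j arbitrary: y)
  case (Suc j)
  have "(Q ^^ Suc j) (S h) y = (\<integral>\<^sup>+z. indicator \<Omega> z * (\<integral>\<^sup>+w. indicator (- \<Omega>) w * h w * chain_density j z w \<partial>lborel) * p y z \<partial>lborel)"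
    by (simp add: Q_def Suc)
  also have "\<dots> = (\<integral>\<^sup>+z. \<integral>\<^sup>+w. indicator (- \<Omega>) w * h w * (indicator \<Omega> z * p y z * chain_density j z w) \<partial>lborel \<partial>lborel)"
  proof (rule nn_integral_cong)
    fix z
    have "indicator \<Omega> z * (\<integral>\<^sup>+w. indicator (- \<Omega>) w * h w * chain_density j z w \<partial>lborel) * p y z =
      (indicator \<Omega> z * p y z) * (\<integral>\<^sup>+w. indicator (- \<Omega>) w * h w * chain_density j z w \<partial>lborel)"
      by (simp only: ac_simps)
    also have "\<dots> = (\<integral>\<^sup>+w. (indicator \<Omega> z * p y z) * (indicator (- \<Omega>) w * h w * chain_density j z w) \<partial>lborel)"
      by (rule nn_integral_cmult[symmetric]) measurable
    finally show "indicator \<Omega> z * (\<integral>\<^sup>+w. indicator (- \<Omega>) w * h w * chain_density j z w \<partial>lborel) * p y z =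
      (\<integral>\<^sup>+w. indicator (- \<Omega>) w * h w * (indicator \<Omega> z * p y z * chain_density j z w) \<partial>lborel)"
      by (simp only: ac_simps)
  qed
  also have "\<dots> = (\<integral>\<^sup>+w. \<integral>\<^sup>+z. indicator (- \<Omega>) w * h w * (indicator \<Omega> z * p y z * chain_density j z w) \<partial>lborel \<partial>lborel)"
    by (rule lborel_pair.Fubini') measurable
  also have "\<dots> = (\<integral>\<^sup>+w. indicator (- \<Omega>) w * h w * chain_density (Suc j) y w \<partial>lborel)"
    unfolding chain_density.simps by (intro nn_integral_cong nn_integral_cmult) measurable
  finally show ?case .
qed (simp add: S_def)

definition exit_density :: "'a \<Rightarrow> 'a \<Rightarrow> ennreal" where
  "exit_density y w = indicator (- \<Omega>) w * (\<Sum>j. chain_density j y w)"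

lemma measurable_exit_density [measurable (raw)]:
  assumes [measurable]: "f \<in> borel_measurable M" "g \<in> borel_measurable M"
  shows "(\<lambda>x. exit_density (f x) (g x)) \<in> borel_measurable M"
  unfolding exit_density_def by measurable

lemma nn_integral_exit_density:
  assumes [measurable]: "h \<in> borel_measurable borel"
  shows "(\<integral>\<^sup>+w. h w * exit_density y w \<partial>lborel) = (\<Sum>j. (Q ^^ j) (S h) y)"
proof -
  have "(\<integral>\<^sup>+w. h w * exit_density y w \<partial>lborel) = (\<integral>\<^sup>+w. (\<Sum>j. indicator (- \<Omega>) w * h w * chain_density j y w) \<partial>lborel)"
    unfolding exit_density_def by (intro nn_integral_cong) (simp add: ac_simps)
  also have "\<dots> = (\<Sum>j. \<integral>\<^sup>+w. indicator (- \<Omega>) w * h w * chain_density j y w \<partial>lborel)"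
    by (rule nn_integral_suminf) measurable
  finally show ?thesis by (simp add: Q_pow_S_density)
qed

definition eps :: "'a \<Rightarrow> 'a measure" where "eps y = density lborel (exit_density y)"

lemma sets_eps [simp, measurable_cong]: "sets (eps y) = sets borel"
  by (simp add: eps_def)

lemma nn_integral_eps:
  assumes [measurable]: "h \<in> borel_measurable borel"
  shows "(\<integral>\<^sup>+w. h w \<partial>eps y) = (\<integral>\<^sup>+w. h w * exit_density y w \<partial>lborel)"
  unfolding eps_def by (subst nn_integral_density) (auto simp: mult.commute)

definition eps_pot :: "'a \<Rightarrow> 'a \<Rightarrow> ennreal" where
  "eps_pot x y = (\<integral>\<^sup>+w. k (x - w) * exit_density y w \<partial>lborel)"

lemma measurable_eps_pot [measurable (raw)]:
  assumes [measurable]: "f \<in> borel_measurable M" "g \<in> borel_measurable M"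
  shows "(\<lambda>x. eps_pot (f x) (g x)) \<in> borel_measurable M"
  unfolding eps_pot_def by measurable

lemma riesz_potential_eps: "riesz_potential \<alpha> (eps y) x = eps_pot x y"
  unfolding riesz_potential_def eps_pot_def by (rule nn_integral_eps) measurable

lemma nn_integral_exit_density_1:
  assumes "y \<in> \<Omega>"
  shows "(\<integral>\<^sup>+w. exit_density y w \<partial>lborel) = 1"
  using nn_integral_exit_density[of "\<lambda>_. 1" y] chain_exit_mass[OF assms] by simp

lemma eps_pot_chain: "eps_pot x y = (\<Sum>j. (Q ^^ j) (S (\<lambda>w. k (x - w))) y)"
  unfolding eps_pot_def by (rule nn_integral_exit_density) measurable

lemma eps_pot_le: "y \<in> \<Omega> \<Longrightarrow> eps_pot x y \<le> k (x - y)"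
  using chain_potential_le[of y x] unfolding eps_pot_chain by (rule order_trans[rotated]) simp_all

lemma eps_pot_eq: "y \<in> \<Omega> \<Longrightarrow> x \<notin> \<Omega> \<Longrightarrow> eps_pot x y = k (x - y)"
  unfolding eps_pot_chain by (rule chain_potential_eq)

lemma emeasure_eps_dom: "emeasure (eps y) \<Omega> = 0"
proof -
  have "emeasure (eps y) \<Omega> = (\<integral>\<^sup>+w. indicator \<Omega> w \<partial>eps y)" by simp
  also have "\<dots> = (\<integral>\<^sup>+w. indicator \<Omega> w * exit_density y w \<partial>lborel)"
    by (rule nn_integral_eps) measurable
  also have "\<dots> = (\<integral>\<^sup>+w. 0 \<partial>(lborel::'a measure))"
    by (intro nn_integral_cong) (auto simp: exit_density_def indicator_def)
  finally show ?thesis by simp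
qed

lemma riesz_capacity_empty: "riesz_capacity \<alpha> ({} :: 'a set) = 0"
proof -
  have "riesz_capacity \<alpha> ({} :: 'a set) \<le> (\<integral>\<^sup>+x. ennreal (((\<lambda>_. 0) x)\<^sup>2) \<partial>(lborel :: 'a measure))"
    unfolding riesz_capacity_def by (rule Inf_lower) (auto intro!: exI[of _ "\<lambda>_::'a. 0::real"])
  then show ?thesis by simp
qed

text \<open>The exceptional set is even empty, since the potentials agree at every point outside
  \<open>\<Omega>\<close>. The energy is finite because on the complement the potential is at most
  the kernel at distance d y, and \<open>eps y\<close> has mass 1.\<close>

lemma is_balayage_eps:
  assumes y: "y \<in> \<Omega>"
  shows "is_balayage \<Omega> \<alpha> y (eps y)"
  unfolding is_balayage_def
proof (intro conjI)
  show "emeasure (eps y) \<Omega> = 0" by (rule emeasure_eps_dom)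
  have "{x \<in> - \<Omega>. riesz_potential \<alpha> (eps y) x \<noteq> k (x - y)} = {}"
    using eps_pot_eq[OF y] by (auto simp: riesz_potential_eps)
  then show "riesz_capacity \<alpha> {x \<in> - \<Omega>. riesz_potential \<alpha> (eps y) x \<noteq> k (x - y)} = 0"
    by (simp only: riesz_capacity_empty)
  obtain u :: 'a where u: "norm u = d y" using vector_choose_size[of "d y"] d_pos[OF y] by auto
  have "(\<integral>\<^sup>+x. riesz_potential \<alpha> (eps y) x \<partial>eps y) = (\<integral>\<^sup>+x. eps_pot x y * exit_density y x \<partial>lborel)"
    unfolding riesz_potential_eps by (rule nn_integral_eps) measurable
  also have "\<dots> \<le> (\<integral>\<^sup>+x. k u * exit_density y x \<partial>lborel)"
  proof (rule nn_integral_mono)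
    fix x
    show "eps_pot x y * exit_density y x \<le> k u * exit_density y x"
    proof (cases "x \<in> \<Omega>")
      case False
      have "eps_pot x y \<le> k (x - y)" by (rule eps_pot_le[OF y])
      also have "\<dots> \<le> k u" using d_le[OF False, of y] u by (intro k_antimono) simp
      finally show ?thesis by (rule mult_right_mono) simp
    qed (simp add: exit_density_def)
  qed
  also have "\<dots> = k u" by (simp add: nn_integral_cmult nn_integral_exit_density_1[OF y])
  also have "\<dots> < \<infinity>" using u d_pos[OF y] by (intro k_finite) auto
  finally show "(\<integral>\<^sup>+x. riesz_potential \<alpha> (eps y) x \<partial>eps y) < \<infinity>" .
qed simp

text \<open>Everything about a balayage measure follows from pairing it with the explicit measures
  \<open>eps x\<close>, which are absolutely continuous and hence do not charge the exceptional set.\<close>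

lemma
  assumes y: "y \<in> \<Omega>" and \<mu>: "is_balayage \<Omega> \<alpha> y \<mu>"
  shows balayage_compact_finite: "\<And>C. compact C \<Longrightarrow> emeasure \<mu> C < \<infinity>"
    and balayage_potential_inside: "\<And>x. x \<in> \<Omega> \<Longrightarrow> riesz_potential \<alpha> \<mu> x = eps_pot y x"
    and balayage_potential_outside: "AE x in lborel. x \<notin> \<Omega> \<longrightarrow> riesz_potential \<alpha> \<mu> x = k (x - y)"
proof -
  have sets[measurable_cong]: "sets \<mu> = sets borel" and null: "emeasure \<mu> \<Omega> = 0"
    and cap: "riesz_capacity \<alpha> {x \<in> - \<Omega>. riesz_potential \<alpha> \<mu> x \<noteq> k (x - y)} = 0"
    using \<mu> by (auto simp: is_balayage_def)
  obtain Z where Z: "Z \<in> null_sets lborel" "{x \<in> - \<Omega>. riesz_potential \<alpha> \<mu> x \<noteq> k (x - y)} \<subseteq> Z"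
    using capacity_zero_imp_null[OF cap] by blast
  show out: "AE x in lborel. x \<notin> \<Omega> \<longrightarrow> riesz_potential \<alpha> \<mu> x = k (x - y)"
    using AE_not_in[OF Z(1)] by eventually_elim (use Z(2) in auto)
  obtain w where w: "ball w (ck * d y) \<subseteq> - \<Omega>"
    using corkscrew[OF y] by (auto simp: d_def)
  \<comment> \<open>A corkscrew ball has positive volume, so it contains a point off the null set Z.
    At this point outside \<open>\<Omega>\<close> the potential of \<mu> is finite, which forces
    \<mu> to be finite on compact sets.\<close>
  have "\<exists>x. x \<in> ball w (ck * d y) \<and> x \<notin> Z"
  proof (rule ccontr)
    assume "\<not> ?thesis"
    then have sub: "ball w (ck * d y) \<subseteq> Z" by auto
    have "0 < emeasure lborel (ball w (ck * d y))"
      using ck d_pos[OF y] by (simp add: emeasure_ball unit_ball_vol_def)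
    also have "\<dots> \<le> emeasure lborel Z" using Z(1) by (intro emeasure_mono sub) auto
    also have "\<dots> = 0" using Z(1) by auto
    finally show False by simp
  qed
  then obtain x0 where x0: "x0 \<notin> \<Omega>" "riesz_potential \<alpha> \<mu> x0 = k (x0 - y)" using w Z(2) by blast
  have pot0: "riesz_potential \<alpha> \<mu> x0 < \<infinity>" unfolding x0(2) using x0(1) y by (intro k_finite) auto
  show fin: "emeasure \<mu> C < \<infinity>" if C: "compact C" for C
  proof -
    have "C \<in> sets borel" using C by (rule borel_compact)
    note [measurable] = this
    obtain R where R: "\<And>z. z \<in> C \<Longrightarrow> norm z \<le> R" using compact_imp_bounded[OF C] by (auto simp: bounded_iff)
    obtain u :: 'a where u: "norm u = norm x0 + \<bar>R\<bar> + 1" using vector_choose_size[of "norm x0 + \<bar>R\<bar> + 1"] by auto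
    have "k u * emeasure \<mu> C = (\<integral>\<^sup>+z. k u * indicator C z \<partial>\<mu>)" using C sets by (simp add: nn_integral_cmult_indicator)
    also have "\<dots> \<le> riesz_potential \<alpha> \<mu> x0" unfolding riesz_potential_def
    proof (rule nn_integral_mono)
      fix z
      show "k u * indicator C z \<le> k (x0 - z)"
      proof (cases "z \<in> C")
        case True
        have "norm (x0 - z) \<le> norm u" using norm_triangle_ineq4[of x0 z] R[OF True] u by simp
        then show ?thesis using True by (simp add: k_antimono)
      qed simp
    qed
    finally have "k u * emeasure \<mu> C < \<infinity>" using pot0 by simp
    then show ?thesis using k_pos[of u] by (auto simp: ennreal_mult_less_top less_top)
  qed
  interpret sigma_finite_measure \<mu> using sets fin by (rule sigma_finite_measure_if_compact_finite)
  interpret pair_sigma_finite \<mu> "lborel :: 'a measure" ..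
  have AE\<mu>: "AE z in \<mu>. z \<notin> \<Omega>" using null sets by (intro AE_not_in null_setsI) auto
  show "riesz_potential \<alpha> \<mu> x = eps_pot y x" if x: "x \<in> \<Omega>" for x
  proof -
    \<comment> \<open>Reciprocity: \<mu> lives off \<open>\<Omega>\<close>, where the kernel with
      pole x is the potential of \<open>eps x\<close>. Exchanging the integrals leaves the potential
      of \<mu> under \<open>eps x\<close>, which may be replaced by the kernel with pole y because
      \<open>eps x\<close> has a density on the complement.\<close>
    have "riesz_potential \<alpha> \<mu> x = (\<integral>\<^sup>+z. eps_pot z x \<partial>\<mu>)"
      unfolding riesz_potential_def
    proof (rule nn_integral_cong_AE)
      show "AE z in \<mu>. k (x - z) = eps_pot z x"
        using AE\<mu> by eventually_elim (use eps_pot_eq[OF x] k_minus_commute in auto)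
    qed
    also have "\<dots> = (\<integral>\<^sup>+w. \<integral>\<^sup>+z. k (z - w) * exit_density x w \<partial>\<mu> \<partial>lborel)"
      unfolding eps_pot_def by (rule Fubini'[symmetric]) measurable
    also have "\<dots> = (\<integral>\<^sup>+w. riesz_potential \<alpha> \<mu> w * exit_density x w \<partial>lborel)"
    proof (rule nn_integral_cong)
      fix w
      have "(\<integral>\<^sup>+z. k (z - w) * exit_density x w \<partial>\<mu>) = (\<integral>\<^sup>+z. k (z - w) \<partial>\<mu>) * exit_density x w"
        by (rule nn_integral_multc) measurable
      then show "(\<integral>\<^sup>+z. k (z - w) * exit_density x w \<partial>\<mu>) = riesz_potential \<alpha> \<mu> w * exit_density x w"
        unfolding riesz_potential_def using k_minus_commute by simp
    qed
    also have "\<dots> = (\<integral>\<^sup>+w. k (y - w) * exit_density x w \<partial>lborel)"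
    proof (rule nn_integral_cong_AE)
      show "AE w in lborel. riesz_potential \<alpha> \<mu> w * exit_density x w = k (y - w) * exit_density x w"
        using out by eventually_elim (use k_minus_commute in \<open>auto simp: exit_density_def indicator_def\<close>)
    qed
    finally show ?thesis by (simp add: eps_pot_def)
  qed
qed

text \<open>The formula for the potential of a balayage measure inside \<open>\<Omega>\<close>,
  applied to \<open>eps y\<close> itself, exchanges the two arguments.\<close>

lemma eps_pot_sym: "x \<in> \<Omega> \<Longrightarrow> y \<in> \<Omega> \<Longrightarrow> eps_pot x y = eps_pot y x"
  using balayage_potential_inside[OF _ is_balayage_eps, of y x] by (simp add: riesz_potential_eps)

text \<open>Reciprocity inside \<open>\<Omega>\<close> and the boundary condition outside show that
  every balayage measure has potential \<open>eps_pot x y\<close> at almost every x, finite away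
  from y; injectivity of the Riesz potential then identifies the measure.\<close>

lemma balayage_eq:
  assumes y: "y \<in> \<Omega>"
  shows "balayage \<Omega> \<alpha> y = eps y"
  unfolding balayage_def
proof (rule the_equality)
  show "is_balayage \<Omega> \<alpha> y (eps y)" by (rule is_balayage_eps[OF y])
  fix \<mu> assume \<mu>: "is_balayage \<Omega> \<alpha> y \<mu>"
  show "\<mu> = eps y"
  proof (rule riesz_potential_inj)
    show "sets \<mu> = sets borel" using \<mu> by (simp add: is_balayage_def)
    show "emeasure \<mu> C < \<infinity>" "emeasure (eps y) C < \<infinity>" if "compact C" for C
      using balayage_compact_finite[OF y _ that] \<mu> is_balayage_eps[OF y] by auto
    have ne: "AE x in lborel. x \<noteq> y" by (rule AE_lborel_singleton)
    show "AE x in lborel. riesz_potential \<alpha> \<mu> x = riesz_potential \<alpha> (eps y) x \<and> riesz_potential \<alpha> \<mu> x < \<infinity>"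
      using balayage_potential_outside[OF y \<mu>] ne
    proof eventually_elim
      case (elim x)
      have eq: "riesz_potential \<alpha> \<mu> x = eps_pot x y"
      proof (cases "x \<in> \<Omega>")
        case True
        then show ?thesis using balayage_potential_inside[OF y \<mu> True] eps_pot_sym[OF True y] by simp
      next
        case False
        then show ?thesis using elim eps_pot_eq[OF y False] by simp
      qed
      moreover have "eps_pot x y < \<infinity>"
        using eps_pot_le[OF y, of x] k_finite[of "x - y"] elim by (auto intro: le_less_trans)
      ultimately show ?case by (simp add: riesz_potential_eps)
    qed
  qed simp
qed

text \<open>The diagonal is tested through \<open>norm (x - y) = 0\<close>, a condition on a Borel
  function of the pair, which makes joint measurability immediate.\<close>

definition gr :: "'a \<Rightarrow> 'a \<Rightarrow> ennreal" where
  "gr x y = (if norm (x - y) = 0 then \<infinity> else k (x - y) - eps_pot x y)"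

lemma measurable_gr [measurable (raw)]:
  assumes [measurable]: "f \<in> borel_measurable M" "g \<in> borel_measurable M"
  shows "(\<lambda>x. gr (f x) (g x)) \<in> borel_measurable M"
  unfolding gr_def by measurable

lemma green_eq: "y \<in> \<Omega> \<Longrightarrow> green \<Omega> \<alpha> x y = gr x y"
  by (simp add: green_def gr_def balayage_eq riesz_potential_eps)

lemma k_eq_gr_eps_pot:
  assumes y: "y \<in> \<Omega>"
  shows "k (x - y) = gr x y + eps_pot x y"
  using eps_pot_le[OF y, of x] by (cases "x = y") (auto simp: gr_def diff_add_cancel_ennreal)

lemma eps_pot_finite: "y \<in> \<Omega> \<Longrightarrow> x \<noteq> y \<Longrightarrow> eps_pot x y < \<infinity>"
  using eps_pot_le[of y x] k_finite[of "x - y"] by (auto intro: le_less_trans)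

lemma gr_outside: "y \<in> \<Omega> \<Longrightarrow> x \<notin> \<Omega> \<Longrightarrow> gr x y = 0"
  using k_finite[of "x - y"] by (auto simp: gr_def eps_pot_eq)

lemma gr_sym: "x \<in> \<Omega> \<Longrightarrow> y \<in> \<Omega> \<Longrightarrow> gr x y = gr y x"
  by (simp add: gr_def eps_pot_sym[of x y] norm_minus_commute k_minus_commute[of x y])

text \<open>The left side is the occupation density that the walk collects in its successive balls.
  It is bounded by cancelling the finite exit potential from \<open>chain_potential_le\<close>; on
  the diagonal \<open>gr\<close> is infinite anyway.\<close>

lemma chain_le_gr:
  assumes y: "y \<in> \<Omega>"
  shows "(\<Sum>j. (Q ^^ j) (\<lambda>z. ball_green (d z / 2) (x - z)) y) \<le> gr x y"
proof (cases "x = y")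
  case False
  let ?s = "\<Sum>j. (Q ^^ j) (\<lambda>z. ball_green (d z / 2) (x - z)) y"
  have "eps_pot x y + ?s \<le> eps_pot x y + gr x y"
    using chain_potential_le[OF y, of x] k_eq_gr_eps_pot[OF y, of x] by (simp add: eps_pot_chain add.commute)
  then show ?thesis using eps_pot_finite[OF y False] by (subst (asm) ennreal_add_left_cancel_le) auto
qed (simp add: gr_def)

section \<open>The killing density as weight\<close>

definition killing :: "'a \<Rightarrow> ennreal" where
  "killing x = (\<integral>\<^sup>+w. indicator (- \<Omega>) w * J (x - w) \<partial>lborel)"

lemma measurable_killing [measurable]: "killing \<in> borel_measurable borel"
  unfolding killing_def[abs_def] by measurable

text \<open>The summand 1 makes the constant positive without a lower bound for
  \<open>shell_integral\<close>.\<close>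

definition kup :: real where
  "kup = enn2real (shell_integral TYPE('a)) / (\<alpha> * c0 * gam) + 1"

lemma kup_pos: "0 < kup"
  unfolding kup_def using alpha c0_pos gam_pos by (intro add_nonneg_pos divide_nonneg_pos) auto

lemma nn_integral_J_far:
  assumes R: "0 < R"
  shows "(\<integral>\<^sup>+z. J z * indicator {R..} (norm z) \<partial>lborel) \<le> ennreal (kup * R powr (- \<alpha>))"
proof -
  define s where "s = enn2real (shell_integral TYPE('a))"
  have s: "shell_integral TYPE('a) = ennreal s" "0 \<le> s"
    using shell_integral_finite[where 'a='a] by (auto simp: s_def)
  have "(\<integral>\<^sup>+z. J z * indicator {R..} (norm z) \<partial>lborel) =
    (\<integral>\<^sup>+z. ennreal (1 / (c0 * gam)) * (ennreal (norm (z::'a) powr (- \<alpha> - DIM('a))) * indicator {R..} (norm z)) \<partial>lborel)"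
    unfolding J_def using c0_pos gam_pos
    by (intro nn_integral_cong) (simp add: ennreal_mult'[symmetric] mult.assoc[symmetric])
  also have "\<dots> = ennreal (1 / (c0 * gam)) * (shell_integral TYPE('a) * ennreal (R powr (- \<alpha> - DIM('a) + DIM('a)) / (- (- \<alpha> - DIM('a)) - DIM('a))))"
    using alpha R by (subst nn_integral_cmult, measurable, subst nn_integral_norm_powr_far) auto
  also have "\<dots> = ennreal (s / (\<alpha> * c0 * gam) * R powr (- \<alpha>))"
    unfolding s using s(2) alpha c0_pos gam_pos by (simp add: ennreal_mult'[symmetric] field_simps)
  also have "\<dots> \<le> ennreal (kup * R powr (- \<alpha>))"
    unfolding kup_def s_def[symmetric] by (intro ennreal_leI mult_right_mono) auto
  finally show ?thesis .
qed

lemma killing_le: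
  assumes x: "x \<in> \<Omega>"
  shows "killing x \<le> ennreal (kup * d x powr (- \<alpha>))"
proof -
  have "killing x \<le> (\<integral>\<^sup>+w. J (x - w) * indicator {d x..} (norm (x - w)) \<partial>lborel)"
    unfolding killing_def using d_le[of _ x]
    by (intro nn_integral_mono) (auto simp: indicator_def norm_minus_commute)
  also have "\<dots> = (\<integral>\<^sup>+z. J z * indicator {d x..} (norm z) \<partial>lborel)"
    by (rule nn_integral_lborel_translate(4)) measurable
  also have "\<dots> \<le> ennreal (kup * d x powr (- \<alpha>))"
    by (rule nn_integral_J_far[OF d_pos[OF x]])
  finally show ?thesis .
qed

definition klo :: real where
  "klo = (Ck + ck) powr (- \<alpha> - DIM('a)) * unit_ball_vol (real DIM('a)) * ck ^ DIM('a) / (c0 * gam)"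

lemma klo_pos: "0 < klo"
  unfolding klo_def using ck Ck c0_pos gam_pos by (auto intro!: divide_pos_pos mult_pos_pos simp: unit_ball_vol_def)

text \<open>A corkscrew ball alone contributes this much: its volume is of order d y^n, and all its
  points lie within (Ck + ck) d y of y, where J is at least of order d y^(-\<alpha> - n).\<close>

lemma killing_ge:
  assumes y: "y \<in> \<Omega>"
  shows "ennreal (klo * d y powr (- \<alpha>)) \<le> killing y"
proof -
  obtain w where w: "ball w (ck * d y) \<subseteq> - \<Omega>" "\<And>v. v \<in> ball w (ck * d y) \<Longrightarrow> norm (v - y) \<le> (Ck + ck) * d y"
    by (rule escape_mass[OF y]) blast
  let ?n = "real DIM('a)"
  let ?M = "Ck + ck"
  define t where "t = d y"
  have t: "0 < t" using d_pos[OF y] by (simp add: t_def)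
  define m where "m = (?M * t) powr (- \<alpha> - ?n) / (c0 * gam)"
  have lower: "ennreal m \<le> J (y - v)" if v: "v \<in> ball w (ck * d y)" for v
  proof -
    have "v \<notin> \<Omega>" using v w by auto
    then have vd: "t \<le> norm (v - y)" using d_le[of v y] by (simp add: t_def)
    have "(?M * t) powr (- \<alpha> - ?n) \<le> norm (v - y) powr (- \<alpha> - ?n)"
      using w(2)[OF v] vd t alpha by (intro powr_mono2') (auto simp: t_def)
    then show ?thesis unfolding m_def J_def using c0_pos gam_pos
      by (intro ennreal_leI divide_right_mono) (auto simp: norm_minus_commute)
  qed
  have "klo * t powr (- \<alpha>) = m * (unit_ball_vol ?n * (ck * t) ^ DIM('a))"
  proof -
    have "t powr (- \<alpha> - ?n) * t ^ DIM('a) = t powr (- \<alpha> - ?n + ?n)"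
      unfolding powr_add using t by (simp add: powr_realpow)
    then show ?thesis unfolding klo_def m_def powr_mult power_mult_distrib by (simp add: field_simps)
  qed
  moreover have m0: "0 \<le> m" using c0_pos gam_pos by (simp add: m_def)
  ultimately have "ennreal (klo * d y powr (- \<alpha>)) = ennreal m * emeasure lborel (ball w (ck * d y))"
    using ck t by (simp add: emeasure_ball t_def ennreal_mult')
  also have "\<dots> = (\<integral>\<^sup>+v. ennreal m * indicator (ball w (ck * d y)) v \<partial>lborel)"
    by (subst nn_integral_cmult_indicator) simp_all
  also have "\<dots> \<le> killing y" unfolding killing_def
    using lower w(1) by (intro nn_integral_mono) (auto simp: indicator_def)
  finally show ?thesis .
qed

definition q :: "'a \<Rightarrow> real" where "q x = enn2real (killing x)"

lemma q_eq: "x \<in> \<Omega> \<Longrightarrow> ennreal (q x) = killing x"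
  unfolding q_def using killing_le[of x] by (intro ennreal_enn2real) (auto intro: le_less_trans)

lemma measurable_q [measurable]: "q \<in> borel_measurable borel"
  unfolding q_def[abs_def] by measurable

lemma q_L1_loc: "q \<in> L1_loc \<Omega>"
  unfolding L1_loc_def
proof (intro CollectI conjI allI impI)
  show "q \<in> borel_measurable (restrict_space lborel \<Omega>)"
    by (intro measurable_restrict_space1) simp
  fix K assume "compact K \<and> K \<subseteq> \<Omega>"
  then have K: "compact K" "K \<subseteq> \<Omega>" by auto
  show "set_integrable lborel K q"
  proof (cases "K = {}")
    case False
    obtain x0 where x0: "x0 \<in> K" "\<And>x. x \<in> K \<Longrightarrow> d x0 \<le> d x"
    proof -
      have "continuous_on K d" unfolding d_def[abs_def] by (intro continuous_intros)
      from continuous_attains_inf[OF K(1) False this] show ?thesis using that by blast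
    qed
    have dx0: "0 < d x0" using x0 K d_pos by auto
    have [measurable]: "K \<in> sets borel" using K by (simp add: borel_compact)
    have bound: "norm (q x) \<le> kup * d x0 powr (- \<alpha>)" if x: "x \<in> K" for x
    proof -
      have "q x \<le> kup * d x powr (- \<alpha>)"
      proof -
        have "ennreal (q x) \<le> ennreal (kup * d x powr (- \<alpha>))" using killing_le[of x] q_eq[of x] x K by auto
        then show ?thesis using kup_pos by (subst (asm) ennreal_le_iff) auto
      qed
      also have "\<dots> \<le> kup * d x0 powr (- \<alpha>)"
        using x0(2)[OF x] dx0 kup_pos alpha by (intro mult_left_mono powr_mono2') auto
      finally show ?thesis by (simp add: q_def)
    qed
    show ?thesis unfolding set_integrable_def
    proof (rule integrableI_bounded_set_indicator[where B="kup * d x0 powr (- \<alpha>)"])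
      show "emeasure lborel K < \<infinity>" using emeasure_compact_finite[OF K(1)] .
      show "AE x in lborel. x \<in> K \<longrightarrow> norm (q x) \<le> kup * d x0 powr (- \<alpha>)" using bound by auto
    qed simp_all
  qed simp
qed

abbreviation om :: "'a measure" where "om \<equiv> weight_measure \<Omega> q"

lemma space_om: "space om = \<Omega>"
  by (simp add: weight_measure_def space_restrict_space)

lemma measurable_om: "h \<in> borel_measurable borel \<Longrightarrow> h \<in> borel_measurable om"
  unfolding weight_measure_def by (simp add: measurable_restrict_space1)

lemma nn_integral_om:
  assumes [measurable]: "h \<in> borel_measurable borel"
  shows "(\<integral>\<^sup>+x. h x \<partial>om) = (\<integral>\<^sup>+x. indicator \<Omega> x * killing x * h x \<partial>lborel)"
proof -
  have "(\<integral>\<^sup>+x. h x \<partial>om) = (\<integral>\<^sup>+x. ennreal (q x) * h x \<partial>restrict_space lborel \<Omega>)"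
    unfolding weight_measure_def by (rule nn_integral_density) (auto intro: measurable_restrict_space1)
  also have "\<dots> = (\<integral>\<^sup>+x. ennreal (q x) * h x * indicator \<Omega> x \<partial>lborel)"
    by (rule nn_integral_restrict_space) simp
  also have "\<dots> = (\<integral>\<^sup>+x. indicator \<Omega> x * killing x * h x \<partial>lborel)"
    by (intro nn_integral_cong) (auto simp: indicator_def q_eq)
  finally show ?thesis .
qed

section \<open>The Green potential of the killing density\<close>

lemma measurable_Q_pow_pair:
  assumes [measurable]: "(\<lambda>(y, z). H y z) \<in> borel_measurable (borel \<Otimes>\<^sub>M borel)"
  shows "(\<lambda>(y, x). (Q ^^ j) (H y) x) \<in> borel_measurable (borel \<Otimes>\<^sub>M borel)"
proof (induction j)
  case (Suc j)
  note [measurable] = Suc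
  have "(\<lambda>u. (Q ^^ j) (H (f u)) (g u)) \<in> borel_measurable M"
    if [measurable]: "f \<in> borel_measurable M" "g \<in> borel_measurable M" for f g and M :: "'b measure"
    using measurable_compose[OF measurable_Pair[OF that] Suc] by simp
  note [measurable (raw)] = this
  show ?case unfolding funpow.simps o_def Q_def[of "(Q ^^ j) (H _)"] by measurable
qed simp

lemma Q_pow_integral:
  fixes H :: "'a \<Rightarrow> 'a \<Rightarrow> ennreal"
  assumes [measurable]: "(\<lambda>(y, z). H y z) \<in> borel_measurable (borel \<Otimes>\<^sub>M borel)"
  shows "(Q ^^ j) (\<lambda>z. \<integral>\<^sup>+y. H y z \<partial>lborel) x = (\<integral>\<^sup>+y. (Q ^^ j) (H y) x \<partial>lborel)"
proof (induction j arbitrary: x)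
  case (Suc j)
  note [measurable] = measurable_Q_pow_pair[OF assms, of j]
  have "(Q ^^ Suc j) (\<lambda>z. \<integral>\<^sup>+y. H y z \<partial>lborel) x = (\<integral>\<^sup>+z. indicator \<Omega> z * (\<integral>\<^sup>+y. (Q ^^ j) (H y) z \<partial>lborel) * p x z \<partial>lborel)"
    by (simp add: Q_def[of "(Q ^^ j) _"] Suc)
  also have "\<dots> = (\<integral>\<^sup>+z. \<integral>\<^sup>+y. indicator \<Omega> z * p x z * (Q ^^ j) (H y) z \<partial>lborel \<partial>lborel)"
  proof (rule nn_integral_cong)
    fix z
    have "(\<integral>\<^sup>+y. indicator \<Omega> z * p x z * (Q ^^ j) (H y) z \<partial>lborel) = indicator \<Omega> z * p x z * (\<integral>\<^sup>+y. (Q ^^ j) (H y) z \<partial>lborel)"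
      by (rule nn_integral_cmult) measurable
    then show "indicator \<Omega> z * (\<integral>\<^sup>+y. (Q ^^ j) (H y) z \<partial>lborel) * p x z = (\<integral>\<^sup>+y. indicator \<Omega> z * p x z * (Q ^^ j) (H y) z \<partial>lborel)"
      by (simp only: ac_simps)
  qed
  also have "\<dots> = (\<integral>\<^sup>+y. \<integral>\<^sup>+z. indicator \<Omega> z * p x z * (Q ^^ j) (H y) z \<partial>lborel \<partial>lborel)"
    by (rule lborel_pair.Fubini') measurable
  also have "\<dots> = (\<integral>\<^sup>+y. (Q ^^ Suc j) (H y) x \<partial>lborel)"
    by (simp add: Q_def ac_simps)
  finally show ?case .
qed simp

lemma Q_pow_mono:
  assumes "\<And>z. z \<in> \<Omega> \<Longrightarrow> f z \<le> g z" and y: "y \<in> \<Omega>"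
  shows "(Q ^^ j) f y \<le> (Q ^^ j) g y"
  using y by (induction j arbitrary: y) (auto intro!: assms Q_mono)

text \<open>The jumps that leave the domain are exactly those counted by \<open>killing\<close>.\<close>

lemma S_1_le:
  assumes z: "z \<in> \<Omega>"
  shows "S (\<lambda>_. 1) z \<le> (\<integral>\<^sup>+y. indicator \<Omega> y * killing y * ball_green (d z / 2) (y - z) \<partial>lborel)"
proof -
  define r where "r = d z / 2"
  have r: "0 < r" "r < d z" using d_pos[OF z] by (auto simp: r_def)
  have "S (\<lambda>_. 1) z = (\<integral>\<^sup>+w. indicator (- \<Omega>) w * poisson r (w - z) \<partial>lborel)"
    by (simp add: S_def p_def r_def)
  also have "\<dots> \<le> (\<integral>\<^sup>+w. indicator (- \<Omega>) w * (\<integral>\<^sup>+y. ball_green r (y - z) * J (y - w) \<partial>lborel) \<partial>lborel)"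
  proof (rule nn_integral_mono)
    fix w
    show "indicator (- \<Omega>) w * poisson r (w - z) \<le> indicator (- \<Omega>) w * (\<integral>\<^sup>+y. ball_green r (y - z) * J (y - w) \<partial>lborel)"
    proof (cases "w \<in> \<Omega>")
      case False
      then have "r < norm (w - z)" using d_le[OF False, of z] r by simp
      then have "poisson r (w - z) \<le> (\<integral>\<^sup>+u. ball_green r u * J (w - z - u) \<partial>lborel)" by (rule poisson_le_ball_green_J[OF r(1)])
      also have "\<dots> = (\<integral>\<^sup>+y. ball_green r (y - z) * J (w - z - (y - z)) \<partial>lborel)"
        by (rule nn_integral_lborel_translate(3)[symmetric]) measurable
      also have "\<dots> = (\<integral>\<^sup>+y. ball_green r (y - z) * J (y - w) \<partial>lborel)"
        using J_minus_commute[of w] by (simp add: algebra_simps)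
      finally show ?thesis by (intro mult_left_mono) auto
    qed simp
  qed
  also have "\<dots> = (\<integral>\<^sup>+w. \<integral>\<^sup>+y. indicator (- \<Omega>) w * (ball_green r (y - z) * J (y - w)) \<partial>lborel \<partial>lborel)"
    by (intro nn_integral_cong nn_integral_cmult[symmetric]) measurable
  also have "\<dots> = (\<integral>\<^sup>+y. \<integral>\<^sup>+w. indicator (- \<Omega>) w * (ball_green r (y - z) * J (y - w)) \<partial>lborel \<partial>lborel)"
    by (rule lborel_pair.Fubini') measurable
  also have "\<dots> = (\<integral>\<^sup>+y. killing y * ball_green r (y - z) \<partial>lborel)"
  proof (rule nn_integral_cong)
    fix y
    have "(\<integral>\<^sup>+w. indicator (- \<Omega>) w * (ball_green r (y - z) * J (y - w)) \<partial>lborel) = (\<integral>\<^sup>+w. (indicator (- \<Omega>) w * J (y - w)) * ball_green r (y - z) \<partial>lborel)"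
      by (simp only: ac_simps)
    also have "\<dots> = killing y * ball_green r (y - z)"
      unfolding killing_def by (rule nn_integral_multc) measurable
    finally show "(\<integral>\<^sup>+w. indicator (- \<Omega>) w * (ball_green r (y - z) * J (y - w)) \<partial>lborel) = killing y * ball_green r (y - z)" .
  qed
  also have "\<dots> = (\<integral>\<^sup>+y. indicator \<Omega> y * killing y * ball_green (d z / 2) (y - z) \<partial>lborel)"
  proof (rule nn_integral_cong)
    fix y
    show "killing y * ball_green r (y - z) = indicator \<Omega> y * killing y * ball_green (d z / 2) (y - z)"
    proof (cases "y \<in> \<Omega>")
      case False
      then have "ball_green r (y - z) = 0" using d_le[OF False, of z] r by (intro ball_green_zero) auto
      then show ?thesis using False by simp
    qed (simp add: r_def)
  qed
  finally show ?thesis .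
qed

text \<open>The walk exits with probability 1. By \<open>S_1_le\<close> each exit is charged to the
  killing density seen through Green's function of the ball that is left, and along the walk these
  ball functions add up to at most Green's function of \<open>\<Omega>\<close>.\<close>

lemma gr_om_ge_1:
  assumes x: "x \<in> \<Omega>"
  shows "1 \<le> (\<integral>\<^sup>+y. indicator \<Omega> y * killing y * gr x y \<partial>lborel)"
proof -
  define H where "H y z = indicator \<Omega> y * killing y * ball_green (d z / 2) (y - z)" for y z
  have H: "(\<lambda>(y, z). H y z) \<in> borel_measurable (borel \<Otimes>\<^sub>M borel)"
    unfolding H_def by measurable
  have H': "(Q ^^ j) (H y) x = indicator \<Omega> y * killing y * (Q ^^ j) (\<lambda>z. ball_green (d z / 2) (y - z)) x" for y j x
  proof (induction j arbitrary: x)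
    case (Suc j)
    then have "(Q ^^ j) (H y) = (\<lambda>x. indicator \<Omega> y * killing y * (Q ^^ j) (\<lambda>z. ball_green (d z / 2) (y - z)) x)" by blast
    then show ?case by (simp add: Q_cmult)
  qed (simp add: H_def)
  have "1 = (\<Sum>j. (Q ^^ j) (S (\<lambda>_. 1)) x)" by (rule chain_exit_mass[OF x, symmetric])
  also have "\<dots> \<le> (\<Sum>j. (Q ^^ j) (\<lambda>z. \<integral>\<^sup>+y. H y z \<partial>lborel) x)"
    by (intro suminf_le Q_pow_mono x) (auto simp: H_def S_1_le)
  also have "\<dots> = (\<Sum>j. \<integral>\<^sup>+y. (Q ^^ j) (H y) x \<partial>lborel)"
    by (simp only: Q_pow_integral[OF H])
  also have "\<dots> = (\<integral>\<^sup>+y. (\<Sum>j. (Q ^^ j) (H y) x) \<partial>lborel)"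
  proof (rule nn_integral_suminf[symmetric])
    fix j
    show "(\<lambda>y. (Q ^^ j) (H y) x) \<in> borel_measurable lborel"
      using measurable_compose[OF _ measurable_Q_pow_pair[OF H, of j], of "\<lambda>y. (y, x)" borel] by simp
  qed
  also have "\<dots> \<le> (\<integral>\<^sup>+y. indicator \<Omega> y * killing y * gr x y \<partial>lborel)"
  proof (rule nn_integral_mono)
    fix y
    show "(\<Sum>j. (Q ^^ j) (H y) x) \<le> indicator \<Omega> y * killing y * gr x y"
    proof (cases "y \<in> \<Omega>")
      case True
      have "(\<Sum>j. (Q ^^ j) (H y) x) = indicator \<Omega> y * killing y * (\<Sum>j. (Q ^^ j) (\<lambda>z. ball_green (d z / 2) (y - z)) x)"
        unfolding H' by simp
      \<comment> \<open>The walk starts at x, so the bound comes with x as the pole; symmetry of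
        \<open>gr\<close> restores the order of the arguments.\<close>
      also have "\<dots> \<le> indicator \<Omega> y * killing y * gr y x"
        by (intro mult_left_mono chain_le_gr x) simp
      finally show ?thesis using gr_sym[OF True x] by simp
    qed (simp add: H')
  qed
  finally show ?thesis .
qed

section \<open>Divergence of the iterated kernels\<close>

primrec ik :: "nat \<Rightarrow> 'a \<Rightarrow> 'a \<Rightarrow> ennreal" where
  "ik 0 x y = gr x y"
| "ik (Suc j) x y = (\<integral>\<^sup>+z. indicator \<Omega> z * killing z * (ik j x z * gr z y) \<partial>lborel)"

lemma measurable_ik_pair: "(\<lambda>(x, y). ik j x y) \<in> borel_measurable (borel \<Otimes>\<^sub>M borel)"
proof (induction j)
  case (Suc j)
  note [measurable] = Suc
  show ?case unfolding ik.simps by measurable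
qed simp

lemma measurable_ik [measurable (raw)]:
  assumes [measurable]: "f \<in> borel_measurable M" "g \<in> borel_measurable M"
  shows "(\<lambda>x. ik j (f x) (g x)) \<in> borel_measurable M"
  using measurable_compose[OF measurable_Pair[OF assms] measurable_ik_pair[of j]] by simp

text \<open>\<open>ik\<close> is built from \<open>gr\<close> instead of \<open>green\<close>, whose
  description operator carries no measurability, and from weighted Lebesgue integrals. It is jointly
  Borel, so Fubini applies to it.\<close>

lemma iterated_kernel_eq: "y \<in> \<Omega> \<Longrightarrow> iterated_kernel (green \<Omega> \<alpha>) om j x y = ik j x y"
proof (induction j arbitrary: y)
  case (Suc j)
  have "iterated_kernel (green \<Omega> \<alpha>) om (Suc j) x y = (\<integral>\<^sup>+z. ik j x z * gr z y \<partial>om)"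
    using Suc by (auto intro!: nn_integral_cong simp: space_om green_eq)
  also have "\<dots> = ik (Suc j) x y"
    by (subst nn_integral_om) simp_all
  finally show ?case .
qed (simp add: green_eq)

lemma ik_mass:
  assumes x: "x \<in> \<Omega>"
  shows "1 \<le> (\<integral>\<^sup>+y. indicator \<Omega> y * killing y * ik j x y \<partial>lborel)"
proof (induction j)
  case 0
  show ?case using gr_om_ge_1[OF x] by simp
next
  case (Suc j)
  let ?w = "\<lambda>y. indicator \<Omega> y * killing y"
  note Suc
  also have "(\<integral>\<^sup>+z. ?w z * ik j x z \<partial>lborel) \<le> (\<integral>\<^sup>+z. ?w z * ik j x z * (\<integral>\<^sup>+y. ?w y * gr z y \<partial>lborel) \<partial>lborel)"
  proof (rule nn_integral_mono)
    fix z
    show "?w z * ik j x z \<le> ?w z * ik j x z * (\<integral>\<^sup>+y. ?w y * gr z y \<partial>lborel)"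
    proof (cases "z \<in> \<Omega>")
      case True
      from mult_left_mono[OF gr_om_ge_1[OF True], of "?w z * ik j x z"] show ?thesis by simp
    qed simp
  qed
  also have "\<dots> = (\<integral>\<^sup>+z. \<integral>\<^sup>+y. ?w z * ik j x z * (?w y * gr z y) \<partial>lborel \<partial>lborel)"
    by (intro nn_integral_cong nn_integral_cmult[symmetric]) measurable
  also have "\<dots> = (\<integral>\<^sup>+y. \<integral>\<^sup>+z. ?w z * ik j x z * (?w y * gr z y) \<partial>lborel \<partial>lborel)"
    by (rule lborel_pair.Fubini') measurable
  also have "\<dots> = (\<integral>\<^sup>+y. ?w y * ik (Suc j) x y \<partial>lborel)"
  proof (rule nn_integral_cong)
    fix y
    have "(\<integral>\<^sup>+z. ?w z * ik j x z * (?w y * gr z y) \<partial>lborel) = (\<integral>\<^sup>+z. ?w y * (?w z * (ik j x z * gr z y)) \<partial>lborel)"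
      by (simp only: ac_simps)
    also have "\<dots> = ?w y * ik (Suc j) x y"
      unfolding ik.simps by (rule nn_integral_cmult) measurable
    finally show "(\<integral>\<^sup>+z. ?w z * ik j x z * (?w y * gr z y) \<partial>lborel) = ?w y * ik (Suc j) x y" .
  qed
  finally show ?case .
qed

lemma u1_infinite:
  assumes x: "x \<in> \<Omega>"
  shows "u1 \<Omega> \<alpha> om x = \<infinity>"
proof -
  have "(\<integral>\<^sup>+y. neumann_kernel (green \<Omega> \<alpha>) om x y \<partial>om) = (\<integral>\<^sup>+y. (\<Sum>j. ik j x y) \<partial>om)"
    unfolding neumann_kernel_def by (intro nn_integral_cong) (simp add: space_om iterated_kernel_eq)
  also have "\<dots> = (\<Sum>j. \<integral>\<^sup>+y. ik j x y \<partial>om)"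
    by (intro nn_integral_suminf measurable_om) measurable
  also have "\<dots> \<ge> (\<Sum>j::nat. 1)"
    using ik_mass[OF x] by (intro suminf_le) (auto simp: nn_integral_om)
  moreover have "(\<Sum>j::nat. 1 :: ennreal) = \<infinity>"
  proof -
    have "(\<Sum>j<N. 1 :: ennreal) \<le> (\<Sum>j::nat. 1)" for N :: nat by (intro sum_le_suminf) auto
    then have "of_nat N \<le> (\<Sum>j::nat. 1 :: ennreal)" for N :: nat by simp
    then show ?thesis by (metis ennreal_Ex_less_of_nat infinity_ennreal_def less_top not_le)
  qed
  ultimately show ?thesis unfolding u1_def by (simp add: top_unique)
qed

section \<open>Hardy's inequality for the censored energy\<close>

definition layer :: "real \<Rightarrow> 'a \<Rightarrow> 'a \<Rightarrow> bool" where
  "layer l y x \<longleftrightarrow> x \<in> \<Omega> \<and> l * d x \<le> d y \<and> norm (x - y) \<le> (Ck + 1) * d y"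

lemma measurable_layer [measurable]: "Measurable.pred (borel \<Otimes>\<^sub>M borel) (\<lambda>(y, x). layer l y x)"
  unfolding layer_def by measurable

definition cl :: real where
  "cl = unit_ball_vol (real DIM('a)) * min ck (1/2) ^ DIM('a) / Ck"

lemma cl_pos: "0 < cl"
  unfolding cl_def using ck Ck by (auto intro!: divide_pos_pos mult_pos_pos simp: unit_ball_vol_def)

text \<open>The segment from y + h in direction v is followed to its first point outside
  \<open>\<Omega>\<close>, at the parameter s0. On the preceding stretch of parameter length \<tau>
  = 1 / (l Ck) the distance to that point is at most \<tau> |v| \<le> d y / l, so this stretch lies
  in the layer.\<close>

lemma line_crosses_layer:
  assumes y: "y \<in> \<Omega>" and l: "2 \<le> l" and h: "norm h \<le> d y / 2" and v: "0 < norm v" "norm v \<le> Ck * d y"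
    and out: "y + h + v \<notin> \<Omega>"
  shows "ennreal (1 / (l * Ck)) \<le> (\<integral>\<^sup>+s. indicator {0..1} s * indicator {x. layer l y x} (y + h + s *\<^sub>R v) \<partial>lborel)"
proof -
  define t where "t = d y"
  have t: "0 < t" using d_pos[OF y] by (simp add: t_def)
  let ?z = "\<lambda>s. y + h + s *\<^sub>R v"
  define A where "A = {s \<in> {0..1}. ?z s \<in> - \<Omega>}"
  have "closed ({0..1} \<inter> ?z -` (- \<Omega>))"
    using open_dom by (intro continuous_closed_preimage continuous_intros) auto
  moreover have "A = {0..1} \<inter> ?z -` (- \<Omega>)" by (auto simp: A_def)
  ultimately have "closed A" by simp
  moreover have "bounded A" using bounded_closed_interval[of 0 "1::real"] by (rule bounded_subset) (auto simp: A_def)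
  ultimately have "compact A" by (simp add: compact_eq_bounded_closed)
  moreover have "1 \<in> A" using out by (simp add: A_def)
  ultimately obtain s0 where s0: "s0 \<in> A" "\<And>s. s \<in> A \<Longrightarrow> s0 \<le> s"
    using compact_attains_inf[of A] by blast
  have s01: "0 \<le> s0" "s0 \<le> 1" "?z s0 \<notin> \<Omega>" using s0(1) by (auto simp: A_def)
  have dz: "d (?z s) \<le> \<bar>s0 - s\<bar> * norm v" for s
  proof -
    have "?z s0 - ?z s = (s0 - s) *\<^sub>R v" by (simp add: algebra_simps)
    then have "norm (?z s0 - ?z s) = \<bar>s0 - s\<bar> * norm v" by (simp only: norm_scaleR)
    then show ?thesis using d_le[OF s01(3), of "?z s"] by simp
  qed
  define \<tau> where "\<tau> = 1 / (l * Ck)"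
  have \<tau>: "0 < \<tau>" using l Ck by (simp add: \<tau>_def)
  have \<tau>v: "l * (\<tau> * norm v) \<le> t"
    using v(2) l Ck by (simp add: \<tau>_def t_def field_simps)
  \<comment> \<open>The starting point is at distance at least d y / 2 from the complement, hence so
    far from the exit point, while \<tau> |v| \<le> d y / 2 because l \<ge> 2. The stretch therefore
    fits into the segment.\<close>
  have "\<tau> \<le> s0"
  proof -
    have "d y - norm h \<le> d (?z 0)" using d_lipschitz[of y "y + h"] by simp
    then have "t / 2 \<le> d (?z 0)" using h by (simp add: t_def)
    also have "\<dots> \<le> s0 * norm v" using dz[of 0] s01 by simp
    finally have 1: "t / 2 \<le> s0 * norm v" .
    have "2 * (\<tau> * norm v) \<le> l * (\<tau> * norm v)" using l \<tau> v by (intro mult_right_mono) auto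
    then have "\<tau> * norm v \<le> s0 * norm v" using \<tau>v 1 by simp
    then show ?thesis using v(1) by simp
  qed
  have "ennreal \<tau> = (\<integral>\<^sup>+s. indicator {s0 - \<tau>..<s0} s \<partial>lborel)" using \<tau> by simp
  also have "\<dots> \<le> (\<integral>\<^sup>+s. indicator {0..1} s * indicator {x. layer l y x} (?z s) \<partial>lborel)"
  proof (rule nn_integral_mono)
    fix s :: real
    show "indicator {s0 - \<tau>..<s0} s \<le> (indicator {0..1} s * indicator {x. layer l y x} (?z s) :: ennreal)"
    proof (cases "s \<in> {s0 - \<tau>..<s0}")
      case True
      then have s: "s \<in> {0..1}" using \<open>\<tau> \<le> s0\<close> s01 by auto
      have "s \<notin> A" using s0(2)[of s] True by auto
      then have "?z s \<in> \<Omega>" using s by (simp add: A_def)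
      moreover have "l * d (?z s) \<le> d y"
      proof -
        have "\<bar>s0 - s\<bar> * norm v \<le> \<tau> * norm v" using True by (intro mult_right_mono) auto
        then have "d (?z s) \<le> \<tau> * norm v" using dz[of s] by linarith
        then have "l * d (?z s) \<le> l * (\<tau> * norm v)" using l by (intro mult_left_mono) auto
        then show ?thesis using \<tau>v by (simp add: t_def)
      qed
      moreover have "norm (?z s - y) \<le> (Ck + 1) * d y"
      proof -
        have "norm (?z s - y) \<le> norm h + norm (s *\<^sub>R v)" using norm_triangle_ineq[of h "s *\<^sub>R v"] by (simp add: algebra_simps)
        also have "\<dots> \<le> d y + 1 * norm v" using h s t by (intro add_mono) (auto simp: t_def intro: mult_left_le_one_le)
        also have "\<dots> \<le> (Ck + 1) * d y" using v by (simp add: algebra_simps)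
        finally show ?thesis .
      qed
      ultimately show ?thesis using s True by (simp add: layer_def)
    qed simp
  qed
  finally show ?thesis by (simp add: \<tau>_def)
qed

text \<open>Fubini over the parallel segments that lead from a small ball about y into the corkscrew
  ball: each spends a parameter length of at least 1 / (l Ck) in the layer, and for every fixed
  parameter the points traced out are a translate of the small ball.\<close>

lemma layer_volume:
  assumes y: "y \<in> \<Omega>" and l: "2 \<le> l"
  shows "ennreal (cl * d y ^ DIM('a) / l) \<le> emeasure lborel {x. layer l y x}"
proof -
  define t where "t = d y"
  have t: "0 < t" using d_pos[OF y] by (simp add: t_def)
  obtain w where w: "ball w (ck * t) \<subseteq> - \<Omega>" "norm (w - y) \<le> Ck * t"
    using corkscrew[OF y] by (auto simp: d_def t_def)
  define v where "v = w - y"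
  have "w \<in> ball w (ck * t)" using t ck by simp
  then have "w \<notin> \<Omega>" using w(1) by blast
  then have v: "0 < norm v" "norm v \<le> Ck * t" using w y by (auto simp: v_def)
  \<comment> \<open>The bound by ck keeps the end points in the corkscrew ball, the bound by 1/2
    keeps the starting points within d y / 2 of y.\<close>
  define \<eta> where "\<eta> = min ck (1/2)"
  have \<eta>: "0 < \<eta>" "\<eta> \<le> ck" "\<eta> \<le> 1/2" using ck by (auto simp: \<eta>_def)
  define B where "B = ball (0::'a) (\<eta> * t)"
  have [measurable]: "B \<in> sets borel" by (simp add: B_def)
  have [measurable]: "{x. layer l y x} \<in> sets borel" unfolding layer_def by measurable
  let ?L = "{x. layer l y x}"
  have "cl * d y ^ DIM('a) / l = unit_ball_vol (real DIM('a)) * (\<eta> * t) ^ DIM('a) * (1 / (l * Ck))"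
    using l Ck by (simp add: cl_def \<eta>_def t_def power_mult_distrib ac_simps)
  then have "ennreal (cl * d y ^ DIM('a) / l) = emeasure lborel B * ennreal (1 / (l * Ck))"
    using \<eta> t l Ck by (simp add: B_def emeasure_ball ennreal_mult''[symmetric])
  also have "\<dots> = (\<integral>\<^sup>+h. indicator B h * ennreal (1 / (l * Ck)) \<partial>lborel)"
    by (subst nn_integral_multc) auto
  also have "\<dots> \<le> (\<integral>\<^sup>+h. indicator B h * (\<integral>\<^sup>+s. indicator {0..1} s * indicator ?L (y + h + s *\<^sub>R v) \<partial>lborel) \<partial>lborel)"
  proof (rule nn_integral_mono)
    fix h :: 'a
    show "indicator B h * ennreal (1 / (l * Ck)) \<le> indicator B h * (\<integral>\<^sup>+s. indicator {0..1} s * indicator ?L (y + h + s *\<^sub>R v) \<partial>lborel)"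
    proof (cases "h \<in> B")
      case True
      then have nh: "norm h < \<eta> * t" by (simp add: B_def)
      have "\<eta> * t \<le> ck * t" "\<eta> * t \<le> t / 2" using \<eta> t by (auto intro: mult_right_mono)
      then have "w + h \<in> ball w (ck * t)" "norm h \<le> d y / 2" using nh by (auto simp: dist_norm t_def)
      then have "ennreal (1 / (l * Ck)) \<le> (\<integral>\<^sup>+s. indicator {0..1} s * indicator ?L (y + h + s *\<^sub>R v) \<partial>lborel)"
        using v w(1) by (intro line_crosses_layer[OF y l]) (auto simp: v_def t_def algebra_simps)
      then show ?thesis using True by simp
    qed simp
  qed
  also have "\<dots> = (\<integral>\<^sup>+h. \<integral>\<^sup>+s. indicator B h * (indicator {0..1} s * indicator ?L (y + h + s *\<^sub>R v)) \<partial>lborel \<partial>lborel)"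
    by (intro nn_integral_cong nn_integral_cmult[symmetric]) measurable
  also have "\<dots> = (\<integral>\<^sup>+s. \<integral>\<^sup>+h. indicator B h * (indicator {0..1} s * indicator ?L (y + h + s *\<^sub>R v)) \<partial>lborel \<partial>lborel)"
    by (rule lborel_pair.Fubini') measurable
  also have "\<dots> \<le> (\<integral>\<^sup>+s. indicator {0..1} s * emeasure lborel ?L \<partial>(lborel :: real measure))"
  proof (rule nn_integral_mono)
    fix s :: real
    have "(\<integral>\<^sup>+h. indicator B h * (indicator {0..1} s * indicator ?L (y + h + s *\<^sub>R v)) \<partial>lborel) \<le>
      (\<integral>\<^sup>+h. indicator {0..1} s * indicator ?L ((y + s *\<^sub>R v) + h) \<partial>lborel)"
      by (intro nn_integral_mono) (auto simp: indicator_def algebra_simps)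
    also have "\<dots> = (\<integral>\<^sup>+h. indicator {0..1} s * indicator ?L h \<partial>lborel)"
      by (rule nn_integral_lborel_translate(1)) measurable
    also have "\<dots> = indicator {0..1} s * emeasure lborel ?L"
      by (subst nn_integral_cmult) auto
    finally show "(\<integral>\<^sup>+h. indicator B h * (indicator {0..1} s * indicator ?L (y + h + s *\<^sub>R v)) \<partial>lborel) \<le> indicator {0..1} s * emeasure lborel ?L" .
  qed
  also have "\<dots> = emeasure lborel ?L" by (subst nn_integral_multc) auto
  finally show ?thesis .
qed

definition cj :: real where "cj = (Ck + 1) powr (\<alpha> + DIM('a)) * (c0 * gam)"

lemma cj_pos: "0 < cj"
  unfolding cj_def using Ck c0_pos gam_pos by simp

lemma d_powr_le_J:
  assumes y: "y \<in> \<Omega>" and ne: "x \<noteq> y" and le: "norm (x - y) \<le> (Ck + 1) * d y"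
  shows "ennreal (d y powr (- \<alpha> - DIM('a))) \<le> ennreal cj * J (x - y)"
proof -
  have "((Ck + 1) * d y) powr (- \<alpha> - DIM('a)) \<le> norm (x - y) powr (- \<alpha> - DIM('a))"
    using ne le alpha by (intro powr_mono2') auto
  then have "(Ck + 1) powr (\<alpha> + DIM('a)) * ((Ck + 1) powr (- \<alpha> - DIM('a)) * d y powr (- \<alpha> - DIM('a))) \<le> (Ck + 1) powr (\<alpha> + DIM('a)) * norm (x - y) powr (- \<alpha> - DIM('a))"
    unfolding powr_mult by (intro mult_left_mono) auto
  moreover have "(Ck + 1) powr (\<alpha> + DIM('a)) * (Ck + 1) powr (- \<alpha> - DIM('a)) = 1"
    unfolding powr_add[symmetric] using Ck by simp
  ultimately have "d y powr (- \<alpha> - DIM('a)) \<le> (Ck + 1) powr (\<alpha> + DIM('a)) * norm (x - y) powr (- \<alpha> - DIM('a))"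
    by (simp add: mult.assoc[symmetric])
  also have "\<dots> = cj * (norm (x - y) powr (- \<alpha> - DIM('a)) / (c0 * gam))"
    unfolding cj_def using c0_pos gam_pos by simp
  finally show ?thesis unfolding J_def using cj_pos c0_pos gam_pos
    by (simp add: ennreal_mult'[symmetric] ennreal_leI)
qed

lemma layer_ne: "y \<in> \<Omega> \<Longrightarrow> 2 \<le> l \<Longrightarrow> layer l y x \<Longrightarrow> x \<noteq> y"
  unfolding layer_def using d_pos[of y] mult_right_mono[of 2 l "d y"] by auto

text \<open>If x lies in the layer of y, then d y \<ge> l d x and d y - d x \<le> |x - y| give |x -
  y| \<ge> l d x / 2. The total weight that x receives is thus a tail of J beyond this radius, of
  order (l d x)^(-\<alpha>), and \<open>killing_ge\<close> turns d x^(-\<alpha>) into the killing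
  density.\<close>

lemma layer_weight:
  assumes x: "x \<in> \<Omega>" and l: "2 \<le> l"
  shows "(\<integral>\<^sup>+y. indicator \<Omega> y * (ennreal (d y powr (- \<alpha> - DIM('a))) * indicator {x. layer l y x} x) \<partial>lborel) \<le>
    ennreal (cj * kup * 2 powr \<alpha> / klo * l powr (- \<alpha>)) * killing x"
proof -
  have dx: "0 < d x" by (rule d_pos[OF x])
  have "(\<integral>\<^sup>+y. indicator \<Omega> y * (ennreal (d y powr (- \<alpha> - DIM('a))) * indicator {x. layer l y x} x) \<partial>lborel) \<le>
    (\<integral>\<^sup>+y. ennreal cj * (J (x - y) * indicator {l * d x / 2..} (norm (x - y))) \<partial>lborel)"
  proof (rule nn_integral_mono)
    fix y
    show "indicator \<Omega> y * (ennreal (d y powr (- \<alpha> - DIM('a))) * indicator {x. layer l y x} x) \<le>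
      ennreal cj * (J (x - y) * indicator {l * d x / 2..} (norm (x - y)))"
    proof (cases "y \<in> \<Omega> \<and> layer l y x")
      case True
      then have "l * d x \<le> d y" "norm (x - y) \<le> (Ck + 1) * d y" by (auto simp: layer_def)
      moreover have "d y - d x \<le> norm (x - y)" using d_lipschitz[of x y] by simp
      moreover have "d x \<le> l * d x / 2" using mult_right_mono[OF l, of "d x"] dx by simp
      ultimately have "l * d x / 2 \<le> norm (x - y)" by simp
      then show ?thesis using d_powr_le_J[of y x] layer_ne[of y l x] True l \<open>norm (x - y) \<le> (Ck + 1) * d y\<close> by simp
    qed auto
  qed
  also have "\<dots> = ennreal cj * (\<integral>\<^sup>+y. J (x - y) * indicator {l * d x / 2..} (norm (x - y)) \<partial>lborel)"
    by (rule nn_integral_cmult) measurable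
  also have "(\<integral>\<^sup>+y. J (x - y) * indicator {l * d x / 2..} (norm (x - y)) \<partial>lborel) = (\<integral>\<^sup>+z. J z * indicator {l * d x / 2..} (norm z) \<partial>lborel)"
    by (rule nn_integral_lborel_translate(4)) measurable
  also have "\<dots> \<le> ennreal (kup * (l * d x / 2) powr (- \<alpha>))"
    using l dx by (intro nn_integral_J_far) simp
  also have "ennreal cj * ennreal (kup * (l * d x / 2) powr (- \<alpha>)) = ennreal (cj * kup * 2 powr \<alpha> / klo * l powr (- \<alpha>)) * ennreal (klo * d x powr (- \<alpha>))"
  proof -
    have "(l * d x / 2) powr (- \<alpha>) = l powr (- \<alpha>) * d x powr (- \<alpha>) * 2 powr \<alpha>"
      unfolding powr_divide powr_mult by (simp add: powr_minus divide_inverse)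
    then have "cj * (kup * (l * d x / 2) powr (- \<alpha>)) = (cj * kup * 2 powr \<alpha> / klo * l powr (- \<alpha>)) * (klo * d x powr (- \<alpha>))"
      using klo_pos by simp
    then show ?thesis using cj_pos kup_pos klo_pos by (simp add: ennreal_mult'[symmetric])
  qed
  also have "\<dots> \<le> ennreal (cj * kup * 2 powr \<alpha> / klo * l powr (- \<alpha>)) * killing x"
    by (intro mult_left_mono killing_ge[OF x]) simp
  finally show ?thesis by (simp add: mult_left_mono)
qed

text \<open>Averaging over a layer costs the factor l, because its volume is only of order d y^n /
  l, while \<open>layer_weight\<close> gains l^(-\<alpha>). The product l^(1 - \<alpha>) can be made
  small since \<alpha> > 1, and finiteness of the left side allows the term to be absorbed.\<close>

lemma hardy:
  "\<exists>C>0. \<forall>u::'a \<Rightarrow> real. u \<in> borel_measurable borel \<longrightarrow>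
     (\<integral>\<^sup>+x. indicator \<Omega> x * killing x * ennreal ((u x)\<^sup>2) \<partial>lborel) < \<infinity> \<longrightarrow>
     (\<integral>\<^sup>+x. indicator \<Omega> x * killing x * ennreal ((u x)\<^sup>2) \<partial>lborel) \<le> ennreal C *
     (\<integral>\<^sup>+y. \<integral>\<^sup>+x. indicator \<Omega> y * indicator \<Omega> x * (ennreal ((u x - u y)\<^sup>2) * J (x - y)) \<partial>lborel \<partial>lborel)"
proof -
  define B where "B = kup / cl"
  have B: "0 < B" unfolding B_def using kup_pos cl_pos by simp
  define D where "D = cj * kup * 2 powr \<alpha> / klo"
  have D: "0 < D" unfolding D_def using cj_pos kup_pos klo_pos by simp
  \<comment> \<open>Chosen so that 2 B D l^(1 - \<alpha>) \<le> 1 / 2; the maximum with 2 meets the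
    requirement of the layer lemmas.\<close>
  define l where "l = max 2 ((4 * B * D) powr (1 / (\<alpha> - 1)))"
  have l: "2 \<le> l" by (simp add: l_def)
  have ldec: "2 * B * l * (D * l powr (- \<alpha>)) \<le> 1 / 2"
  proof -
    have "4 * B * D = ((4 * B * D) powr (1 / (\<alpha> - 1))) powr (\<alpha> - 1)"
      unfolding powr_powr using alpha B D by simp
    also have "\<dots> \<le> l powr (\<alpha> - 1)" using alpha by (intro powr_mono2) (auto simp: l_def)
    finally have 1: "4 * B * D \<le> l powr (\<alpha> - 1)" .
    have "l * l powr (- \<alpha>) * l powr (\<alpha> - 1) = l powr (1 + (- \<alpha>) + (\<alpha> - 1))"
      unfolding powr_add using l by simp
    also have "\<dots> = 1" using l by simp
    finally have "4 * B * D * (l * l powr (- \<alpha>)) \<le> 1"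
      using mult_right_mono[OF 1, of "l * l powr (- \<alpha>)"] l by (simp add: ac_simps)
    then show ?thesis by (simp add: ac_simps)
  qed
  define C where "C = 2 * (2 * B * l * cj)"
  have C: "0 < C" unfolding C_def using B l cj_pos by simp
  show ?thesis
  proof (intro exI[of _ C] conjI C allI impI)
    fix u :: "'a \<Rightarrow> real"
    assume [measurable]: "u \<in> borel_measurable borel"
    assume fin: "(\<integral>\<^sup>+x. indicator \<Omega> x * killing x * ennreal ((u x)\<^sup>2) \<partial>lborel) < \<infinity>"
    define A where "A = (\<integral>\<^sup>+x. indicator \<Omega> x * killing x * ennreal ((u x)\<^sup>2) \<partial>lborel)"
    define E where "E = (\<integral>\<^sup>+y. \<integral>\<^sup>+x. indicator \<Omega> y * indicator \<Omega> x * (ennreal ((u x - u y)\<^sup>2) * J (x - y)) \<partial>lborel \<partial>lborel)"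
    define G where "G y x = indicator \<Omega> y * (ennreal (d y powr (- \<alpha> - DIM('a))) * indicator {x. layer l y x} x)" for y x
    have L_eq: "indicator {x. layer l y x} x = (if layer l y x then 1 else 0 :: ennreal)" for y x by (simp add: indicator_def)
    have Gp: "(\<lambda>(y, x). G y x) \<in> borel_measurable (borel \<Otimes>\<^sub>M borel)"
      unfolding G_def L_eq layer_def by measurable
    have [measurable (raw)]: "(\<lambda>x. G (f x) (g x)) \<in> borel_measurable M" if "f \<in> borel_measurable M" "g \<in> borel_measurable M" for f g and M :: "'b measure"
      using measurable_compose[OF measurable_Pair[OF that] Gp] by simp
    have [measurable]: "{x. layer l y x} \<in> sets borel" for y unfolding layer_def by measurable
    \<comment> \<open>The bound kup d y^(-\<alpha>) for the killing density is spread over the layer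
      of y by \<open>layer_volume\<close>; then (u y)^2 is compared with (u x)^2 and the squared
      difference.\<close>
    have point: "indicator \<Omega> y * killing y * ennreal ((u y)\<^sup>2) \<le>
      (\<integral>\<^sup>+x. ennreal (2 * B * l) * (G y x * ennreal ((u x)\<^sup>2)) + ennreal (2 * B * l) * (G y x * ennreal ((u x - u y)\<^sup>2)) \<partial>lborel)" for y
    proof (cases "y \<in> \<Omega>")
      case y: True
      define t where "t = d y"
      have t: "0 < t" using d_pos[OF y] by (simp add: t_def)
      have "killing y * ennreal ((u y)\<^sup>2) \<le> ennreal (kup * t powr (- \<alpha>)) * ennreal ((u y)\<^sup>2)"
        unfolding t_def by (intro mult_right_mono killing_le y) auto
      also have "\<dots> = ennreal (B * l * t powr (- \<alpha> - DIM('a)) * (u y)\<^sup>2) * ennreal (cl * t ^ DIM('a) / l)"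
      proof -
        have "t powr (- \<alpha> - DIM('a)) * t ^ DIM('a) = t powr (- \<alpha> - DIM('a) + DIM('a))"
          unfolding powr_add using t by (simp add: powr_realpow)
        then have "kup * t powr (- \<alpha>) * (u y)\<^sup>2 = B * l * t powr (- \<alpha> - DIM('a)) * (u y)\<^sup>2 * (cl * t ^ DIM('a) / l)"
          unfolding B_def using l cl_pos by (simp add: field_simps)
        then show ?thesis using B l kup_pos t cl_pos by (simp add: ennreal_mult'[symmetric])
      qed
      also have "\<dots> \<le> ennreal (B * l * t powr (- \<alpha> - DIM('a)) * (u y)\<^sup>2) * emeasure lborel {x. layer l y x}"
        unfolding t_def by (intro mult_left_mono layer_volume y l) auto
      also have "\<dots> = (\<integral>\<^sup>+x. ennreal (B * l * t powr (- \<alpha> - DIM('a)) * (u y)\<^sup>2) * indicator {x. layer l y x} x \<partial>lborel)"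
        by (rule nn_integral_cmult_indicator[symmetric]) measurable
      also have "\<dots> \<le> (\<integral>\<^sup>+x. ennreal (2 * B * l) * (G y x * ennreal ((u x)\<^sup>2)) + ennreal (2 * B * l) * (G y x * ennreal ((u x - u y)\<^sup>2)) \<partial>lborel)"
      proof (rule nn_integral_mono)
        fix x
        have sq: "(u y)\<^sup>2 \<le> 2 * (u x)\<^sup>2 + 2 * (u x - u y)\<^sup>2"
        proof -
          have "0 \<le> (2 * u x - u y)\<^sup>2" by simp
          then show ?thesis by (simp add: power2_eq_square algebra_simps)
        qed
        show "ennreal (B * l * t powr (- \<alpha> - DIM('a)) * (u y)\<^sup>2) * indicator {x. layer l y x} x \<le>
          ennreal (2 * B * l) * (G y x * ennreal ((u x)\<^sup>2)) + ennreal (2 * B * l) * (G y x * ennreal ((u x - u y)\<^sup>2))"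
        proof (cases "layer l y x")
          case True
          let ?p = "t powr (- \<alpha> - DIM('a))"
          have "B * l * ?p * (u y)\<^sup>2 \<le> B * l * ?p * (2 * (u x)\<^sup>2 + 2 * (u x - u y)\<^sup>2)"
            using B l by (intro mult_left_mono sq) auto
          also have "\<dots> = 2 * B * l * (?p * (u x)\<^sup>2) + 2 * B * l * (?p * (u x - u y)\<^sup>2)"
            by (simp add: algebra_simps)
          finally have "ennreal (B * l * ?p * (u y)\<^sup>2) \<le> ennreal (2 * B * l * (?p * (u x)\<^sup>2)) + ennreal (2 * B * l * (?p * (u x - u y)\<^sup>2))"
          proof -
            assume "B * l * ?p * (u y)\<^sup>2 \<le> 2 * B * l * (?p * (u x)\<^sup>2) + 2 * B * l * (?p * (u x - u y)\<^sup>2)"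
            then have "ennreal (B * l * ?p * (u y)\<^sup>2) \<le> ennreal (2 * B * l * (?p * (u x)\<^sup>2) + 2 * B * l * (?p * (u x - u y)\<^sup>2))"
              by (rule ennreal_leI)
            also have "\<dots> = ennreal (2 * B * l * (?p * (u x)\<^sup>2)) + ennreal (2 * B * l * (?p * (u x - u y)\<^sup>2))"
              using B l by (intro ennreal_plus) auto
            finally show ?thesis .
          qed
          then show ?thesis using True y B l by (simp add: G_def t_def ennreal_mult')
        qed simp
      qed
      finally show ?thesis using y by simp
    qed simp
    have "A \<le> (\<integral>\<^sup>+y. \<integral>\<^sup>+x. ennreal (2 * B * l) * (G y x * ennreal ((u x)\<^sup>2)) + ennreal (2 * B * l) * (G y x * ennreal ((u x - u y)\<^sup>2)) \<partial>lborel \<partial>lborel)"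
      unfolding A_def by (intro nn_integral_mono point)
    also have "\<dots> = (\<integral>\<^sup>+y. ennreal (2 * B * l) * (\<integral>\<^sup>+x. G y x * ennreal ((u x)\<^sup>2) \<partial>lborel) + ennreal (2 * B * l) * (\<integral>\<^sup>+x. G y x * ennreal ((u x - u y)\<^sup>2) \<partial>lborel) \<partial>lborel)"
      by (intro nn_integral_cong, subst nn_integral_add) (auto simp: nn_integral_cmult)
    also have "\<dots> = ennreal (2 * B * l) * (\<integral>\<^sup>+y. \<integral>\<^sup>+x. G y x * ennreal ((u x)\<^sup>2) \<partial>lborel \<partial>lborel) +
      ennreal (2 * B * l) * (\<integral>\<^sup>+y. \<integral>\<^sup>+x. G y x * ennreal ((u x - u y)\<^sup>2) \<partial>lborel \<partial>lborel)"
      by (subst nn_integral_add) (auto simp: nn_integral_cmult)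
    also have "(\<integral>\<^sup>+y. \<integral>\<^sup>+x. G y x * ennreal ((u x)\<^sup>2) \<partial>lborel \<partial>lborel) \<le> ennreal (D * l powr (- \<alpha>)) * A"
    proof -
      have "(\<integral>\<^sup>+y. \<integral>\<^sup>+x. G y x * ennreal ((u x)\<^sup>2) \<partial>lborel \<partial>lborel) = (\<integral>\<^sup>+x. \<integral>\<^sup>+y. G y x * ennreal ((u x)\<^sup>2) \<partial>lborel \<partial>lborel)"
        by (rule lborel_pair.Fubini') measurable
      also have "\<dots> = (\<integral>\<^sup>+x. (\<integral>\<^sup>+y. G y x \<partial>lborel) * ennreal ((u x)\<^sup>2) \<partial>lborel)"
        by (intro nn_integral_cong nn_integral_multc) measurable
      also have "\<dots> \<le> (\<integral>\<^sup>+x. ennreal (D * l powr (- \<alpha>)) * (indicator \<Omega> x * killing x * ennreal ((u x)\<^sup>2)) \<partial>lborel)"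
      proof (rule nn_integral_mono)
        fix x
        show "(\<integral>\<^sup>+y. G y x \<partial>lborel) * ennreal ((u x)\<^sup>2) \<le> ennreal (D * l powr (- \<alpha>)) * (indicator \<Omega> x * killing x * ennreal ((u x)\<^sup>2))"
        proof (cases "x \<in> \<Omega>")
          case True
          from mult_right_mono[OF layer_weight[OF True l], of "ennreal ((u x)\<^sup>2)"] True
          show ?thesis by (simp add: G_def D_def mult.assoc)
        next
          case False
          then have "G y x = 0" for y by (simp add: G_def layer_def)
          then show ?thesis by simp
        qed
      qed
      also have "\<dots> = ennreal (D * l powr (- \<alpha>)) * A"
        unfolding A_def by (rule nn_integral_cmult) measurable
      finally show ?thesis .
    qed
    also have "(\<integral>\<^sup>+y. \<integral>\<^sup>+x. G y x * ennreal ((u x - u y)\<^sup>2) \<partial>lborel \<partial>lborel) \<le> ennreal cj * E"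
    proof -
      have "(\<integral>\<^sup>+y. \<integral>\<^sup>+x. G y x * ennreal ((u x - u y)\<^sup>2) \<partial>lborel \<partial>lborel) \<le>
        (\<integral>\<^sup>+y. \<integral>\<^sup>+x. ennreal cj * (indicator \<Omega> y * indicator \<Omega> x * (ennreal ((u x - u y)\<^sup>2) * J (x - y))) \<partial>lborel \<partial>lborel)"
      proof (intro nn_integral_mono)
        fix y x
        show "G y x * ennreal ((u x - u y)\<^sup>2) \<le> ennreal cj * (indicator \<Omega> y * indicator \<Omega> x * (ennreal ((u x - u y)\<^sup>2) * J (x - y)))"
        proof (cases "y \<in> \<Omega> \<and> layer l y x")
          case True
          then have "ennreal (d y powr (- \<alpha> - DIM('a))) \<le> ennreal cj * J (x - y)"
            using l by (intro d_powr_le_J layer_ne) (auto simp: layer_def)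
          from mult_right_mono[OF this, of "ennreal ((u x - u y)\<^sup>2)"] show ?thesis
            using True by (simp add: G_def layer_def ac_simps)
        qed (auto simp: G_def)
      qed
      also have "\<dots> = ennreal cj * E"
        unfolding E_def by (simp add: nn_integral_cmult)
      finally show ?thesis .
    qed
    finally have main: "A \<le> ennreal (2 * B * l) * (ennreal (D * l powr (- \<alpha>)) * A) + ennreal (2 * B * l) * (ennreal cj * E)"
      by (simp add: mult_left_mono add_mono)
    also have "ennreal (2 * B * l) * (ennreal (D * l powr (- \<alpha>)) * A) = ennreal (2 * B * l * (D * l powr (- \<alpha>))) * A"
      using B D l by (simp add: ennreal_mult' mult.assoc)
    also have "\<dots> \<le> ennreal (1 / 2) * A" by (intro mult_right_mono ennreal_leI ldec) auto
    also have "ennreal (2 * B * l) * (ennreal cj * E) = ennreal (2 * B * l * cj) * E"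
      using B cj_pos l by (simp add: ennreal_mult' mult.assoc)
    finally have le: "A \<le> ennreal (1 / 2) * A + ennreal (2 * B * l * cj) * E" by (simp add: add_mono)
    obtain a where a: "A = ennreal a" "0 \<le> a" using fin by (cases A) (auto simp: A_def)
    have "ennreal (1 / 2) * A + ennreal (1 / 2) * A = A"
    proof -
      have "ennreal (1 / 2) * A = ennreal (a / 2)" unfolding a by (subst ennreal_mult'[symmetric]) auto
      moreover have "ennreal (a / 2) + ennreal (a / 2) = ennreal a" using a by (subst ennreal_plus[symmetric]) auto
      ultimately show ?thesis using a by simp
    qed
    then have "ennreal (1 / 2) * A + ennreal (1 / 2) * A \<le> ennreal (1 / 2) * A + ennreal (2 * B * l * cj) * E" using le by simp
    \<comment> \<open>Half of A is cancelled on both sides, which is where A must be finite.\<close>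
    then have "ennreal (1 / 2) * A \<le> ennreal (2 * B * l * cj) * E"
      using a by (subst (asm) ennreal_add_left_cancel_le) (auto simp: ennreal_mult_eq_top_iff)
    then have "2 * (ennreal (1 / 2) * A) \<le> 2 * (ennreal (2 * B * l * cj) * E)" by (intro mult_left_mono) auto
    also have "2 * (ennreal (1 / 2) * A) = A"
      using \<open>ennreal (1 / 2) * A + ennreal (1 / 2) * A = A\<close> by (simp only: mult_2)
    also have "2 * (ennreal (2 * B * l * cj) * E) = ennreal C * E"
      unfolding C_def using B l cj_pos by (simp add: ennreal_mult' mult.assoc)
    finally show "A \<le> ennreal C * E" .
  qed
qed

end

section \<open>The energy of Green potentials\<close>

context riesz_order
begin

lemma k_set_bound:
  assumes [measurable]: "A \<in> sets borel" and fin: "emeasure lborel A < \<infinity>"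
  shows "\<exists>V. \<forall>x. (\<integral>\<^sup>+y. k (x - y) * indicator A y \<partial>lborel) \<le> ennreal V"
proof -
  obtain e :: 'a where e: "norm e = 1" using nonempty_Basis norm_Basis by blast
  let ?N = "\<integral>\<^sup>+z. k z * indicator {..1} (norm z) \<partial>lborel"
  have bd: "(\<integral>\<^sup>+y. k (x - y) * indicator A y \<partial>lborel) \<le> ?N + k e * emeasure lborel A" for x
  proof -
    have "(\<integral>\<^sup>+y. k (x - y) * indicator A y \<partial>lborel) \<le> (\<integral>\<^sup>+y. k (x - y) * indicator {..1} (norm (x - y)) + k e * indicator A y \<partial>lborel)"
    proof (rule nn_integral_mono)
      fix y
      show "k (x - y) * indicator A y \<le> k (x - y) * indicator {..1} (norm (x - y)) + k e * indicator A y"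
      proof (cases "norm (x - y) \<le> 1")
        case False
        then have "k (x - y) \<le> k e" using e by (intro k_antimono) simp
        then show ?thesis using False by (auto simp: indicator_def)
      qed (auto simp: indicator_def)
    qed
    also have "\<dots> = (\<integral>\<^sup>+y. k (x - y) * indicator {..1} (norm (x - y)) \<partial>lborel) + k e * emeasure lborel A"
      by (subst nn_integral_add) (auto simp: nn_integral_cmult_indicator)
    also have "(\<integral>\<^sup>+y. k (x - y) * indicator {..1} (norm (x - y)) \<partial>lborel) = ?N"
      by (rule nn_integral_lborel_translate(4)) measurable
    finally show ?thesis .
  qed
  have "?N + k e * emeasure lborel A < \<infinity>"
  proof -
    have "k e < \<infinity>" using e by (intro k_finite) auto
    then show ?thesis using nn_integral_k_ball[of 1] fin by (simp add: ennreal_mult_less_top)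
  qed
  then obtain V where "?N + k e * emeasure lborel A = ennreal V" by (cases "?N + k e * emeasure lborel A") auto
  then show ?thesis using bd by metis
qed

section \<open>Riesz potentials of densities\<close>

definition Kp :: "('a \<Rightarrow> ennreal) \<Rightarrow> 'a \<Rightarrow> ennreal" where
  "Kp n x = (\<integral>\<^sup>+y. k (x - y) * n y \<partial>lborel)"

lemma measurable_Kp [measurable]:
  assumes [measurable]: "n \<in> borel_measurable borel"
  shows "Kp n \<in> borel_measurable borel"
  unfolding Kp_def[abs_def] by measurable

lemma Kp_add:
  assumes [measurable]: "m \<in> borel_measurable borel" "n \<in> borel_measurable borel"
  shows "Kp (\<lambda>y. m y + n y) x = Kp m x + Kp n x"
  unfolding Kp_def by (subst nn_integral_add[symmetric]) (auto simp: distrib_left)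

lemma Kp_split:
  assumes [measurable]: "n \<in> borel_measurable borel" and r: "0 < r"
  shows "Kp n x = (\<integral>\<^sup>+y. ball_green r (x - y) * n y \<partial>lborel) + (\<integral>\<^sup>+w. poisson r (x - w) * Kp n w \<partial>lborel)"
proof -
  have "Kp n x = (\<integral>\<^sup>+y. ball_green r (x - y) * n y + poisson_pot r (x - y) * n y \<partial>lborel)"
    unfolding Kp_def using k_split[OF r] by (simp add: distrib_right)
  also have "\<dots> = (\<integral>\<^sup>+y. ball_green r (x - y) * n y \<partial>lborel) + (\<integral>\<^sup>+y. poisson_pot r (x - y) * n y \<partial>lborel)"
    by (rule nn_integral_add) measurable
  also have "(\<integral>\<^sup>+y. poisson_pot r (x - y) * n y \<partial>lborel) = (\<integral>\<^sup>+y. \<integral>\<^sup>+w. poisson r (x - w) * (k (w - y) * n y) \<partial>lborel \<partial>lborel)"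
  proof (rule nn_integral_cong)
    fix y :: 'a
    have "poisson_pot r (x - y) = (\<integral>\<^sup>+w. k (x - y - (x - w)) * poisson r (x - w) \<partial>lborel)"
      unfolding poisson_pot_def by (rule nn_integral_lborel_translate(4)[symmetric]) measurable
    also have "\<dots> = (\<integral>\<^sup>+w. poisson r (x - w) * k (w - y) \<partial>lborel)" by (simp add: algebra_simps)
    finally have "poisson_pot r (x - y) * n y = (\<integral>\<^sup>+w. poisson r (x - w) * k (w - y) * n y \<partial>lborel)"
      by (simp add: nn_integral_multc)
    then show "poisson_pot r (x - y) * n y = (\<integral>\<^sup>+w. poisson r (x - w) * (k (w - y) * n y) \<partial>lborel)"
      by (simp only: mult.assoc)
  qed
  also have "\<dots> = (\<integral>\<^sup>+w. \<integral>\<^sup>+y. poisson r (x - w) * (k (w - y) * n y) \<partial>lborel \<partial>lborel)"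
    by (rule lborel_pair.Fubini') measurable
  also have "\<dots> = (\<integral>\<^sup>+w. poisson r (x - w) * Kp n w \<partial>lborel)"
    unfolding Kp_def by (intro nn_integral_cong nn_integral_cmult) measurable
  finally show ?thesis .
qed

text \<open>Lower semicontinuity by Fatou's lemma, as the kernel is continuous away from its
  pole.\<close>

lemma Kp_liminf:
  assumes [measurable]: "n \<in> borel_measurable borel" and h: "h \<longlonglongrightarrow> (0::'a)"
  shows "Kp n x \<le> liminf (\<lambda>i. Kp n (x - h i))"
proof -
  have ne: "AE y in lborel. y \<noteq> x" by (rule AE_lborel_singleton)
  have "Kp n x = (\<integral>\<^sup>+y. liminf (\<lambda>i. k (x - h i - y) * n y) \<partial>lborel)"
    unfolding Kp_def
  proof (rule nn_integral_cong_AE)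
    show "AE y in lborel. k (x - y) * n y = liminf (\<lambda>i. k (x - h i - y) * n y)"
      using ne
    proof eventually_elim
      case (elim y)
      have l: "(\<lambda>i. x - h i - y) \<longlonglongrightarrow> x - 0 - y" by (intro tendsto_intros h)
      have ev: "\<forall>\<^sub>F i in sequentially. x - h i - y \<noteq> 0"
        using elim l by (intro tendsto_imp_eventually_ne[OF l]) auto
      have "(\<lambda>i. kc * norm (x - h i - y) powr (\<alpha> - DIM('a))) \<longlonglongrightarrow> kc * norm (x - 0 - y) powr (\<alpha> - DIM('a))"
        using elim by (intro tendsto_intros l h) auto
      then have "(\<lambda>i. ennreal (kc * norm (x - h i - y) powr (\<alpha> - DIM('a)))) \<longlonglongrightarrow> ennreal (kc * norm (x - 0 - y) powr (\<alpha> - DIM('a)))"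
        by (rule tendsto_ennrealI)
      then have "(\<lambda>i. k (x - h i - y)) \<longlonglongrightarrow> k (x - y)"
        using elim k_eq[of "x - y"] ev by (subst tendsto_cong[where g="\<lambda>i. ennreal (kc * norm (x - h i - y) powr (\<alpha> - DIM('a)))"])
          (auto elim!: eventually_mono simp: k_eq)
      moreover have "k (x - y) \<noteq> 0" "k (x - y) \<noteq> \<infinity>" using k_pos[of "x - y"] k_finite[of "x - y"] elim by auto
      ultimately have "(\<lambda>i. k (x - h i - y) * n y) \<longlonglongrightarrow> k (x - y) * n y"
        by (intro tendsto_mult_ennreal tendsto_const) auto
      then show ?case using lim_imp_Liminf[OF sequentially_bot] by metis
    qed
  qed
  also have "\<dots> \<le> liminf (\<lambda>i. \<integral>\<^sup>+y. k (x - h i - y) * n y \<partial>lborel)"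
    by (rule nn_integral_liminf) measurable
  finally show ?thesis by (simp add: Kp_def)
qed

text \<open>Expansion of the square against an even density of mass 1. The mixed term stands on the
  left, so that the identity holds even if the integrals are infinite.\<close>

lemma symmetric_square_identity:
  fixes u :: "'a \<Rightarrow> real"
  assumes [measurable]: "u \<in> borel_measurable borel" and nn: "\<And>x. 0 \<le> u x" and r: "0 < r"
  shows "(\<integral>\<^sup>+x. \<integral>\<^sup>+y. ennreal ((u x - u y)\<^sup>2) * poisson r (x - y) \<partial>lborel \<partial>lborel) +
     2 * (\<integral>\<^sup>+x. \<integral>\<^sup>+y. ennreal (u x) * ennreal (u y) * poisson r (x - y) \<partial>lborel \<partial>lborel) = 2 * (\<integral>\<^sup>+x. ennreal ((u x)\<^sup>2) \<partial>lborel)"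
proof -
  have mass: "(\<integral>\<^sup>+y. poisson r (x - y) \<partial>lborel) = 1" for x
    using nn_integral_poisson[OF r] by (subst nn_integral_lborel_translate(4)) auto
  have a: "(\<integral>\<^sup>+x. \<integral>\<^sup>+y. ennreal ((u x)\<^sup>2) * poisson r (x - y) \<partial>lborel \<partial>lborel) = (\<integral>\<^sup>+x. ennreal ((u x)\<^sup>2) \<partial>lborel)"
    by (simp add: nn_integral_cmult mass)
  have "(\<integral>\<^sup>+x. \<integral>\<^sup>+y. ennreal ((u y)\<^sup>2) * poisson r (x - y) \<partial>lborel \<partial>lborel) = (\<integral>\<^sup>+y. \<integral>\<^sup>+x. ennreal ((u y)\<^sup>2) * poisson r (x - y) \<partial>lborel \<partial>lborel)"
    by (rule lborel_pair.Fubini') measurable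
  also have "\<dots> = (\<integral>\<^sup>+x. ennreal ((u x)\<^sup>2) \<partial>lborel)"
    by (simp add: nn_integral_cmult mass poisson_minus_commute[of r _ "_::'a"] a cong: nn_integral_cong)
  finally have b: "(\<integral>\<^sup>+x. \<integral>\<^sup>+y. ennreal ((u y)\<^sup>2) * poisson r (x - y) \<partial>lborel \<partial>lborel) = (\<integral>\<^sup>+x. ennreal ((u x)\<^sup>2) \<partial>lborel)" .
  have point: "ennreal ((u x - u y)\<^sup>2) * poisson r (x - y) + 2 * (ennreal (u x) * ennreal (u y) * poisson r (x - y)) =
    ennreal ((u x)\<^sup>2) * poisson r (x - y) + ennreal ((u y)\<^sup>2) * poisson r (x - y)" for x y
  proof -
    have "ennreal ((u x - u y)\<^sup>2) + 2 * (ennreal (u x) * ennreal (u y)) = ennreal ((u x - u y)\<^sup>2) + ennreal (2 * (u x * u y))"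
      using nn by (simp add: ennreal_mult')
    also have "\<dots> = ennreal ((u x)\<^sup>2) + ennreal ((u y)\<^sup>2)"
    proof -
      have "ennreal ((u x - u y)\<^sup>2) + ennreal (2 * (u x * u y)) = ennreal ((u x - u y)\<^sup>2 + 2 * (u x * u y))"
        using nn by (intro ennreal_plus[symmetric]) auto
      also have "(u x - u y)\<^sup>2 + 2 * (u x * u y) = (u x)\<^sup>2 + (u y)\<^sup>2" by (simp add: power2_eq_square algebra_simps)
      also have "ennreal \<dots> = ennreal ((u x)\<^sup>2) + ennreal ((u y)\<^sup>2)" by (intro ennreal_plus) auto
      finally show ?thesis .
    qed
    finally show ?thesis by (simp add: distrib_right[symmetric] mult.assoc[symmetric])
  qed
  have "(\<integral>\<^sup>+x. \<integral>\<^sup>+y. ennreal ((u x - u y)\<^sup>2) * poisson r (x - y) \<partial>lborel \<partial>lborel) +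
     2 * (\<integral>\<^sup>+x. \<integral>\<^sup>+y. ennreal (u x) * ennreal (u y) * poisson r (x - y) \<partial>lborel \<partial>lborel) =
     (\<integral>\<^sup>+x. \<integral>\<^sup>+y. ennreal ((u x - u y)\<^sup>2) * poisson r (x - y) + 2 * (ennreal (u x) * ennreal (u y) * poisson r (x - y)) \<partial>lborel \<partial>lborel)"
    by (simp add: nn_integral_add nn_integral_cmult)
  also have "\<dots> = 2 * (\<integral>\<^sup>+x. ennreal ((u x)\<^sup>2) \<partial>lborel)"
    unfolding point using a b by (simp add: nn_integral_add mult_2)
  finally show ?thesis .
qed

text \<open>Shifting the point is the same as shifting the ball in the opposite direction. The mass
  gained lies in a shell of width \<rho> outside the ball of radius R0 + 1, hence at distance at
  least 1 from x, where the kernel is at most kc.\<close>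

lemma beta_shift:
  fixes R0 Mb :: real
  assumes R0: "0 \<le> R0" and x: "norm x \<le> R0" and h: "norm h \<le> \<rho>" and Mb: "0 \<le> Mb" and \<rho>: "0 \<le> \<rho>"
  shows "Kp (\<lambda>y. ennreal Mb * indicator (cball 0 (R0 + 1)) y) (x - h) \<le>
    Kp (\<lambda>y. ennreal Mb * indicator (cball 0 (R0 + 1)) y) x +
    ennreal (kc * Mb * unit_ball_vol DIM('a) * ((R0 + 1 + \<rho>) ^ DIM('a) - (R0 + 1) ^ DIM('a)))"
proof -
  let ?B = "cball (0::'a) (R0 + 1)" and ?B' = "cball (0::'a) (R0 + 1 + \<rho>)"
  have [measurable]: "?B \<in> sets borel" "?B' \<in> sets borel" by simp_all
  have "Kp (\<lambda>y. ennreal Mb * indicator ?B y) (x - h) = (\<integral>\<^sup>+y. k (x - h - (y - h)) * (ennreal Mb * indicator ?B (y - h)) \<partial>lborel)"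
    unfolding Kp_def by (subst nn_integral_lborel_translate(3)) auto
  also have "\<dots> \<le> (\<integral>\<^sup>+y. k (x - y) * (ennreal Mb * indicator ?B y) + ennreal (kc * Mb) * indicator (?B' - ?B) y \<partial>lborel)"
  proof (rule nn_integral_mono)
    fix y :: 'a
    have s: "x - h - (y - h) = x - y" by simp
    show "k (x - h - (y - h)) * (ennreal Mb * indicator ?B (y - h)) \<le> k (x - y) * (ennreal Mb * indicator ?B y) + ennreal (kc * Mb) * indicator (?B' - ?B) y"
    proof (cases "y \<in> ?B \<or> y - h \<notin> ?B")
      case False
      have "norm y \<le> norm (y - h) + norm h" using norm_triangle_ineq[of "y - h" h] by simp
      then have yB': "y \<in> ?B'" using False h by simp
      have "norm y - norm x \<le> norm (x - y)" using norm_triangle_ineq2[of y x] by (simp add: norm_minus_commute)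
      then have n1: "1 \<le> norm (x - y)" using False x by simp
      obtain e :: 'a where e: "norm e = 1" using nonempty_Basis norm_Basis by blast
      have "k (x - y) \<le> k e" using n1 e by (intro k_antimono) simp
      also have "k e = ennreal kc" using e by (subst k_eq) auto
      finally have "k (x - y) * ennreal Mb \<le> ennreal kc * ennreal Mb" by (intro mult_right_mono) auto
      then show ?thesis unfolding s using False yB' Mb kc_pos by (simp add: ennreal_mult')
    qed (auto simp: indicator_def)
  qed
  also have "\<dots> = Kp (\<lambda>y. ennreal Mb * indicator ?B y) x + ennreal (kc * Mb) * emeasure lborel (?B' - ?B)"
    unfolding Kp_def by (subst nn_integral_add) (auto simp: nn_integral_cmult_indicator)
  also have "emeasure lborel (?B' - ?B) = ennreal (unit_ball_vol DIM('a) * ((R0 + 1 + \<rho>) ^ DIM('a) - (R0 + 1) ^ DIM('a)))"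
  proof -
    have "emeasure lborel (?B' - ?B) = emeasure lborel ?B' - emeasure lborel ?B"
      using \<rho> emeasure_lborel_cball_finite[of "0::'a" "R0 + 1"] by (intro emeasure_Diff) auto
    also have "\<dots> = ennreal (unit_ball_vol DIM('a) * (R0 + 1 + \<rho>) ^ DIM('a)) - ennreal (unit_ball_vol DIM('a) * (R0 + 1) ^ DIM('a))"
      using R0 \<rho> by (simp add: emeasure_cball)
    also have "\<dots> = ennreal (unit_ball_vol DIM('a) * (R0 + 1 + \<rho>) ^ DIM('a) - unit_ball_vol DIM('a) * (R0 + 1) ^ DIM('a))"
      using R0 by (intro ennreal_minus) auto
    finally show ?thesis by (simp add: right_diff_distrib)
  qed
  also have "ennreal (kc * Mb) * \<dots> = ennreal (kc * Mb * unit_ball_vol DIM('a) * ((R0 + 1 + \<rho>) ^ DIM('a) - (R0 + 1) ^ DIM('a)))"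
    using kc_pos Mb by (simp add: ennreal_mult'[symmetric] mult.assoc)
  finally show ?thesis .
qed

end

lemma ennreal_mult_liminf_le:
  fixes a :: ennreal
  shows "a * liminf u \<le> liminf (\<lambda>i. a * u i)"
  unfolding liminf_SUP_INF SUP_mult_left_ennreal
proof (rule SUP_mono)
  fix n :: nat
  have "a * (INF i\<in>{n..}. u i) \<le> (INF i\<in>{n..}. a * u i)"
    by (intro INF_greatest mult_left_mono INF_lower) auto
  then show "\<exists>m\<in>UNIV. a * (INF i\<in>{n..}. u i) \<le> (INF i\<in>{m..}. a * u i)" by blast
qed

context corkscrew_domain
begin

section \<open>Green potentials of densities on the domain\<close>

definition Gr :: "('a \<Rightarrow> ennreal) \<Rightarrow> 'a \<Rightarrow> ennreal" where
  "Gr m x = (\<integral>\<^sup>+y. gr x y * m y \<partial>lborel)"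

lemma measurable_Gr [measurable]:
  assumes [measurable]: "m \<in> borel_measurable borel"
  shows "Gr m \<in> borel_measurable borel"
  unfolding Gr_def[abs_def] by measurable

text \<open>The density of the balayage onto the complement of the measure with density m.\<close>

definition swept :: "('a \<Rightarrow> ennreal) \<Rightarrow> 'a \<Rightarrow> ennreal" where
  "swept m w = (\<integral>\<^sup>+y. exit_density y w * m y \<partial>lborel)"

lemma measurable_swept [measurable]:
  assumes [measurable]: "m \<in> borel_measurable borel"
  shows "swept m \<in> borel_measurable borel"
  unfolding swept_def[abs_def] by measurable

lemma Gr_outside:
  assumes "\<And>y. y \<notin> \<Omega> \<Longrightarrow> m y = 0" and "x \<notin> \<Omega>"
  shows "Gr m x = 0"
proof -
  have "gr x y * m y = 0" for y using assms gr_outside[of y x] by (cases "y \<in> \<Omega>") auto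
  then have "(\<lambda>y. gr x y * m y) = (\<lambda>_. 0)" by blast
  then show ?thesis by (simp add: Gr_def)
qed

lemma Kp_eq_Gr:
  assumes [measurable]: "m \<in> borel_measurable borel" and m0: "\<And>y. y \<notin> \<Omega> \<Longrightarrow> m y = 0"
  shows "Kp m x = Gr m x + Kp (swept m) x"
proof -
  have "Kp m x = (\<integral>\<^sup>+y. gr x y * m y + eps_pot x y * m y \<partial>lborel)"
    unfolding Kp_def
  proof (rule nn_integral_cong)
    fix y
    show "k (x - y) * m y = gr x y * m y + eps_pot x y * m y"
      using k_eq_gr_eps_pot[of y x] m0[of y] by (cases "y \<in> \<Omega>") (auto simp: distrib_right)
  qed
  also have "\<dots> = Gr m x + (\<integral>\<^sup>+y. eps_pot x y * m y \<partial>lborel)"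
    unfolding Gr_def by (rule nn_integral_add) measurable
  also have "(\<integral>\<^sup>+y. eps_pot x y * m y \<partial>lborel) = (\<integral>\<^sup>+y. \<integral>\<^sup>+w. k (x - w) * (exit_density y w * m y) \<partial>lborel \<partial>lborel)"
    unfolding eps_pot_def by (intro nn_integral_cong) (simp add: nn_integral_multc[symmetric] mult.assoc)
  also have "\<dots> = (\<integral>\<^sup>+w. \<integral>\<^sup>+y. k (x - w) * (exit_density y w * m y) \<partial>lborel \<partial>lborel)"
    by (rule lborel_pair.Fubini') measurable
  also have "\<dots> = Kp (swept m) x"
    unfolding Kp_def swept_def by (intro nn_integral_cong nn_integral_cmult) measurable
  finally show ?thesis .
qed

lemma Kp_bounded:
  assumes m: "\<And>y. m y \<le> ennreal Mb * indicator A y" and A: "A \<in> sets borel" "emeasure lborel A < \<infinity>"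
  shows "\<exists>V\<ge>0. \<forall>x. Kp m x \<le> ennreal V"
proof -
  obtain V where V: "\<And>x. (\<integral>\<^sup>+y. k (x - y) * indicator A y \<partial>lborel) \<le> ennreal V" using k_set_bound[OF A] by blast
  note [measurable] = A(1)
  have "Kp m x \<le> ennreal (max 0 (\<bar>Mb\<bar> * V))" for x
  proof -
    have "Kp m x \<le> (\<integral>\<^sup>+y. ennreal \<bar>Mb\<bar> * (k (x - y) * indicator A y) \<partial>lborel)"
      unfolding Kp_def
    proof (rule nn_integral_mono)
      fix y
      have "ennreal Mb \<le> ennreal \<bar>Mb\<bar>" by (intro ennreal_leI) simp
      then have "m y \<le> ennreal \<bar>Mb\<bar> * indicator A y" by (intro order_trans[OF m] mult_right_mono) auto
      from mult_left_mono[OF this, of "k (x - y)"]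
      show "k (x - y) * m y \<le> ennreal \<bar>Mb\<bar> * (k (x - y) * indicator A y)" by (simp add: ac_simps)
    qed
    also have "\<dots> = ennreal \<bar>Mb\<bar> * (\<integral>\<^sup>+y. k (x - y) * indicator A y \<partial>lborel)" by (rule nn_integral_cmult) measurable
    also have "\<dots> \<le> ennreal \<bar>Mb\<bar> * ennreal V" by (intro mult_left_mono V) simp
    also have "\<dots> = ennreal (\<bar>Mb\<bar> * V)" by (simp add: ennreal_mult')
    also have "\<dots> \<le> ennreal (max 0 (\<bar>Mb\<bar> * V))" by (intro ennreal_leI) simp
    finally show ?thesis .
  qed
  then show ?thesis by (intro exI[of _ "max 0 (\<bar>Mb\<bar> * V)"]) auto
qed

lemma emeasure_dom_finite: "emeasure lborel \<Omega> < \<infinity>"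
  using emeasure_bounded_finite[OF bounded_dom] .

text \<open>By \<open>Kp_eq_Gr\<close> the Green potential is the Riesz potential of m minus that of
  the swept density. The former satisfies the splitting at radius r exactly, the latter is at least
  its own Poisson average; their difference is a subsolution.\<close>

lemma Gr_subsolution:
  assumes [measurable]: "m \<in> borel_measurable borel" and m0: "\<And>y. y \<notin> \<Omega> \<Longrightarrow> m y = 0"
    and fin: "Kp m x < \<infinity>" and r: "0 < r"
  shows "Gr m x \<le> (\<integral>\<^sup>+z. ball_green r (x - z) * m z \<partial>lborel) + (\<integral>\<^sup>+w. poisson r (x - w) * Gr m w \<partial>lborel)"
proof -
  let ?b = "Kp (swept m)"
  have KG: "Kp m x = Gr m x + ?b x" for x by (rule Kp_eq_Gr) (use m0 in auto)
  have "Gr m x + ?b x = (\<integral>\<^sup>+z. ball_green r (x - z) * m z \<partial>lborel) + (\<integral>\<^sup>+w. poisson r (x - w) * Kp m w \<partial>lborel)"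
    unfolding KG[symmetric] by (rule Kp_split[OF _ r]) measurable
  also have "(\<integral>\<^sup>+w. poisson r (x - w) * Kp m w \<partial>lborel) = (\<integral>\<^sup>+w. poisson r (x - w) * Gr m w + poisson r (x - w) * ?b w \<partial>lborel)"
    unfolding KG by (simp add: distrib_left)
  also have "\<dots> = (\<integral>\<^sup>+w. poisson r (x - w) * Gr m w \<partial>lborel) + (\<integral>\<^sup>+w. poisson r (x - w) * ?b w \<partial>lborel)"
    by (rule nn_integral_add) measurable
  also have "(\<integral>\<^sup>+w. poisson r (x - w) * ?b w \<partial>lborel) \<le> ?b x"
    by (subst (2) Kp_split[OF _ r]) auto
  finally have le: "?b x + Gr m x \<le> ?b x + ((\<integral>\<^sup>+z. ball_green r (x - z) * m z \<partial>lborel) + (\<integral>\<^sup>+w. poisson r (x - w) * Gr m w \<partial>lborel))"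
    by (simp add: ac_simps add_mono)
  have "?b x \<noteq> \<infinity>" using fin KG[of x] by auto
  then show ?thesis using le by (subst (asm) ennreal_add_left_cancel_le) auto
qed

text \<open>The subsolution inequality is multiplied by the Green potential and integrated.
  \<open>symmetric_square_identity\<close> turns this into an upper bound for the Dirichlet integral
  against the Poisson density, and \<open>poisson_ge\<close> replaces that density by J at distances
  above r. Boundedness of m makes the cancelled terms finite.\<close>

lemma truncated_energy_le:
  assumes [measurable]: "m \<in> borel_measurable borel" and m: "\<And>y. m y \<le> ennreal Mb * indicator \<Omega> y" and r: "0 < r"
  shows "ennreal gam * (\<integral>\<^sup>+x. \<integral>\<^sup>+y. ennreal ((enn2real (Gr m x) - enn2real (Gr m y))\<^sup>2) * (J (x - y) * indicator {r<..} (norm (x - y))) \<partial>lborel \<partial>lborel) \<le>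
    2 * (\<integral>\<^sup>+x. m x * (\<integral>\<^sup>+z. ball_green 1 z * Gr m (x - r *\<^sub>R z) \<partial>lborel) \<partial>lborel)"
proof -
  have m0: "m y = 0" if "y \<notin> \<Omega>" for y using m[of y] that by simp
  have KG: "Kp m x = Gr m x + Kp (swept m) x" for x by (rule Kp_eq_Gr) (use m0 in auto)
  obtain V where V0: "0 \<le> V" and V: "\<And>x. Kp m x \<le> ennreal V" using Kp_bounded[OF m measurable_dom emeasure_dom_finite] by blast
  have GrV: "Gr m x \<le> ennreal V" for x using V[of x] KG[of x] by (metis order_trans le_iff_add)
  define u where "u x = enn2real (Gr m x)" for x
  have u: "ennreal (u x) = Gr m x" for x
    unfolding u_def using GrV[of x] by (intro ennreal_enn2real) (auto intro: le_less_trans)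
  have u0: "0 \<le> u x" for x by (simp add: u_def)
  have [measurable]: "u \<in> borel_measurable borel" unfolding u_def[abs_def] by measurable
  define X where "X = (\<integral>\<^sup>+x. \<integral>\<^sup>+y. ennreal ((u x - u y)\<^sup>2) * poisson r (x - y) \<partial>lborel \<partial>lborel)"
  define Y where "Y = (\<integral>\<^sup>+x. \<integral>\<^sup>+y. Gr m x * Gr m y * poisson r (x - y) \<partial>lborel \<partial>lborel)"
  define N where "N = (\<integral>\<^sup>+x. ennreal ((u x)\<^sup>2) \<partial>lborel)"
  define P where "P = (\<integral>\<^sup>+x. Gr m x * (\<integral>\<^sup>+z. ball_green r (x - z) * m z \<partial>lborel) \<partial>lborel)"
  have XYN: "X + 2 * Y = 2 * N"
    unfolding X_def Y_def N_def using symmetric_square_identity[of u, OF _ u0 r] by (simp add: u)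
  have "N \<le> (\<integral>\<^sup>+x. ennreal (V\<^sup>2) * indicator \<Omega> x \<partial>lborel)"
    unfolding N_def
  proof (rule nn_integral_mono)
    fix x
    show "ennreal ((u x)\<^sup>2) \<le> ennreal (V\<^sup>2) * indicator \<Omega> x"
    proof (cases "x \<in> \<Omega>")
      case True
      have "ennreal (u x) \<le> ennreal V" using GrV[of x] u by simp
      then have "u x \<le> V" using V0 by (simp add: ennreal_le_iff)
      then have "(u x)\<^sup>2 \<le> V\<^sup>2" using u0 by (intro power_mono) auto
      then show ?thesis using True by (simp add: ennreal_leI)
    next
      case False
      then show ?thesis using Gr_outside[of m x] m0 by (simp add: u_def)
    qed
  qed
  also have "\<dots> < \<infinity>" using emeasure_dom_finite by (simp add: nn_integral_cmult_indicator ennreal_mult_less_top)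
  finally have Nfin: "N < \<infinity>" .
  have "2 * Y \<le> 2 * N" unfolding XYN[symmetric] by simp
  moreover have "2 * N < \<infinity>" using Nfin by (simp add: ennreal_mult_less_top)
  ultimately have Yfin: "2 * Y < \<infinity>" by (rule le_less_trans)
  have "N = (\<integral>\<^sup>+x. Gr m x * Gr m x \<partial>lborel)"
    unfolding N_def u[symmetric] using u0 by (simp add: ennreal_mult'[symmetric] power2_eq_square)
  also have "\<dots> \<le> (\<integral>\<^sup>+x. Gr m x * (\<integral>\<^sup>+z. ball_green r (x - z) * m z \<partial>lborel) + Gr m x * (\<integral>\<^sup>+w. poisson r (x - w) * Gr m w \<partial>lborel) \<partial>lborel)"
    unfolding distrib_left[symmetric]
    using le_less_trans[OF V ennreal_less_top] by (intro nn_integral_mono mult_left_mono Gr_subsolution m0 r) auto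
  also have "\<dots> = P + (\<integral>\<^sup>+x. Gr m x * (\<integral>\<^sup>+w. poisson r (x - w) * Gr m w \<partial>lborel) \<partial>lborel)"
    unfolding P_def by (rule nn_integral_add) measurable
  also have "(\<integral>\<^sup>+x. Gr m x * (\<integral>\<^sup>+w. poisson r (x - w) * Gr m w \<partial>lborel) \<partial>lborel) = Y"
    unfolding Y_def by (intro nn_integral_cong) (simp add: nn_integral_cmult[symmetric] ac_simps)
  finally have NPY: "N \<le> P + Y" .
  have "2 * Y + X \<le> 2 * Y + 2 * P"
    using mult_left_mono[OF NPY, of 2] XYN by (simp add: distrib_left add.commute)
  then have XP: "X \<le> 2 * P" using Yfin by (subst (asm) ennreal_add_left_cancel_le) auto
  \<comment> \<open>Rescaling the ball of radius r to the unit ball extracts r^n r^(\<alpha> - n) =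
    r^\<alpha>, the same factor that \<open>poisson_ge\<close> brings to the other side, so the
    bound keeps its form as r tends to 0.\<close>
  have P_eq: "P = ennreal (r powr \<alpha>) * (\<integral>\<^sup>+x. m x * (\<integral>\<^sup>+z. ball_green 1 z * Gr m (x - r *\<^sub>R z) \<partial>lborel) \<partial>lborel)"
  proof -
    have "P = (\<integral>\<^sup>+x. \<integral>\<^sup>+z. m z * (ball_green r (x - z) * Gr m x) \<partial>lborel \<partial>lborel)"
      unfolding P_def by (intro nn_integral_cong) (simp add: nn_integral_cmult[symmetric] ac_simps)
    also have "\<dots> = (\<integral>\<^sup>+z. \<integral>\<^sup>+x. m z * (ball_green r (x - z) * Gr m x) \<partial>lborel \<partial>lborel)"
      by (rule lborel_pair.Fubini') measurable
    also have "\<dots> = (\<integral>\<^sup>+z. m z * (\<integral>\<^sup>+x. ball_green r (x - z) * Gr m x \<partial>lborel) \<partial>lborel)"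
      by (intro nn_integral_cong nn_integral_cmult) measurable
    also have "\<dots> = (\<integral>\<^sup>+z. ennreal (r powr \<alpha>) * (m z * (\<integral>\<^sup>+x. ball_green 1 x * Gr m (z - r *\<^sub>R x) \<partial>lborel)) \<partial>lborel)"
    proof (rule nn_integral_cong)
      fix z
      have "(\<integral>\<^sup>+x. ball_green r (x - z) * Gr m x \<partial>lborel) = ennreal (\<bar>- r\<bar> ^ DIM('a)) * (\<integral>\<^sup>+x. ball_green r (z + (- r) *\<^sub>R x - z) * Gr m (z + (- r) *\<^sub>R x) \<partial>lborel)"
        by (rule nn_integral_lborel_affine) (use r in auto)
      also have "\<dots> = ennreal (r powr DIM('a)) * (\<integral>\<^sup>+x. ennreal (r powr (\<alpha> - DIM('a))) * (ball_green 1 x * Gr m (z - r *\<^sub>R x)) \<partial>lborel)"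
        using r by (simp add: ball_green_scale powr_realpow mult.assoc)
      also have "\<dots> = ennreal (r powr DIM('a)) * (ennreal (r powr (\<alpha> - DIM('a))) * (\<integral>\<^sup>+x. ball_green 1 x * Gr m (z - r *\<^sub>R x) \<partial>lborel))"
        by (subst nn_integral_cmult) auto
      also have "\<dots> = ennreal (r powr DIM('a) * r powr (\<alpha> - DIM('a))) * (\<integral>\<^sup>+x. ball_green 1 x * Gr m (z - r *\<^sub>R x) \<partial>lborel)"
        by (simp add: ennreal_mult' mult.assoc)
      also have "r powr DIM('a) * r powr (\<alpha> - DIM('a)) = r powr \<alpha>" unfolding powr_add[symmetric] by simp
      finally show "m z * (\<integral>\<^sup>+x. ball_green r (x - z) * Gr m x \<partial>lborel) = ennreal (r powr \<alpha>) * (m z * (\<integral>\<^sup>+x. ball_green 1 x * Gr m (z - r *\<^sub>R x) \<partial>lborel))"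
        by (simp add: ac_simps)
    qed
    also have "\<dots> = ennreal (r powr \<alpha>) * (\<integral>\<^sup>+x. m x * (\<integral>\<^sup>+z. ball_green 1 z * Gr m (x - r *\<^sub>R z) \<partial>lborel) \<partial>lborel)"
      by (rule nn_integral_cmult) measurable
    finally show ?thesis .
  qed
  let ?E = "\<integral>\<^sup>+x. \<integral>\<^sup>+y. ennreal ((u x - u y)\<^sup>2) * (J (x - y) * indicator {r<..} (norm (x - y))) \<partial>lborel \<partial>lborel"
  have "ennreal (r powr \<alpha>) * (ennreal gam * ?E) = (\<integral>\<^sup>+x. \<integral>\<^sup>+y. ennreal (r powr \<alpha> * gam) * (ennreal ((u x - u y)\<^sup>2) * (J (x - y) * indicator {r<..} (norm (x - y)))) \<partial>lborel \<partial>lborel)"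
    by (simp add: nn_integral_cmult ennreal_mult' mult.assoc)
  also have "\<dots> \<le> X" unfolding X_def
  proof (intro nn_integral_mono)
    fix x y
    show "ennreal (r powr \<alpha> * gam) * (ennreal ((u x - u y)\<^sup>2) * (J (x - y) * indicator {r<..} (norm (x - y)))) \<le> ennreal ((u x - u y)\<^sup>2) * poisson r (x - y)"
    proof (cases "r < norm (x - y)")
      case True
      from mult_left_mono[OF poisson_ge[OF r True], of "ennreal ((u x - u y)\<^sup>2)"] show ?thesis
        using True by (simp add: ac_simps)
    qed simp
  qed
  also have "\<dots> \<le> 2 * P" by (rule XP)
  finally have "ennreal (r powr \<alpha>) * (ennreal gam * ?E) \<le> ennreal (r powr \<alpha>) * (2 * (\<integral>\<^sup>+x. m x * (\<integral>\<^sup>+z. ball_green 1 z * Gr m (x - r *\<^sub>R z) \<partial>lborel) \<partial>lborel))"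
    unfolding P_eq by (simp add: ac_simps)
  then show ?thesis using r by (subst (asm) ennreal_mult_le_mult_iff) (auto simp: u_def)
qed

text \<open>As r tends to 0, averages of \<open>Gr m\<close> over small balls must be bounded from
  above. With a constant density \<beta> \<ge> m on a larger ball, \<open>Gr m\<close> is
  \<open>Kp \<beta>\<close> minus \<open>Kp n\<close> for a nonnegative n: \<open>beta_shift\<close>
  bounds the averages of the first from above, \<open>Kp_liminf\<close> those of the second from
  below.\<close>

lemma energy_le:
  assumes [measurable]: "m \<in> borel_measurable borel" and m: "\<And>y. m y \<le> ennreal Mb * indicator \<Omega> y" and Mb: "0 \<le> Mb"
  shows "(\<integral>\<^sup>+x. \<integral>\<^sup>+y. ennreal ((enn2real (Gr m x) - enn2real (Gr m y))\<^sup>2) * J (x - y) \<partial>lborel \<partial>lborel) \<le>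
    2 * (\<integral>\<^sup>+x. m x * Gr m x \<partial>lborel)"
proof -
  have m0: "m y = 0" if "y \<notin> \<Omega>" for y using m[of y] that by simp
  obtain R0 where R0: "0 \<le> R0" "\<And>x. x \<in> \<Omega> \<Longrightarrow> norm x \<le> R0"
    using bounded_dom unfolding bounded_iff by (metis order_trans abs_ge_self abs_ge_zero)
  let ?B = "cball (0::'a) (R0 + 1)"
  \<comment> \<open>The radius R0 + 1 leaves distance 1 between \<open>\<Omega>\<close> and the
    boundary of the ball, as \<open>beta_shift\<close> requires.\<close>
  define \<beta> where "\<beta> = (\<lambda>y. ennreal Mb * indicator ?B y)"
  have [measurable]: "?B \<in> sets borel" by simp
  have [measurable]: "\<beta> \<in> borel_measurable borel" unfolding \<beta>_def by measurable
  have m\<beta>: "m y \<le> \<beta> y" for y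
    using m[of y] R0(2)[of y] by (cases "y \<in> \<Omega>") (auto simp: \<beta>_def)
  have KG: "Kp m x = Gr m x + Kp (swept m) x" for x by (rule Kp_eq_Gr) (use m0 in auto)
  define n where "n y = swept m y + (\<beta> y - m y)" for y
  have [measurable]: "n \<in> borel_measurable borel" unfolding n_def[abs_def] by measurable
  have uw: "Kp \<beta> x = Gr m x + Kp n x" for x
  proof -
    have "\<beta> = (\<lambda>y. m y + (\<beta> y - m y))"
      using m\<beta> by (intro ext) (simp add: add_diff_inverse_ennreal)
    then have "Kp \<beta> x = Kp m x + Kp (\<lambda>y. \<beta> y - m y) x"
      using Kp_add[of m "\<lambda>y. \<beta> y - m y" x] by simp
    then show ?thesis unfolding n_def KG by (simp add: Kp_add add.assoc)
  qed
  \<comment> \<open>m is paired with the averages of f at scale r, weighted by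
    \<open>ball_green 1\<close> of total mass \<open>gam\<close>. Additivity of I in f lets the
    splitting of \<open>Kp \<beta>\<close> be used without subtraction.\<close>
  define I where "I f r = (\<integral>\<^sup>+x. m x * (\<integral>\<^sup>+z. ball_green 1 z * f (x - r *\<^sub>R z) \<partial>lborel) \<partial>lborel)" for f :: "'a \<Rightarrow> ennreal" and r :: real
  have I0: "I f 0 = ennreal gam * (\<integral>\<^sup>+x. m x * f x \<partial>lborel)" if [measurable]: "f \<in> borel_measurable borel" for f
  proof -
    have "I f 0 = (\<integral>\<^sup>+x. ennreal gam * (m x * f x) \<partial>lborel)"
      unfolding I_def by (intro nn_integral_cong) (simp add: nn_integral_multc nn_integral_ball_green_1, simp add: ac_simps)
    also have "\<dots> = ennreal gam * (\<integral>\<^sup>+x. m x * f x \<partial>lborel)" by (rule nn_integral_cmult) measurable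
    finally show ?thesis .
  qed
  have Iadd: "I (Kp \<beta>) r = I (Gr m) r + I (Kp n) r" for r
    unfolding I_def uw by (simp add: distrib_left nn_integral_add)
  define \<epsilon> where "\<epsilon> r = kc * Mb * unit_ball_vol DIM('a) * ((R0 + 1 + r) ^ DIM('a) - (R0 + 1) ^ DIM('a))" for r
  define M where "M = enn2real (\<integral>\<^sup>+x. m x \<partial>lborel)"
  have "(\<integral>\<^sup>+x. m x \<partial>lborel) \<le> (\<integral>\<^sup>+x. ennreal Mb * indicator \<Omega> x \<partial>lborel)" by (intro nn_integral_mono m)
  also have "\<dots> < \<infinity>" using emeasure_dom_finite by (simp add: nn_integral_cmult_indicator ennreal_mult_less_top)
  finally have M: "(\<integral>\<^sup>+x. m x \<partial>lborel) = ennreal M" "0 \<le> M" by (auto simp: M_def)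
  have \<epsilon>0: "0 \<le> \<epsilon> r" if "0 \<le> r" for r
  proof -
    have "(R0 + 1) ^ DIM('a) \<le> (R0 + 1 + r) ^ DIM('a)" using that R0 by (intro power_mono) auto
    then show ?thesis unfolding \<epsilon>_def using kc_pos Mb by (auto intro!: mult_nonneg_nonneg)
  qed
  have upper: "I (Kp \<beta>) r \<le> I (Kp \<beta>) 0 + ennreal (\<epsilon> r * gam * M)" if r: "0 \<le> r" for r
  proof -
    have "I (Kp \<beta>) r \<le> (\<integral>\<^sup>+x. m x * (\<integral>\<^sup>+z. ball_green 1 z * (Kp \<beta> x + ennreal (\<epsilon> r)) \<partial>lborel) \<partial>lborel)"
      unfolding I_def
    proof (rule nn_integral_mono)
      fix x
      show "m x * (\<integral>\<^sup>+z. ball_green 1 z * Kp \<beta> (x - r *\<^sub>R z) \<partial>lborel) \<le> m x * (\<integral>\<^sup>+z. ball_green 1 z * (Kp \<beta> x + ennreal (\<epsilon> r)) \<partial>lborel)"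
      proof (cases "x \<in> \<Omega>")
        case True
        show ?thesis
        proof (rule mult_left_mono, rule nn_integral_mono)
          fix z
          show "ball_green 1 z * Kp \<beta> (x - r *\<^sub>R z) \<le> ball_green 1 z * (Kp \<beta> x + ennreal (\<epsilon> r))"
          proof (cases "norm z \<le> 1")
            case z: True
            have "norm (r *\<^sub>R z) \<le> r" using r z mult_left_le[of "norm z" r] by simp
            then have "Kp \<beta> (x - r *\<^sub>R z) \<le> Kp \<beta> x + ennreal (\<epsilon> r)"
              unfolding \<beta>_def \<epsilon>_def using R0(1) R0(2)[OF True] Mb r by (intro beta_shift)
            then show ?thesis by (intro mult_left_mono) auto
          qed (simp add: ball_green_zero)
        qed simp
      qed (simp add: m0)
    qed
    also have "\<dots> = (\<integral>\<^sup>+x. ennreal gam * (m x * Kp \<beta> x) + ennreal (\<epsilon> r * gam) * m x \<partial>lborel)"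
    proof (rule nn_integral_cong)
      fix x
      have "m x * (\<integral>\<^sup>+z. ball_green 1 z * (Kp \<beta> x + ennreal (\<epsilon> r)) \<partial>lborel) = m x * (ennreal gam * (Kp \<beta> x + ennreal (\<epsilon> r)))"
        by (simp add: nn_integral_multc nn_integral_ball_green_1)
      also have "\<dots> = ennreal gam * (m x * Kp \<beta> x) + (ennreal (\<epsilon> r) * ennreal gam) * m x"
        by (simp add: distrib_left ac_simps)
      finally show "m x * (\<integral>\<^sup>+z. ball_green 1 z * (Kp \<beta> x + ennreal (\<epsilon> r)) \<partial>lborel) = ennreal gam * (m x * Kp \<beta> x) + ennreal (\<epsilon> r * gam) * m x"
        using \<epsilon>0[OF r] by (simp add: ennreal_mult')
    qed
    also have "\<dots> = I (Kp \<beta>) 0 + ennreal (\<epsilon> r * gam) * ennreal M"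
      by (subst nn_integral_add) (auto simp: nn_integral_cmult I0 M)
    finally show ?thesis using M(2) by (simp add: ennreal_mult'')
  qed
  define rr where "rr i = 1 / real (Suc i)" for i
  have rr: "0 < rr i" "rr j \<le> rr i" if "i \<le> j" for i j using that by (auto simp: rr_def field_simps)
  have rr0: "rr \<longlonglongrightarrow> 0" unfolding rr_def[abs_def] by (intro LIMSEQ_Suc lim_1_over_n)
  have fatou: "I (Kp n) 0 \<le> liminf (\<lambda>i. I (Kp n) (rr i))"
  proof -
    have "(\<integral>\<^sup>+z. ball_green 1 z * Kp n x \<partial>lborel) \<le> liminf (\<lambda>i. \<integral>\<^sup>+z. ball_green 1 z * Kp n (x - rr i *\<^sub>R z) \<partial>lborel)" for x
    proof -
      have "(\<integral>\<^sup>+z. ball_green 1 z * Kp n x \<partial>lborel) \<le> (\<integral>\<^sup>+z. liminf (\<lambda>i. ball_green 1 z * Kp n (x - rr i *\<^sub>R z)) \<partial>lborel)"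
      proof (rule nn_integral_mono)
        fix z :: 'a
        have "(\<lambda>i. rr i *\<^sub>R z) \<longlonglongrightarrow> 0 *\<^sub>R z" by (intro tendsto_intros rr0)
        then have "Kp n x \<le> liminf (\<lambda>i. Kp n (x - rr i *\<^sub>R z))" by (intro Kp_liminf) auto
        then have "ball_green 1 z * Kp n x \<le> ball_green 1 z * liminf (\<lambda>i. Kp n (x - rr i *\<^sub>R z))" by (intro mult_left_mono) auto
        also have "\<dots> \<le> liminf (\<lambda>i. ball_green 1 z * Kp n (x - rr i *\<^sub>R z))"
          by (rule ennreal_mult_liminf_le)
        finally show "ball_green 1 z * Kp n x \<le> liminf (\<lambda>i. ball_green 1 z * Kp n (x - rr i *\<^sub>R z))" .
      qed
      also have "\<dots> \<le> liminf (\<lambda>i. \<integral>\<^sup>+z. ball_green 1 z * Kp n (x - rr i *\<^sub>R z) \<partial>lborel)"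
        by (rule nn_integral_liminf) measurable
      finally show ?thesis .
    qed
    note inner = this
    have "I (Kp n) 0 \<le> (\<integral>\<^sup>+x. liminf (\<lambda>i. m x * (\<integral>\<^sup>+z. ball_green 1 z * Kp n (x - rr i *\<^sub>R z) \<partial>lborel)) \<partial>lborel)"
      unfolding I_def
    proof (rule nn_integral_mono)
      fix x
      have "m x * (\<integral>\<^sup>+z. ball_green 1 z * Kp n (x - 0 *\<^sub>R z) \<partial>lborel) \<le> m x * liminf (\<lambda>i. \<integral>\<^sup>+z. ball_green 1 z * Kp n (x - rr i *\<^sub>R z) \<partial>lborel)"
        using inner[of x] by (intro mult_left_mono) auto
      also have "\<dots> \<le> liminf (\<lambda>i. m x * (\<integral>\<^sup>+z. ball_green 1 z * Kp n (x - rr i *\<^sub>R z) \<partial>lborel))"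
        by (rule ennreal_mult_liminf_le)
      finally show "m x * (\<integral>\<^sup>+z. ball_green 1 z * Kp n (x - 0 *\<^sub>R z) \<partial>lborel) \<le> liminf (\<lambda>i. m x * (\<integral>\<^sup>+z. ball_green 1 z * Kp n (x - rr i *\<^sub>R z) \<partial>lborel))" .
    qed
    also have "\<dots> \<le> liminf (\<lambda>i. I (Kp n) (rr i))"
      unfolding I_def by (rule nn_integral_liminf) measurable
    finally show ?thesis .
  qed
  define D where "D x y = ennreal ((enn2real (Gr m x) - enn2real (Gr m y))\<^sup>2)" for x y
  have [measurable]: "(\<lambda>(x, y). D x y) \<in> borel_measurable (borel \<Otimes>\<^sub>M borel)" unfolding D_def by measurable
  define E where "E r = (\<integral>\<^sup>+x. \<integral>\<^sup>+y. D x y * (J (x - y) * indicator {r<..} (norm (x - y))) \<partial>lborel \<partial>lborel)" for r :: real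
  have EI: "ennreal gam * E r \<le> 2 * I (Gr m) r" if "0 < r" for r
    unfolding E_def D_def I_def using m that by (intro truncated_energy_le) auto
  have Emono: "E r \<le> E s" if "s \<le> r" for r s
    unfolding E_def using that by (intro nn_integral_mono mult_left_mono) (auto simp: indicator_def)
  have "I (Kp \<beta>) 0 < \<infinity>"
  proof -
    have "emeasure lborel ?B < \<infinity>" using emeasure_lborel_cball_finite by (simp add: less_top)
    then obtain V where V: "\<And>x. Kp \<beta> x \<le> ennreal V" using Kp_bounded[of \<beta> Mb ?B] by (auto simp: \<beta>_def)
    have "(\<integral>\<^sup>+x. m x * Kp \<beta> x \<partial>lborel) \<le> (\<integral>\<^sup>+x. m x * ennreal V \<partial>lborel)"
      by (intro nn_integral_mono mult_left_mono V) auto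
    also have "\<dots> < \<infinity>" by (simp add: nn_integral_multc M ennreal_mult_less_top)
    finally show ?thesis by (simp add: I0 ennreal_mult_less_top)
  qed
  then obtain b where b: "I (Kp \<beta>) 0 = ennreal b" "0 \<le> b" by (cases "I (Kp \<beta>) 0") auto
  \<comment> \<open>The truncation of the energy stays at level j while the averaging radius
    \<open>rr i\<close> shrinks, so that on the left only \<open>I (Kp n)\<close> varies and Fatou's
    lemma applies to it.\<close>
  have Erj: "ennreal gam * E (rr j) \<le> 2 * I (Gr m) 0" for j
  proof -
    have step: "ennreal gam * E (rr j) + 2 * I (Kp n) (rr i) \<le> ennreal (2 * (b + \<epsilon> (rr i) * gam * M))" if "j \<le> i" for i
    proof -
      have "ennreal gam * E (rr j) + 2 * I (Kp n) (rr i) \<le> ennreal gam * E (rr i) + 2 * I (Kp n) (rr i)"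
        using Emono[OF rr(2)[OF that]] by (intro add_right_mono mult_left_mono) auto
      also have "\<dots> \<le> 2 * I (Gr m) (rr i) + 2 * I (Kp n) (rr i)"
        by (intro add_right_mono EI rr(1)[OF order_refl])
      also have "\<dots> = 2 * I (Kp \<beta>) (rr i)" unfolding Iadd by (simp add: distrib_left)
      also have "\<dots> \<le> 2 * (ennreal b + ennreal (\<epsilon> (rr i) * gam * M))"
        unfolding b(1)[symmetric] using rr(1)[OF order_refl, of i] by (intro mult_left_mono upper) auto
      also have "\<dots> = 2 * ennreal (b + \<epsilon> (rr i) * gam * M)"
        using b \<epsilon>0[of "rr i"] rr(1)[OF order_refl, of i] gam_pos M by (subst ennreal_plus) auto
      also have "\<dots> = ennreal (2 * (b + \<epsilon> (rr i) * gam * M))" by (subst ennreal_mult') auto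
      finally show ?thesis .
    qed
    have "ennreal gam * E (rr j) \<le> ennreal (2 * (b + \<epsilon> (rr j) * gam * M))"
      by (rule order_trans[OF _ step[OF order_refl]]) simp
    then have "ennreal gam * E (rr j) < \<infinity>" by (rule le_less_trans) simp
    then obtain c where c: "ennreal gam * E (rr j) = ennreal c" "0 \<le> c" by (cases "ennreal gam * E (rr j)") auto
    have Wi: "I (Kp n) (rr i) \<le> ennreal (b + \<epsilon> (rr i) * gam * M - c / 2)" if "j \<le> i" for i
    proof -
      note st = step[OF that, unfolded c(1)]
      have "2 * I (Kp n) (rr i) \<le> ennreal (2 * (b + \<epsilon> (rr i) * gam * M))"
        using order_trans[OF _ st, of "2 * I (Kp n) (rr i)"] by simp
      then have "2 * I (Kp n) (rr i) < \<infinity>" by (rule le_less_trans) simp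
      then have "I (Kp n) (rr i) < \<infinity>" by (auto simp: ennreal_mult_less_top)
      then obtain w where w: "I (Kp n) (rr i) = ennreal w" "0 \<le> w" by (cases "I (Kp n) (rr i)") auto
      have "ennreal (c + 2 * w) \<le> ennreal (2 * (b + \<epsilon> (rr i) * gam * M))"
        using st c w by (simp add: ennreal_mult' ennreal_plus)
      moreover have "0 \<le> 2 * (b + \<epsilon> (rr i) * gam * M)"
        using b \<epsilon>0[of "rr i"] rr(1)[OF order_refl, of i] gam_pos M by simp
      ultimately have "c + 2 * w \<le> 2 * (b + \<epsilon> (rr i) * gam * M)" by (simp add: ennreal_le_iff)
      then show ?thesis unfolding w by (intro ennreal_leI) simp
    qed
    have "I (Kp n) 0 \<le> liminf (\<lambda>i. ennreal (b + \<epsilon> (rr i) * gam * M - c / 2))"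
    proof (rule order_trans[OF fatou], rule Liminf_mono)
      show "\<forall>\<^sub>F i in sequentially. I (Kp n) (rr i) \<le> ennreal (b + \<epsilon> (rr i) * gam * M - c / 2)"
        using eventually_ge_at_top[of j] by eventually_elim (rule Wi)
    qed
    also have "(\<lambda>i. ennreal (b + \<epsilon> (rr i) * gam * M - c / 2)) \<longlonglongrightarrow> ennreal (b + \<epsilon> 0 * gam * M - c / 2)"
      unfolding \<epsilon>_def by (intro tendsto_intros rr0)
    then have "liminf (\<lambda>i. ennreal (b + \<epsilon> (rr i) * gam * M - c / 2)) = ennreal (b - c / 2)"
      using lim_imp_Liminf[OF sequentially_bot] by (simp add: \<epsilon>_def)
    finally have W: "I (Kp n) 0 \<le> ennreal (b - c / 2)" .
    have sum: "ennreal b = I (Gr m) 0 + I (Kp n) 0" using Iadd[of 0] b by simp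
    obtain w g where wg: "I (Kp n) 0 = ennreal w" "0 \<le> w" "I (Gr m) 0 = ennreal g" "0 \<le> g"
      using sum by (cases "I (Kp n) 0"; cases "I (Gr m) 0") auto
    have bwg: "b = g + w" using sum wg b by (simp add: ennreal_plus[symmetric] del: ennreal_plus)
    \<comment> \<open>Since \<open>ennreal\<close> sends negative numbers to 0, W is informative
      only for b - c / 2 \<ge> 0. The other case is excluded by the limit of \<open>step\<close>,
      which gives c \<le> 2 b.\<close>
    have "c / 2 \<le> g"
    proof (cases "0 \<le> b - c / 2")
      case True
      then have "w \<le> b - c / 2" using W wg by (simp add: ennreal_le_iff)
      then show ?thesis using bwg by simp
    next
      case False
      have "ennreal c \<le> ennreal (2 * (b + \<epsilon> (rr i) * gam * M))" if "j \<le> i" for i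
        using order_trans[OF _ step[OF that, unfolded c(1)], of "ennreal c"] by simp
      moreover have "(\<lambda>i. ennreal (2 * (b + \<epsilon> (rr i) * gam * M))) \<longlonglongrightarrow> ennreal (2 * (b + \<epsilon> 0 * gam * M))"
        unfolding \<epsilon>_def by (intro tendsto_intros rr0)
      ultimately have "ennreal c \<le> ennreal (2 * (b + \<epsilon> 0 * gam * M))"
        by (intro tendsto_lowerbound[OF _ _ sequentially_bot]) (auto simp: eventually_sequentially)
      then have "c \<le> 2 * b" using b by (simp add: \<epsilon>_def ennreal_le_iff)
      then show ?thesis using False by simp
    qed
    then have "ennreal c \<le> ennreal (2 * g)" by (intro ennreal_leI) simp
    then show ?thesis unfolding c wg using wg by (simp add: ennreal_mult')
  qed
  have "(\<integral>\<^sup>+x. \<integral>\<^sup>+y. D x y * J (x - y) \<partial>lborel \<partial>lborel) = (SUP j. E (rr j))"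
  proof -
    have inc: "incseq (\<lambda>j y. D x y * (J (x - y) * indicator {rr j<..} (norm (x - y))))" for x
      using rr(2) by (auto simp: incseq_def le_fun_def indicator_def intro!: mult_left_mono) (meson le_less_trans)
    have pt: "D x y * J (x - y) = (SUP j. D x y * (J (x - y) * indicator {rr j<..} (norm (x - y))))" for x y
    proof (rule antisym)
      show "D x y * J (x - y) \<le> (SUP j. D x y * (J (x - y) * indicator {rr j<..} (norm (x - y))))"
      proof (cases "x = y")
        case False
        then obtain j where "inverse (real (Suc j)) < norm (x - y)" using reals_Archimedean[of "norm (x - y)"] by auto
        then have "rr j < norm (x - y)" by (simp add: rr_def inverse_eq_divide)
        then show ?thesis by (intro SUP_upper2[of j]) auto
      qed (simp add: D_def)
      show "(SUP j. D x y * (J (x - y) * indicator {rr j<..} (norm (x - y)))) \<le> D x y * J (x - y)"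
        by (intro SUP_least mult_left_mono) (auto simp: indicator_def)
    qed
    have "(\<integral>\<^sup>+x. \<integral>\<^sup>+y. D x y * J (x - y) \<partial>lborel \<partial>lborel) =
      (\<integral>\<^sup>+x. (SUP j. \<integral>\<^sup>+y. D x y * (J (x - y) * indicator {rr j<..} (norm (x - y))) \<partial>lborel) \<partial>lborel)"
      unfolding pt by (intro nn_integral_cong nn_integral_monotone_convergence_SUP inc) measurable
    also have "\<dots> = (SUP j. E (rr j))"
      unfolding E_def
    proof (rule nn_integral_monotone_convergence_SUP)
      show "incseq (\<lambda>j x. \<integral>\<^sup>+y. D x y * (J (x - y) * indicator {rr j<..} (norm (x - y))) \<partial>lborel)"
        using inc by (auto simp: incseq_def le_fun_def intro!: nn_integral_mono)
    qed measurable
    finally show ?thesis .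
  qed
  then have "ennreal gam * (\<integral>\<^sup>+x. \<integral>\<^sup>+y. D x y * J (x - y) \<partial>lborel \<partial>lborel) = (SUP j. ennreal gam * E (rr j))"
    by (simp add: SUP_mult_left_ennreal)
  also have "\<dots> \<le> 2 * I (Gr m) 0" by (intro SUP_least Erj)
  also have "\<dots> = ennreal gam * (2 * (\<integral>\<^sup>+x. m x * Gr m x \<partial>lborel))" by (simp add: I0 ac_simps)
  finally show ?thesis using gam_pos by (subst (asm) ennreal_mult_le_mult_iff) (auto simp: D_def)
qed

section \<open>The operator norm\<close>

abbreviation wt :: "'a \<Rightarrow> ennreal" where "wt x \<equiv> indicator \<Omega> x * killing x"

text \<open>A pair with exactly one point in \<open>\<Omega>\<close> contributes u^2 J there, and
  integrating out the other point yields the killing density. Such pairs occur in both orders, hence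
  the factor 2.\<close>

lemma nonlocal_energy_split:
  fixes u :: "'a \<Rightarrow> real"
  assumes [measurable]: "u \<in> borel_measurable borel" and u0: "\<And>x. x \<notin> \<Omega> \<Longrightarrow> u x = 0"
  shows "(\<integral>\<^sup>+y. \<integral>\<^sup>+x. indicator \<Omega> y * indicator \<Omega> x * (ennreal ((u x - u y)\<^sup>2) * J (x - y)) \<partial>lborel \<partial>lborel) +
      2 * (\<integral>\<^sup>+x. wt x * ennreal ((u x)\<^sup>2) \<partial>lborel) \<le>
    (\<integral>\<^sup>+x. \<integral>\<^sup>+y. ennreal ((u x - u y)\<^sup>2) * J (x - y) \<partial>lborel \<partial>lborel)"
proof -
  let ?a = "\<lambda>x y. indicator \<Omega> x * indicator \<Omega> y * (ennreal ((u y - u x)\<^sup>2) * J (y - x))"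
  let ?b = "\<lambda>x y. (indicator \<Omega> x * ennreal ((u x)\<^sup>2)) * (indicator (- \<Omega>) y * J (x - y))"
  have A: "(\<integral>\<^sup>+x. \<integral>\<^sup>+y. ?b x y \<partial>lborel \<partial>lborel) = (\<integral>\<^sup>+x. wt x * ennreal ((u x)\<^sup>2) \<partial>lborel)"
    unfolding killing_def by (intro nn_integral_cong, subst nn_integral_cmult) (auto simp: ac_simps)
  have A': "(\<integral>\<^sup>+x. \<integral>\<^sup>+y. ?b y x \<partial>lborel \<partial>lborel) = (\<integral>\<^sup>+x. wt x * ennreal ((u x)\<^sup>2) \<partial>lborel)"
    unfolding A[symmetric] by (rule lborel_pair.Fubini') measurable
  have "(\<integral>\<^sup>+y. \<integral>\<^sup>+x. indicator \<Omega> y * indicator \<Omega> x * (ennreal ((u x - u y)\<^sup>2) * J (x - y)) \<partial>lborel \<partial>lborel) +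
      2 * (\<integral>\<^sup>+x. wt x * ennreal ((u x)\<^sup>2) \<partial>lborel) =
      (\<integral>\<^sup>+x. \<integral>\<^sup>+y. ?a x y \<partial>lborel \<partial>lborel) + ((\<integral>\<^sup>+x. \<integral>\<^sup>+y. ?b x y \<partial>lborel \<partial>lborel) + (\<integral>\<^sup>+x. \<integral>\<^sup>+y. ?b y x \<partial>lborel \<partial>lborel))"
    unfolding A A' mult_2 ..
  also have "\<dots> = (\<integral>\<^sup>+x. \<integral>\<^sup>+y. ?a x y + (?b x y + ?b y x) \<partial>lborel \<partial>lborel)"
    by (simp add: nn_integral_add)
  also have "\<dots> \<le> (\<integral>\<^sup>+x. \<integral>\<^sup>+y. ennreal ((u x - u y)\<^sup>2) * J (x - y) \<partial>lborel \<partial>lborel)"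
  proof (intro nn_integral_mono)
    fix x y
    have s: "(u y - u x)\<^sup>2 = (u x - u y)\<^sup>2" by (rule power2_commute)
    show "?a x y + (?b x y + ?b y x) \<le> ennreal ((u x - u y)\<^sup>2) * J (x - y)"
      unfolding s J_minus_commute[of y x] using u0[of x] u0[of y]
      by (cases "x \<in> \<Omega>"; cases "y \<in> \<Omega>") auto
  qed
  finally show ?thesis .
qed

text \<open>Let u be the Green potential, A its weighted square integral and E its censored energy.
  The energy bound reads E + 2 A \<le> 2 U, and A \<le> C E improves it to \<theta> A \<le> U with
  \<theta> = 1 + 1 / (2 C). Since U^2 \<le> N A by Cauchy-Schwarz, \<theta>^2 A \<le> N follows. The
  bound on \<open>wt y * f y\<close> keeps A, E and U finite.\<close>

lemma contraction_bounded:
  assumes C: "0 < C" and hardyC: "\<And>u. u \<in> borel_measurable borel \<Longrightarrow>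
     (\<integral>\<^sup>+x. wt x * ennreal ((u x)\<^sup>2) \<partial>lborel) < \<infinity> \<Longrightarrow>
     (\<integral>\<^sup>+x. wt x * ennreal ((u x)\<^sup>2) \<partial>lborel) \<le> ennreal C *
     (\<integral>\<^sup>+y. \<integral>\<^sup>+x. indicator \<Omega> y * indicator \<Omega> x * (ennreal ((u x - u y)\<^sup>2) * J (x - y)) \<partial>lborel \<partial>lborel)"
    and [measurable]: "f \<in> borel_measurable borel" and f: "\<And>y. wt y * f y \<le> ennreal Mb * indicator \<Omega> y" and Mb: "0 \<le> Mb"
  shows "(\<integral>\<^sup>+x. wt x * (Gr (\<lambda>y. wt y * f y) x)\<^sup>2 \<partial>lborel) \<le> ennreal (1 / (1 + 1 / (2 * C))\<^sup>2) * (\<integral>\<^sup>+x. wt x * (f x)\<^sup>2 \<partial>lborel)"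
proof -
  define m where "m y = wt y * f y" for y
  have [measurable]: "m \<in> borel_measurable borel" unfolding m_def[abs_def] by measurable
  have m: "m y \<le> ennreal Mb * indicator \<Omega> y" for y using f by (simp add: m_def)
  have m0: "y \<notin> \<Omega> \<Longrightarrow> m y = 0" for y by (simp add: m_def)
  have KG: "Kp m x = Gr m x + Kp (swept m) x" for x by (rule Kp_eq_Gr) (use m0 in auto)
  obtain V where V0: "0 \<le> V" and V: "\<And>x. Kp m x \<le> ennreal V" using Kp_bounded[OF m measurable_dom emeasure_dom_finite] by blast
  have GrV: "Gr m x \<le> ennreal V" for x using V[of x] KG[of x] by (metis order_trans le_iff_add)
  define u where "u x = enn2real (Gr m x)" for x
  have u: "ennreal (u x) = Gr m x" for x
    unfolding u_def using GrV[of x] by (intro ennreal_enn2real) (auto intro: le_less_trans)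
  have u2: "ennreal ((u x)\<^sup>2) = (Gr m x)\<^sup>2" for x
    unfolding u[symmetric] by (subst ennreal_power) (auto simp: u_def)
  have [measurable]: "u \<in> borel_measurable borel" unfolding u_def[abs_def] by measurable
  have uo: "x \<notin> \<Omega> \<Longrightarrow> u x = 0" for x using Gr_outside[of m x] m0 by (simp add: u_def)
  define A where "A = (\<integral>\<^sup>+x. wt x * ennreal ((u x)\<^sup>2) \<partial>lborel)"
  define E where "E = (\<integral>\<^sup>+y. \<integral>\<^sup>+x. indicator \<Omega> y * indicator \<Omega> x * (ennreal ((u x - u y)\<^sup>2) * J (x - y)) \<partial>lborel \<partial>lborel)"
  define U where "U = (\<integral>\<^sup>+x. m x * Gr m x \<partial>lborel)"
  define N where "N = (\<integral>\<^sup>+x. wt x * (f x)\<^sup>2 \<partial>lborel)"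
  have EA: "E + 2 * A \<le> 2 * U"
  proof -
    have "E + 2 * A \<le> (\<integral>\<^sup>+x. \<integral>\<^sup>+y. ennreal ((u x - u y)\<^sup>2) * J (x - y) \<partial>lborel \<partial>lborel)"
      unfolding E_def A_def using uo by (intro nonlocal_energy_split) auto
    also have "\<dots> \<le> 2 * U"
      unfolding u_def U_def by (rule energy_le[OF _ m Mb]) measurable
    finally show ?thesis .
  qed
  have "U \<le> (\<integral>\<^sup>+x. (ennreal Mb * indicator \<Omega> x) * ennreal V \<partial>lborel)"
    unfolding U_def by (intro nn_integral_mono mult_mono m GrV) auto
  also have "\<dots> = ennreal Mb * emeasure lborel \<Omega> * ennreal V"
    by (simp add: nn_integral_multc nn_integral_cmult_indicator)
  also have "\<dots> < \<infinity>" using emeasure_dom_finite by (simp add: ennreal_mult_less_top)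
  finally have "U < \<infinity>" .
  then obtain uu where uu: "U = ennreal uu" "0 \<le> uu" by (cases U) auto
  have U2: "2 * U = ennreal (2 * uu)" using uu by (simp add: ennreal_mult')
  have "2 * A \<le> 2 * U" using order_trans[OF _ EA, of "2 * A"] by simp
  then have "2 * A < \<infinity>" unfolding U2 by (rule le_less_trans) simp
  then have Afin: "A < \<infinity>" by (auto simp: ennreal_mult_less_top)
  then obtain a where a: "A = ennreal a" "0 \<le> a" by (cases A) auto
  have "E \<le> 2 * U" using order_trans[OF _ EA, of E] by simp
  then have "E < \<infinity>" unfolding U2 by (rule le_less_trans) simp
  then obtain e where e: "E = ennreal e" "0 \<le> e" by (cases E) auto
  have "A \<le> ennreal C * E" unfolding A_def E_def using Afin by (intro hardyC) (auto simp: A_def)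
  then have ace: "a \<le> C * e" using a e C by (simp add: ennreal_mult'[symmetric] ennreal_le_iff)
  have "ennreal (e + 2 * a) \<le> ennreal (2 * uu)" using EA a e uu by (simp add: ennreal_mult' ennreal_plus)
  then have eu: "e + 2 * a \<le> 2 * uu" using uu by (simp add: ennreal_le_iff)
  define \<theta> where "\<theta> = 1 + 1 / (2 * C)"
  have \<theta>: "1 < \<theta>" using C by (simp add: \<theta>_def)
  have "a / C \<le> e" using ace C by (simp add: field_simps)
  then have au: "\<theta> * a \<le> uu" unfolding \<theta>_def using eu by (simp add: field_simps)
  have CS: "U\<^sup>2 \<le> N * A"
  proof -
    let ?M = "density lborel wt"
    have "U = (\<integral>\<^sup>+x. f x * Gr m x \<partial>?M)"
      unfolding U_def m_def[of "_"] by (subst nn_integral_density) (auto simp: mult.assoc m_def[abs_def])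
    then have "U\<^sup>2 \<le> (\<integral>\<^sup>+x. (f x)\<^sup>2 \<partial>?M) * (\<integral>\<^sup>+x. (Gr m x)\<^sup>2 \<partial>?M)"
      by (simp only:) (intro Cauchy_Schwarz_nn_integral; measurable)
    also have "(\<integral>\<^sup>+x. (f x)\<^sup>2 \<partial>?M) = N" unfolding N_def by (subst nn_integral_density) auto
    also have "(\<integral>\<^sup>+x. (Gr m x)\<^sup>2 \<partial>?M) = A" unfolding A_def u2 by (subst nn_integral_density) auto
    finally show ?thesis .
  qed
  have "A \<le> ennreal (1 / \<theta>\<^sup>2) * N"
  proof (cases "a = 0 \<or> N = \<infinity>")
    case True
    then show ?thesis using a \<theta> by (auto simp: ennreal_mult_top)
  next
    case False
    then obtain nn where nn: "N = ennreal nn" "0 \<le> nn" by (cases N) auto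
    have "(\<theta> * a)\<^sup>2 \<le> uu\<^sup>2" using au \<theta> a by (intro power_mono) auto
    also have "uu\<^sup>2 \<le> nn * a" using CS uu nn a by (simp add: ennreal_power ennreal_mult'[symmetric] ennreal_le_iff)
    finally have "\<theta>\<^sup>2 * a * a \<le> nn * a" by (simp add: power2_eq_square ac_simps)
    then have "\<theta>\<^sup>2 * a \<le> nn" using a False by (simp add: mult_le_cancel_right)
    then have "a \<le> 1 / \<theta>\<^sup>2 * nn" using \<theta> by (simp add: field_simps)
    then show ?thesis using a nn by (simp add: ennreal_mult'[symmetric] ennreal_leI)
  qed
  then show ?thesis unfolding A_def u2 N_def \<theta>_def m_def .
qed

text \<open>A general f is approximated from below by cutting it at height i and removing points
  closer than 1 / (i + 1) to the complement, where the killing density is not controlled. Monotone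
  convergence handles the inner integral, Fatou's lemma the outer one, and the constant does not
  depend on i.\<close>

lemma contraction:
  "\<exists>\<theta>>1. \<forall>f. f \<in> borel_measurable borel \<longrightarrow>
     (\<integral>\<^sup>+x. wt x * (Gr (\<lambda>y. wt y * f y) x)\<^sup>2 \<partial>lborel) \<le> ennreal (1 / \<theta>\<^sup>2) * (\<integral>\<^sup>+x. wt x * (f x)\<^sup>2 \<partial>lborel)"
proof -
  obtain C where C: "0 < C" and hardyC: "\<And>u. u \<in> borel_measurable borel \<Longrightarrow>
     (\<integral>\<^sup>+x. wt x * ennreal ((u x)\<^sup>2) \<partial>lborel) < \<infinity> \<Longrightarrow>
     (\<integral>\<^sup>+x. wt x * ennreal ((u x)\<^sup>2) \<partial>lborel) \<le> ennreal C *
     (\<integral>\<^sup>+y. \<integral>\<^sup>+x. indicator \<Omega> y * indicator \<Omega> x * (ennreal ((u x - u y)\<^sup>2) * J (x - y)) \<partial>lborel \<partial>lborel)"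
    using hardy by blast
  define \<theta> where "\<theta> = 1 + 1 / (2 * C)"
  have \<theta>: "1 < \<theta>" using C by (simp add: \<theta>_def)
  show ?thesis
  proof (intro exI[of _ \<theta>] conjI \<theta> allI impI)
    fix f :: "'a \<Rightarrow> ennreal" assume [measurable]: "f \<in> borel_measurable borel"
    define f' where "f' i y = min (f y) (of_nat i) * indicator {0..} (d y - 1 / real (Suc i))" for i y
    have [measurable]: "f' i \<in> borel_measurable borel" for i unfolding f'_def[abs_def] by measurable
    have f'_le: "f' i y \<le> f y" for i y by (auto simp: f'_def indicator_def)
    have f'_mono: "f' i y \<le> f' (Suc i) y" for i y
    proof (cases "1 / real (Suc i) \<le> d y")
      case True
      have "1 / real (Suc (Suc i)) \<le> 1 / real (Suc i)" by (simp add: field_simps)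
      then have "1 / real (Suc (Suc i)) \<le> d y" using True by simp
      moreover have "min (f y) (of_nat i) \<le> min (f y) (of_nat (Suc i))" by (intro min.mono) auto
      ultimately show ?thesis using True by (simp add: f'_def)
    qed (simp add: f'_def)
    have f'_lim: "(\<lambda>i. f' i y) \<longlonglongrightarrow> f y" if y: "y \<in> \<Omega>" for y
    proof -
      have "(\<lambda>i. min (f y) (of_nat i)) \<longlonglongrightarrow> min (f y) \<infinity>"
        by (intro tendsto_min tendsto_const) (simp add: of_nat_tendsto_top_ennreal)
      then have "(\<lambda>i. min (f y) (of_nat i)) \<longlonglongrightarrow> f y" by simp
      moreover have "\<forall>\<^sub>F i in sequentially. f' i y = min (f y) (of_nat i)"
      proof -
        have "(\<lambda>i. 1 / real (Suc i)) \<longlonglongrightarrow> 0" by (intro LIMSEQ_Suc lim_1_over_n)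
        from order_tendstoD(2)[OF this d_pos[OF y]] show ?thesis
          by eventually_elim (simp add: f'_def)
      qed
      ultimately show ?thesis by (simp add: tendsto_cong)
    qed
    define g where "g i x = Gr (\<lambda>y. wt y * f' i y) x" for i x
    define g0 where "g0 x = Gr (\<lambda>y. wt y * f y) x" for x
    have [measurable]: "g i \<in> borel_measurable borel" for i unfolding g_def[abs_def] by measurable
    have g_lim: "(\<lambda>i. g i x) \<longlonglongrightarrow> g0 x" for x
      unfolding g_def g0_def Gr_def
    proof (rule nn_integral_LIMSEQ)
      show "incseq (\<lambda>i y. gr x y * (wt y * f' i y))"
        by (intro incseq_SucI le_funI mult_left_mono f'_mono) auto
      show "(\<lambda>i. gr x y * (wt y * f' i y)) \<longlonglongrightarrow> gr x y * (wt y * f y)" for y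
      proof (cases "y \<in> \<Omega>")
        case True
        have "incseq (\<lambda>i. gr x y * (wt y * f' i y))" by (intro incseq_SucI mult_left_mono f'_mono) auto
        then have "(\<lambda>i. gr x y * (wt y * f' i y)) \<longlonglongrightarrow> (SUP i. gr x y * (wt y * f' i y))" by (rule LIMSEQ_SUP)
        also have "(SUP i. gr x y * (wt y * f' i y)) = gr x y * (wt y * (SUP i. f' i y))"
          by (simp add: SUP_mult_left_ennreal)
        also have "(SUP i. f' i y) = f y"
        proof -
          have "incseq (\<lambda>i. f' i y)" by (intro incseq_SucI f'_mono)
          then have "(\<lambda>i. f' i y) \<longlonglongrightarrow> (SUP i. f' i y)" by (rule LIMSEQ_SUP)
          then show ?thesis using f'_lim[OF True] LIMSEQ_unique by blast
        qed
        finally show ?thesis .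
      qed simp
    qed measurable
    have bound: "(\<integral>\<^sup>+x. wt x * (g i x)\<^sup>2 \<partial>lborel) \<le> ennreal (1 / \<theta>\<^sup>2) * (\<integral>\<^sup>+x. wt x * (f x)\<^sup>2 \<partial>lborel)" for i
    proof -
      define Mb where "Mb = kup * (1 / real (Suc i)) powr (- \<alpha>) * real i"
      have "(\<integral>\<^sup>+x. wt x * (g i x)\<^sup>2 \<partial>lborel) \<le> ennreal (1 / \<theta>\<^sup>2) * (\<integral>\<^sup>+x. wt x * (f' i x)\<^sup>2 \<partial>lborel)"
        unfolding g_def \<theta>_def
      proof (rule contraction_bounded[where Mb = Mb, OF C])
        show "(\<integral>\<^sup>+x. wt x * ennreal ((u x)\<^sup>2) \<partial>lborel) \<le> ennreal C *
            (\<integral>\<^sup>+y. \<integral>\<^sup>+x. indicator \<Omega> y * indicator \<Omega> x * (ennreal ((u x - u y)\<^sup>2) * J (x - y)) \<partial>lborel \<partial>lborel)"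
          if "u \<in> borel_measurable borel" "(\<integral>\<^sup>+x. wt x * ennreal ((u x)\<^sup>2) \<partial>lborel) < \<infinity>" for u
          by (rule hardyC[OF that])
        show "0 \<le> Mb" using kup_pos by (simp add: Mb_def)
        show "wt y * f' i y \<le> ennreal Mb * indicator \<Omega> y" for y
        proof (cases "y \<in> \<Omega> \<and> 1 / real (Suc i) \<le> d y")
          case True
          have "killing y \<le> ennreal (kup * d y powr (- \<alpha>))" using True by (intro killing_le) simp
          also have "\<dots> \<le> ennreal (kup * (1 / real (Suc i)) powr (- \<alpha>))"
            using True kup_pos alpha by (intro ennreal_leI mult_left_mono powr_mono2') auto
          finally have "killing y * f' i y \<le> ennreal (kup * (1 / real (Suc i)) powr (- \<alpha>)) * ennreal (real i)"
            by (intro mult_mono) (auto simp: f'_def indicator_def ennreal_of_nat_eq_real_of_nat)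
          also have "\<dots> = ennreal Mb" unfolding Mb_def using kup_pos by (simp add: ennreal_mult')
          finally show ?thesis using True by simp
        qed (auto simp: f'_def indicator_def)
      qed measurable
      also have "\<dots> \<le> ennreal (1 / \<theta>\<^sup>2) * (\<integral>\<^sup>+x. wt x * (f x)\<^sup>2 \<partial>lborel)"
        by (intro mult_left_mono nn_integral_mono power_mono f'_le) auto
      finally show ?thesis .
    qed
    have "(\<integral>\<^sup>+x. wt x * (g0 x)\<^sup>2 \<partial>lborel) \<le> (\<integral>\<^sup>+x. liminf (\<lambda>i. wt x * (g i x)\<^sup>2) \<partial>lborel)"
    proof (rule nn_integral_mono)
      fix x
      have "(\<lambda>i. g i x * g i x) \<longlonglongrightarrow> g0 x * g0 x"
        by (intro tendsto_mult_ennreal g_lim) auto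
      then have "(g0 x)\<^sup>2 = liminf (\<lambda>i. (g i x)\<^sup>2)"
        unfolding power2_eq_square by (rule lim_imp_Liminf[OF sequentially_bot, symmetric])
      then have "wt x * (g0 x)\<^sup>2 = wt x * liminf (\<lambda>i. (g i x)\<^sup>2)" by simp
      also have "\<dots> \<le> liminf (\<lambda>i. wt x * (g i x)\<^sup>2)" by (rule ennreal_mult_liminf_le)
      finally show "wt x * (g0 x)\<^sup>2 \<le> liminf (\<lambda>i. wt x * (g i x)\<^sup>2)" .
    qed
    also have "\<dots> \<le> liminf (\<lambda>i. \<integral>\<^sup>+x. wt x * (g i x)\<^sup>2 \<partial>lborel)"
      by (rule nn_integral_liminf) measurable
    also have "\<dots> \<le> liminf (\<lambda>i::nat. ennreal (1 / \<theta>\<^sup>2) * (\<integral>\<^sup>+x. wt x * (f x)\<^sup>2 \<partial>lborel))"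
      by (intro Liminf_mono always_eventually allI bound)
    also have "\<dots> = ennreal (1 / \<theta>\<^sup>2) * (\<integral>\<^sup>+x. wt x * (f x)\<^sup>2 \<partial>lborel)"
      by (rule Liminf_const[OF sequentially_bot])
    finally show "(\<integral>\<^sup>+x. wt x * (Gr (\<lambda>y. wt y * f y) x)\<^sup>2 \<partial>lborel) \<le> ennreal (1 / \<theta>\<^sup>2) * (\<integral>\<^sup>+x. wt x * (f x)\<^sup>2 \<partial>lborel)"
      by (simp only: g0_def)
  qed
qed

text \<open>The real operator is dominated pointwise by the nonnegative one applied to |f|, for
  which the contraction is known. A function measurable for \<open>om\<close> is first extended by 0
  to a Borel function on the whole space.\<close>

lemma kernel_operator_L2_bound:
  assumes \<theta>: "1 < \<theta>" and contr: "\<And>f. f \<in> borel_measurable borel \<Longrightarrow>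
     (\<integral>\<^sup>+x. wt x * (Gr (\<lambda>y. wt y * f y) x)\<^sup>2 \<partial>lborel) \<le> ennreal (1 / \<theta>\<^sup>2) * (\<integral>\<^sup>+x. wt x * (f x)\<^sup>2 \<partial>lborel)"
    and f: "f \<in> L2 om"
  shows "AE x in om. (\<integral>\<^sup>+y. green \<Omega> \<alpha> x y * ennreal \<bar>f y\<bar> \<partial>om) < \<infinity>"
    and "kernel_operator (green \<Omega> \<alpha>) om f \<in> L2 om"
    and "L2_norm om (kernel_operator (green \<Omega> \<alpha>) om f) \<le> 1 / \<theta> * L2_norm om f"
proof -
  have fm: "f \<in> borel_measurable om" and fi: "integrable om (\<lambda>x. (f x)\<^sup>2)" using f by (auto simp: L2_def)
  define f' where "f' x = indicator \<Omega> x *\<^sub>R f x" for x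
  have [measurable]: "f' \<in> borel_measurable borel"
    using fm unfolding weight_measure_def f'_def[abs_def] by (simp add: borel_measurable_restrict_space_iff)
  have f'_eq: "x \<in> \<Omega> \<Longrightarrow> f' x = f x" for x by (simp add: f'_def)
  define F where "F x = ennreal \<bar>f' x\<bar>" for x
  have [measurable]: "F \<in> borel_measurable borel" unfolding F_def[abs_def] by measurable
  define TF where "TF = Gr (\<lambda>y. wt y * F y)"
  have [measurable]: "TF \<in> borel_measurable borel" unfolding TF_def by measurable
  have TF_om: "(\<integral>\<^sup>+y. gr x y * F y \<partial>om) = TF x" for x
    unfolding TF_def Gr_def by (subst nn_integral_om) (auto simp: ac_simps)
  have TF: "(\<integral>\<^sup>+y. green \<Omega> \<alpha> x y * ennreal \<bar>f y\<bar> \<partial>om) = TF x" for x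
    unfolding TF_om[symmetric] by (intro nn_integral_cong) (simp add: space_om green_eq F_def f'_eq)
  have F2: "(\<integral>\<^sup>+x. wt x * (F x)\<^sup>2 \<partial>lborel) = ennreal (\<integral>x. (f x)\<^sup>2 \<partial>om)"
  proof -
    have "(\<integral>\<^sup>+x. wt x * (F x)\<^sup>2 \<partial>lborel) = (\<integral>\<^sup>+x. (F x)\<^sup>2 \<partial>om)" by (subst nn_integral_om) auto
    also have "\<dots> = (\<integral>\<^sup>+x. ennreal ((f x)\<^sup>2) \<partial>om)"
      by (intro nn_integral_cong) (simp add: space_om F_def f'_eq ennreal_power)
    also have "\<dots> = ennreal (\<integral>x. (f x)\<^sup>2 \<partial>om)" by (rule nn_integral_eq_integral[OF fi]) simp
    finally show ?thesis .
  qed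
  have TF2: "(\<integral>\<^sup>+x. (TF x)\<^sup>2 \<partial>om) \<le> ennreal (1 / \<theta>\<^sup>2 * (\<integral>x. (f x)\<^sup>2 \<partial>om))"
  proof -
    have "(\<integral>\<^sup>+x. (TF x)\<^sup>2 \<partial>om) = (\<integral>\<^sup>+x. wt x * (TF x)\<^sup>2 \<partial>lborel)" by (subst nn_integral_om) auto
    also have "\<dots> \<le> ennreal (1 / \<theta>\<^sup>2) * (\<integral>\<^sup>+x. wt x * (F x)\<^sup>2 \<partial>lborel)"
      unfolding TF_def by (rule contr) measurable
    also have "\<dots> = ennreal (1 / \<theta>\<^sup>2 * (\<integral>x. (f x)\<^sup>2 \<partial>om))" unfolding F2 by (rule ennreal_mult'[symmetric]) simp
    finally show ?thesis .
  qed
  have TFm: "(\<lambda>x. (TF x)\<^sup>2) \<in> borel_measurable om" by (rule measurable_om) measurable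
  have "(\<integral>\<^sup>+x. (TF x)\<^sup>2 \<partial>om) \<noteq> \<infinity>" using TF2 by (auto simp: top_unique)
  then have "AE x in om. (TF x)\<^sup>2 \<noteq> \<infinity>" by (rule nn_integral_PInf_AE[OF TFm])
  then show "AE x in om. (\<integral>\<^sup>+y. green \<Omega> \<alpha> x y * ennreal \<bar>f y\<bar> \<partial>om) < \<infinity>"
    unfolding TF by eventually_elim (auto simp: less_top power2_eq_square ennreal_mult_eq_top_iff)
  define K where "K = kernel_operator (green \<Omega> \<alpha>) om f"
  have K_om: "K x = (\<integral>y. enn2real (gr x y) * f' y \<partial>om)" for x
    unfolding K_def kernel_operator_def
    by (intro Bochner_Integration.integral_cong) (auto simp: space_om green_eq f'_eq)
  have K_eq: "K x = (\<integral>y. indicator \<Omega> y *\<^sub>R (q y * (enn2real (gr x y) * f' y)) \<partial>lborel)" for x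
  proof -
    have [measurable]: "(\<lambda>y. enn2real (gr x y) * f' y) \<in> borel_measurable (restrict_space lborel \<Omega>)"
      "q \<in> borel_measurable (restrict_space lborel \<Omega>)"
      by (intro measurable_restrict_space1; measurable)+
    have "K x = (\<integral>y. q y *\<^sub>R (enn2real (gr x y) * f' y) \<partial>restrict_space lborel \<Omega>)"
      unfolding K_om weight_measure_def by (rule integral_density) (measurable, simp add: q_def)
    also have "\<dots> = (\<integral>y. indicator \<Omega> y *\<^sub>R (q y *\<^sub>R (enn2real (gr x y) * f' y)) \<partial>lborel)"
      by (rule integral_restrict_space) simp
    finally show ?thesis by simp
  qed
  have [measurable]: "K \<in> borel_measurable borel" unfolding K_eq[abs_def] by measurable
  have K_le: "ennreal \<bar>K x\<bar> \<le> TF x" for x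
  proof (cases "integrable om (\<lambda>y. enn2real (gr x y) * f' y)")
    case True
    have "ennreal \<bar>K x\<bar> \<le> (\<integral>\<^sup>+y. ennreal (norm (enn2real (gr x y) * f' y)) \<partial>om)"
      using integral_norm_bound_ennreal[OF True] by (simp add: K_om)
    also have "\<dots> \<le> (\<integral>\<^sup>+y. gr x y * F y \<partial>om)"
    proof (rule nn_integral_mono)
      fix y
      have "ennreal (norm (enn2real (gr x y) * f' y)) = ennreal (enn2real (gr x y)) * F y"
        by (simp add: F_def abs_mult ennreal_mult')
      \<comment> \<open>Where \<open>gr\<close> is infinite, in particular on the diagonal,
        \<open>enn2real\<close> gives 0, so only an inequality holds.\<close>
      also have "\<dots> \<le> gr x y * F y"
        by (intro mult_right_mono) (cases "gr x y"; auto)+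
      finally show "ennreal (norm (enn2real (gr x y) * f' y)) \<le> gr x y * F y" .
    qed
    finally show ?thesis unfolding TF_om .
  \<comment> \<open>A divergent Bochner integral has the value 0, which satisfies the bound.\<close>
  next
    case False
    then show ?thesis by (simp add: K_om not_integrable_integral_eq)
  qed
  have Km: "K \<in> borel_measurable om" by (rule measurable_om) measurable
  have K2: "(\<integral>\<^sup>+x. ennreal ((K x)\<^sup>2) \<partial>om) \<le> ennreal (1 / \<theta>\<^sup>2 * (\<integral>x. (f x)\<^sup>2 \<partial>om))"
  proof -
    have "(\<integral>\<^sup>+x. ennreal ((K x)\<^sup>2) \<partial>om) \<le> (\<integral>\<^sup>+x. (TF x)\<^sup>2 \<partial>om)"
    proof (rule nn_integral_mono)
      fix x
      have "ennreal ((K x)\<^sup>2) = (ennreal \<bar>K x\<bar>)\<^sup>2" by (simp add: ennreal_power)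
      also have "\<dots> \<le> (TF x)\<^sup>2" by (intro power_mono K_le) simp
      finally show "ennreal ((K x)\<^sup>2) \<le> (TF x)\<^sup>2" .
    qed
    then show ?thesis using TF2 by (rule order_trans)
  qed
  have Kint: "integrable om (\<lambda>x. (K x)\<^sup>2)"
  proof (rule integrableI_bounded)
    show "(\<lambda>x. (K x)\<^sup>2) \<in> borel_measurable om" using Km by measurable
    show "(\<integral>\<^sup>+x. ennreal (norm ((K x)\<^sup>2)) \<partial>om) < \<infinity>"
      using K2 by (simp add: le_less_trans[OF _ ennreal_less_top])
  qed
  then show "kernel_operator (green \<Omega> \<alpha>) om f \<in> L2 om"
    using Km unfolding K_def[symmetric] L2_def by simp
  have "ennreal (\<integral>x. (K x)\<^sup>2 \<partial>om) \<le> ennreal (1 / \<theta>\<^sup>2 * (\<integral>x. (f x)\<^sup>2 \<partial>om))"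
    using K2 nn_integral_eq_integral[OF Kint] by simp
  then have "(\<integral>x. (K x)\<^sup>2 \<partial>om) \<le> 1 / \<theta>\<^sup>2 * (\<integral>x. (f x)\<^sup>2 \<partial>om)"
    by (subst (asm) ennreal_le_iff) simp_all
  then have "sqrt (\<integral>x. (K x)\<^sup>2 \<partial>om) \<le> sqrt (1 / \<theta>\<^sup>2 * (\<integral>x. (f x)\<^sup>2 \<partial>om))" by (rule real_sqrt_le_mono)
  also have "\<dots> = 1 / \<theta> * sqrt (\<integral>x. (f x)\<^sup>2 \<partial>om)"
    using \<theta> by (simp add: real_sqrt_mult real_sqrt_divide)
  finally show "L2_norm om (kernel_operator (green \<Omega> \<alpha>) om f) \<le> 1 / \<theta> * L2_norm om f"
    by (simp add: L2_norm_def K_def)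
qed

lemma kernel_operator_norm_less_1: "kernel_operator_norm (green \<Omega> \<alpha>) om < 1"
proof -
  obtain \<theta> where \<theta>: "1 < \<theta>" and contr: "\<And>f. f \<in> borel_measurable borel \<Longrightarrow>
     (\<integral>\<^sup>+x. wt x * (Gr (\<lambda>y. wt y * f y) x)\<^sup>2 \<partial>lborel) \<le> ennreal (1 / \<theta>\<^sup>2) * (\<integral>\<^sup>+x. wt x * (f x)\<^sup>2 \<partial>lborel)"
    using contraction by blast
  have \<theta>1: "1 / \<theta> < 1" using \<theta> by simp
  have "kernel_operator_norm (green \<Omega> \<alpha>) om \<le> ennreal (1 / \<theta>)"
    unfolding kernel_operator_norm_def
  proof (rule Inf_lower, intro CollectI exI[of _ "1 / \<theta>"] conjI refl ballI)
    show "0 \<le> 1 / \<theta>" using \<theta> by simp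
    fix f assume f: "f \<in> L2 om"
    show "AE x in om. (\<integral>\<^sup>+y. green \<Omega> \<alpha> x y * ennreal \<bar>f y\<bar> \<partial>om) < \<infinity>"
      by (rule kernel_operator_L2_bound(1)[OF \<theta> _ f]) (rule contr)
    show "kernel_operator (green \<Omega> \<alpha>) om f \<in> L2 om"
      by (rule kernel_operator_L2_bound(2)[OF \<theta> _ f]) (rule contr)
    show "L2_norm om (kernel_operator (green \<Omega> \<alpha>) om f) \<le> 1 / \<theta> * L2_norm om f"
      by (rule kernel_operator_L2_bound(3)[OF \<theta> _ f]) (rule contr)
  qed
  also have "\<dots> < ennreal 1" by (rule ennreal_lessI[OF zero_less_one \<theta>1])
  finally show ?thesis by simp
qed

end

section \<open>Exterior corkscrew balls of Lipschitz domains\<close>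

text \<open>The point a of the complement nearest to y lies on or below the graph. The ball of
  radius \<delta> / (1 + L) about the point at distance \<delta> below a lies in the downward cone
  of slope L with apex a, and therefore below the graph.\<close>

lemma lipschitz_boundary_corkscrew:
  fixes \<Omega> :: "'a::euclidean_space set"
  assumes op: "open \<Omega>" and p: "p \<in> frontier \<Omega>" and lip: "lipschitz_boundary \<Omega>"
  shows "\<exists>s>0. \<exists>c>0. \<exists>C>0. \<forall>y\<in>\<Omega> \<inter> ball p s.
    \<exists>w. ball w (c * infdist y (- \<Omega>)) \<subseteq> - \<Omega> \<and> norm (w - y) \<le> C * infdist y (- \<Omega>)"
proof -
  obtain e r L and \<phi> :: "'a \<Rightarrow> real" where e: "norm e = 1" and r: "0 < r"
    and L: "L-lipschitz_on {y. y \<bullet> e = 0} \<phi>"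
    and graph: "\<Omega> \<inter> ball p r = {x \<in> ball p r. \<phi> (x - (x \<bullet> e) *\<^sub>R e) < x \<bullet> e}"
    using lip p unfolding lipschitz_boundary_def by meson
  have L0: "0 \<le> L" using L by (rule lipschitz_on_nonneg)
  have ee: "e \<bullet> e = 1" using e by (simp add: dot_square_norm)
  define P where "P x = x - (x \<bullet> e) *\<^sub>R e" for x
  have P0: "P x \<bullet> e = 0" for x by (simp add: P_def inner_diff_left ee)
  have P_le: "norm (P x) \<le> norm x" for x
  proof -
    have "norm (P x) ^ 2 = norm x ^ 2 - (x \<bullet> e) ^ 2"
      unfolding power2_norm_eq_inner P_def by (simp add: inner_diff inner_commute ee power2_eq_square)
    then have "norm (P x) ^ 2 \<le> norm x ^ 2" by simp
    then show ?thesis by (rule power2_le_imp_le) simp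
  qed
  have P_diff: "P x - P y = P (x - y)" for x y by (simp add: P_def inner_diff_left algebra_simps)
  have pO: "p \<notin> \<Omega>" using p op by (simp add: frontier_def interior_open)
  \<comment> \<open>Starting within r / 4 of p, the points y, a and the whole ball about w stay in
    \<open>ball p r\<close>, where the graph describes \<open>\<Omega>\<close>.\<close>
  have "\<exists>w. ball w (1 / (1 + L) * infdist y (- \<Omega>)) \<subseteq> - \<Omega> \<and> norm (w - y) \<le> 2 * infdist y (- \<Omega>)"
    if y: "y \<in> \<Omega> \<inter> ball p (r / 4)" for y
  proof -
    define \<delta> where "\<delta> = infdist y (- \<Omega>)"
    have "closed (- \<Omega>)" using op by (simp add: closed_Compl)
    then obtain a where a: "a \<in> - \<Omega>" and ya: "\<delta> = dist y a"
      using infdist_attains_inf[of "- \<Omega>" y] pO unfolding \<delta>_def by auto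
    have "\<delta> \<le> dist y p" unfolding \<delta>_def using pO by (intro infdist_le) simp
    then have \<delta>: "\<delta> < r / 4" using y by (simp add: dist_commute)
    have \<delta>0: "0 < \<delta>" unfolding ya using a y by auto
    define w where "w = a - \<delta> *\<^sub>R e"
    have wa: "norm (w - a) = \<delta>" using e \<delta>0 by (simp add: w_def)
    have pa: "dist p a < r / 2" using dist_triangle[of p a y] y ya \<delta> by simp
    define c where "c = 1 / (1 + L)"
    have c: "0 < c" "c \<le> 1" "c + L * c = 1" using L0 by (auto simp: c_def field_simps)
    have "z \<notin> \<Omega>" if z: "z \<in> ball w (c * \<delta>)" for z
    proof
      assume zO: "z \<in> \<Omega>"
      have zw: "norm (z - w) < c * \<delta>" using z by (simp add: dist_norm norm_minus_commute)
      have "c * \<delta> \<le> \<delta>" using c \<delta>0 by simp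
      have "dist p z \<le> dist p a + dist a w + dist w z"
        using dist_triangle[of p z a] dist_triangle[of a z w] by simp
      also have "\<dots> < r / 2 + \<delta> + \<delta>"
        using pa wa zw \<open>c * \<delta> \<le> \<delta>\<close> by (simp add: dist_norm norm_minus_commute)
      also have "\<dots> < r" using \<delta> by simp
      finally have "z \<in> ball p r" by simp
      then have "\<phi> (P z) < z \<bullet> e" using zO graph unfolding P_def by blast
      have "a \<in> ball p r" using pa r by simp
      then have "a \<bullet> e \<le> \<phi> (P a)" using a graph unfolding P_def by fastforce
      have Pzw: "P z - P a = P (z - w)"
        unfolding P_diff by (simp add: P_def w_def inner_diff_left inner_add_left ee algebra_simps)
      have "\<phi> (P a) - \<phi> (P z) \<le> L * norm (P z - P a)"
        using lipschitz_onD[OF L, of "P z" "P a"] P0 by (simp add: dist_norm)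
      also have "\<dots> \<le> L * (c * \<delta>)"
        unfolding Pzw using L0 P_le[of "z - w"] zw by (intro mult_left_mono) auto
      finally have 1: "\<phi> (P a) - L * c * \<delta> \<le> \<phi> (P z)" by simp
      have "(z - w) \<bullet> e \<le> norm (z - w)" using norm_cauchy_schwarz[of "z - w" e] e by simp
      then have "z \<bullet> e < w \<bullet> e + c * \<delta>" using zw by (simp add: inner_diff_left)
      also have "\<dots> = a \<bullet> e - (c + L * c) * \<delta> + c * \<delta>" by (simp add: w_def inner_diff_left ee c)
      also have "\<dots> \<le> \<phi> (P z)" using 1 \<open>a \<bullet> e \<le> \<phi> (P a)\<close> by (simp add: algebra_simps)
      finally show False using \<open>\<phi> (P z) < z \<bullet> e\<close> by simp
    qed
    moreover have "norm (w - y) \<le> 2 * \<delta>"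
      using norm_triangle_ineq[of "w - a" "a - y"] wa ya by (simp add: dist_norm norm_minus_commute)
    ultimately show ?thesis unfolding \<delta>_def[symmetric] c_def by blast
  qed
  then show ?thesis using r L0
    by (intro exI[of _ "r / 4"] exI[of _ "1 / (1 + L)"] exI[of _ 2] conjI ballI) auto
qed

text \<open>Near an interior point the distance to the complement is bounded below and above, so a
  single unit ball far away from \<open>\<Omega>\<close> serves all y, with constants that depend on
  p.\<close>

lemma interior_corkscrew:
  fixes \<Omega> :: "'a::euclidean_space set"
  assumes op: "open \<Omega>" and bd: "bounded \<Omega>" and p: "p \<in> \<Omega>"
  shows "\<exists>s>0. \<exists>c>0. \<exists>C>0. \<forall>y\<in>\<Omega> \<inter> ball p s.
    \<exists>w. ball w (c * infdist y (- \<Omega>)) \<subseteq> - \<Omega> \<and> norm (w - y) \<le> C * infdist y (- \<Omega>)"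
proof -
  obtain R where R: "0 < R" and \<Omega>R: "\<And>x. x \<in> \<Omega> \<Longrightarrow> norm x \<le> R" using bd bounded_pos[of \<Omega>] by auto
  obtain b :: 'a where b: "norm b = 1" using vector_choose_size[of 1] by auto
  define w where "w = (R + 1) *\<^sub>R b"
  have nw: "norm w = R + 1" using R b by (simp add: w_def)
  have wball: "ball w 1 \<subseteq> - \<Omega>"
  proof
    fix z assume "z \<in> ball w 1"
    then have "norm w < norm z + 1" using norm_triangle_ineq3[of w z] by (simp add: dist_norm)
    then show "z \<in> - \<Omega>" using \<Omega>R[of z] nw by auto
  qed
  have wO: "w \<in> - \<Omega>" by (rule subsetD[OF wball]) simp
  define D where "D = 2 * R + 1"
  have D: "0 < D" using R by (simp add: D_def)
  have wy: "norm (w - y) \<le> D" if "y \<in> \<Omega>" for y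
    using norm_triangle_ineq4[of w y] \<Omega>R[OF that] nw by (simp add: D_def)
  define s where "s = infdist p (- \<Omega>) / 2"
  have cl: "closed (- \<Omega>)" using op by (simp add: closed_Compl)
  have s: "0 < s" unfolding s_def
    using cl p wO in_closed_iff_infdist_zero[of "- \<Omega>" p] infdist_nonneg[of p "- \<Omega>"] by fastforce
  have "ball w (1 / D * infdist y (- \<Omega>)) \<subseteq> - \<Omega> \<and> norm (w - y) \<le> D / s * infdist y (- \<Omega>)"
    if y: "y \<in> \<Omega> \<inter> ball p s" for y
  proof
    have "infdist y (- \<Omega>) \<le> D"
      using infdist_le[OF wO, of y] wy[of y] y by (simp add: dist_norm norm_minus_commute)
    then have "ball w (1 / D * infdist y (- \<Omega>)) \<subseteq> ball w 1" using D by (intro subset_ball) simp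
    then show "ball w (1 / D * infdist y (- \<Omega>)) \<subseteq> - \<Omega>" using wball by blast
    have "infdist p (- \<Omega>) \<le> infdist y (- \<Omega>) + dist p y" by (rule infdist_triangle)
    then have "s \<le> infdist y (- \<Omega>)" using y by (simp add: s_def)
    then have "D \<le> D / s * infdist y (- \<Omega>)" using D s by (simp add: field_simps)
    then show "norm (w - y) \<le> D / s * infdist y (- \<Omega>)" using wy[of y] y by simp
  qed
  then show ?thesis using s D
    by (intro exI[of _ s] exI[of _ "1 / D"] exI[of _ "D / s"] conjI ballI exI[of _ w]) auto
qed

text \<open>The two local versions provide constants near each point of the compact closure. A
  finite subcover makes them uniform, with the smallest radius factor and the largest distance
  factor.\<close>

lemma bounded_lipschitz_domain_corkscrew:
  fixes \<Omega> :: "'a::euclidean_space set"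
  assumes dom: "bounded_lipschitz_domain \<Omega>"
  shows "\<exists>c>0. \<exists>C>0. \<forall>y\<in>\<Omega>.
    \<exists>w. ball w (c * infdist y (- \<Omega>)) \<subseteq> - \<Omega> \<and> norm (w - y) \<le> C * infdist y (- \<Omega>)"
proof -
  define Q where "Q c C y \<longleftrightarrow>
    (\<exists>w. ball w (c * infdist y (- \<Omega>)) \<subseteq> - \<Omega> \<and> norm (w - y) \<le> C * infdist y (- \<Omega>))" for c C y
  have Q_mono: "Q c' C' y" if Q: "Q c C y" and c': "c' \<le> c" and C': "C \<le> C'" for c c' C C' y
  proof -
    from Q obtain w where w: "ball w (c * infdist y (- \<Omega>)) \<subseteq> - \<Omega>" "norm (w - y) \<le> C * infdist y (- \<Omega>)"
      unfolding Q_def by blast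
    have "ball w (c' * infdist y (- \<Omega>)) \<subseteq> ball w (c * infdist y (- \<Omega>))"
      by (intro subset_ball mult_right_mono c' infdist_nonneg)
    moreover have "C * infdist y (- \<Omega>) \<le> C' * infdist y (- \<Omega>)" by (intro mult_right_mono C' infdist_nonneg)
    ultimately show ?thesis unfolding Q_def using w by (intro exI[of _ w]) auto
  qed
  have op: "open \<Omega>" and bd: "bounded \<Omega>" and ne: "\<Omega> \<noteq> {}" and lip: "lipschitz_boundary \<Omega>"
    using dom by (auto simp: bounded_lipschitz_domain_def)
  have "\<exists>s>0. \<exists>c>0. \<exists>C>0. \<forall>y\<in>\<Omega> \<inter> ball p s. Q c C y" if "p \<in> closure \<Omega>" for p
  proof (cases "p \<in> \<Omega>")
    case True
    show ?thesis unfolding Q_def by (rule interior_corkscrew[OF op bd True])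
  next
    case False
    then have "p \<in> frontier \<Omega>" using that op by (simp add: frontier_def interior_open)
    then show ?thesis unfolding Q_def using op lip by (intro lipschitz_boundary_corkscrew)
  qed
  then obtain s c C where sc: "\<And>p. p \<in> closure \<Omega> \<Longrightarrow> 0 < s p \<and> 0 < c p \<and> 0 < C p"
    and Q: "\<And>p y. p \<in> closure \<Omega> \<Longrightarrow> y \<in> \<Omega> \<Longrightarrow> y \<in> ball p (s p) \<Longrightarrow> Q (c p) (C p) y"
    by (metis IntI)
  have cpt: "compact (closure \<Omega>)" using bd by simp
  have cov: "closure \<Omega> \<subseteq> (\<Union>p\<in>closure \<Omega>. ball p (s p))" using sc by force
  obtain F where F: "F \<subseteq> closure \<Omega>" "finite F" "closure \<Omega> \<subseteq> (\<Union>p\<in>F. ball p (s p))"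
    by (rule compactE_image[OF cpt _ cov]) auto
  have Fne: "F \<noteq> {}" using F(3) ne closure_subset[of \<Omega>] by auto
  obtain p0 where "p0 \<in> F" using Fne by blast
  then have "0 < C p0" "C p0 \<le> Max (C ` F)" using F sc by auto
  then have Max: "0 < Max (C ` F)" by linarith
  have Min: "0 < Min (c ` F)" using F Fne sc by (auto simp: Min_gr_iff)
  have "Q (Min (c ` F)) (Max (C ` F)) y" if y: "y \<in> \<Omega>" for y
  proof -
    obtain p where "p \<in> F" "y \<in> ball p (s p)" using F(3) y closure_subset[of \<Omega>] by blast
    then have "Q (c p) (C p) y" using F y by (intro Q) auto
    moreover have "Min (c ` F) \<le> c p" "C p \<le> Max (C ` F)" using \<open>p \<in> F\<close> F by auto
    ultimately show ?thesis by (rule Q_mono)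
  qed
  then show ?thesis using Min Max unfolding Q_def
    by (intro exI[of _ "Min (c ` F)"] exI[of _ "Max (C ` F)"] conjI ballI)
qed

theorem theorem1p4:
  fixes \<Omega> :: "(real ^ 'n) set" and \<alpha> :: real
  assumes "2 \<le> CARD('n)"
    and "bounded_lipschitz_domain \<Omega>"
    and "1 < \<alpha>" and "\<alpha> < 2"
  shows "\<exists>q. q \<in> L1_loc \<Omega> \<and> (\<forall>x\<in>\<Omega>. 0 \<le> q x) \<and>
           kernel_operator_norm (green \<Omega> \<alpha>) (weight_measure \<Omega> q) < 1 \<and>
           (\<forall>x\<in>\<Omega>. u1 \<Omega> \<alpha> (weight_measure \<Omega> q) x = \<infinity>)"
proof -
  obtain c C where cC: "0 < c" "0 < C" and "\<And>y. y \<in> \<Omega> \<Longrightarrow>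
      \<exists>w. ball w (c * infdist y (- \<Omega>)) \<subseteq> - \<Omega> \<and> norm (w - y) \<le> C * infdist y (- \<Omega>)"
    using bounded_lipschitz_domain_corkscrew[OF assms(2)] by blast
  then interpret corkscrew_domain \<alpha> "TYPE(real ^ 'n)" \<Omega> c C
    using assms by unfold_locales (auto simp: bounded_lipschitz_domain_def)
  show ?thesis
  proof (intro exI[of _ q] conjI ballI)
    show "q \<in> L1_loc \<Omega>" by (rule q_L1_loc)
    show "0 \<le> q x" for x by (simp add: q_def)
    show "kernel_operator_norm (green \<Omega> \<alpha>) om < 1" by (rule kernel_operator_norm_less_1)
    show "u1 \<Omega> \<alpha> om x = \<infinity>" if "x \<in> \<Omega>" for x by (rule u1_infinite[OF that])
  qed
qed

end
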